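(* For every primitive hyperbolic lattice $S$ of rank $3$ which is reflective of hyperbolic type, $$a(S^*/S)\le 8\,(16144800)^2,\qquad a_1(S^*/S)\le 2834349,\qquad a_2(S^*/S)\le 4561.$$
   Context: A lattice is a free $\mathbb Z$-module of finite rank with a nondegenerate integral symmetric bilinear form; it is hyperbolic if its signature is $(1,\mathrm{rk}-1)$, and primitive if the form is not divisible by any integer $m>1$ (i.e. the form divided by $m$ is not integral). $S^*=\mathrm{Hom}(S,\mathbb Z)\supset S$ is the dual lattice; for a finite abelian group $L^*/L$, $a(L^*/L)$ is its exponent, $a_1(L^*/L)$ the product of all distinct odd prime divisors of $a(L^*/L)$, and $a_2(L^*/L)$ the greatest prime divisor of $a(L^*/L)$. A root of $S$ is a primitive $r\in S$ with $r^2<0$ and $r^2\mid 2(r,x)$ for all $x\in S$, giving the reflection $s_r(x)=x-\frac{2(x,r)}{r^2}r$. With $V^+$ a component of $\{x\in S\otimes\mathbb R:x^2>0\}$, $\mathcal L(S)=V^+/\mathbb R_{>0}$, $O^+(S)$ the automorphisms preserving $V^+$, $W(S)$ the group generated by all $s_r$, $\mathcal M$ a fundamental polygon of $W(S)$ and $A(\mathcal M)=\{\phi\in O^+(S):\phi(\mathcal M)=\mathcal M\}$: $S$ is reflective of hyperbolic type if some nonzero $\rho\in S$ with $\rho^2<0$ is fixed by a finite-index subgroup of $A(\mathcal M)$, and every nonzero element of $S$ fixed by a finite-index subgroup of $A(\mathcal M)$ has negative square. *)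

theory Defs
  imports "HOL-Analysis.Analysis"
begin

text \<open>A rank 3 lattice S is modelled as Z^3 inside S (x) R = real^3, with the
  bilinear form given by an integral Gram matrix G.\<close>

definition bf :: "int^3^3 \<Rightarrow> real^3 \<Rightarrow> real^3 \<Rightarrow> real" where
  "bf G x y = (\<Sum>i\<in>UNIV. \<Sum>j\<in>UNIV. of_int (G$i$j) * x$i * y$j)"

definition lat :: "(real^3) set" where
  "lat = {x. \<forall>i. x$i \<in> \<int>}"

definition symmetric_gram :: "int^3^3 \<Rightarrow> bool" where
  "symmetric_gram G \<longleftrightarrow> (\<forall>i j. G$i$j = G$j$i)"

definition nondegenerate :: "int^3^3 \<Rightarrow> bool" where
  "nondegenerate G \<longleftrightarrow> (\<forall>x\<in>lat. (\<forall>y\<in>lat. bf G x y = 0) \<longrightarrow> x = 0)"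

definition hyperbolic_lattice :: "int^3^3 \<Rightarrow> bool" where
  "hyperbolic_lattice G \<longleftrightarrow> symmetric_gram G \<and> nondegenerate G \<and>
     (\<exists>W. subspace W \<and> dim W = 1 \<and> (\<forall>x\<in>W. x \<noteq> 0 \<longrightarrow> bf G x x > 0)) \<and>
     (\<exists>W. subspace W \<and> dim W = 2 \<and> (\<forall>x\<in>W. x \<noteq> 0 \<longrightarrow> bf G x x < 0))"

definition primitive_form :: "int^3^3 \<Rightarrow> bool" where
  "primitive_form G \<longleftrightarrow>
     \<not> (\<exists>m::int. m > 1 \<and> (\<forall>x\<in>lat. \<forall>y\<in>lat. bf G x y / of_int m \<in> \<int>))"

text \<open>Dual lattice S^* = Hom(S,Z), realised inside S (x) Q \<subseteq> S (x) R.\<close>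
definition dual_lat :: "int^3^3 \<Rightarrow> (real^3) set" where
  "dual_lat G = {x. \<forall>y\<in>lat. bf G x y \<in> \<int>}"

definition disc_exponent :: "int^3^3 \<Rightarrow> nat" where
  "disc_exponent G = (LEAST m::nat. m > 0 \<and> (\<forall>x\<in>dual_lat G. real m *\<^sub>R x \<in> lat))"

definition odd_rad :: "nat \<Rightarrow> nat" where
  "odd_rad n = (\<Prod>{p. prime p \<and> p dvd n \<and> odd p})"

definition max_prime_div :: "nat \<Rightarrow> nat" where
  "max_prime_div n = Max (insert 1 {p. prime p \<and> p dvd n})"

definition is_root :: "int^3^3 \<Rightarrow> real^3 \<Rightarrow> bool" where
  "is_root G r \<longleftrightarrow> r \<in> lat \<and>
     \<not> (\<exists>m::int. m > 1 \<and> (\<exists>y\<in>lat. r = of_int m *\<^sub>R y)) \<and>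
     bf G r r < 0 \<and> (\<forall>x\<in>lat. 2 * bf G r x / bf G r r \<in> \<int>)"

definition reflection :: "int^3^3 \<Rightarrow> real^3 \<Rightarrow> real^3 \<Rightarrow> real^3" where
  "reflection G r x = x - (2 * bf G x r / bf G r r) *\<^sub>R r"

definition posset :: "int^3^3 \<Rightarrow> (real^3) set" where
  "posset G = {x. bf G x x > 0}"

definition is_Vplus :: "int^3^3 \<Rightarrow> (real^3) set \<Rightarrow> bool" where
  "is_Vplus G V \<longleftrightarrow> (\<exists>v\<in>posset G. V = connected_component_set (posset G) v)"

definition mirrors :: "int^3^3 \<Rightarrow> (real^3) set" where
  "mirrors G = \<Union>{{x. bf G x r = 0} | r. is_root G r}"

text \<open>A fundamental polygon of W(S) (as a cone in V^+): the closure in V^+ of a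
  connected component of V^+ minus all mirrors.\<close>
definition is_fund_polygon :: "int^3^3 \<Rightarrow> (real^3) set \<Rightarrow> (real^3) set \<Rightarrow> bool" where
  "is_fund_polygon G V M \<longleftrightarrow>
     (\<exists>x0\<in>V - mirrors G. M = closure (connected_component_set (V - mirrors G) x0) \<inter> V)"

text \<open>O^+(S): automorphisms of S (extended linearly to S (x) R) preserving V^+.\<close>
definition O_plus :: "int^3^3 \<Rightarrow> (real^3) set \<Rightarrow> ((real^3) \<Rightarrow> (real^3)) set" where
  "O_plus G V = {f. linear f \<and> bij f \<and> f ` lat = lat \<and>
      (\<forall>x\<in>lat. \<forall>y\<in>lat. bf G (f x) (f y) = bf G x y) \<and> f ` V = V}"

definition A_M :: "int^3^3 \<Rightarrow> (real^3) set \<Rightarrow> (real^3) set \<Rightarrow> ((real^3) \<Rightarrow> (real^3)) set" where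
  "A_M G V M = {f \<in> O_plus G V. f ` M = M}"

definition finite_index_subgroup ::
  "((real^3) \<Rightarrow> (real^3)) set \<Rightarrow> ((real^3) \<Rightarrow> (real^3)) set \<Rightarrow> bool" where
  "finite_index_subgroup H A \<longleftrightarrow> H \<subseteq> A \<and> id \<in> H \<and>
     (\<forall>f\<in>H. \<forall>g\<in>H. f \<circ> g \<in> H) \<and> (\<forall>f\<in>H. inv f \<in> H) \<and>
     finite ((\<lambda>f. (\<lambda>h. f \<circ> h) ` H) ` A)"

definition fixed_by_finite_index ::
  "int^3^3 \<Rightarrow> (real^3) set \<Rightarrow> (real^3) set \<Rightarrow> real^3 \<Rightarrow> bool" where
  "fixed_by_finite_index G V M x \<longleftrightarrow>
     (\<exists>H. finite_index_subgroup H (A_M G V M) \<and> (\<forall>h\<in>H. h x = x))"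

definition reflective_hyperbolic_type :: "int^3^3 \<Rightarrow> bool" where
  "reflective_hyperbolic_type G \<longleftrightarrow>
     (\<exists>V M. is_Vplus G V \<and> is_fund_polygon G V M \<and>
        (\<exists>\<rho>\<in>lat. \<rho> \<noteq> 0 \<and> bf G \<rho> \<rho> < 0 \<and> fixed_by_finite_index G V M \<rho>) \<and>
        (\<forall>x\<in>lat. x \<noteq> 0 \<and> fixed_by_finite_index G V M x \<longrightarrow> bf G x x < 0))"

end

theory Submission
  imports Defs
begin

text \<open>Since no lattice vector of positive square is fixed by a subgroup of finite index, \<open>A(M)\<close> is infinite,
  and its subgroup fixing \<open>\<rho>\<close> contains a translation along the geodesic \<open>\<rho>\<^sup>\<bottom>\<close>. Hence the polygon is periodic
  along this geodesic. On each side of it (except on the one cut off when \<open>\<rho>\<^sup>\<bottom>\<close> is itself a side) the walls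
  form a chain, infinite in both directions, in which neighbours meet or are parallel, and only finitely many distances
  to \<open>\<rho>\<^sup>\<bottom>\<close> occur. An ideal end of a wall is never an obstruction to finding the neighbour: at an irrational end a
  Pell automorph, at a rational one a parabolic isometry would produce a further symmetry or a further wall.

  The exponent of the discriminant group is bounded through few walls with small Gram entries: the dual lattice
  is controlled by Cramer's rule for three roots, because for a primitive form an odd prime dividing the exponent
  must divide either the determinant of their Cartan matrix or one of the entries linking them. A wall orthogonal to two
  others, together with a fourth wall, gives a second criterion. Such walls are found next to a wall at maximal
  distance from \<open>\<rho>\<^sup>\<bottom>\<close>, where those orthogonal to both of two close neighbours are left out, if this distance
  is large; otherwise all remaining walls are close to \<open>\<rho>\<^sup>\<bottom>\<close> and one compares the chain with \<open>\<rho>\<close> or with the chain on the opposite side.\<close>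

section \<open>Lattice vectors and the cross product\<close>

text \<open>Arithmetic information passes only between walls that are not orthogonal:
  \<open>kk_relation\<close> ties the squares of two roots together only if their Gram entry is
  nonzero. Right angles are thus the obstacle. They are why a wall orthogonal to both neighbours,
  with a small entry between these (a \<open>bubble\<close>), is skipped, and why a four-walls
  criterion stands beside the three-walls one. The thresholds are matched. If the farthest
  non-bubble has \<open>hs\<close>^2 at least 5/3 and is orthogonal to both neighbours in the
  reduced chain, the entry between these is at most 4.2, so \<open>al\<close> is an integer below
  70.56; with the cutoff 70 the wall would be a bubble itself. In the other case \<open>hc\<close>^2
  is at most 8/3, and the estimates near the geodesic start from 8/3. In the criteria, 2834349
  bounds, up to powers of 2, a number divisible by all odd primes of the exponent, and 4561 bounds
  each of its factors. The bound on the exponent itself then holds with much room.\<close>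

lemma bf_expand: "bf G x y =
   of_int (G$1$1) * x$1 * y$1 + of_int (G$1$2) * x$1 * y$2 + of_int (G$1$3) * x$1 * y$3
 + of_int (G$2$1) * x$2 * y$1 + of_int (G$2$2) * x$2 * y$2 + of_int (G$2$3) * x$2 * y$3
 + of_int (G$3$1) * x$3 * y$1 + of_int (G$3$2) * x$3 * y$2 + of_int (G$3$3) * x$3 * y$3"
  by (simp add: bf_def sum_3)

lemma vec3_eq_iff: "x = (y::'a^3) \<longleftrightarrow> x$1 = y$1 \<and> x$2 = y$2 \<and> x$3 = y$3"
  by (simp add: vec_eq_iff forall_3)

lemma bf_add_left: "bf G (x + y) z = bf G x z + bf G y z"
  and bf_add_right: "bf G z (x + y) = bf G z x + bf G z y"
  and bf_scale_left: "bf G (a *\<^sub>R x) z = a * bf G x z"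
  and bf_scale_right: "bf G z (a *\<^sub>R x) = a * bf G z x"
  and bf_diff_left: "bf G (x - y) z = bf G x z - bf G y z"
  and bf_diff_right: "bf G z (x - y) = bf G z x - bf G z y"
  and bf_minus_left: "bf G (- x) z = - bf G x z"
  and bf_minus_right: "bf G z (- x) = - bf G z x"
  and bf_zero_left: "bf G 0 z = 0"
  and bf_zero_right: "bf G z 0 = 0"
  by (simp_all add: bf_expand algebra_simps)

lemmas bf_lin = bf_add_left bf_add_right bf_scale_left bf_scale_right bf_diff_left bf_diff_right
  bf_minus_left bf_minus_right bf_zero_left bf_zero_right

lemma continuous_on_bf [continuous_intros]:
  "continuous_on S f \<Longrightarrow> continuous_on S g \<Longrightarrow> continuous_on S (\<lambda>x. bf G (f x) (g x))"
  unfolding bf_expand by (intro continuous_intros)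

lemma lat_iff: "x \<in> lat \<longleftrightarrow> x$1 \<in> \<int> \<and> x$2 \<in> \<int> \<and> x$3 \<in> \<int>"
  by (simp add: lat_def forall_3)

lemma lat_add: "x \<in> lat \<Longrightarrow> y \<in> lat \<Longrightarrow> x + y \<in> lat"
  and lat_diff: "x \<in> lat \<Longrightarrow> y \<in> lat \<Longrightarrow> x - y \<in> lat"
  and lat_minus: "x \<in> lat \<Longrightarrow> - x \<in> lat"
  and lat_zero: "0 \<in> lat"
  and lat_scale: "x \<in> lat \<Longrightarrow> a \<in> \<int> \<Longrightarrow> a *\<^sub>R x \<in> lat"
  by (auto simp: lat_iff)

lemmas lat_intros = lat_add lat_diff lat_minus lat_zero lat_scale

lemma lat_vector: "a \<in> \<int> \<Longrightarrow> b \<in> \<int> \<Longrightarrow> c \<in> \<int> \<Longrightarrow> vector [a, b, c] \<in> lat"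
  by (simp add: lat_iff)

lemma bf_lat_Ints: "x \<in> lat \<Longrightarrow> y \<in> lat \<Longrightarrow> bf G x y \<in> \<int>"
  unfolding bf_expand lat_iff by (intro Ints_add Ints_mult) auto

lemma finite_lat_bounded:
  assumes "\<And>x. x \<in> S \<Longrightarrow> x \<in> lat \<and> norm x \<le> C"
  shows "finite S"
proof -
  let ?I = "of_int ` {- \<lceil>C\<rceil>..\<lceil>C\<rceil>} :: real set"
  have fin: "finite ((\<lambda>(a,b,c). vector [a, b, c] :: real^3) ` (?I \<times> ?I \<times> ?I))" by auto
  have "x \<in> (\<lambda>(a,b,c). vector [a, b, c] :: real^3) ` (?I \<times> ?I \<times> ?I)" if "x \<in> S" for x
  proof -
    have x: "x \<in> lat" "norm x \<le> C" using assms that by auto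
    have I: "x$i \<in> ?I" for i
    proof -
      obtain m where m: "x$i = of_int m" using x(1) by (auto simp: lat_def elim: Ints_cases)
      have "\<bar>x$i\<bar> \<le> C" using component_le_norm_cart[of x i] x(2) by linarith
      then have "m \<in> {- \<lceil>C\<rceil>..\<lceil>C\<rceil>}" unfolding m atLeastAtMost_iff
        by (auto simp: abs_le_iff le_ceiling_iff minus_le_iff)
      then show ?thesis using m by auto
    qed
    have "x = (\<lambda>(a,b,c). vector [a, b, c] :: real^3) (x$1, x$2, x$3)" by (simp add: vec3_eq_iff)
    moreover have "(x$1, x$2, x$3) \<in> ?I \<times> ?I \<times> ?I" using I by blast
    ultimately show ?thesis by (rule image_eqI)
  qed
  then have "S \<subseteq> (\<lambda>(a,b,c). vector [a, b, c] :: real^3) ` (?I \<times> ?I \<times> ?I)" by (rule subsetI)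
  then show ?thesis by (rule finite_subset[OF _ fin])
qed

section \<open>Primitive vectors and their Bezout certificates\<close>

definition prim :: "real^3 \<Rightarrow> bool" where
  "prim r \<longleftrightarrow> r \<in> lat \<and> \<not> (\<exists>m::int. m > 1 \<and> (\<exists>y\<in>lat. r = of_int m *\<^sub>R y))"

definition dot3 :: "real^3 \<Rightarrow> real^3 \<Rightarrow> real" where
  "dot3 x y = x$1 * y$1 + x$2 * y$2 + x$3 * y$3"

lemma dot3_lat: "x \<in> lat \<Longrightarrow> y \<in> lat \<Longrightarrow> dot3 x y \<in> \<int>"
  unfolding dot3_def lat_iff by (intro Ints_add Ints_mult) auto

lemma prim_nonzero: "prim r \<Longrightarrow> r \<noteq> 0"
  unfolding prim_def by (metis lat_zero one_less_numeral_iff scaleR_zero_right semiring_norm(76))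

text \<open>Bezout twice, for the first two coordinates and then with the third. A vector
  \<open>z\<close> with \<open>dot3 z y = 1\<close> certifies that \<open>y\<close> is
  primitive.\<close>

lemma lat_content:
  assumes "x \<in> lat" "x \<noteq> 0"
  obtains g :: int and y z where "g > 0" "x = of_int g *\<^sub>R y" "y \<in> lat" "z \<in> lat" "dot3 z y = 1"
proof -
  obtain a b c :: int where abc: "x$1 = of_int a" "x$2 = of_int b" "x$3 = of_int c"
    using assms(1) unfolding lat_iff by (auto elim!: Ints_cases)
  let ?h = "gcd a b" let ?g = "gcd ?h c"
  obtain u w where uw: "u * a + w * b = ?h" using bezout_int by blast
  obtain p q where pq: "p * ?h + q * c = ?g" using bezout_int by blast
  have ne: "?g \<noteq> 0" using assms(2) abc by (auto simp: vec3_eq_iff)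
  then have gpos: "?g > 0" by (metis gcd_ge_0_int less_le)
  obtain a' b' c' where d: "a = ?g * a'" "b = ?g * b'" "c = ?g * c'"
    by (metis dvd_def gcd_dvd1 gcd_dvd2 dvd_trans)
  let ?y = "vector [of_int a', of_int b', of_int c'] :: real^3"
  let ?z = "vector [of_int (p*u), of_int (p*w), of_int q] :: real^3"
  have "?g * (p*u*a' + p*w*b' + q*c') = p*(u*(?g*a') + w*(?g*b')) + q*(?g*c')" by (simp add: algebra_simps)
  also have "\<dots> = ?g" using uw pq d by metis
  finally have "p*u*a' + p*w*b' + q*c' = 1" using ne mult_cancel_left2 by blast
  then have "of_int (p*u*a' + p*w*b' + q*c') = (1::real)" by simp
  then have dz: "dot3 ?z ?y = 1" by (simp add: dot3_def)
  have "x = of_int ?g *\<^sub>R ?y" using abc d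
    by (simp add: vec3_eq_iff) (metis of_int_mult)
  moreover have "?y \<in> lat" "?z \<in> lat" by (intro lat_vector Ints_of_int)+
  ultimately show thesis using that[OF gpos _ _ _ dz] by blast
qed

lemma prim_bezout:
  assumes "prim r" obtains z where "z \<in> lat" "dot3 z r = 1"
proof -
  obtain g :: int and y z where g: "g > 0" "r = of_int g *\<^sub>R y" "y \<in> lat" "z \<in> lat" "dot3 z y = 1"
    using lat_content[of r] assms prim_nonzero unfolding prim_def by metis
  then have "g = 1" using assms unfolding prim_def by (metis g(1) int_one_le_iff_zero_less less_le)
  then show thesis using g that by simp
qed

lemma dot3_scale: "dot3 z (a *\<^sub>R x) = a * dot3 z x"
  by (simp add: dot3_def algebra_simps)

lemma prim_proportional:
  assumes "prim r" "prim r'" "r' = a *\<^sub>R r"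
  shows "a = 1 \<or> a = -1"
proof -
  obtain z where z: "z \<in> lat" "dot3 z r = 1" using prim_bezout assms by blast
  obtain w where w: "w \<in> lat" "dot3 w r' = 1" using prim_bezout assms by blast
  have "a \<in> \<int>" using dot3_lat[OF z(1), of r'] assms z by (simp add: prim_def dot3_scale)
  then obtain m where m: "a = of_int m" by (auto elim: Ints_cases)
  have "dot3 w r \<in> \<int>" using dot3_lat w assms by (simp add: prim_def)
  then obtain n where n: "dot3 w r = of_int n" by (auto elim: Ints_cases)
  have "of_int (m * n) = (1::real)" using w m n assms by (simp add: dot3_scale)
  then have "m * n = 1" by linarith
  then have "m = 1 \<or> m = -1" using zmult_eq_1_iff by blast
  then show ?thesis using m by auto
qed

lemma prim_if_bezout:
  assumes "y \<in> lat" "z \<in> lat" "dot3 z y = 1" shows "prim y"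
  unfolding prim_def
proof (intro conjI notI)
  assume "\<exists>m::int. m > 1 \<and> (\<exists>ya\<in>lat. y = of_int m *\<^sub>R ya)"
  then obtain m :: int and y' where m: "m > 1" "y' \<in> lat" "y = of_int m *\<^sub>R y'" by blast
  obtain n where n: "dot3 z y' = of_int n" using dot3_lat[OF assms(2) m(2)] by (auto elim: Ints_cases)
  have "of_int (m * n) = (1::real)" using assms m n by (simp add: dot3_scale)
  then have "m * n = 1" by linarith
  then show False using m(1) zmult_eq_1_iff by auto
qed (rule assms)

text \<open>\<open>adj G\<close> applied to the Euclidean cross product: the cross product of the quadratic space,
  normalised so that it preserves the lattice.\<close>
definition cr :: "int^3^3 \<Rightarrow> real^3 \<Rightarrow> real^3 \<Rightarrow> real^3" where
  "cr G x y = (let g = (\<lambda>i j. real_of_int (G$i$j));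
     u = x$2*y$3 - x$3*y$2; v = x$3*y$1 - x$1*y$3; w = x$1*y$2 - x$2*y$1 in
   vector [ (g 2 2*g 3 3 - g 2 3*g 2 3)*u + (g 1 3*g 2 3 - g 1 2*g 3 3)* v + (g 1 2*g 2 3 - g 1 3*g 2 2)*w,
            (g 1 3*g 2 3 - g 1 2*g 3 3)*u + (g 1 1*g 3 3 - g 1 3*g 1 3)* v + (g 1 2*g 1 3 - g 1 1*g 2 3)*w,
            (g 1 2*g 2 3 - g 1 3*g 2 2)*u + (g 1 2*g 1 3 - g 1 1*g 2 3)* v + (g 1 1*g 2 2 - g 1 2*g 1 2)*w])"

text \<open>The Gram determinant, expanded along the first row with the symmetry of the entries
  already used.\<close>

definition dG :: "int^3^3 \<Rightarrow> int" where
  "dG G = G$1$1*(G$2$2*G$3$3 - G$2$3*G$2$3) + G$1$2*(G$1$3*G$2$3 - G$1$2*G$3$3) + G$1$3*(G$1$2*G$2$3 - G$1$3*G$2$2)"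

definition tri :: "real^3 \<Rightarrow> real^3 \<Rightarrow> real^3 \<Rightarrow> real" where
  "tri x y z = (x$2*y$3 - x$3*y$2)*z$1 + (x$3*y$1 - x$1*y$3)*z$2 + (x$1*y$2 - x$2*y$1)*z$3"

lemma tri_perm: "tri x y z = tri y z x" "tri x z y = - tri x y z" "tri y x z = - tri x y z"
  by (simp_all add: tri_def algebra_simps)

lemma tri_same: "tri x x z = 0" "tri x z x = 0" "tri z x x = 0"
  by (simp_all add: tri_def algebra_simps)

lemma tri_lin:
  "tri (x + x') y z = tri x y z + tri x' y z" "tri (a *\<^sub>R x) y z = a * tri x y z"
  "tri x (y + y') z = tri x y z + tri x y' z" "tri x (a *\<^sub>R y) z = a * tri x y z"
  "tri x y (z + z') = tri x y z + tri x y z'" "tri x y (a *\<^sub>R z) = a * tri x y z"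
  by (simp_all add: tri_def algebra_simps)

lemma tri_zero_right: "(\<And>z. tri x y z = 0) \<Longrightarrow> x \<noteq> 0 \<Longrightarrow> \<exists>a. y = a *\<^sub>R x"
proof -
  assume h: "\<And>z. tri x y z = 0" and x: "x \<noteq> 0"
  have e: "x$2*y$3 = x$3*y$2" "x$3*y$1 = x$1*y$3" "x$1*y$2 = x$2*y$1"
    using h[of "vector [1,0,0]"] h[of "vector [0,1,0]"] h[of "vector [0,0,1]"] by (simp_all add: tri_def)
  consider "x$1 \<noteq> 0" | "x$2 \<noteq> 0" | "x$3 \<noteq> 0" using x by (auto simp: vec3_eq_iff)
  then show ?thesis
  proof cases
    case 1 then show ?thesis using e by (intro exI[of _ "y$1/x$1"]) (simp add: vec3_eq_iff field_simps)
  next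
    case 2 then show ?thesis using e by (intro exI[of _ "y$2/x$2"]) (simp add: vec3_eq_iff field_simps)
  next
    case 3 then show ?thesis using e by (intro exI[of _ "y$3/x$3"]) (simp add: vec3_eq_iff field_simps)
  qed
qed

lemma tri_expand:
  assumes "tri x y z \<noteq> 0"
  shows "w = (tri w y z / tri x y z) *\<^sub>R x + (tri x w z / tri x y z) *\<^sub>R y + (tri x y w / tri x y z) *\<^sub>R z"
proof -
  have "tri x y z * w$i = tri w y z * x$i + tri x w z * y$i + tri x y w * z$i" for i
    using exhaust_3[of i] by (elim disjE) (simp_all add: tri_def algebra_simps)
  then show ?thesis using assms by (simp add: vec_eq_iff field_simps)
qed

lemma cr_lin: "cr G (x + y) z = cr G x z + cr G y z" "cr G z (x + y) = cr G z x + cr G z y"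
  "cr G (a *\<^sub>R x) z = a *\<^sub>R cr G x z" "cr G z (a *\<^sub>R x) = a *\<^sub>R cr G z x"
  "cr G x x = 0"  "cr G z (x - y) = cr G z x - cr G z y"
  by (simp_all add: cr_def Let_def vec3_eq_iff algebra_simps)

lemma cr_lat: "x \<in> lat \<Longrightarrow> y \<in> lat \<Longrightarrow> cr G x y \<in> lat"
  unfolding cr_def Let_def by (rule lat_vector) (auto simp: lat_iff intro!: Ints_add Ints_mult Ints_diff)

lemma symm: "symmetric_gram G \<Longrightarrow> G$2$1 = G$1$2 \<and> G$3$1 = G$1$3 \<and> G$3$2 = G$2$3"
  by (auto simp: symmetric_gram_def)

lemma bf_sym: "symmetric_gram G \<Longrightarrow> bf G x y = bf G y x"
  by (simp add: bf_expand symm algebra_simps)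

text \<open>The adjugate of the Gram matrix times the Gram matrix is its determinant.\<close>

lemma bf_cr: "symmetric_gram G \<Longrightarrow> bf G (cr G x y) z = of_int (dG G) * tri x y z"
  unfolding bf_expand by (simp add: symm cr_def Let_def dG_def tri_def) algebra

text \<open>\<open>cr G z w\<close> is the Euclidean cross product of \<open>Gz\<close> and
  \<open>Gw\<close>, so this is Lagrange's identity for two cross products.\<close>

lemma tri_cr: "symmetric_gram G \<Longrightarrow> tri x y (cr G z w) = bf G x z * bf G y w - bf G x w * bf G y z"
  unfolding bf_expand by (simp add: symm cr_def Let_def tri_def) algebra

section \<open>Signature and local finiteness\<close>

locale hyp =
  fixes G :: "int^3^3"
  assumes hyp: "hyperbolic_lattice G"
begin

abbreviation b where "b \<equiv> bf G"
definition d :: real where "d = of_int (dG G)"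

lemma sg: "symmetric_gram G" using hyp by (simp add: hyperbolic_lattice_def)
lemma sym: "b x y = b y x" by (rule bf_sym[OF sg])
lemma b_cr: "b (cr G x y) z = d * tri x y z" unfolding d_def by (rule bf_cr[OF sg])
lemma b_cr': "b z (cr G x y) = d * tri x y z" using b_cr sym by metis
lemma tcr: "tri x y (cr G z w) = b x z * b y w - b x w * b y z" by (rule tri_cr[OF sg])
lemma cr_norm: "b (cr G x y) (cr G x y) = d * (b x x * b y y - (b x y)^2)"
  by (simp add: b_cr tcr power2_eq_square sym[of y x])

lemma ex_pos: "\<exists>x. b x x > 0"
proof -
  obtain W where W: "subspace W" "dim W = 1" "\<And>x. x \<in> W \<Longrightarrow> x \<noteq> 0 \<Longrightarrow> b x x > 0"
    using hyp unfolding hyperbolic_lattice_def by blast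
  have "W \<noteq> {0}" using W(2) by auto
  then obtain x where "x \<in> W" "x \<noteq> 0" using W(1) subspace_0 by blast
  then show ?thesis using W(3) by blast
qed

text \<open>Otherwise \<open>x\<close> and \<open>y\<close> span a positive semidefinite plane,
  which in dimension 3 shares a nonzero vector with the negative definite plane
  \<open>W\<close>.\<close>

lemma neg_orth:
  assumes "b x x > 0" "b x y = 0" "y \<noteq> 0" shows "b y y < 0"
proof (rule ccontr)
  assume "\<not> b y y < 0" then have yy: "b y y \<ge> 0" by simp
  obtain W where W: "subspace W" "dim W = 2" "\<And>x. x \<in> W \<Longrightarrow> x \<noteq> 0 \<Longrightarrow> b x x < 0"
    using hyp unfolding hyperbolic_lattice_def by blast
  have x0: "x \<noteq> 0" using assms(1) by (auto simp: bf_lin)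
  have "y \<notin> span {x}"
  proof
    assume "y \<in> span {x}"
    then obtain a where a: "y = a *\<^sub>R x" by (auto simp: span_singleton)
    then have "a * b x x = 0" using assms(2) by (simp add: bf_lin)
    then show False using a assms by simp
  qed
  then have ind: "independent {x, y}" "x \<noteq> y"
    using x0 span_base[of x "{x}"] by (auto simp: independent_insert insert_commute[of x y])
  have "dim (span {x,y}) = 2" using ind by (simp add: dim_eq_card_independent)
  moreover have "dim {u + w |u w. u \<in> span {x,y} \<and> w \<in> W} \<le> 3"
    using dim_subset_UNIV[of "{u + w |u w. u \<in> span {x,y} \<and> w \<in> W}"] by simp
  ultimately have "dim (span {x,y} \<inter> W) > 0"
    using dim_sums_Int[of "span {x,y}" W] W by (simp add: subspace_span)
  then have "span {x,y} \<inter> W \<noteq> {0}" by (metis dim_singleton less_numeral_extra(3) dim_eq_0 subset_refl)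
  then obtain z where z: "z \<in> span {x,y}" "z \<in> W" "z \<noteq> 0"
    using W(1) subspace_0 span_zero by blast
  obtain p q where "z = p *\<^sub>R x + q *\<^sub>R y"
    using z(1) by (auto simp: span_insert span_singleton algebra_simps)
  then have "b z z = p^2 * b x x + q^2 * b y y"
    using assms(2) sym[of y x] by (simp add: bf_lin power2_eq_square)
  then have "b z z \<ge> 0" using assms(1) yy by simp
  then show False using W(3)[OF z(2,3)] by simp
qed

lemma neg_orth': "b x x > 0 \<Longrightarrow> b x y = 0 \<Longrightarrow> b y y \<le> 0"
  using neg_orth[of x y] by (cases "y = 0") (auto simp: bf_lin)

text \<open>The reversed Cauchy-Schwarz inequality, from projecting \<open>y\<close> to the negative
  definite plane orthogonal to \<open>x\<close>.\<close>

lemma rcs: assumes "b x x > 0" shows "b x x * b y y \<le> (b x y)^2"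
proof -
  let ?z = "b x x *\<^sub>R y - b x y *\<^sub>R x"
  have "b ?z ?z \<le> 0" by (rule neg_orth'[OF assms]) (simp add: bf_lin)
  moreover have "b ?z ?z = b x x * (b x x * b y y - (b x y)^2)"
    using sym[of y x] by (simp add: bf_lin power2_eq_square algebra_simps)
  ultimately show ?thesis using assms by (simp add: mult_le_0_iff)
qed

text \<open>For orthogonal \<open>x\<close>, \<open>y\<close> with x^2 > 0 > y^2 the vector
  \<open>cr G x y\<close> is orthogonal to \<open>x\<close> and has square d x^2 y^2, which must be
  negative.\<close>

lemma d_pos: "d > 0"
proof -
  obtain x where x: "b x x > 0" using ex_pos by blast
  have "\<exists>y. b x y = 0 \<and> y \<noteq> 0"
  proof -
    let ?a = "b x (vector [1,0,0])" and ?b = "b x (vector [0,1,0])"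
    show ?thesis
    proof (cases "?a = 0")
      case True then show ?thesis by (intro exI[of _ "vector [1,0,0]"]) (simp add: vec3_eq_iff)
    next
      case False
      then show ?thesis
        by (intro exI[of _ "?b *\<^sub>R vector [1,0,0] - ?a *\<^sub>R vector [0,1,0]"])
           (simp add: bf_diff_right bf_scale_right vec3_eq_iff)
    qed
  qed
  then obtain y where y: "b x y = 0" "y \<noteq> 0" by blast
  have yy: "b y y < 0" by (rule neg_orth[OF x y])
  have n: "b (cr G x y) (cr G x y) = d * (b x x * b y y)" by (simp add: cr_norm y)
  have o: "b x (cr G x y) = 0" by (simp add: b_cr' tri_same)
  have "b (cr G x y) (cr G x y) \<le> 0" by (rule neg_orth'[OF x o])
  moreover have "b x x * b y y < 0" using x yy by (simp add: mult_pos_neg)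
  ultimately have "d \<ge> 0" unfolding n by (simp add: mult_le_0_iff)
  moreover have "d \<noteq> 0"
  proof
    assume d0: "d = 0"
    have "cr G x y = 0"
    proof (rule ccontr)
      assume "cr G x y \<noteq> 0"
      then have "b (cr G x y) (cr G x y) < 0" using neg_orth[OF x o] by blast
      then show False using n d0 by simp
    qed
    then have "tri z w (cr G x y) = 0" for z w by (simp add: tri_def)
    then have "tri x y (cr G x y) = 0" by blast
    then have "b x x * b y y = 0" using tcr[of x y x y] y(1) by simp
    then show False using x yy by simp
  qed
  ultimately show ?thesis by simp
qed

text \<open>The plane orthogonal to a positive vector is negative definite, so \<open>2 (x,r)\<^sup>2 - x\<^sup>2 r\<^sup>2\<close>
  is a positive definite form in \<open>r\<close>.\<close>
lemma majorant:
  assumes "b x x > 0"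
  obtains m where "m > 0" "\<And>r. m * (norm r)^2 \<le> 2 * (b x r)^2 - b x x * b r r"
proof -
  let ?Q = "\<lambda>r. 2 * (b x r)^2 - b x x * b r r"
  have pos: "?Q r > 0" if "r \<noteq> 0" for r
  proof (cases "b x r = 0")
    case True
    then show ?thesis using neg_orth[OF assms True that] assms by (simp add: mult_pos_neg)
  next
    case False
    then show ?thesis using rcs[OF assms, of r] by (smt (verit) zero_less_power2)
  qed
  have "compact (sphere 0 1 :: (real^3) set)" by simp
  moreover have "sphere 0 1 \<noteq> ({} :: (real^3) set)" by simp
  moreover have "continuous_on (sphere 0 1) ?Q" by (intro continuous_intros)
  ultimately obtain u where u: "u \<in> sphere 0 1" "\<And>w. w \<in> sphere 0 1 \<Longrightarrow> ?Q u \<le> ?Q w"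
    using continuous_attains_inf[of "sphere 0 1" ?Q] by blast
  show thesis
  proof (rule that[of "?Q u"])
    have "u \<noteq> 0" using u(1) by auto
    then show "?Q u > 0" by (rule pos)
    fix r :: "real^3"
    show "?Q u * (norm r)^2 \<le> ?Q r"
    proof (cases "r = 0")
      case False
      let ?w = "(1 / norm r) *\<^sub>R r"
      have "?Q u \<le> ?Q ?w" using u(2) False by simp
      moreover have "?Q ?w = ?Q r / (norm r)^2"
        by (simp add: bf_lin power2_eq_square divide_simps algebra_simps)
      ultimately have "?Q u \<le> ?Q r / (norm r)^2" by simp
      then show ?thesis using False by (simp add: pos_le_divide_eq)
    qed (simp add: bf_lin)
  qed
qed

lemma finite_lat_form_bounded:
  assumes "b x x > 0" shows "finite {r\<in>lat. \<bar>b x r\<bar> \<le> C \<and> - b r r \<le> k}"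
proof -
  obtain m where m: "m > 0" "\<And>r. m * (norm r)^2 \<le> 2 * (b x r)^2 - b x x * b r r"
    using majorant[OF assms] by blast
  show ?thesis
  proof (rule finite_lat_bounded[where C = "sqrt ((2 * C^2 + b x x * k) / m)"])
    fix r assume "r \<in> {r\<in>lat. \<bar>b x r\<bar> \<le> C \<and> - b r r \<le> k}"
    then have r: "r \<in> lat" "\<bar>b x r\<bar> \<le> C" "- b r r \<le> k" by auto
    have "(b x r)^2 \<le> C^2" using r(2) by (metis abs_ge_zero power2_abs power_mono)
    moreover have "b x x * (- b r r) \<le> b x x * k" using assms r(3) by (intro mult_left_mono) auto
    ultimately have "m * (norm r)^2 \<le> 2 * C^2 + b x x * k" using m(2)[of r] by simp
    then have "(norm r)^2 \<le> (2 * C^2 + b x x * k) / m" using m(1) by (simp add: pos_le_divide_eq mult.commute)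
    then show "r \<in> lat \<and> norm r \<le> sqrt ((2 * C^2 + b x x * k) / m)"
      using r(1) real_le_rsqrt by blast
  qed
qed

text \<open>Cauchy-Schwarz in the negative definite plane orthogonal to \<open>x\<close>, for the
  projections of \<open>y\<close> and \<open>r\<close>, scaled by x^2 to avoid division.\<close>

lemma cs_orth:
  assumes "b x x > 0"
  shows "(b x x * b y r - b x y * b x r)^2 \<le> (b x x * b y y - (b x y)^2) * (b x x * b r r - (b x r)^2)"
proof -
  let ?u = "b x x *\<^sub>R y - b x y *\<^sub>R x" and ?w = "b x x *\<^sub>R r - b x r *\<^sub>R x"
  have uw: "b ?u ?w = b x x * (b x x * b y r - b x y * b x r)"
    and uu: "b ?u ?u = b x x * (b x x * b y y - (b x y)^2)"
    and ww: "b ?w ?w = b x x * (b x x * b r r - (b x r)^2)"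
    using sym[of y x] sym[of r x] by (simp_all add: bf_lin power2_eq_square algebra_simps)
  have "(b ?u ?w)^2 \<le> b ?u ?u * b ?w ?w"
  proof (cases "?u = 0")
    case True then show ?thesis by (simp add: bf_lin)
  next
    case False
    have neg: "b ?u ?u < 0" by (rule neg_orth[OF assms _ False]) (simp add: bf_lin)
    let ?z = "b ?u ?u *\<^sub>R ?w - b ?u ?w *\<^sub>R ?u"
    have "b ?z ?z \<le> 0" by (rule neg_orth'[OF assms]) (simp add: bf_lin)
    moreover have "b (b u u *\<^sub>R w - b u w *\<^sub>R u) (b u u *\<^sub>R w - b u w *\<^sub>R u) = b u u * (b u u * b w w - (b u w)^2)" for u w
      using sym[of w u] by (simp add: bf_lin power2_eq_square algebra_simps)
    ultimately have "b ?u ?u * (b ?u ?u * b ?w ?w - (b ?u ?w)^2) \<le> 0" by metis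
    then show ?thesis using neg by (simp add: mult_le_0_iff)
  qed
  then show ?thesis unfolding uw uu ww using assms
    by (simp add: power_mult_distrib power2_eq_square mult.assoc mult.left_commute)
qed

text \<open>Local finiteness of mirrors. Opposite signs at \<open>x\<close> and \<open>y\<close>
  make the product of the projections in \<open>cs_orth\<close> large, which bounds
  \<open>b x r\<close>; the majorant then leaves finitely many lattice vectors.\<close>

lemma finite_separating:
  assumes "b x x > 0" "b y y > 0" "b x y > 0"
  shows "finite {r\<in>lat. - b r r \<le> k \<and> b x r \<ge> 0 \<and> b y r \<le> 0}"
proof -
  let ?E = "(b x y)^2 / (b x x * b y y)"
  let ?C = "sqrt (?E * b x x * \<bar>k\<bar>)"
  have "{r\<in>lat. - b r r \<le> k \<and> b x r \<ge> 0 \<and> b y r \<le> 0} \<subseteq> {r\<in>lat. \<bar>b x r\<bar> \<le> ?C \<and> - b r r \<le> k}"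
  proof safe
    fix r assume r: "r \<in> lat" "- b r r \<le> k" "b x r \<ge> 0" "b y r \<le> 0"
    have cs: "(b x x * b y r - b x y * b x r)^2 \<le> (b x x * b y y - (b x y)^2) * (b x x * b r r - (b x r)^2)"
      by (rule cs_orth[OF assms(1)])
    have "b x x * b y r - b x y * b x r \<le> - (b x y * b x r)" using r assms by (simp add: mult_nonneg_nonpos)
    moreover have "b x y * b x r \<ge> 0" using r assms by simp
    ultimately have "(b x y * b x r)^2 \<le> (b x x * b y r - b x y * b x r)^2"
      by (intro abs_le_square_iff[THEN iffD1]) linarith
    then have "b x x * (b y y * (b x r)^2) \<le> b x x * ((- b r r) * ((b x y)^2 - b x x * b y y))"
      using cs by (simp add: algebra_simps power2_eq_square)
    then have "b y y * (b x r)^2 \<le> (- b r r) * ((b x y)^2 - b x x * b y y)" by (rule mult_left_le_imp_le[OF _ assms(1)])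
    also have "\<dots> \<le> \<bar>k\<bar> * ((b x y)^2 - b x x * b y y)"
      using rcs[OF assms(1), of y] r(2) by (intro mult_right_mono) auto
    also have "\<dots> \<le> \<bar>k\<bar> * (b x y)^2" using assms by (intro mult_left_mono) auto
    finally have "(b x r)^2 \<le> ?E * b x x * \<bar>k\<bar>" using assms by (simp add: field_simps)
    then show "\<bar>b x r\<bar> \<le> ?C" by (simp add: real_le_rsqrt)
  qed
  then show ?thesis using finite_lat_form_bounded[OF assms(1)] finite_subset by blast
qed

end

section \<open>The cone and the polygon\<close>

locale hypV = hyp +
  fixes V assumes Vp: "is_Vplus G V"
begin

text \<open>\<open>b _ v\<close> never vanishes on the positive cone, so its sign separates the two
  nappes; the nappe of \<open>v\<close> is star-shaped about \<open>v\<close>.\<close>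

lemma V_ex: "\<exists>v. b v v > 0 \<and> V = {x. b x x > 0 \<and> b x v > 0}"
proof -
  obtain v where v: "b v v > 0" "V = connected_component_set (posset G) v"
    using Vp by (auto simp: is_Vplus_def posset_def)
  have "V = {x. b x x > 0 \<and> b x v > 0}"
  proof (intro set_eqI iffI)
    fix x assume "x \<in> V"
    then obtain T where T: "connected T" "T \<subseteq> posset G" "v \<in> T" "x \<in> T"
      using v(2) by (auto simp: connected_component_def)
    have xx: "b x x > 0" using T by (auto simp: posset_def)
    have "b x v > 0"
    proof (rule ccontr)
      assume "\<not> b x v > 0"
      moreover have "continuous_on T (\<lambda>y. b y v)" by (intro continuous_intros)
      then have "connected ((\<lambda>y. b y v) ` T)" using T(1) by (rule connected_continuous_image)
      moreover have "b x v \<in> (\<lambda>y. b y v) ` T" "b v v \<in> (\<lambda>y. b y v) ` T" using T by auto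
      ultimately have "0 \<in> (\<lambda>y. b y v) ` T"
        using v(1) unfolding connected_iff_interval by (metis less_eq_real_def not_less)
      then obtain y where y: "y \<in> T" "b y v = 0" by auto
      then have "b y y > 0" using T(2) by (auto simp: posset_def)
      then show False using neg_orth'[OF v(1), of y] y(2) sym[of y v] by simp
    qed
    then show "x \<in> {x. b x x > 0 \<and> b x v > 0}" using xx by simp
  next
    fix x assume "x \<in> {x. b x x > 0 \<and> b x v > 0}"
    then have x: "b x x > 0" "b x v > 0" by auto
    have "closed_segment v x \<subseteq> posset G"
    proof
      fix y assume "y \<in> closed_segment v x"
      then obtain u where u: "0 \<le> u" "u \<le> 1" "y = (1 - u) *\<^sub>R v + u *\<^sub>R x"
        by (auto simp: in_segment)
      have e: "b y y = (1-u)^2 * b v v + u^2 * b x x + 2 * (1-u) * u * b x v"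
        using sym[of v x] by (simp add: u(3) bf_lin power2_eq_square algebra_simps)
      have "u = 0 \<or> u^2 * b x x > 0" using x by (cases "u = 0") auto
      moreover have "(1-u)^2 * b v v \<ge> 0" "2 * (1-u) * u * b x v \<ge> 0" "u^2 * b x x \<ge> 0" using u x v by auto
      ultimately have "b y y > 0" unfolding e using v(1)
        by (cases "u = 0") (simp, linarith)
      then show "y \<in> posset G" by (simp add: posset_def)
    qed
    then have "connected_component (posset G) v x"
      unfolding connected_component_def by (metis connected_segment ends_in_segment)
    then show "x \<in> V" using v(2) by simp
  qed
  then show ?thesis using v by blast
qed

lemma V_pos: "x \<in> V \<Longrightarrow> b x x > 0" using V_ex by auto

text \<open>\<open>y\<close> may lie on the boundary of the cone, as ideal points do; the point
  \<open>x'\<close> decides on which of the two nappes \<open>y\<close> lies.\<close>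

lemma cone_pos:
  assumes "x \<in> V" "b y y \<ge> 0" "x' \<in> V" "b x' y > 0" shows "b x y > 0"
proof -
  obtain v where v: "b v v > 0" "V = {x. b x x > 0 \<and> b x v > 0}" using V_ex by blast
  have key: "b x y > 0" if x: "b x x > 0" "b x v > 0" and y: "b y y \<ge> 0" "b y v > 0" for x y
  proof (rule ccontr)
    assume n: "\<not> b x y > 0"
    let ?z = "b y v *\<^sub>R x - b x v *\<^sub>R y"
    have "b ?z ?z \<le> 0" by (rule neg_orth'[OF v(1)]) (simp add: bf_lin sym[of v])
    moreover have "b ?z ?z = (b y v)^2 * b x x + (b x v)^2 * b y y - 2 * b x v * b y v * b x y"
      using sym[of y x] by (simp add: bf_lin power2_eq_square algebra_simps)
    moreover have "(b y v)^2 * b x x > 0" "(b x v)^2 * b y y \<ge> 0" "2 * b x v * b y v * b x y \<le> 0"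
      using x y n by (auto simp: mult_nonneg_nonpos)
    ultimately show False by linarith
  qed
  have "b y v > 0"
  proof (rule ccontr)
    assume n: "\<not> b y v > 0"
    have "b y v \<noteq> 0"
    proof
      assume "b y v = 0"
      then have "y = 0" using neg_orth[OF v(1), of y] assms(2) sym[of y v] by fastforce
      then show False using assms(4) by (simp add: bf_lin)
    qed
    then have "b x' (- y) > 0" using key[of x' "- y"] assms n v(2) by (simp add: bf_lin)
    then show False using assms(4) by (simp add: bf_lin)
  qed
  then show ?thesis using key assms v(2) by auto
qed

lemma V_V: "x \<in> V \<Longrightarrow> y \<in> V \<Longrightarrow> b x y > 0"
  using cone_pos[of x y y] V_pos[of y] by simp

lemma V_I: assumes "b x x > 0" "y \<in> V" "b y x > 0" shows "x \<in> V"
proof -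
  obtain v where v: "b v v > 0" "V = {x. b x x > 0 \<and> b x v > 0}" using V_ex by blast
  then have "v \<in> V" by auto
  then have "b v x > 0" using cone_pos[of v x y] assms by simp
  then show ?thesis using v(2) assms sym by auto
qed

lemma V_scale: "x \<in> V \<Longrightarrow> a > 0 \<Longrightarrow> a *\<^sub>R x \<in> V"
  using V_I[of "a *\<^sub>R x" x] V_pos[of x] by (simp add: bf_lin)

lemma V_add:
  assumes "x \<in> V" "b y y \<ge> 0" "b x y \<ge> 0" shows "x + y \<in> V"
  by (rule V_I[OF _ assms(1)]) (use assms V_pos[OF assms(1)] sym[of y x] in \<open>simp_all add: bf_lin\<close>)

lemma V_add': "x \<in> V \<Longrightarrow> y \<in> V \<Longrightarrow> x + y \<in> V"
  using V_add V_V V_pos less_imp_le by metis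

lemma V_segment:
  assumes "x \<in> V" "y \<in> V" "0 \<le> u" "u \<le> 1" shows "(1 - u) *\<^sub>R x + u *\<^sub>R y \<in> V"
proof (cases "u = 0 \<or> u = 1")
  case False
  then show ?thesis using assms by (intro V_add' V_scale) auto
qed (use assms in auto)

lemma V_open: "open V"
proof -
  obtain v where v: "V = {x. b x x > 0 \<and> b x v > 0}" using V_ex by blast
  have "open {x. b x x > 0}" "open {x. b x v > 0}"
    by (auto intro!: open_Collect_less continuous_intros)
  then show ?thesis unfolding v by (simp add: open_Collect_conj)
qed

section \<open>Roots and lattice isometries\<close>

lemma root_prim: "is_root G r \<Longrightarrow> prim r" by (simp add: is_root_def prim_def)
lemma root_lat: "is_root G r \<Longrightarrow> r \<in> lat" by (simp add: is_root_def)
lemma root_neg: "is_root G r \<Longrightarrow> b r r < 0" by (simp add: is_root_def)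
lemma root_int: "is_root G r \<Longrightarrow> x \<in> lat \<Longrightarrow> 2 * b r x / b r r \<in> \<int>" by (simp add: is_root_def)
lemma root_iff: "is_root G r \<longleftrightarrow> prim r \<and> b r r < 0 \<and> (\<forall>x\<in>lat. 2 * b r x / b r r \<in> \<int>)"
  by (auto simp: is_root_def prim_def)

lemma prim_minus: "prim r \<Longrightarrow> prim (- r)"
  unfolding prim_def by (metis add.inverse_inverse lat_minus scaleR_minus_right)

lemma root_minus: "is_root G r \<Longrightarrow> is_root G (- r)"
  unfolding root_iff using prim_minus by (simp add: bf_lin)

text \<open>The adjugate Gram matrix preserves the lattice and inverts the form up to
  \<open>d\<close>; apply it to a Bezout certificate of \<open>r\<close>.\<close>

lemma exists_dual: assumes "prim r" shows "\<exists>y\<in>lat. b r y = d"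
proof -
  obtain z where z: "z \<in> lat" "dot3 z r = 1" using prim_bezout[OF assms] by blast
  let ?e1 = "vector [1,0,0] :: real^3" and ?e2 = "vector [0,1,0] :: real^3" and ?e3 = "vector [0,0,1] :: real^3"
  have e: "?e1 \<in> lat" "?e2 \<in> lat" "?e3 \<in> lat" by (auto intro!: lat_vector)
  let ?y = "z$1 *\<^sub>R cr G ?e2 ?e3 + z$2 *\<^sub>R cr G ?e3 ?e1 + z$3 *\<^sub>R cr G ?e1 ?e2"
  have "?y \<in> lat" using z e by (intro lat_intros cr_lat) (auto simp: lat_iff)
  moreover have "b r ?y = d * dot3 z r"
    by (simp add: bf_lin b_cr' tri_def dot3_def algebra_simps)
  ultimately show ?thesis using z by auto
qed

text \<open>At the vector of \<open>exists_dual\<close> the root condition says that r^2 divides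
  2d.\<close>

lemma root_bound: assumes "is_root G r" shows "- b r r \<le> 2 * d"
proof -
  obtain y where y: "y \<in> lat" "b r y = d" using exists_dual root_prim assms by blast
  have "2 * d / b r r \<in> \<int>" using root_int[OF assms y(1)] y(2) by simp
  moreover have "2 * d / b r r \<noteq> 0" using d_pos root_neg[OF assms] by simp
  ultimately have "\<bar>2 * d / b r r\<bar> \<ge> 1" by (rule Ints_nonzero_abs_ge1)
  then show ?thesis using d_pos root_neg[OF assms] by (simp add: abs_div_pos field_simps abs_if split: if_splits)
qed

lemma root_scale:
  assumes "is_root G r" "is_root G s" "s = a *\<^sub>R r" shows "s = r \<or> s = - r"
  using prim_proportional[OF root_prim[OF assms(1)] root_prim[OF assms(2)] assms(3)] assms(3) by auto

definition iso :: "(real^3 \<Rightarrow> real^3) \<Rightarrow> bool" where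
  "iso f \<longleftrightarrow> linear f \<and> bij f \<and> f ` lat = lat \<and> (\<forall>x y. b (f x) (f y) = b x y)"

lemma iso_root: assumes "iso f" "is_root G r" shows "is_root G (f r)"
proof -
  have l: "linear f" and bj: "bij f" and L: "f ` lat = lat" and B: "\<And>x y. b (f x) (f y) = b x y"
    using assms(1) by (auto simp: iso_def)
  have "f r \<in> lat" using L root_lat[OF assms(2)] by blast
  moreover have "\<not> (\<exists>m::int. m > 1 \<and> (\<exists>y\<in>lat. f r = of_int m *\<^sub>R y))"
  proof
    assume "\<exists>m::int. m > 1 \<and> (\<exists>y\<in>lat. f r = of_int m *\<^sub>R y)"
    then obtain m :: int and y where m: "m > 1" "y \<in> lat" "f r = of_int m *\<^sub>R y" by blast
    obtain y' where y': "y' \<in> lat" "y = f y'" using m(2) L by blast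
    have "f r = f (of_int m *\<^sub>R y')" using m y' l by (simp add: linear_scale)
    then have "r = of_int m *\<^sub>R y'" using bj by (simp add: bij_is_inj inj_eq)
    then show False using root_prim[OF assms(2)] m(1) y'(1) by (auto simp: prim_def)
  qed
  moreover have "\<forall>x\<in>lat. 2 * b (f r) x / b (f r) (f r) \<in> \<int>"
    using L B root_int[OF assms(2)] by (metis imageE)
  ultimately show ?thesis using B root_neg[OF assms(2)] by (simp add: root_iff prim_def)
qed

lemma O_plus_iso: assumes "f \<in> O_plus G V" shows "iso f"
proof -
  have l: "linear f" and bj: "bij f" and L: "f ` lat = lat"
    and B: "\<And>x y. x \<in> lat \<Longrightarrow> y \<in> lat \<Longrightarrow> b (f x) (f y) = b x y"
    using assms by (auto simp: O_plus_def)
  let ?e1 = "vector [1,0,0] :: real^3" and ?e2 = "vector [0,1,0] :: real^3" and ?e3 = "vector [0,0,1] :: real^3"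
  have e: "?e1 \<in> lat" "?e2 \<in> lat" "?e3 \<in> lat" by (auto intro!: lat_vector)
  have ex: "x = x$1 *\<^sub>R ?e1 + x$2 *\<^sub>R ?e2 + x$3 *\<^sub>R ?e3" for x :: "real^3" by (simp add: vec3_eq_iff)
  have fx: "f x = x$1 *\<^sub>R f ?e1 + x$2 *\<^sub>R f ?e2 + x$3 *\<^sub>R f ?e3" for x
    using l by (subst ex[of x]) (simp add: linear_add linear_scale)
  have "b (f x) (f y) = b x y" for x y
  proof -
    have "b (f x) (f y) = b (x$1 *\<^sub>R ?e1 + x$2 *\<^sub>R ?e2 + x$3 *\<^sub>R ?e3) (y$1 *\<^sub>R ?e1 + y$2 *\<^sub>R ?e2 + y$3 *\<^sub>R ?e3)"
      unfolding fx[of x] fx[of y] bf_add_left bf_add_right bf_scale_left bf_scale_right using B e by simp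
    then show ?thesis using ex[of x] ex[of y] by simp
  qed
  then show ?thesis using l bj L by (simp add: iso_def)
qed

lemma iso_inv: assumes "iso f" shows "iso (inv f)"
proof -
  have l: "linear f" and bj: "bij f" and L: "f ` lat = lat" and B: "\<And>x y. b (f x) (f y) = b x y"
    using assms by (auto simp: iso_def)
  have "linear (inv f)" using l bj by (simp add: bij_is_inj bij_is_surj inj_linear_imp_inv_linear linear_injective_imp_surjective)
  moreover have "inv f ` lat = lat" using L bj by (metis bij_is_inj image_inv_f_f)
  moreover have "b (inv f x) (inv f y) = b x y" for x y using B bj by (metis bij_inv_eq_iff)
  ultimately show ?thesis using bj by (simp add: iso_def bij_imp_bij_inv)
qed

lemma iso_comp: "iso f \<Longrightarrow> iso g \<Longrightarrow> iso (f \<circ> g)"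
  unfolding iso_def by (metis bij_comp comp_apply image_comp linear_compose)

lemma iso_V: assumes "iso f" "x \<in> V" "f x \<in> V" shows "f ` V = V"
proof -
  have main: "g y \<in> V" if g: "iso g" and x: "x \<in> V" "g x \<in> V" and y: "y \<in> V" for g x y
    by (rule V_I[OF _ x(2)]) (use g V_pos[OF y] V_V[OF x(1) y] in \<open>simp_all add: iso_def\<close>)
  have bj: "bij f" using assms by (simp add: iso_def)
  have "f y \<in> V" if "y \<in> V" for y using main[OF assms that] .
  moreover have "inv f y \<in> V" if "y \<in> V" for y
    using main[OF iso_inv[OF assms(1)] assms(3) _ that] assms(2) bj by (simp add: bij_is_inj)
  ultimately show ?thesis using bj by (auto simp: image_iff) (metis bij_inv_eq_iff)
qed

end

section \<open>The polygon as the chamber of the positive roots\<close>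

locale chamber = hypV +
  fixes x0 assumes x0: "x0 \<in> V" "x0 \<notin> mirrors G"
begin

text \<open>As \<open>x0\<close> avoids all mirrors, this set of positive roots contains exactly one
  of \<open>r\<close> and \<open>-r\<close> for each root \<open>r\<close>.\<close>

definition Rp where "Rp = {r. is_root G r \<and> b x0 r > 0}"
definition Ch where "Ch = {x\<in>V. \<forall>r\<in>Rp. b x r \<ge> 0}"

lemma Rp_root: "r \<in> Rp \<Longrightarrow> is_root G r" by (simp add: Rp_def)

lemma root_Rp: assumes "is_root G r" shows "r \<in> Rp \<or> - r \<in> Rp"
proof -
  have "b x0 r \<noteq> 0" using x0 assms by (auto simp: mirrors_def)
  then show ?thesis using assms root_minus by (auto simp: Rp_def bf_lin)
qed

lemma Rp_anti: "r \<in> Rp \<Longrightarrow> - r \<notin> Rp" by (simp add: Rp_def bf_lin)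

lemma Rp_scale: assumes "r \<in> Rp" "s \<in> Rp" "s = a *\<^sub>R r" shows "s = r"
  using root_scale[OF Rp_root[OF assms(1)] Rp_root[OF assms(2)] assms(3)] Rp_anti assms by auto

lemma Rp_if_pos: assumes "is_root G r" "x \<in> Ch" "b x r > 0" shows "r \<in> Rp"
  using root_Rp[OF assms(1)] assms(2,3) by (force simp: Ch_def bf_lin)

lemma x0_Ch: "x0 \<in> Ch" using x0 by (auto simp: Ch_def Rp_def)

lemma component_eq: "connected_component_set (V - mirrors G) x0 = {x\<in>V. \<forall>r\<in>Rp. b x r > 0}"
proof (intro set_eqI iffI)
  fix x assume "x \<in> connected_component_set (V - mirrors G) x0"
  then obtain T where T: "connected T" "T \<subseteq> V - mirrors G" "x0 \<in> T" "x \<in> T"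
    by (auto simp: connected_component_def)
  have "b x r > 0" if r: "r \<in> Rp" for r
  proof (rule ccontr)
    assume n: "\<not> b x r > 0"
    have "continuous_on T (\<lambda>y. b y r)" by (intro continuous_intros)
    then have "connected ((\<lambda>y. b y r) ` T)" using T(1) by (rule connected_continuous_image)
    moreover have "b x r \<in> (\<lambda>y. b y r) ` T" "b x0 r \<in> (\<lambda>y. b y r) ` T" using T by auto
    moreover have "b x r \<le> 0" "0 \<le> b x0 r" using n r by (auto simp: Rp_def)
    ultimately have "0 \<in> (\<lambda>y. b y r) ` T" unfolding connected_iff_interval by blast
    then obtain y where "y \<in> T" "b y r = 0" by auto
    then show False using T(2) Rp_root[OF r] by (auto simp: mirrors_def)
  qed
  then show "x \<in> {x\<in>V. \<forall>r\<in>Rp. b x r > 0}" using T by auto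
next
  fix x assume x: "x \<in> {x\<in>V. \<forall>r\<in>Rp. b x r > 0}"
  have "closed_segment x0 x \<subseteq> V - mirrors G"
  proof
    fix y assume "y \<in> closed_segment x0 x"
    then obtain u where u: "0 \<le> u" "u \<le> 1" "y = (1 - u) *\<^sub>R x0 + u *\<^sub>R x" by (auto simp: in_segment)
    have yV: "y \<in> V" using u V_segment x0 x by auto
    have pos: "b y r > 0" if "r \<in> Rp" for r
    proof (cases "u = 0")
      case True then show ?thesis using that u by (simp add: Rp_def)
    next
      case False
      have "(1-u) * b x0 r \<ge> 0" "u * b x r > 0" using False that u x by (auto simp: Rp_def)
      then show ?thesis unfolding u(3) bf_lin by linarith
    qed
    have "y \<notin> mirrors G"
    proof
      assume "y \<in> mirrors G"
      then obtain r where r: "is_root G r" "b y r = 0" by (auto simp: mirrors_def)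
      then show False using root_Rp[OF r(1)] pos[of r] pos[of "- r"] by (auto simp: bf_lin)
    qed
    then show "y \<in> V - mirrors G" using yV by simp
  qed
  then have "connected_component (V - mirrors G) x0 x"
    unfolding connected_component_def by (metis connected_segment ends_in_segment)
  then show "x \<in> connected_component_set (V - mirrors G) x0" by simp
qed

text \<open>For the harder inclusion: x + x0/n is strictly positive on every positive root and tends
  to \<open>x\<close>.\<close>

lemma polygon_eq: "closure (connected_component_set (V - mirrors G) x0) \<inter> V = Ch"
proof (intro set_eqI iffI)
  fix x assume x: "x \<in> closure (connected_component_set (V - mirrors G) x0) \<inter> V"
  have "b x r \<ge> 0" if "r \<in> Rp" for r
  proof -
    have "closed {y. b y r \<ge> 0}" by (intro closed_Collect_le continuous_intros)
    moreover have "connected_component_set (V - mirrors G) x0 \<subseteq> {y. b y r \<ge> 0}"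
      using that component_eq by auto
    ultimately have "closure (connected_component_set (V - mirrors G) x0) \<subseteq> {y. b y r \<ge> 0}"
      by (simp add: closure_minimal)
    then show ?thesis using x by auto
  qed
  then show "x \<in> Ch" using x by (auto simp: Ch_def)
next
  fix x assume x: "x \<in> Ch"
  let ?f = "\<lambda>n. x + (1 / real (Suc n)) *\<^sub>R x0"
  have "?f n \<in> connected_component_set (V - mirrors G) x0" for n
  proof -
    have "?f n \<in> V" using x x0 by (intro V_add' V_scale) (auto simp: Ch_def)
    moreover have "b (?f n) r > 0" if "r \<in> Rp" for r
    proof -
      have "b x r \<ge> 0" "b x0 r > 0" using that x by (auto simp: Ch_def Rp_def)
      then show ?thesis by (simp add: bf_lin add_nonneg_pos)
    qed
    ultimately show ?thesis unfolding component_eq by blast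
  qed
  moreover have "?f \<longlonglongrightarrow> x + 0 *\<^sub>R x0"
    using LIMSEQ_inverse_real_of_nat by (intro tendsto_intros) (simp add: inverse_eq_divide)
  ultimately have "x \<in> closure (connected_component_set (V - mirrors G) x0)"
    unfolding closure_sequential by (intro exI[of _ ?f]) auto
  then show "x \<in> closure (connected_component_set (V - mirrors G) x0) \<inter> V" using x by (simp add: Ch_def)
qed

text \<open>The criterion by which all new symmetries of the polygon are produced. Mapping
  \<open>Rp\<close> into itself suffices: if the preimage of a positive root \<open>r\<close> were
  not positive, its negative would be, and \<open>f\<close> would make \<open>-r\<close>
  positive.\<close>

lemma A_M_I:
  assumes f: "iso f" and v: "x \<in> V" "f x \<in> V" and R: "\<And>r. r \<in> Rp \<Longrightarrow> f r \<in> Rp"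
  shows "f \<in> A_M G V Ch"
proof -
  have bj: "bij f" and B: "\<And>x y. b (f x) (f y) = b x y" using f by (auto simp: iso_def)
  have lin: "linear f" using f by (simp add: iso_def)
  have fV: "f ` V = V" by (rule iso_V[OF f v])
  have R': "inv f r \<in> Rp" if "r \<in> Rp" for r
  proof (rule ccontr)
    assume "inv f r \<notin> Rp"
    then have "- inv f r \<in> Rp" using root_Rp[OF iso_root[OF iso_inv[OF f] Rp_root[OF that]]] by blast
    then have "f (- inv f r) \<in> Rp" by (rule R)
    then have "- r \<in> Rp" using lin bj by (simp add: linear_neg bij_is_surj surj_f_inv_f)
    then show False using that Rp_anti by blast
  qed
  have "f ` Ch = Ch"
  proof (intro set_eqI iffI)
    fix y assume "y \<in> f ` Ch"
    then obtain x where x: "x \<in> Ch" "y = f x" by blast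
    have "b (f x) r \<ge> 0" if "r \<in> Rp" for r
    proof -
      have "b (f x) r = b x (inv f r)" using B[of x "inv f r"] bj by (simp add: bij_is_surj surj_f_inv_f)
      then show ?thesis using x R'[OF that] by (simp add: Ch_def)
    qed
    then show "y \<in> Ch" using x fV by (auto simp: Ch_def)
  next
    fix y assume y: "y \<in> Ch"
    then obtain x where x: "x \<in> V" "y = f x" using fV by (auto simp: Ch_def)
    have "b x r \<ge> 0" if "r \<in> Rp" for r using y R[OF that] B x by (auto simp: Ch_def)
    then show "y \<in> f ` Ch" using x by (auto simp: Ch_def)
  qed
  then show ?thesis using f fV by (auto simp: A_M_def O_plus_def iso_def)
qed

lemma A_M_iso: "f \<in> A_M G V Ch \<Longrightarrow> iso f" by (auto simp: A_M_def intro: O_plus_iso)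

lemma finite_sep:
  assumes "x \<in> V" "y \<in> V" shows "finite {r\<in>Rp. b x r \<ge> 0 \<and> b y r \<le> 0}"
proof (rule finite_subset[OF _ finite_separating[of x y "2 * d"]])
  show "{r\<in>Rp. b x r \<ge> 0 \<and> b y r \<le> 0} \<subseteq> {r\<in>lat. - b r r \<le> 2 * d \<and> b x r \<ge> 0 \<and> b y r \<le> 0}"
    using Rp_root root_lat root_bound by auto
qed (use assms V_pos V_V in auto)

end

section \<open>Pell automorphs\<close>

lemma square_if_rational:
  fixes a :: real assumes "a \<in> \<rat>" "a^2 = of_nat n" shows "\<exists>m. n = m^2"
proof -
  obtain p q :: int where pq: "q > 0" "coprime p q" "a = of_int p / of_int q"
    using assms(1) by (metis Rats_cases' )
  have "(of_int (p^2) :: real) = of_int (int n * q^2)"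
    using assms(2) pq by (simp add: field_simps)
  then have e: "p^2 = int n * q^2" by linarith
  then have "q^2 dvd p^2" by simp
  moreover have "coprime (p^2) (q^2)" using pq by simp
  ultimately have "q^2 dvd 1" by (metis coprime_common_divisor dvd_refl)
  then have "q dvd 1" by (metis dvd_trans dvd_power zero_less_numeral)
  then have "q = 1" using pq(1) by simp
  then have "int n = int ((nat \<bar>p\<bar>)^2)" using e by simp
  then show ?thesis by (metis of_nat_eq_iff)
qed

text \<open>Infinitely many good approximations h/k of sqrt n have bounded norm h^2 - n k^2, so two
  of them share the norm and the residues modulo it. Their quotient is the wanted unit.\<close>

lemma pell:
  assumes "\<nexists>m. n = m^2" shows "\<exists>t u :: nat. u > 0 \<and> t^2 = n * u^2 + 1"
proof -
  let ?a = "sqrt (real n)"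
  have irr: "?a \<notin> \<rat>" using square_if_rational[of ?a n] assms by auto
  have norm_nz: "h^2 \<noteq> int n * k^2" if "k > 0" for h k :: int
  proof
    assume e: "h^2 = int n * k^2"
    have "(of_int h / of_int k :: real)^2 = real n" using e that
      by (simp add: power_divide divide_eq_eq) (metis of_int_mult of_int_of_nat_eq of_int_power)
    then have "?a = \<bar>of_int h / of_int k\<bar>" by (metis real_sqrt_abs)
    moreover have "\<bar>of_int h / of_int k :: real\<bar> \<in> \<rat>" by simp
    ultimately show False using irr by simp
  qed
  define B where "B = \<lceil>2 * ?a + 1\<rceil>"
  let ?N = "\<lambda>(h,k). h^2 - int n * k^2"
  let ?f = "\<lambda>x. (?N x, fst x mod ?N x, snd x mod ?N x)"
  have inf: "infinite (approx_set ?a)" using irr rational_iff_finite_approx_set by blast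
  have N: "?N (h,k) \<in> {-B..B}" if "(h,k) \<in> approx_set ?a" for h k
  proof -
    have hk: "k > 0" "\<bar>?a - of_int h / of_int k\<bar> < 1 / (of_int k)^2"
      using that by (auto simp: approx_set_def)
    have "1 / (of_int k)^2 \<le> (1::real)" using hk(1) by simp
    then have s: "\<bar>?a + of_int h / of_int k\<bar> \<le> 2 * ?a + 1" using hk(2) real_sqrt_ge_zero[of "real n"] by linarith
    define X where "X = ?a - of_int h / of_int k"
    define Y where "Y = ?a + of_int h / of_int k"
    define K where "K = (of_int k :: real)"
    have K: "K > 0" using hk(1) by (simp add: K_def)
    have "of_int (?N (h,k)) = - (K^2 * (X * Y))"
      using hk(1) by (simp add: X_def Y_def K_def field_simps power2_eq_square)
    then have "\<bar>of_int (?N (h,k)) :: real\<bar> = K^2 * (\<bar>X\<bar> * \<bar>Y\<bar>)" by (simp add: abs_mult)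
    also have "\<dots> \<le> K^2 * (1 / K^2 * (2 * ?a + 1))"
      using hk(2) s K by (intro mult_left_mono mult_mono) (auto simp: X_def Y_def K_def)
    also have "\<dots> = 2 * ?a + 1" using K by simp
    finally show ?thesis unfolding B_def atLeastAtMost_iff by linarith
  qed
  have "?f ` approx_set ?a \<subseteq> {-B..B} \<times> {-B..B} \<times> {-B..B}"
  proof
    fix y assume "y \<in> ?f ` approx_set ?a"
    then obtain h k where hk: "(h,k) \<in> approx_set ?a" "y = ?f (h,k)" by auto
    have kp: "k > 0" using hk by (auto simp: approx_set_def)
    have nz: "?N (h,k) \<noteq> 0" using norm_nz[OF kp, of h] by simp
    have m: "\<bar>z mod ?N (h,k)\<bar> \<le> B" for z
      using N[OF hk(1)] abs_mod_less[OF nz, of z] by auto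
    show "y \<in> {-B..B} \<times> {-B..B} \<times> {-B..B}"
      using N[OF hk(1)] m[of h] m[of k] by (auto simp: hk(2) abs_le_iff)
  qed
  then have "finite (?f ` approx_set ?a)" by (rule finite_subset) simp
  then have "\<not> inj_on ?f (approx_set ?a)" using inf finite_imageD by blast
  then obtain h k h' k' where ne: "(h,k) \<noteq> (h',k')" and A: "(h,k) \<in> approx_set ?a" "(h',k') \<in> approx_set ?a"
    and eq: "?f (h,k) = ?f (h',k')" unfolding inj_on_def by fast
  define M where "M = ?N (h,k)"
  have M: "h^2 - int n * k^2 = M" "h'^2 - int n * k'^2 = M" "h mod M = h' mod M" "k mod M = k' mod M"
    using eq by (auto simp: M_def)
  have pos: "k > 0" "k' > 0" "coprime h k" "coprime h' k'" using A by (auto simp: approx_set_def)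
  have M0: "M \<noteq> 0" using norm_nz[OF pos(1), of h] M(1) by simp
  obtain p where p: "h' = h + M * p" using M(3) by (metis mod_eqE mult.commute add.commute diff_add_cancel)
  obtain q where q: "k' = k + M * q" using M(4) by (metis mod_eqE mult.commute add.commute diff_add_cancel)
  \<comment> \<open>t + u sqrt n is the quotient of h' + k' sqrt n by h + k sqrt n; the congruences
    modulo \<open>M\<close> remove the denominator \<open>M\<close>.\<close>
  define t where "t = 1 + h * p - int n * k * q"
  define u where "u = h * q - p * k"
  have t: "M * t = h * h' - int n * k * k'" unfolding t_def p q using M(1) by (simp add: algebra_simps power2_eq_square)
  have u: "M * u = h * k' - h' * k" unfolding u_def p q by (simp add: algebra_simps)
  have "(M * t)^2 - int n * (M * u)^2 = (h^2 - int n * k^2) * (h'^2 - int n * k'^2)"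
    unfolding t u by (simp add: algebra_simps power2_eq_square)
  then have "M^2 * (t^2 - int n * u^2) = M^2 * 1" unfolding M(1,2) by (simp add: algebra_simps power2_eq_square)
  then have tu: "t^2 - int n * u^2 = 1" using M0 by simp
  have "u \<noteq> 0"
  proof
    assume "u = 0"
    then have e: "h * k' = h' * k" using u by simp
    then have "k dvd h * k'" "k' dvd h' * k" by (metis dvd_triv_right)+
    then have "k dvd k'" "k' dvd k" using pos(3,4) by (meson coprime_commute coprime_dvd_mult_right_iff)+
    then have "k = k'" using pos by (meson zdvd_antisym_nonneg less_imp_le)
    then show False using e ne pos by simp
  qed
  then have "nat \<bar>u\<bar> > 0" by simp
  moreover have "int ((nat \<bar>t\<bar>)^2) = int (n * (nat \<bar>u\<bar>)^2 + 1)" using tu by simp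
  then have "(nat \<bar>t\<bar>)^2 = n * (nat \<bar>u\<bar>)^2 + 1" by (metis of_nat_eq_iff)
  ultimately show ?thesis by blast
qed

context hyp
begin

lemma nondeg: assumes "\<And>z. b x z = 0" shows "x = 0"
proof (rule ccontr)
  assume x: "x \<noteq> 0"
  obtain p where "b p p > 0" using ex_pos by blast
  then have "b x x < 0" using neg_orth[of p x] x assms[of p] sym[of p x] by simp
  then show False using assms by simp
qed

lemma cr_skew: "b (cr G v x) y = - b x (cr G v y)"
  by (simp add: b_cr b_cr' tri_def algebra_simps)

lemma cr_cr: "cr G v (cr G v x) = (d * b x v) *\<^sub>R v - (d * b v v) *\<^sub>R x"
proof -
  have "b (cr G v (cr G v x)) z = b ((d * b x v) *\<^sub>R v - (d * b v v) *\<^sub>R x) z" for z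
    using sym[of x v] unfolding cr_skew[of v "cr G v x"] b_cr[of v x] tcr bf_lin by (simp add: algebra_simps)
  then show ?thesis using nondeg[of "cr G v (cr G v x) - ((d * b x v) *\<^sub>R v - (d * b v v) *\<^sub>R x)"]
    unfolding bf_diff_left[of _ "cr G v (cr G v x)"] by simp
qed

lemma cr_orth: "b v (cr G v x) = 0" "b x (cr G v x) = 0"
  by (simp_all add: b_cr' tri_same)

text \<open>The combination of \<open>x\<close> and \<open>y\<close> orthogonal to a positive vector
  \<open>p\<close> is isotropic in a negative definite plane, hence zero.\<close>

lemma null_orth:
  assumes "b x x = 0" "b y y = 0" "b x y = 0" "x \<noteq> 0" shows "\<exists>a. y = a *\<^sub>R x"
proof -
  obtain p where p: "b p p > 0" using ex_pos by blast
  let ?z = "b p x *\<^sub>R y - b p y *\<^sub>R x"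
  have "b p ?z = 0" by (simp add: bf_lin)
  moreover have "b ?z ?z = 0" using assms sym[of y x] by (simp add: bf_lin)
  ultimately have "?z = 0" using neg_orth[OF p, of ?z] by fastforce
  moreover have "b p x \<noteq> 0" using neg_orth[OF p, of x] assms by fastforce
  ultimately show ?thesis by (intro exI[of _ "b p y / b p x"]) (simp add: vec_eq_iff field_simps)
qed

text \<open>\<open>tau v t u = 1 + 2tu J + 2u\<^sup>2 J\<^sup>2\<close> with \<open>J = cr v\<close>. Since \<open>J\<^sup>3 = D J\<close> for \<open>D = - d v\<^sup>2\<close>,
  Pell's equation \<open>t\<^sup>2 = D u\<^sup>2 + 1\<close> makes it an isometry; \<open>v\<^sup>2 = 0\<close>, \<open>t = u = 1\<close> gives a parabolic one.\<close>
definition tau :: "real^3 \<Rightarrow> real \<Rightarrow> real \<Rightarrow> real^3 \<Rightarrow> real^3" where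
  "tau v t u x = x + (2*t*u) *\<^sub>R cr G v x + (2*u^2) *\<^sub>R cr G v (cr G v x)"

lemma cr_cube: "cr G v (cr G v (cr G v x)) = (- d * b v v) *\<^sub>R cr G v x"
  using sym[of "cr G v x" v] by (simp add: cr_cr[of v "cr G v x"] cr_orth)

lemma linear_tau: "linear (tau v t u)"
  by (rule linearI) (simp_all add: tau_def cr_lin algebra_simps)

lemma tau_inverse:
  assumes "t^2 = 1 - d * b v v * u^2" shows "tau v t (-u) (tau v t u x) = x"
proof -
  let ?J = "cr G v"
  have J4: "?J (?J (?J (?J x))) = (- d * b v v) *\<^sub>R ?J (?J x)" by (rule cr_cube)
  have "tau v t (-u) (tau v t u x) = x + (4*u^2 - 4*t^2*u^2 - 4 * u^4 * (d * b v v)) *\<^sub>R ?J (?J x)"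
    unfolding tau_def cr_lin J4 cr_cube
    by (simp add: vec_eq_iff algebra_simps power2_eq_square power4_eq_xxxx)
  also have "4*u^2 - 4*t^2*u^2 - 4 * u^4 * (d * b v v) = 0"
    unfolding assms by (simp add: algebra_simps power2_eq_square power4_eq_xxxx)
  finally show ?thesis by simp
qed

lemma tau_isometry:
  assumes "t^2 = 1 - d * b v v * u^2" shows "b (tau v t u x) (tau v t u y) = b x y"
proof -
  have "b (tau v t u x) z = b x (tau v t (-u) z)" for z
    unfolding tau_def by (simp add: bf_lin cr_skew)
  then show ?thesis using tau_inverse[OF assms] by simp
qed

lemma tau_lat: "v \<in> lat \<Longrightarrow> x \<in> lat \<Longrightarrow> t \<in> \<int> \<Longrightarrow> u \<in> \<int> \<Longrightarrow> tau v t u x \<in> lat"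
  unfolding tau_def by (intro lat_intros cr_lat) auto

lemma tau_eigen:
  assumes "cr G v n = a *\<^sub>R n" "t^2 = 1 + a^2 * u^2" shows "tau v t u n = (t + u * a)^2 *\<^sub>R n"
proof -
  have "tau v t u n = (1 + 2*t*u*a + 2*u^2*a^2) *\<^sub>R n"
    unfolding tau_def assms(1) cr_lin by (simp add: assms(1) algebra_simps power2_eq_square)
  also have "1 + 2*t*u*a + 2*u^2*a^2 = (t + u * a)^2" using assms(2) by (simp add: power2_eq_square algebra_simps)
  finally show ?thesis .
qed

text \<open>\<open>cr G v n\<close> is isotropic and orthogonal to \<open>n\<close>, hence a
  multiple of \<open>n\<close>; applying \<open>cr G v\<close> once more gives the square of the
  eigenvalue.\<close>

lemma cr_null:
  assumes "b n n = 0" "b v n = 0" "n \<noteq> 0" obtains a where "cr G v n = a *\<^sub>R n" "a^2 = - d * b v v"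
proof -
  have "b (cr G v n) (cr G v n) = 0" using assms by (simp add: cr_norm)
  moreover have "b n (cr G v n) = 0" by (rule cr_orth)
  ultimately obtain a where a: "cr G v n = a *\<^sub>R n" using null_orth[of n "cr G v n"] assms by blast
  have "(a^2) *\<^sub>R n = (- d * b v v) *\<^sub>R n"
    using cr_cr[of v n] assms sym[of n v] by (simp add: a cr_lin power2_eq_square)
  then have "a^2 = - d * b v v" using assms(3) by (metis scaleR_cancel_right)
  then show thesis by (rule that[OF a])
qed

lemma disc_nat: assumes "v \<in> lat" "b v v \<le> 0" shows "\<exists>n. - d * b v v = real n"
proof -
  have "- d * b v v \<in> \<int>" unfolding d_def using bf_lat_Ints[OF assms(1,1)] by (intro Ints_mult Ints_minus) auto
  then obtain m where m: "- d * b v v = of_int m" by (rule Ints_cases)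
  moreover have "- d * b v v \<ge> 0" using d_pos assms(2) by (simp add: mult_nonneg_nonpos)
  ultimately have "m \<ge> 0" by simp
  then show ?thesis using m by (metis of_nat_nat of_int_of_nat_eq)
qed

lemma eigen_square:
  assumes "v \<in> lat" "y \<in> lat" "y \<noteq> 0" "cr G v y = a *\<^sub>R y" "a^2 = real n" shows "\<exists>m. n = m^2"
proof -
  obtain i where i: "y$i \<noteq> 0" using assms(3) by (auto simp: vec_eq_iff)
  have "cr G v y $ i = a * y$i" using assms(4) by simp
  then have "a = cr G v y $ i / y $ i" using i by simp
  moreover have "cr G v y $ i \<in> \<int>" "y$i \<in> \<int>" using cr_lat assms(1,2) by (auto simp: lat_def)
  ultimately have "a \<in> \<rat>" using Ints_subset_Rats by (auto intro!: Rats_divide)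
  then show ?thesis using square_if_rational assms(5) by blast
qed

text \<open>The projection \<open>w\<close> of \<open>r\<close> to the plane orthogonal to
  \<open>v\<close>, scaled into the lattice, is an eigenvector of \<open>cr G v\<close> for the
  irrational eigenvalue of \<open>n\<close> unless it is 0. A lattice vector cannot be such an
  eigenvector.\<close>

lemma orth_irrational_end:
  assumes v: "v \<in> lat" "b v v < 0" and n: "b n n = 0" "b v n = 0" "n \<noteq> 0"
    and ns: "\<nexists>m. - d * b v v = real (m^2)" and r: "r \<in> lat" "b n r = 0"
  shows "\<exists>a. r = a *\<^sub>R v"
proof -
  obtain a where a: "cr G v n = a *\<^sub>R n" "a^2 = - d * b v v" using cr_null n by blast
  have a0: "a \<noteq> 0" using a(2) v(2) d_pos by auto
  define w where "w = b v v *\<^sub>R r - b r v *\<^sub>R v"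
  have w: "w \<in> lat" unfolding w_def using v r by (intro lat_intros) (auto intro: bf_lat_Ints)
  have wv: "b w v = 0" "b w n = 0" using n r sym[of r n] sym[of v n] by (simp_all add: w_def bf_lin)
  define J where "J = cr G v"
  have JJ: "J (J w) = a^2 *\<^sub>R w" unfolding J_def cr_cr wv a(2) by simp
  have null: "b A A = 0" if "J A = c *\<^sub>R A" "c \<noteq> 0" for A c
    using cr_orth(2)[of A v] that by (simp add: J_def bf_lin)
  have nJ: "b n (J w) = 0"
    using cr_skew[of v n w] wv(2) sym[of n w] by (simp add: J_def a(1) bf_scale_left)
  \<comment> \<open>\<open>?B\<close> has eigenvalue \<open>-a\<close>, so it is isotropic; being
    orthogonal to \<open>n\<close> it is a multiple of \<open>n\<close>, whose eigenvalue is
    \<open>a\<close>. Hence it vanishes.\<close>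
  let ?B = "J w - a *\<^sub>R w"
  have Jl: "J (x + y) = J x + J y" "J (c *\<^sub>R x) = c *\<^sub>R J x" "J (x - y) = J x - J y" for x y c
    by (simp_all add: J_def cr_lin)
  have JB: "J ?B = (-a) *\<^sub>R ?B" by (simp add: Jl JJ vec_eq_iff algebra_simps power2_eq_square)
  have "b n ?B = 0" using nJ wv(2) sym[of n w] by (simp add: bf_diff_right bf_scale_right)
  moreover have "b ?B ?B = 0" by (rule null[OF JB]) (use a0 in simp)
  ultimately obtain c where c: "?B = c *\<^sub>R n" using null_orth[of n ?B] n by blast
  have "J ?B = (c * a) *\<^sub>R n" by (simp only: c Jl) (simp add: J_def a(1))
  then have "(c * a) *\<^sub>R n = (- a * c) *\<^sub>R n" using JB c by simp
  then have "c * a = - a * c" using n(3) by (metis scaleR_cancel_right)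
  then have "c = 0" using a0 by simp
  then have "J w = a *\<^sub>R w" using c by simp
  moreover obtain k where k: "- d * b v v = real k" using disc_nat[of v] v by auto
  ultimately have "w = 0" using eigen_square[OF v(1) w, of a k] a(2) ns by (auto simp: J_def)
  then show ?thesis using v(2) by (intro exI[of _ "b r v / b v v"]) (simp add: w_def vec_eq_iff field_simps)
qed

end

context hypV
begin

lemma tau_iso:
  assumes "v \<in> lat" "t^2 = 1 - d * b v v * u^2" "t \<in> \<int>" "u \<in> \<int>" shows "iso (tau v t u)"
proof -
  have i1: "tau v t (-u) (tau v t u x) = x" for x by (rule tau_inverse[OF assms(2)])
  have i2: "tau v t u (tau v t (-u) x) = x" for x using tau_inverse[of t v "-u" x] assms(2) by simp
  have "bij (tau v t u)" by (rule bijI'[OF _ ]) (metis i1, metis i2)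
  moreover have "tau v t u ` lat = lat"
  proof (intro set_eqI iffI)
    fix y assume "y \<in> tau v t u ` lat" then show "y \<in> lat" using tau_lat[OF assms(1) _ assms(3,4)] by auto
  next
    fix y assume "y \<in> lat"
    then have "tau v t (-u) y \<in> lat" using tau_lat[OF assms(1) _ assms(3), of y "-u"] assms(4) by simp
    then show "y \<in> tau v t u ` lat" by (intro image_eqI[of _ _ "tau v t (-u) y"]) (simp_all add: i2)
  qed
  ultimately show ?thesis unfolding iso_def using linear_tau tau_isometry[OF assms(2)] by blast
qed

end

section \<open>Translations along the geodesic of rho\<close>

context chamber
begin

lemma A_M_iff: "f \<in> A_M G V Ch \<longleftrightarrow> iso f \<and> f ` V = V \<and> f ` Ch = Ch"
  using O_plus_iso by (auto simp: A_M_def) (auto simp: O_plus_def iso_def)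

lemma A_M_comp: "f \<in> A_M G V Ch \<Longrightarrow> g \<in> A_M G V Ch \<Longrightarrow> f \<circ> g \<in> A_M G V Ch"
  unfolding A_M_iff by (metis image_comp iso_comp)

lemma A_M_id: "id \<in> A_M G V Ch"
  by (auto simp: A_M_iff iso_def linear_id)

lemma A_M_inv: assumes "f \<in> A_M G V Ch" shows "inv f \<in> A_M G V Ch"
proof -
  have "inj f" using assms by (simp add: A_M_iff iso_def bij_is_inj)
  then show ?thesis using assms iso_inv unfolding A_M_iff by (metis image_inv_f_f)
qed

lemma A_M_pow: "f \<in> A_M G V Ch \<Longrightarrow> f ^^ n \<in> A_M G V Ch"
  by (induction n) (auto simp: A_M_id A_M_comp)

end

locale refl = chamber +
  fixes \<rho> H
  assumes \<rho>: "\<rho> \<in> lat" "b \<rho> \<rho> < 0"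
    and H: "finite_index_subgroup H (A_M G V Ch)" "\<And>h. h \<in> H \<Longrightarrow> h \<rho> = \<rho>"
    and inf: "infinite (A_M G V Ch)"
begin

abbreviation "AM \<equiv> A_M G V Ch"

lemma H_sub: "h \<in> H \<Longrightarrow> h \<in> AM" and H_id: "id \<in> H"
  and H_comp: "f \<in> H \<Longrightarrow> g \<in> H \<Longrightarrow> f \<circ> g \<in> H" and H_inv: "f \<in> H \<Longrightarrow> inv f \<in> H"
  and H_fin: "finite ((\<lambda>f. (\<lambda>h. f \<circ> h) ` H) ` AM)"
  using H(1) by (auto simp: finite_index_subgroup_def)

lemma H_infinite: "infinite H"
proof
  assume fin: "finite H"
  have "f \<in> (\<lambda>h. f \<circ> h) ` H" for f :: "real^3 \<Rightarrow> real^3" by (rule image_eqI[OF _ H_id]) simp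
  then have "AM \<subseteq> \<Union> ((\<lambda>f. (\<lambda>h. f \<circ> h) ` H) ` AM)" by blast
  moreover have "finite (\<Union> ((\<lambda>f. (\<lambda>h. f \<circ> h) ` H) ` AM))" using fin H_fin by (intro finite_Union) auto
  ultimately show False using inf finite_subset by blast
qed

text \<open>By finite index two powers of \<open>f\<close> lie in the same left coset of
  \<open>H\<close>, so their quotient fixes \<rho>.\<close>

lemma power_fix:
  assumes "f \<in> AM" obtains j where "j > 0" "(f ^^ j) \<rho> = \<rho>"
proof -
  let ?c = "\<lambda>i. (\<lambda>h. (f ^^ i) \<circ> h) ` H"
  have "range ?c \<subseteq> (\<lambda>f. (\<lambda>h. f \<circ> h) ` H) ` AM" using A_M_pow[OF assms] by blast
  then have "finite (range ?c)" using H_fin finite_subset by blast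
  then have "\<not> inj ?c" using finite_imageD infinite_UNIV_nat by blast
  then obtain i i' where ii: "i \<noteq> i'" "?c i = ?c i'" unfolding inj_on_def by blast
  have main: "\<exists>j>0. (f ^^ j) \<rho> = \<rho>" if lt: "i < i'" and eq: "?c i = ?c i'" for i i'
  proof -
    have "f ^^ i' \<in> ?c i'" by (rule image_eqI[OF _ H_id]) simp
    then obtain h where h: "h \<in> H" "f ^^ i' = (f ^^ i) \<circ> h" using eq by auto
    have "(f ^^ i) ((f ^^ (i' - i)) \<rho>) = (f ^^ i') \<rho>"
      using lt by (metis funpow_add comp_apply le_add_diff_inverse less_imp_le)
    also have "\<dots> = (f ^^ i) \<rho>" by (simp add: H(2)[OF h(1)] h(2))
    finally have "(f ^^ (i' - i)) \<rho> = \<rho>"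
      using A_M_pow[OF assms, of i] by (simp add: A_M_iff iso_def bij_is_inj inj_eq)
    then show ?thesis using lt by (intro exI[of _ "i' - i"]) simp
  qed
  then show thesis using that ii by (metis linorder_neqE_nat)
qed

text \<open>A nonsingular ideal point \<open>n\<close> of the polygon cannot be an irrational end of a rational geodesic
  \<open>v\<^sup>\<bottom>\<close> other than the one of \<open>\<rho>\<close>, since the Pell automorph along \<open>v\<^sup>\<bottom>\<close> would preserve the polygon.\<close>
lemma irrational_end:
  assumes v: "v \<in> lat" "b v v < 0" and n: "b n n = 0" "b v n = 0" "b x0 n > 0"
    and R: "\<And>r. r \<in> Rp \<Longrightarrow> b n r > 0 \<or> (\<exists>a. r = a *\<^sub>R v)"
    and ns: "\<nexists>m. - d * b v v = real (m^2)"
  shows "\<exists>c. \<rho> = c *\<^sub>R v"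
proof -
  have n0: "n \<noteq> 0" using n(3) by (auto simp: bf_lin)
  obtain D where D: "- d * b v v = real D" using disc_nat v by force
  have "\<nexists>m. D = m^2" using ns D by auto
  then obtain t u :: nat where tu: "u > 0" "t^2 = D * u^2 + 1" using pell by blast
  then have "real (t^2) = real (D * u^2 + 1)" by simp
  then have tu': "(real t)^2 = 1 - d * b v v * (real u)^2" unfolding D[symmetric] of_nat_add of_nat_mult by simp
  define f where "f = tau v (real t) (real u)"
  have f: "iso f" unfolding f_def by (rule tau_iso[OF v(1) tu']) auto
  have B: "b (f x) (f y) = b x y" for x y using f by (simp add: iso_def)
  obtain a where a: "cr G v n = a *\<^sub>R n" "a^2 = - d * b v v" using cr_null[OF n(1,2) n0] by blast
  have a0: "a \<noteq> 0" using a(2) v(2) d_pos by auto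
  have tua: "(real t)^2 = 1 + a^2 * (real u)^2" using tu' a(2) by simp
  define l where "l = (real t + real u * a)^2"
  have fn: "f n = l *\<^sub>R n" unfolding f_def l_def by (rule tau_eigen[OF a(1) tua])
  have prod: "(real t + real u * a) * (real t - real u * a) = 1"
    using tua by (simp add: algebra_simps power2_eq_square)
  have l0: "l > 0" unfolding l_def using prod by (metis mult_zero_left zero_less_power2 zero_neq_one)
  have l1: "l \<noteq> 1"
  proof
    assume "l = 1"
    then have "real t + real u * a = 1 \<or> real t + real u * a = -1" unfolding l_def by (simp add: power2_eq_1_iff)
    then have "real u * a = 0"
    proof
      assume e: "real t + real u * a = 1"
      have "real t - real u * a = 1" using prod unfolding e by simp
      then show ?thesis using e by linarith
    next
      assume e: "real t + real u * a = - 1"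
      have "real t - real u * a = - 1" using prod unfolding e by simp
      then show ?thesis using e by linarith
    qed
    then show False using a0 tu(1) by simp
  qed
  have fv: "f v = v" unfolding f_def tau_def cr_lin by (simp add: cr_def Let_def vec3_eq_iff)
  have V1: "f x0 \<in> V"
  proof -
    have "b (f x0) n = b x0 n / l" using B[of x0 n] fn l0 by (simp add: bf_lin field_simps)
    then have p: "b (f x0) n > 0" using n(3) l0 by simp
    have ff: "b (f x0) (f x0) > 0" using B V_pos x0 by simp
    have "b x0 (f x0) \<noteq> 0"
      using neg_orth'[OF V_pos[OF x0(1)], of "f x0"] ff by auto
    moreover have "\<not> b x0 (f x0) < 0"
    proof
      assume "b x0 (f x0) < 0"
      then have "- f x0 \<in> V" using V_I[of "- f x0" x0] x0 ff by (simp add: bf_lin)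
      then have "b (- f x0) n > 0" using cone_pos[of "- f x0" n x0] n x0 by simp
      then show False using p by (simp add: bf_lin)
    qed
    ultimately show ?thesis using V_I[of "f x0" x0] x0 ff by simp
  qed
  have nn: "b n r \<ge> 0" if "r \<in> Rp" for r using R[OF that] n(2) sym[of n v] by (auto simp: bf_lin)
  have "f \<in> AM"
  proof (rule A_M_I[OF f x0(1) V1])
    fix r assume r: "r \<in> Rp"
    show "f r \<in> Rp"
    proof (cases "\<exists>a. r = a *\<^sub>R v")
      case True
      then obtain c where c: "r = c *\<^sub>R v" by blast
      then show ?thesis using r fv f by (simp add: iso_def linear_scale)
    next
      case False
      then have "b n r > 0" using R[OF r] by blast
      moreover have "b n (f r) = b n r / l" using B[of n r] fn l0 by (simp add: bf_lin field_simps)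
      ultimately have p: "b n (f r) > 0" using l0 by simp
      show ?thesis
        using root_Rp[OF iso_root[OF f Rp_root[OF r]]] nn[of "- f r"] p by (auto simp: bf_lin)
    qed
  qed
  then obtain j where j: "j > 0" "(f ^^ j) \<rho> = \<rho>" using power_fix by blast
  have Bj: "b ((f ^^ j) x) ((f ^^ j) y) = b x y" for x y j by (induction j) (simp_all add: B)
  \<comment> \<open>The isometry \<open>f ^^ j\<close> fixes \<rho> and scales \<open>m\<close> by a
    factor other than 1, so the product of both is 0.\<close>
  have orth: "b m \<rho> = 0" if m: "f m = k *\<^sub>R m" "k > 0" "k \<noteq> 1" for m k
  proof -
    have "(f ^^ i) m = k^i *\<^sub>R m" for i
      by (induction i) (use m f in \<open>simp_all add: iso_def linear_scale mult.commute\<close>)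
    then have "k^j * b m \<rho> = b m \<rho>" using Bj[of j m \<rho>] j(2) by (simp add: bf_lin)
    moreover have "k^j \<noteq> 1" using m j(1) by (metis power_eq_1_iff abs_of_pos real_norm_def less_numeral_extra(3))
    ultimately show ?thesis by simp
  qed
  have n\<rho>: "b n \<rho> = 0" using orth[OF fn l0 l1] .
  show ?thesis
    using orth_irrational_end[OF v n(1,2) n0 ns \<rho>(1) n\<rho>] .
qed

text \<open>If no mirror passes through the cusp \<open>c\<close>, the parabolic isometry at
  \<open>c\<close> preserves the polygon. A power of it then fixes \<rho>, but it fixes only
  multiples of \<open>c\<close>, and \<rho> has negative square.\<close>

lemma rational_end:
  assumes c: "c \<in> lat" "b c c = 0" "b x0 c > 0" and R: "\<And>r. r \<in> Rp \<Longrightarrow> b c r > 0" shows False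
proof -
  define f where "f = tau c 1 1"
  have f: "iso f" unfolding f_def by (rule tau_iso[OF c(1)]) (use c in auto)
  have B: "b (f x) (f y) = b x y" for x y using f by (simp add: iso_def)
  have cr0: "cr G c 0 = 0" by (simp add: cr_def Let_def vec3_eq_iff)
  have fc: "f c = c" unfolding f_def tau_def by (simp add: cr_lin cr0)
  have V1: "f x0 \<in> V"
  proof -
    have p: "b (f x0) c > 0" using B[of x0 c] fc c(3) by simp
    have ff: "b (f x0) (f x0) > 0" using B V_pos x0 by simp
    have "b x0 (f x0) \<noteq> 0"
      using neg_orth'[OF V_pos[OF x0(1)], of "f x0"] ff by auto
    moreover have "\<not> b x0 (f x0) < 0"
    proof
      assume "b x0 (f x0) < 0"
      then have "- f x0 \<in> V" using V_I[of "- f x0" x0] x0 ff by (simp add: bf_lin)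
      then have "b (- f x0) c > 0" using cone_pos[of "- f x0" c x0] c x0 by simp
      then show False using p by (simp add: bf_lin)
    qed
    ultimately show ?thesis using V_I[of "f x0" x0] x0 ff by simp
  qed
  have "f \<in> AM"
  proof (rule A_M_I[OF f x0(1) V1])
    fix r assume r: "r \<in> Rp"
    have "b c (f r) > 0" using B[of c r] fc R[OF r] by simp
    then show "f r \<in> Rp"
      using root_Rp[OF iso_root[OF f Rp_root[OF r]]] R[of "- f r"] by (auto simp: bf_lin)
  qed
  then obtain j where j: "j > 0" "(f ^^ j) \<rho> = \<rho>" using power_fix by blast
  let ?J = "cr G c"
  have J3: "?J (?J (?J x)) = 0" for x using cr_cube[of c x] c(2) by simp
  \<comment> \<open>\<open>f\<close> is exp(2J) with J^3 = 0, so its powers are exp(2iJ).\<close>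
  have pow: "(f ^^ i) x = x + (2 * real i) *\<^sub>R ?J x + (2 * (real i)^2) *\<^sub>R ?J (?J x)" for i x
  proof (induction i)
    case (Suc i)
    have "(f ^^ Suc i) x = f (x + (2 * real i) *\<^sub>R ?J x + (2 * (real i)^2) *\<^sub>R ?J (?J x))" using Suc by simp
    also have "\<dots> = x + (2 * real (Suc i)) *\<^sub>R ?J x + (2 * (real (Suc i))^2) *\<^sub>R ?J (?J x)"
      unfolding f_def tau_def cr_lin J3 cr0 by (simp add: vec_eq_iff algebra_simps power2_eq_square)
    finally show ?case .
  qed simp
  have e: "(2 * real j) *\<^sub>R ?J \<rho> + (2 * (real j)^2) *\<^sub>R ?J (?J \<rho>) = 0" using pow[of j \<rho>] j(2) by simp
  have "?J ((2 * real j) *\<^sub>R ?J \<rho> + (2 * (real j)^2) *\<^sub>R ?J (?J \<rho>)) = (2 * real j) *\<^sub>R ?J (?J \<rho>)"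
    by (simp add: cr_lin J3)
  moreover have "?J 0 = 0" by (rule cr0)
  ultimately have "?J (?J \<rho>) = 0" using e j(1) by simp
  then have J0: "?J \<rho> = 0" using e j(1) by simp
  have "tri c \<rho> z = 0" for z using b_cr[of c \<rho> z] d_pos by (simp add: J0 bf_lin)
  moreover have "c \<noteq> 0" using c(3) by (auto simp: bf_lin)
  ultimately obtain k where "\<rho> = k *\<^sub>R c" using tri_zero_right by blast
  then show False using \<rho>(2) c(2) by (simp add: bf_lin)
qed

text \<open>\<open>rh\<close> is \<open>\<rho>\<close> normalised to square \<open>-1\<close>, \<open>uu\<close> the projection of \<open>x0\<close> to \<open>\<rho>\<^sup>\<bottom>\<close>; the isotropic vectors
  \<open>pp, qq\<close> are the ends of the geodesic \<open>\<rho>\<^sup>\<bottom>\<close>.\<close>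
definition rh where "rh = (1 / sqrt (- b \<rho> \<rho>)) *\<^sub>R \<rho>"
definition uu where "uu = (let u = x0 + (b x0 \<rho> / - b \<rho> \<rho>) *\<^sub>R \<rho> in (1 / sqrt (b u u)) *\<^sub>R u)"
definition ww where "ww = (1 / sqrt d) *\<^sub>R cr G rh uu"
definition pp where "pp = (1/2) *\<^sub>R (uu + ww)"
definition qq where "qq = (1/2) *\<^sub>R (uu - ww)"

lemma \<rho>_rh: "\<rho> = sqrt (- b \<rho> \<rho>) *\<^sub>R rh" using \<rho> by (simp add: rh_def)
lemma rh_norm: "b rh rh = - 1" using \<rho> by (simp add: rh_def bf_lin field_simps)

lemma uu_props: "b uu uu = 1" "b rh uu = 0" "uu \<in> V"
proof -
  let ?u = "x0 + (b x0 \<rho> / - b \<rho> \<rho>) *\<^sub>R \<rho>"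
  have o: "b \<rho> ?u = 0" using \<rho> sym[of \<rho> x0] by (simp add: bf_lin)
  have xx: "b x0 x0 > 0" using V_pos x0 by blast
  have s: "b x0 ?u = b x0 x0 + (b x0 \<rho>)^2 / - b \<rho> \<rho>" by (simp add: bf_lin power2_eq_square)
  have s2: "b x0 ?u > 0" unfolding s using xx \<rho>(2) by (intro add_pos_nonneg divide_nonneg_pos) auto
  have n: "b ?u ?u = b x0 ?u" unfolding bf_add_left[of _ x0] bf_scale_left o by simp
  have up: "b ?u ?u > 0" using n s2 by simp
  have uV: "?u \<in> V" by (rule V_I[OF up x0(1) s2])
  show "b uu uu = 1" using up by (simp add: uu_def Let_def bf_scale_left bf_scale_right del: bf_add_left)
  show "b rh uu = 0" using o by (simp add: uu_def rh_def Let_def bf_scale_left bf_scale_right)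
  show "uu \<in> V" unfolding uu_def Let_def using uV up by (intro V_scale) auto
qed

lemma ww_props: "b ww ww = - 1" "b rh ww = 0" "b uu ww = 0"
  using d_pos rh_norm uu_props
  by (simp_all add: ww_def bf_scale_left bf_scale_right cr_norm cr_orth field_simps)

lemma pq: "b pp pp = 0" "b qq qq = 0" "b pp qq = 1/2" "b qq pp = 1/2" "b rh pp = 0" "b rh qq = 0"
  "b pp rh = 0" "b qq rh = 0"
  "b uu pp = 1/2" "b uu qq = 1/2"
  using uu_props ww_props sym[of ww uu] sym[of _ rh] by (simp_all add: pp_def qq_def bf_lin)

lemma uu_pq: "uu = pp + qq" by (simp add: pp_def qq_def scaleR_add_right[symmetric] scaleR_2[symmetric])

lemma coords_zero: assumes "b pp y = 0" "b qq y = 0" "b rh y = 0" shows "y = 0"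
proof -
  have uy: "b uu y = 0" using assms by (simp add: uu_pq bf_lin)
  have wy: "b ww y = 0" using assms uy by (simp add: pp_def bf_lin)
  have "tri rh uu (cr G rh uu) = - 1" by (simp add: tcr rh_norm uu_props)
  then have t: "tri rh uu ww \<noteq> 0" using d_pos by (simp add: ww_def tri_lin)
  have "b y z = 0" for z
    using uy wy assms(3) sym[of y] by (subst tri_expand[OF t, of z]) (simp add: bf_lin)
  then show ?thesis by (rule nondeg)
qed

lemma coords: "x = (2 * b qq x) *\<^sub>R pp + (2 * b pp x) *\<^sub>R qq - b rh x *\<^sub>R rh"
proof -
  have "x - ((2 * b qq x) *\<^sub>R pp + (2 * b pp x) *\<^sub>R qq - b rh x *\<^sub>R rh) = 0"
    by (rule coords_zero) (simp_all add: bf_lin pq rh_norm)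
  then show ?thesis by simp
qed

lemma b_coords: "b x y = 2 * (b qq x * b pp y + b pp x * b qq y) - b rh x * b rh y"
  by (subst coords[of x]) (simp add: bf_lin algebra_simps)

lemma pq_cone: assumes "x \<in> V" shows "b pp x > 0" "b qq x > 0"
  using cone_pos[OF assms, of pp uu] cone_pos[OF assms, of qq uu] pq uu_props sym by auto

text \<open>The images of \<open>x0\<close> under the powers of \<open>g\<close> stay in the polygon
  and converge in direction to \<open>e\<close>, so no positive root is negative at
  \<open>e\<close>.\<close>

lemma boost_pos:
  assumes g: "g \<in> AM" "g e = l *\<^sub>R e" "g e' = (1/l) *\<^sub>R e'" "g rh = rh" and l: "l > 1"
    and x: "x0 = A *\<^sub>R e + B *\<^sub>R e' + C *\<^sub>R rh" "A > 0" and r: "r \<in> Rp"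
  shows "b e r \<ge> 0"
proof (rule ccontr)
  assume n: "\<not> b e r \<ge> 0"
  have lin: "linear g" using g by (simp add: A_M_iff iso_def)
  have pow: "(g ^^ n) x0 = (A * l^n) *\<^sub>R e + (B * (1/l)^n) *\<^sub>R e' + C *\<^sub>R rh" for n
    by (induction n) (simp_all add: x(1) g lin linear_add linear_scale mult_ac)
  have "b ((g ^^ n) x0) r \<ge> 0" for n
  proof -
    have "(g ^^ n) x0 \<in> Ch" using A_M_pow[OF g(1), of n] x0_Ch unfolding A_M_iff by blast
    then show ?thesis using r by (simp add: Ch_def)
  qed
  then have ge: "A * l^n * b e r + B * (1/l)^n * b e' r + C * b rh r \<ge> 0" for n
    unfolding pow by (simp add: bf_lin)
  let ?K = "\<bar>B * b e' r\<bar> + \<bar>C * b rh r\<bar> + 1"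
  obtain n where nn: "?K / (A * - b e r) < l^n" using real_arch_pow[OF l] by blast
  then have "?K < l^n * (A * - b e r)" using n x(2) by (subst (asm) pos_divide_less_eq) (auto simp: mult_pos_neg)
  moreover have "B * (1/l)^n * b e' r \<le> \<bar>B * b e' r\<bar>"
  proof -
    have "0 \<le> (1/l)^n" "(1/l)^n \<le> 1" using l by (auto intro: power_le_one)
    then have "\<bar>(1/l)^n * (B * b e' r)\<bar> \<le> \<bar>B * b e' r\<bar>" by (simp only: abs_mult) (simp add: mult_left_le_one_le)
    then show ?thesis by (simp add: mult_ac)
  qed
  ultimately show False using ge[of n] by (simp add: algebra_simps)
qed

text \<open>Otherwise the orbit of \<open>r\<close> under the powers of \<open>g\<close> would be an
  infinite set of roots with bounded product with \<open>uu\<close>.\<close>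

lemma boost_nonzero:
  assumes g: "g \<in> AM" "g e = m *\<^sub>R e" "g rh = rh" and m: "0 < m" "m < 1"
    and r: "is_root G r" "r = X *\<^sub>R e + Y *\<^sub>R rh" and e: "b uu e \<noteq> 0" shows "X = 0"
proof (rule ccontr)
  assume X: "X \<noteq> 0"
  have lin: "linear g" using g by (simp add: A_M_iff iso_def)
  have pow: "(g ^^ n) r = (X * m^n) *\<^sub>R e + Y *\<^sub>R rh" for n
    by (induction n) (simp_all add: r(2) g lin linear_add linear_scale mult_ac)
  have "range (\<lambda>n. (g ^^ n) r) \<subseteq> {s\<in>lat. \<bar>b uu s\<bar> \<le> \<bar>X * b uu e\<bar> \<and> - b s s \<le> 2 * d}"
  proof
    fix s assume "s \<in> range (\<lambda>n. (g ^^ n) r)"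
    then obtain n where s: "s = (g ^^ n) r" by blast
    have "is_root G s" unfolding s using iso_root[OF A_M_iso[OF A_M_pow[OF g(1)]] r(1)] .
    moreover have "\<bar>b uu s\<bar> = m^n * \<bar>X * b uu e\<bar>" unfolding s pow using m uu_props sym[of uu rh] by (simp add: bf_lin abs_mult)
    moreover have "m^n \<le> 1" "m^n \<ge> 0" using m by (auto intro: power_le_one)
    ultimately show "s \<in> {s\<in>lat. \<bar>b uu s\<bar> \<le> \<bar>X * b uu e\<bar> \<and> - b s s \<le> 2 * d}"
      using root_lat root_bound by (simp add: mult_left_le_one_le)
  qed
  moreover have "finite {s\<in>lat. \<bar>b uu s\<bar> \<le> \<bar>X * b uu e\<bar> \<and> - b s s \<le> 2 * d}"
    by (rule finite_lat_form_bounded) (simp add: uu_props)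
  ultimately have "finite (range (\<lambda>n. (g ^^ n) r))" using finite_subset by blast
  moreover have "inj (\<lambda>n. (g ^^ n) r)"
  proof (rule injI)
    fix i j assume "(g ^^ i) r = (g ^^ j) r"
    then have "b uu ((X * m^i) *\<^sub>R e + Y *\<^sub>R rh) = b uu ((X * m^j) *\<^sub>R e + Y *\<^sub>R rh)" unfolding pow by (rule arg_cong)
    then have "X * m^i * b uu e = X * m^j * b uu e" unfolding bf_lin by simp
    then have "m^i = m^j" using X e by simp
    then show "i = j" using m by (metis less_irrefl nat_neq_iff power_strict_decreasing)
  qed
  ultimately show False using finite_imageD infinite_UNIV_nat by blast
qed

text \<open>\<open>H\<close> fixes \<open>rh\<close> and so permutes the two isotropic lines
  orthogonal to it. The two cases are translations along the geodesic and reversals of it.\<close>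

lemma H_acts:
  assumes "h \<in> H" obtains l where "l > 0" "h pp = l *\<^sub>R pp" "h qq = (1/l) *\<^sub>R qq"
  | l where "l > 0" "h pp = l *\<^sub>R qq" "h qq = (1/l) *\<^sub>R pp"
proof -
  have hA: "h \<in> AM" by (rule H_sub[OF assms])
  have B: "b (h x) (h y) = b x y" for x y using hA by (simp add: A_M_iff iso_def)
  have hV: "h x \<in> V" if "x \<in> V" for x using hA that by (auto simp: A_M_iff)
  have hr: "h rh = rh" using hA H(2)[OF assms] by (simp add: rh_def A_M_iff iso_def linear_scale)
  have null: "b qq y * b pp y = 0 \<and> y = (2 * b qq y) *\<^sub>R pp + (2 * b pp y) *\<^sub>R qq"
    if "b y y = 0" "b rh y = 0" for y
  proof
    show "b qq y * b pp y = 0" using b_coords[of y y] that by (simp add: mult.commute)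
    show "y = (2 * b qq y) *\<^sub>R pp + (2 * b pp y) *\<^sub>R qq" by (rule trans[OF coords[of y]]) (simp add: that)
  qed
  have P: "b (h pp) (h pp) = 0" "b rh (h pp) = 0" "b (h qq) (h qq) = 0" "b rh (h qq) = 0" "b (h pp) (h qq) = 1/2"
    using B[of pp pp] B[of rh pp] B[of qq qq] B[of rh qq] B[of pp qq] hr pq by simp_all
  have pos: "b (h uu) (h pp) > 0" using B pq by simp
  have c: "b uu (h pp) > 0" using cone_pos[of uu "h pp" "h uu"] uu_props hV P(1) pos by simp
  have "b qq (h pp) = 0 \<or> b pp (h pp) = 0" using null[OF P(1,2)] by simp
  then show thesis
  proof
    assume z: "b pp (h pp) = 0"
    let ?l = "2 * b qq (h pp)"
    have hp: "h pp = ?l *\<^sub>R pp" using null[OF P(1,2)] z by simp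
    have l: "?l > 0" using c z by (simp add: uu_pq bf_lin)
    have "b pp (h qq) = 1 / (2 * ?l)" using P(5) l by (subst (asm) hp) (simp add: bf_lin field_simps)
    then have "h qq = (1 / ?l) *\<^sub>R qq" using null[OF P(3,4)] l by auto
    then show thesis using that(1)[OF l hp] by blast
  next
    assume z: "b qq (h pp) = 0"
    let ?l = "2 * b pp (h pp)"
    have hp: "h pp = ?l *\<^sub>R qq" using null[OF P(1,2)] z by simp
    have l: "?l > 0" using c z by (simp add: uu_pq bf_lin)
    have "b qq (h qq) = 1 / (2 * ?l)" using P(5) l by (subst (asm) hp) (simp add: bf_lin field_simps)
    then have "h qq = (1 / ?l) *\<^sub>R pp" using null[OF P(3,4)] l by auto
    then show thesis using that(2)[OF l hp] by blast
  qed
qed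

lemma H_rh: "h \<in> H \<Longrightarrow> h rh = rh"
  using H_sub[of h] H(2)[of h] by (simp add: rh_def A_M_iff iso_def linear_scale)

lemma AM_eqI:
  assumes "f \<in> AM" "g \<in> AM" "f pp = g pp" "f qq = g qq" "f rh = g rh" shows "f = g"
proof
  fix x
  have l: "linear f" "linear g" using assms by (auto simp: A_M_iff iso_def)
  show "f x = g x"
    by (subst (1 2) coords[of x]) (use assms l in \<open>simp add: linear_add linear_diff linear_scale\<close>)
qed

text \<open>Without a nontrivial translation \<open>H\<close> would consist of the identity and at
  most one reversal, but it is infinite.\<close>

lemma boost: obtains g l where "g \<in> H" "l > 1" "g pp = l *\<^sub>R pp" "g qq = (1/l) *\<^sub>R qq"
proof -
  have "\<exists>g\<in>H. \<exists>l>0. l \<noteq> 1 \<and> g pp = l *\<^sub>R pp \<and> g qq = (1/l) *\<^sub>R qq"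
  proof (rule ccontr)
    assume no: "\<not> ?thesis"
    have t1: "h = id" if h: "h \<in> H" "l > 0" "h pp = l *\<^sub>R pp" "h qq = (1/l) *\<^sub>R qq" for h l
    proof -
      have "l = 1" using no h by blast
      then show ?thesis using h H_rh by (intro AM_eqI) (auto simp: H_sub A_M_id)
    qed
    have t2: "h = h'" if h: "h \<in> H" "l > 0" "h pp = l *\<^sub>R qq" "h qq = (1/l) *\<^sub>R pp"
      and h': "h' \<in> H" "l' > 0" "h' pp = l' *\<^sub>R qq" "h' qq = (1/l') *\<^sub>R pp" for h l h' l'
    proof -
      have lin: "linear h" using H_sub[OF h(1)] by (simp add: A_M_iff iso_def)
      have "h \<circ> h' = id"
        by (rule t1[of _ "l' / l"]) (use h h' lin in \<open>simp_all add: H_comp linear_scale\<close>)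
      moreover have "h' \<circ> h' = id"
        by (rule t1[of _ 1]) (use h' H_sub[OF h'(1)] in \<open>simp_all add: H_comp linear_scale A_M_iff iso_def\<close>)
      ultimately show ?thesis by (metis comp_assoc comp_id fun.map_id)
    qed
    have "H \<subseteq> {id} \<union> {h\<in>H. \<exists>l>0. h pp = l *\<^sub>R qq \<and> h qq = (1/l) *\<^sub>R pp}" (is "_ \<subseteq> _ \<union> ?T")
    proof
      fix h assume h: "h \<in> H" show "h \<in> {id} \<union> ?T" by (rule H_acts[OF h]) (use t1 h in blast)+
    qed
    moreover have "finite ?T"
    proof (cases "?T = {}")
      case False
      then obtain h where "h \<in> ?T" by blast
      then have "?T \<subseteq> {h}" using t2 by blast
      then show ?thesis by (rule finite_subset) simp
    next
      case True show ?thesis unfolding True by simp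
    qed
    ultimately have "finite H" by (meson finite.emptyI finite.insertI finite_UnI finite_subset)
    then show False using H_infinite by simp
  qed
  then obtain g l where g: "g \<in> H" "l > 0" "l \<noteq> 1" "g pp = l *\<^sub>R pp" "g qq = (1/l) *\<^sub>R qq" by blast
  show thesis
  proof (cases "l > 1")
    case True then show thesis using that g by blast
  next
    case False
    have bj: "bij g" and lin: "linear g" using H_sub[OF g(1)] by (auto simp: A_M_iff iso_def)
    have "g ((1/l) *\<^sub>R pp) = pp" "g (l *\<^sub>R qq) = qq" using g lin by (simp_all add: linear_scale)
    then have "inv g pp = (1/l) *\<^sub>R pp" "inv g qq = (1/(1/l)) *\<^sub>R qq" using bj by (metis bij_inv_eq_iff divide_divide_eq_right mult_1 div_by_1)+
    moreover have "1/l > 1" using False g by simp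
    ultimately show thesis using that H_inv[OF g(1)] by blast
  qed
qed

text \<open>\<open>boost_pos\<close>, for a translation and its inverse, gives weak inequalities at
  both ends, and \<open>boost_nonzero\<close> excludes equality. Thus no mirror other than that of
  \<rho> meets the geodesic of \<rho> or shares an end with it.\<close>

lemma Rp_sides:
  assumes r: "r \<in> Rp" and np: "\<nexists>a. r = a *\<^sub>R \<rho>" shows "b pp r > 0" "b qq r > 0"
proof -
  obtain g l where g: "g \<in> H" "l > 1" "g pp = l *\<^sub>R pp" "g qq = (1/l) *\<^sub>R qq" by (rule boost)
  have gA: "g \<in> AM" "inv g \<in> AM" using H_sub g A_M_inv by auto
  have bj: "bij g" and lin: "linear g" using gA(1) by (auto simp: A_M_iff iso_def)
  have "g ((1/l) *\<^sub>R pp) = pp" "g (l *\<^sub>R qq) = qq" using g lin by (simp_all add: linear_scale)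
  then have ig: "inv g pp = (1/l) *\<^sub>R pp" "inv g qq = l *\<^sub>R qq" using bj by (metis bij_inv_eq_iff)+
  have rh: "g rh = rh" "inv g rh = rh" using H_rh g H_inv by auto
  have x: "x0 = (2 * b qq x0) *\<^sub>R pp + (2 * b pp x0) *\<^sub>R qq + (- b rh x0) *\<^sub>R rh"
    "x0 = (2 * b pp x0) *\<^sub>R qq + (2 * b qq x0) *\<^sub>R pp + (- b rh x0) *\<^sub>R rh"
    by (rule trans[OF coords[of x0]], simp add: algebra_simps)+
  have p0: "b pp x0 > 0" "b qq x0 > 0" using pq_cone x0 by auto
  have ge: "b pp r \<ge> 0" "b qq r \<ge> 0"
    using boost_pos[OF gA(1) g(3,4) rh(1) g(2) x(1) _ r] boost_pos[OF gA(2) ig(2,1) rh(2) g(2) x(2) _ r] p0 by auto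
  have eq\<rho>: "\<exists>a. r = a *\<^sub>R \<rho>" if "b pp r = 0" "b qq r = 0"
  proof -
    have "r = (- b rh r) *\<^sub>R rh" by (rule trans[OF coords[of r]]) (simp add: that)
    then have "r = (- b rh r / sqrt (- b \<rho> \<rho>)) *\<^sub>R \<rho>" by (metis rh_def scaleR_scaleR times_divide_eq_right mult.right_neutral)
    then show ?thesis by blast
  qed
  have l': "0 < 1/l" "1/l < 1" using g(2) by auto
  have "b pp r \<noteq> 0"
  proof
    assume z: "b pp r = 0"
    have "r = (2 * b qq r) *\<^sub>R pp + (- b rh r) *\<^sub>R rh" by (rule trans[OF coords[of r]]) (simp add: z)
    then have "2 * b qq r = 0"
      by (rule boost_nonzero[OF gA(2) ig(1) rh(2) l' Rp_root[OF r]]) (simp add: pq)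
    then show False using eq\<rho> z np by simp
  qed
  moreover have "b qq r \<noteq> 0"
  proof
    assume z: "b qq r = 0"
    have "r = (2 * b pp r) *\<^sub>R qq + (- b rh r) *\<^sub>R rh" by (rule trans[OF coords[of r]]) (simp add: z)
    then have "2 * b pp r = 0"
      by (rule boost_nonzero[OF gA(1) g(4) rh(1) l' Rp_root[OF r]]) (simp add: pq)
    then show False using eq\<rho> z np by simp
  qed
  ultimately show "b pp r > 0" "b qq r > 0" using ge by auto
qed

end

section \<open>Walls\<close>

context hypV
begin

definition refl_map where "refl_map e x = x - (2 * b e x / b e e) *\<^sub>R e"

lemma iso_refl_map: assumes "is_root G e" shows "iso (refl_map e)"
proof -
  have ee: "b e e \<noteq> 0" using root_neg[OF assms] by simp
  have inv: "refl_map e (refl_map e x) = x" for x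
    using ee by (simp add: refl_map_def bf_lin vec_eq_iff field_simps)
  have lat: "refl_map e x \<in> lat" if "x \<in> lat" for x
    unfolding refl_map_def using that root_lat[OF assms] root_int[OF assms that] by (intro lat_intros)
  have "linear (refl_map e)"
    by (rule linearI) (simp_all add: refl_map_def bf_lin vec_eq_iff add_divide_distrib algebra_simps)
  moreover have "bij (refl_map e)" by (rule bijI') (metis inv)+
  moreover have "refl_map e ` lat = lat" using lat inv by (metis (no_types, lifting) image_eqI image_subsetI subsetI subset_antisym)
  moreover have "b (refl_map e x) (refl_map e y) = b x y" for x y
    using ee sym[of x e] by (simp add: refl_map_def bf_lin field_simps)
  ultimately show ?thesis by (simp add: iso_def)
qed

lemma nondeg3:
  assumes "tri x y z \<noteq> 0" "b w x = 0" "b w y = 0" "b w z = 0" shows "w = 0"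
proof (rule nondeg)
  fix v show "b w v = 0" by (subst tri_expand[OF assms(1), of v]) (simp add: bf_lin assms)
qed

end

context chamber
begin

lemma Ch_V: "x \<in> Ch \<Longrightarrow> x \<in> V" and Ch_ge: "x \<in> Ch \<Longrightarrow> r \<in> Rp \<Longrightarrow> b x r \<ge> 0"
  by (auto simp: Ch_def)

text \<open>The point \<open>x\<close> in the relative interior of the side, on no mirror but that
  of \<open>e\<close>, is what makes \<open>e\<close> a genuine side.\<close>

definition wall_at where
  "wall_at e x \<longleftrightarrow> e \<in> Rp \<and> x \<in> V \<and> b x e = 0 \<and> (\<forall>r\<in>Rp. r \<noteq> e \<longrightarrow> b x r > 0)"
definition wall where "wall e \<longleftrightarrow> (\<exists>x. wall_at e x)"

lemma wall_at_Ch: "wall_at e x \<Longrightarrow> x \<in> Ch"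
  unfolding wall_at_def Ch_def by force

lemma wall_Rp: "wall e \<Longrightarrow> e \<in> Rp" by (auto simp: wall_def wall_at_def)
lemma wall_root: "wall e \<Longrightarrow> is_root G e" using wall_Rp Rp_root by blast

text \<open>If the product were negative, the reflection of \<open>e'\<close> in \<open>e\<close>
  would be a root positive at a point of the side \<open>e\<close> and negative at a point of the
  side \<open>e'\<close>; its mirror would cut the polygon.\<close>

lemma wall_acute: assumes "wall e" "wall e'" "e \<noteq> e'" shows "b e e' \<ge> 0"
proof (rule ccontr)
  assume "\<not> b e e' \<ge> 0" then have n: "b e e' < 0" by simp
  obtain x x' where x: "wall_at e x" "wall_at e' x'" using assms by (auto simp: wall_def)
  let ?k = "2 * b e e' / b e e"
  have k: "?k > 0" using n root_neg[OF wall_root[OF assms(1)]] by (simp add: divide_neg_neg)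
  let ?r = "refl_map e e'"
  have r: "is_root G ?r" by (rule iso_root[OF iso_refl_map wall_root]) (use assms wall_root in auto)
  have "b x ?r > 0" using x assms unfolding refl_map_def by (simp add: wall_at_def bf_lin)
  then have "?r \<in> Rp" using Rp_if_pos[OF r wall_at_Ch[OF x(1)]] by blast
  then have "b x' ?r \<ge> 0" using wall_at_Ch[OF x(2)] Ch_ge by blast
  moreover have "b x' ?r = - (?k * b x' e)" using x(2) unfolding refl_map_def by (simp add: wall_at_def bf_lin)
  moreover have "b x' e > 0" using x(2) assms wall_Rp by (auto simp: wall_at_def)
  then have "?k * b x' e > 0" using k by (rule mult_pos_pos[rotated])
  ultimately show False by linarith
qed

text \<open>Only finitely many mirrors separate \<open>P\<close> from P + tw, and \<epsilon> stays
  below the parameters at which they are crossed.\<close>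

lemma nudge:
  assumes P: "P \<in> Ch"
  shows "\<exists>\<epsilon>>0. P + \<epsilon> *\<^sub>R w \<in> V \<and> (\<forall>r\<in>Rp. b P r > 0 \<longrightarrow> b (P + \<epsilon> *\<^sub>R w) r > 0)"
proof -
  have "continuous_on UNIV (\<lambda>\<epsilon>::real. P + \<epsilon> *\<^sub>R w)" by (intro continuous_intros)
  then have "open ((\<lambda>\<epsilon>. P + \<epsilon> *\<^sub>R w) -` V)" using V_open by (simp add: open_vimage)
  moreover have "0 \<in> (\<lambda>\<epsilon>. P + \<epsilon> *\<^sub>R w) -` V" using P Ch_V by simp
  ultimately obtain \<delta> where \<delta>: "\<delta> > 0" "\<And>t. \<bar>t\<bar> < \<delta> \<Longrightarrow> P + t *\<^sub>R w \<in> V"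
    unfolding open_dist by (metis (no_types, lifting) dist_real_def vimage_eq diff_zero)
  define t where "t = \<delta> / 2"
  have t: "t > 0" "P + t *\<^sub>R w \<in> V" using \<delta> by (auto simp: t_def)
  let ?S = "{r\<in>Rp. b P r \<ge> 0 \<and> b (P + t *\<^sub>R w) r \<le> 0} \<inter> {r. b P r > 0}"
  have fin: "finite ?S" using finite_sep[OF Ch_V[OF P] t(2)] by simp
  let ?f = "\<lambda>r. b P r / (\<bar>b w r\<bar> + 1)"
  define \<epsilon> where "\<epsilon> = Min (insert t (?f ` ?S)) / 2"
  have M: "Min (insert t (?f ` ?S)) > 0" using fin t(1) by (subst Min_gr_iff) auto
  have \<epsilon>: "\<epsilon> > 0" "\<epsilon> < t" "\<And>r. r \<in> ?S \<Longrightarrow> \<epsilon> < ?f r"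
  proof -
    show "\<epsilon> > 0" using M by (simp add: \<epsilon>_def)
    have "Min (insert t (?f ` ?S)) \<le> t" using fin by (intro Min_le) auto
    then show "\<epsilon> < t" using M by (simp add: \<epsilon>_def)
    fix r assume "r \<in> ?S"
    then have "Min (insert t (?f ` ?S)) \<le> ?f r" using fin by (intro Min_le) auto
    then show "\<epsilon> < ?f r" unfolding \<epsilon>_def using M by linarith
  qed
  have "b (P + \<epsilon> *\<^sub>R w) r > 0" if r: "r \<in> Rp" "b P r > 0" for r
  proof (cases "r \<in> ?S")
    case True
    then have "\<epsilon> * (\<bar>b w r\<bar> + 1) < b P r" using \<epsilon>(3)[OF True] by (simp add: pos_less_divide_eq)
    moreover have "\<epsilon> * (\<bar>b w r\<bar> + 1) \<ge> - (\<epsilon> * b w r)"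
      using \<epsilon>(1) by (simp add: algebra_simps) (smt (verit) mult_left_mono mult_minus_right)
    ultimately show ?thesis by (simp add: bf_lin)
  next
    case False
    then have p: "b P r + t * b w r > 0" using r by (auto simp: bf_lin)
    have "t * b (P + \<epsilon> *\<^sub>R w) r = (t - \<epsilon>) * b P r + \<epsilon> * (b P r + t * b w r)" by (simp add: bf_lin algebra_simps)
    also have "\<dots> > 0" using mult_pos_pos[OF \<epsilon>(1) p] mult_pos_pos[of "t - \<epsilon>" "b P r"] \<epsilon>(2) r(2) by linarith
    finally show ?thesis using t(1) zero_less_mult_pos by blast
  qed
  moreover have "P + \<epsilon> *\<^sub>R w \<in> V" using \<delta>(2)[of \<epsilon>] \<epsilon> by (simp add: t_def)
  ultimately show ?thesis using \<epsilon>(1) by blast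
qed

text \<open>Among the mirrors through the exit point \<open>P\<close>
  the wall is singled out by an extremal slope in the plane \<open>P\<^sup>\<bottom>\<close>.\<close>
lemma first_wall:
  assumes x: "x \<in> Ch" and y: "y \<in> V" and r0: "r0 \<in> Rp" "b y r0 < 0"
    and xy: "\<And>r. r \<in> Rp \<Longrightarrow> b x r = 0 \<Longrightarrow> b y r \<ge> 0"
  obtains e1 l where "wall e1" "0 < l" "l < 1" "(1 - l) *\<^sub>R x + l *\<^sub>R y \<in> Ch"
    "b ((1 - l) *\<^sub>R x + l *\<^sub>R y) e1 = 0" "b x e1 > 0"
proof -
  let ?S = "{r\<in>Rp. b y r < 0}"
  have "?S \<subseteq> {r\<in>Rp. b x r \<ge> 0 \<and> b y r \<le> 0}" using x by (auto simp: Ch_ge)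
  then have finS: "finite ?S" using finite_sep[OF Ch_V[OF x] y] finite_subset by blast
  have Sx: "b x r > 0" if "r \<in> ?S" for r using that xy[of r] Ch_ge[OF x, of r] by fastforce
  let ?l = "\<lambda>r. b x r / (b x r - b y r)"
  obtain r1 where r1: "r1 \<in> ?S" "\<And>r. r \<in> ?S \<Longrightarrow> ?l r1 \<le> ?l r"
    using ex_min_if_finite[of "?l ` ?S"] finS r0 by (auto simp: not_less) (metis (no_types, lifting) linorder_not_le)
  define l where "l = ?l r1"
  have l: "0 < l" "l < 1" using Sx[OF r1(1)] r1(1) by (auto simp: l_def divide_simps)
  define P where "P = (1 - l) *\<^sub>R x + l *\<^sub>R y"
  have bP: "b P r = b x r - l * (b x r - b y r)" for r by (simp add: P_def bf_lin algebra_simps)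
  have PV: "P \<in> V" unfolding P_def using V_segment[OF Ch_V[OF x] y] l by simp
  have Pge: "b P r \<ge> 0" if r: "r \<in> Rp" for r
  proof (cases "b y r < 0")
    case True
    then have "l \<le> ?l r" using r1(2)[of r] r by (simp add: l_def)
    then have "l * (b x r - b y r) \<le> b x r" using Sx[of r] True r by (simp add: pos_le_divide_eq)
    then show ?thesis by (simp add: bP)
  next
    case False
    have "b P r = (1 - l) * b x r + l * b y r" by (simp add: P_def bf_lin)
    moreover have "(1 - l) * b x r \<ge> 0" "l * b y r \<ge> 0" using l False Ch_ge[OF x r] by auto
    ultimately show ?thesis by linarith
  qed
  have PCh: "P \<in> Ch" using PV Pge by (simp add: Ch_def)
  have Pr1: "b P r1 = 0" using Sx[OF r1(1)] r1(1) by (simp add: bP l_def)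
  have xr1: "b x r1 > 0" using Sx[OF r1(1)] .
  let ?F = "{r\<in>Rp. b P r = 0 \<and> b x r > 0}"
  have finF: "finite ?F" by (rule finite_subset[OF _ finite_sep[OF PV PV]]) auto
  have T: "tri P x (cr G P x) < 0"
  proof -
    have "b P P * b x x < (b P x)^2"
    proof -
      let ?z = "b P P *\<^sub>R x - b P x *\<^sub>R P"
      have zr: "b ?z r1 \<noteq> 0" using Pr1 xr1 V_pos[OF PV] by (simp add: bf_lin)
      have "?z \<noteq> 0"
      proof
        assume "?z = 0" then show False using zr unfolding bf_zero_left by (simp add: bf_zero_left)
      qed
      then have "b ?z ?z < 0" by (intro neg_orth[OF V_pos[OF PV]]) (simp_all add: bf_lin)
      moreover have "b ?z ?z = b P P * (b P P * b x x - (b P x)^2)"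
        using sym[of x P] by (simp add: bf_lin power2_eq_square algebra_simps)
      ultimately show ?thesis using V_pos[OF PV] by (simp add: mult_less_0_iff)
    qed
    then show ?thesis using sym[of x P] by (simp add: tcr power2_eq_square)
  qed
  have det0: "w = 0" if "b w P = 0" "b w x = 0" "b w (cr G P x) = 0" for w
    using nondeg3[of P x "cr G P x" w] T that by auto
  \<comment> \<open>At most one positive root vanishes at both \<open>P\<close> and
    \<open>x\<close>. The normal \<open>z\<close> of the plane through them is oriented to be
    positive on it.\<close>
  have "\<exists>z. (\<forall>r\<in>Rp. b P r = 0 \<and> b x r = 0 \<longrightarrow> b z r > 0) \<and> (\<exists>s. s \<noteq> 0 \<and> z = s *\<^sub>R cr G P x)"
  proof (cases "\<exists>r\<in>Rp. b P r = 0 \<and> b x r = 0")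
    case True
    then obtain e where e: "e \<in> Rp" "b P e = 0" "b x e = 0" by blast
    have ce: "b (cr G P x) e \<noteq> 0"
    proof
      assume "b (cr G P x) e = 0"
      then have "e = 0" using det0[of e] e sym[of e] by simp
      then show False using Rp_root[OF e(1)] root_neg by (force simp: bf_lin)
    qed
    have uniq: "r = e" if r: "r \<in> Rp" "b P r = 0" "b x r = 0" for r
    proof -
      let ?c = "cr G P x"
      have "b ?c e *\<^sub>R r - b ?c r *\<^sub>R e = 0" using det0[of "b ?c e *\<^sub>R r - b ?c r *\<^sub>R e"] e r sym[of r] sym[of e]
        by (simp add: bf_lin)
      then have "r = (b ?c r / b ?c e) *\<^sub>R e" using ce by (simp add: vec_eq_iff field_simps)
      then show ?thesis using Rp_scale[OF e(1) r(1)] by blast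
    qed
    show ?thesis
    proof (cases "b (cr G P x) e > 0")
      case True then show ?thesis using uniq by (intro exI[of _ "cr G P x"]) (auto intro!: exI[of _ 1])
    next
      case False
      then show ?thesis using uniq ce
        by (intro exI[of _ "- cr G P x"]) (auto simp: bf_lin not_less less_le intro!: exI[of _ "-1"])
    qed
  next
    case False then show ?thesis by (intro exI[of _ "cr G P x"]) (auto intro!: exI[of _ 1])
  qed
  then obtain z s where z: "\<And>r. r \<in> Rp \<Longrightarrow> b P r = 0 \<Longrightarrow> b x r = 0 \<Longrightarrow> b z r > 0"
    and s: "s \<noteq> 0" "z = s *\<^sub>R cr G P x" by blast
  let ?q = "\<lambda>r. b z r / b x r"
  obtain e1 where e1: "e1 \<in> ?F" "\<And>r. r \<in> ?F \<Longrightarrow> ?q e1 \<le> ?q r"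
    using ex_min_if_finite[of "?q ` ?F"] finF r1(1) Pr1 xr1 by (auto simp: not_less) (metis (no_types, lifting) linorder_not_le)
  have e1': "e1 \<in> Rp" "b P e1 = 0" "b x e1 > 0" using e1(1) by auto
  \<comment> \<open>\<open>w\<close> is tangent to the mirror of \<open>e1\<close>. By minimality of
    the slope it is positive on all other positive roots vanishing at \<open>P\<close>, so a small
    step along it reaches the relative interior of the side \<open>e1\<close>.\<close>
  define w where "w = b x e1 *\<^sub>R z - b z e1 *\<^sub>R x"
  have we: "b w e1 = 0" by (simp add: w_def bf_lin)
  have wr: "b w r > 0" if r: "r \<in> Rp" "b P r = 0" "r \<noteq> e1" for r
  proof (cases "b x r = 0")
    case True
    then show ?thesis using z[OF r(1,2) True] e1' by (simp add: w_def bf_lin)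
  next
    case False
    then have xr: "b x r > 0" using Ch_ge[OF x r(1)] by simp
    then have "?q e1 \<le> ?q r" using e1(2) r by simp
    then have ge: "b w r \<ge> 0" using xr e1' by (simp add: w_def bf_lin frac_le_eq divide_le_eq field_simps)
    have "b w r \<noteq> 0"
    proof
      assume 0: "b w r = 0"
      let ?v = "b x e1 *\<^sub>R r - b x r *\<^sub>R e1"
      have "b x e1 * b z r = b z e1 * b x r" using 0 by (simp add: w_def bf_lin)
      then have "b z ?v = 0" by (simp add: bf_lin mult.commute)
      then have "b ?v (cr G P x) = 0" using s sym[of ?v] by (simp add: bf_lin)
      moreover have "b ?v P = 0" "b ?v x = 0" using r e1' sym[of r] sym[of e1] by (simp_all add: bf_lin)
      ultimately have "?v = 0" using det0 by blast
      then have "r = (b x r / b x e1) *\<^sub>R e1" using e1' by (simp add: vec_eq_iff field_simps)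
      then show False using Rp_scale[OF e1'(1) r(1)] r(3) by blast
    qed
    then show ?thesis using ge by simp
  qed
  obtain \<epsilon> where \<epsilon>: "\<epsilon> > 0" "P + \<epsilon> *\<^sub>R w \<in> V" "\<And>r. r \<in> Rp \<Longrightarrow> b P r > 0 \<Longrightarrow> b (P + \<epsilon> *\<^sub>R w) r > 0"
    using nudge[OF PCh] by blast
  have "wall_at e1 (P + \<epsilon> *\<^sub>R w)" unfolding wall_at_def
  proof (intro conjI ballI impI)
    show "b (P + \<epsilon> *\<^sub>R w) e1 = 0" using e1' we by (simp add: bf_lin)
    fix r assume r: "r \<in> Rp" "r \<noteq> e1"
    show "b (P + \<epsilon> *\<^sub>R w) r > 0"
    proof (cases "b P r = 0")
      case True then show ?thesis using wr[OF r(1) True r(2)] \<epsilon>(1) by (simp add: bf_lin)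
    next
      case False then show ?thesis using \<epsilon>(3)[OF r(1)] Pge[OF r(1)] by simp
    qed
  qed (use e1' \<epsilon> in auto)
  then have "wall e1" by (auto simp: wall_def)
  then show thesis using that[of e1 l] l PCh e1' by (simp add: P_def)
qed

text \<open>Here the eigenvalue \<open>a\<close> of J = \<open>cr G v\<close> at \<open>n\<close> is
  an integer. J^2 + aJ preserves the lattice and kills the eigenlines for 0 and -a, so it produces a
  lattice vector on the line of \<open>n\<close>.\<close>

lemma rational_end_vector:
  assumes v: "v \<in> lat" and vv: "b v v < 0" and n: "b n n = 0" "b v n = 0" and n0: "n \<noteq> 0"
    and m: "- d * b v v = real (m^2)"
  obtains c l where "prim c" "n = l *\<^sub>R c" "l > 0"
proof -
  obtain a where a: "cr G v n = a *\<^sub>R n" "a^2 = - d * b v v" using cr_null n n0 by blast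
  have "a^2 = (real m)^2" using a(2) m by simp
  then have aI: "a \<in> \<int>" by (auto simp: power2_eq_iff)
  have a0: "a \<noteq> 0" using a(2) vv d_pos by auto
  let ?J = "cr G v"
  let ?K = "\<lambda>y. ?J (?J y) + a *\<^sub>R ?J y"
  have "\<exists>y\<in>lat. ?K y \<noteq> 0"
  proof (rule ccontr)
    assume no: "\<not> ?thesis"
    let ?e1 = "vector [1,0,0] :: real^3" and ?e2 = "vector [0,1,0] :: real^3" and ?e3 = "vector [0,0,1] :: real^3"
    have z: "?K ?e1 = 0" "?K ?e2 = 0" "?K ?e3 = 0" using no by (auto intro!: lat_vector)
    have ex: "n = n$1 *\<^sub>R ?e1 + n$2 *\<^sub>R ?e2 + n$3 *\<^sub>R ?e3" by (simp add: vec3_eq_iff)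
    have "?K (p *\<^sub>R f + q *\<^sub>R g + r *\<^sub>R h) = p *\<^sub>R ?K f + q *\<^sub>R ?K g + r *\<^sub>R ?K h" for p q r f g h
      by (simp add: cr_lin algebra_simps)
    then have "?K n = 0" using z ex by (metis add.right_neutral scaleR_zero_right)
    moreover have "?K n = (2 * a^2) *\<^sub>R n" by (simp add: a(1) cr_lin power2_eq_square scaleR_add_left[symmetric])
    ultimately show False using a0 n0 by simp
  qed
  then obtain y where y: "y \<in> lat" "?K y \<noteq> 0" by blast
  have yl: "?K y \<in> lat" using y(1) v aI by (intro lat_intros cr_lat)
  have JK: "?J (?K y) = a *\<^sub>R ?K y"
    using a(2) by (simp add: cr_lin cr_cube vec_eq_iff algebra_simps power2_eq_square)
  have KK: "b (?K y) (?K y) = 0" using cr_orth(2)[of "?K y" v] a0 unfolding JK by (simp add: bf_scale_right)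
  have nK: "b n (?K y) = 0"
  proof -
    have "b (?J n) (?K y) = - b n (?J (?K y))" by (rule cr_skew)
    then have "a * b n (?K y) = - (a * b n (?K y))" unfolding JK a(1) by (simp add: bf_scale_left bf_scale_right)
    then show ?thesis using a0 by simp
  qed
  obtain g :: int and c z where g: "g > 0" "?K y = of_int g *\<^sub>R c" "c \<in> lat" "z \<in> lat" "dot3 z c = 1"
    using lat_content[OF yl y(2)] by metis
  obtain q where q: "?K y = q *\<^sub>R n" using null_orth[OF n(1) KK nK n0] by blast
  have q0: "q \<noteq> 0" using q y(2) by auto
  define c' where "c' = (if q > 0 then c else - c)"
  have pc: "prim c'" using prim_if_bezout[OF g(3,4,5)] prim_minus by (simp add: c'_def)
  have nc: "n = (real_of_int g / \<bar>q\<bar>) *\<^sub>R c'"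
  proof -
    have "q *\<^sub>R n = of_int g *\<^sub>R c" using q g(2) by simp
    then have "n = (of_int g / q) *\<^sub>R c" using q0 by (simp add: vec_eq_iff field_simps)
    then show ?thesis by (auto simp: c'_def)
  qed
  define l where "l = real_of_int g / \<bar>q\<bar>"
  have l0: "l > 0" using g q0 by (simp add: l_def)
  have nl: "n = l *\<^sub>R c'" using nc by (simp add: l_def)
  show thesis by (rule that[OF pc nl l0])
qed

text \<open>The orthogonal complement of \<open>n\<close> is negative semidefinite. Isotropic
  \<open>n\<close> is allowed, so parallel walls are covered as well as meeting ones.\<close>

lemma cs_cone:
  assumes "b n n \<ge> 0" "n \<noteq> 0" "b n x = 0" "b n y = 0" shows "(b x y)^2 \<le> b x x * b y y"
proof -
  have neg: "b w w \<le> 0" if "b n w = 0" for w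
  proof (cases "b n n = 0")
    case False then show ?thesis using neg_orth'[of n w] assms that by simp
  next
    case True
    show ?thesis
    proof (rule ccontr)
      assume "\<not> b w w \<le> 0"
      then have "b n n < 0" using neg_orth[of w n] that sym[of w n] assms(2) by simp
      then show False using True by simp
    qed
  qed
  have q: "b x x * (b x x * b y y - (b x y)^2) \<le> 0" "b y y * (b x x * b y y - (b x y)^2) \<le> 0"
  proof -
    have "b (b x x *\<^sub>R y - b x y *\<^sub>R x) (b x x *\<^sub>R y - b x y *\<^sub>R x) \<le> 0" using assms by (intro neg) (simp add: bf_lin)
    then show "b x x * (b x x * b y y - (b x y)^2) \<le> 0"
      using sym[of y x] by (simp add: bf_lin power2_eq_square algebra_simps)
    have "b (b y y *\<^sub>R x - b x y *\<^sub>R y) (b y y *\<^sub>R x - b x y *\<^sub>R y) \<le> 0" using assms by (intro neg) (simp add: bf_lin)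
    then show "b y y * (b x x * b y y - (b x y)^2) \<le> 0"
      using sym[of y x] by (simp add: bf_lin power2_eq_square algebra_simps)
  qed
  have xx: "b x x \<le> 0" "b y y \<le> 0" using neg assms by auto
  show ?thesis
  proof (cases "b x x < 0 \<or> b y y < 0")
    case True then show ?thesis using q by (auto simp: mult_le_0_iff)
  next
    case False
    then have z: "b x x = 0" "b y y = 0" using xx by auto
    have "b (x + y) (x + y) \<le> 0" "b (x - y) (x - y) \<le> 0" using assms by (intro neg; simp add: bf_lin)+
    then show ?thesis using z sym[of y x] by (simp add: bf_lin)
  qed
qed

end

context refl
begin

text \<open>The next wall at the end \<open>n\<close> of a wall \<open>e\<close>: either they meet inside \<open>V\<close> at \<open>P\<close>, or \<open>n\<close> is a
  multiple of a primitive isotropic lattice vector \<open>c\<close> and they are parallel.\<close>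
lemma next_wall:
  assumes e: "wall e" "\<nexists>a. \<rho> = a *\<^sub>R e" and n: "b n n = 0" "b e n = 0" "b x0 n > 0"
  obtains (meet) e1 P where "wall e1" "e1 \<noteq> e" "b n e1 < 0" "P \<in> Ch" "b P e = 0" "b P e1 = 0"
  | (cusp) e1 c l where "wall e1" "e1 \<noteq> e" "b n e1 = 0" "prim c" "n = l *\<^sub>R c" "l > 0" "\<And>r. r \<in> Rp \<Longrightarrow> b c r \<ge> 0"
proof -
  obtain x where x: "wall_at e x" using e(1) by (auto simp: wall_def)
  have xe: "b x e = 0" and xr: "\<And>r. r \<in> Rp \<Longrightarrow> r \<noteq> e \<Longrightarrow> b x r > 0" and xV: "x \<in> V"
    using x by (auto simp: wall_at_def)
  have xCh: "x \<in> Ch" by (rule wall_at_Ch[OF x])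
  have eR: "e \<in> Rp" by (rule wall_Rp[OF e(1)])
  have er: "is_root G e" by (rule wall_root[OF e(1)])
  have ee: "b e e < 0" by (rule root_neg[OF er])
  have n0: "n \<noteq> 0" using n(3) by (auto simp: bf_lin)
  have xn: "b y n > 0" if "y \<in> V" for y using cone_pos[OF that, of n x0] n x0 by simp
  show thesis
  proof (cases "\<exists>r\<in>Rp. b n r < 0")
    case True
    then obtain r0 where r0: "r0 \<in> Rp" "b n r0 < 0" by blast
    \<comment> \<open>Long enough for x + tn to lie strictly beyond the mirror of
      \<open>r0\<close>.\<close>
    define t where "t = (\<bar>b x r0\<bar> + 1) / - b n r0"
    have t: "t > 0" using r0 unfolding t_def by (intro divide_pos_pos) auto
    let ?y = "x + t *\<^sub>R n"
    have yV: "?y \<in> V" using xn[OF xV] n t by (intro V_add[OF xV]) (simp_all add: bf_lin)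
    have yr0: "b ?y r0 < 0"
    proof -
      have "t * b n r0 = - (\<bar>b x r0\<bar> + 1)" using r0(2) by (simp add: t_def)
      then show ?thesis by (simp add: bf_lin)
    qed
    have xy: "b ?y r \<ge> 0" if "r \<in> Rp" "b x r = 0" for r
      using xr[of r] that n(2) sym[of n e] by (cases "r = e") (auto simp: bf_lin)
    obtain e1 l where e1: "wall e1" "0 < l" "l < 1" "(1 - l) *\<^sub>R x + l *\<^sub>R ?y \<in> Ch"
      "b ((1 - l) *\<^sub>R x + l *\<^sub>R ?y) e1 = 0" "b x e1 > 0"
      by (rule first_wall[OF xCh yV r0(1) yr0 xy])
    have P: "(1 - l) *\<^sub>R x + l *\<^sub>R ?y = x + (l * t) *\<^sub>R n" by (simp add: algebra_simps)
    have "b x e1 + l * t * b n e1 = 0" using e1(5) unfolding P by (simp add: bf_lin)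
    moreover have "l * t > 0" using e1 t by simp
    ultimately have ne1: "b n e1 < 0" using e1(6) by (smt (verit) mult_nonneg_nonneg)
    show thesis
      by (rule meet[OF e1(1) _ ne1 e1(4) _ e1(5)])
         (use e1 xe n sym[of n e] in \<open>auto simp: P bf_lin\<close>)
  next
    case False
    then have nR: "\<And>r. r \<in> Rp \<Longrightarrow> b n r \<ge> 0" by fastforce
    \<comment> \<open>Now \<open>n\<close> is nonnegative on all positive roots. At an irrational
      end all of them except \<open>e\<close> would be strictly positive there, and
      \<open>irrational_end\<close> would put \<rho> on the line of \<open>e\<close>.\<close>
    have "\<exists>m. - d * b e e = real (m^2)"
    proof (rule ccontr)
      assume ns: "\<nexists>m. - d * b e e = real (m^2)"
      have "b n r > 0 \<or> (\<exists>a. r = a *\<^sub>R e)" if r: "r \<in> Rp" for r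
        using orth_irrational_end[OF root_lat[OF er] ee n(1,2) n0 ns root_lat[OF Rp_root[OF r]]] nR[OF r] by fastforce
      then show False using irrational_end[OF root_lat[OF er] ee n _ ns] e(2) by blast
    qed
    then obtain m where m: "- d * b e e = real (m^2)" by blast
    obtain c' l where pc: "prim c'" and nl: "n = l *\<^sub>R c'" and l0: "l > 0"
      using rational_end_vector[OF root_lat[OF er] ee n(1,2) n0 m] by metis
    have cR: "b c' r \<ge> 0" if "r \<in> Rp" for r using nR[OF that] l0 unfolding nl by (simp add: bf_lin zero_le_mult_iff)
    have clat: "c' \<in> lat" using pc by (simp add: prim_def)
    have cc: "b c' c' = 0" "b e c' = 0" "b c' e = 0" using n(1,2) l0 sym[of c' e] by (auto simp: nl bf_lin)
    have cV: "b y c' > 0" if "y \<in> V" for y using xn[OF that] l0 by (simp add: nl bf_lin zero_less_mult_iff)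
    have c0: "c' \<noteq> 0" by (rule prim_nonzero[OF pc])
    obtain \<kappa> where \<kappa>: "cr G c' e = \<kappa> *\<^sub>R c'"
    proof -
      have "b (cr G c' e) (cr G c' e) = 0" using cc by (simp add: cr_norm)
      then show thesis using null_orth[of c' "cr G c' e"] that cc c0 cr_orth(1) by blast
    qed
    have \<kappa>0: "\<kappa> \<noteq> 0"
    proof
      assume "\<kappa> = 0"
      then have "tri c' e w = 0" for w using b_cr[of c' e w] d_pos \<kappa> by (simp add: bf_lin)
      then obtain k where "e = k *\<^sub>R c'" using tri_zero_right[OF _ c0] by blast
      then show False using ee cc by (simp add: bf_lin)
    qed
    obtain i :: nat where i: "real i > b x0 e / (2 * \<bar>\<kappa>\<bar> * b x0 c')" using reals_Archimedean2 by blast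
    \<comment> \<open>Sign and size of \<open>u\<close> make the negative of the parabolic image of
      \<open>e\<close> a root M c' - e that is positive at \<open>x0\<close>: a second mirror
      through the cusp, facing that of \<open>e\<close>.\<close>
    define u where "u = (if \<kappa> < 0 then real i else - real i)"
    have uI: "u \<in> \<int>" by (simp add: u_def)
    define M where "M = 2 * real i * \<bar>\<kappa>\<bar>"
    have \<kappa>u: "2 * u * \<kappa> = - M" by (simp add: u_def M_def)
    have it: "iso (tau c' 1 u)" by (rule tau_iso[OF clat]) (use cc uI in auto)
    have "tau c' 1 u e = e - M *\<^sub>R c'"
      unfolding tau_def \<kappa> cr_lin using \<kappa>u by (simp add: vec_eq_iff algebra_simps)
    then have rt: "is_root G (M *\<^sub>R c' - e)" using root_minus[OF iso_root[OF it er]] by simp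
    have Mx: "M * b x0 c' > b x0 e"
      using i \<kappa>0 cV[OF x0(1)] by (simp add: M_def pos_divide_less_eq mult_ac)
    have x0e: "b x0 e > 0" using eR by (simp add: Rp_def)
    have Mpos: "M > 0" using Mx x0e cV[OF x0(1)] by (smt (verit) mult_nonpos_nonneg)
    define r' where "r' = M *\<^sub>R c' - e"
    have r'R: "r' \<in> Rp" using rt Mx by (simp add: r'_def Rp_def bf_lin)
    have r'r: "is_root G r'" by (rule Rp_root[OF r'R])
    have xr': "b x r' > 0" using Mpos cV[OF xV] xe by (simp add: r'_def bf_lin)
    \<comment> \<open>The target is the reflection of \<open>x\<close> in the second mirror, pushed
      towards the cusp until all positive roots not vanishing at the cusp are positive. The segment
      from \<open>x\<close> to it must leave the polygon through a wall passing through the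
      cusp.\<close>
    let ?yr = "refl_map r' x"
    have y0V: "?yr \<in> V"
    proof (rule V_I[OF _ xV])
      show "b ?yr ?yr > 0" using iso_refl_map[OF r'r] V_pos[OF xV] by (simp add: iso_def)
      have "b x ?yr = b x x + 2 * (b x r')^2 / (- b r' r')"
        using sym[of r' x] by (simp add: refl_map_def bf_lin power2_eq_square)
      moreover have "2 * (b x r')^2 / (- b r' r') \<ge> 0" using root_neg[OF r'r] by (intro divide_nonneg_pos) auto
      ultimately show "b x ?yr > 0" using V_pos[OF xV] by linarith
    qed
    have y0r': "b ?yr r' < 0" using xr' root_neg[OF r'r] sym[of r' x] by (simp add: refl_map_def bf_lin)
    have y0e: "b ?yr e > 0"
    proof -
      have "b r' e = - b e e" by (simp add: r'_def bf_lin cc)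
      then have "b ?yr e = 2 * b x r' * b e e / b r' r'" using xe sym[of r' x] by (simp add: refl_map_def bf_lin)
      also have "\<dots> > 0" using xr' ee root_neg[OF r'r] by (intro divide_neg_neg mult_pos_neg) auto
      finally show ?thesis .
    qed
    let ?S = "{r\<in>Rp. b x r \<ge> 0 \<and> b ?yr r \<le> 0} \<inter> {r. b c' r > 0}"
    have finS: "finite ?S" using finite_sep[OF xV y0V] by simp
    define L where "L = Max (insert 0 ((\<lambda>r. (- b ?yr r + 1) / b c' r) ` ?S))"
    have L0: "L \<ge> 0" unfolding L_def using finS by (intro Max_ge) auto
    have LS: "b ?yr r + L * b c' r > 0" if "r \<in> ?S" for r
    proof -
      have "(- b ?yr r + 1) / b c' r \<le> L" unfolding L_def using finS that by (intro Max_ge) auto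
      then show ?thesis using that by (simp add: pos_divide_le_eq)
    qed
    let ?y = "?yr + L *\<^sub>R c'"
    have yV: "?y \<in> V" using cV[OF y0V] L0 cc by (intro V_add[OF y0V]) (simp_all add: bf_lin)
    have ypos: "b ?y r > 0" if r: "r \<in> Rp" "b c' r > 0" for r
    proof (cases "b ?yr r \<le> 0")
      case True
      then have "r \<in> ?S" using r Ch_ge[OF xCh r(1)] by simp
      then show ?thesis unfolding bf_lin by (rule LS)
    next
      case False
      moreover have "L * b c' r \<ge> 0" using L0 r by simp
      ultimately show ?thesis by (simp add: bf_lin)
    qed
    have yr': "b ?y r' < 0" using y0r' cc by (simp add: bf_lin r'_def)
    have xy: "b ?y r \<ge> 0" if "r \<in> Rp" "b x r = 0" for r
      using xr[of r] that y0e cc by (cases "r = e") (auto simp: bf_lin)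
    obtain e1 t where e1: "wall e1" "0 < t" "t < 1" "(1 - t) *\<^sub>R x + t *\<^sub>R ?y \<in> Ch"
      "b ((1 - t) *\<^sub>R x + t *\<^sub>R ?y) e1 = 0" "b x e1 > 0"
      by (rule first_wall[OF xCh yV r'R yr' xy])
    have "(1 - t) * b x e1 + t * b ?y e1 = 0" using e1(5) by (simp add: bf_lin)
    moreover have "(1 - t) * b x e1 > 0" using e1 by simp
    ultimately have "b ?y e1 < 0" using e1(2) by (smt (verit) mult_nonneg_nonneg)
    then have "b c' e1 = 0" using ypos[OF wall_Rp[OF e1(1)]] cR[OF wall_Rp[OF e1(1)]] by fastforce
    then have "b n e1 = 0" by (simp add: nl bf_lin)
    moreover have "e1 \<noteq> e" using e1(6) xe by auto
    ultimately show thesis using cusp[OF e1(1) _ _ pc nl l0 cR] by blast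
  qed
qed

end

section \<open>Finiteness of the distances of walls\<close>

definition rem :: "real \<Rightarrow> real^3 \<Rightarrow> real^3" where
  "rem T x = (\<chi> i. x$i - T * of_int \<lfloor>x$i / T\<rfloor>)"

lemma rem_eq: assumes "rem T x = rem T y" "T \<noteq> 0" shows "(1/T) *\<^sub>R (y - x) \<in> lat"
  unfolding lat_def
proof (intro CollectI allI)
  fix i
  have "x$i - T * of_int \<lfloor>x$i / T\<rfloor> = y$i - T * of_int \<lfloor>y$i / T\<rfloor>"
    using arg_cong[OF assms(1), of "\<lambda>v. v$i"] by (simp add: rem_def)
  then have "(y$i - x$i) / T = of_int (\<lfloor>y$i / T\<rfloor> - \<lfloor>x$i / T\<rfloor>)" using assms(2) by (simp add: field_simps)
  then show "((1/T) *\<^sub>R (y - x)) $ i \<in> \<int>" by (metis Ints_of_int vector_minus_component vector_scaleR_component mult.left_neutral times_divide_eq_left real_scaleR_def)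
qed

lemma rem_lat: "x \<in> lat \<Longrightarrow> T \<in> \<int> \<Longrightarrow> rem T x \<in> lat"
  unfolding lat_def rem_def by auto

lemma rem_norm: assumes "T \<noteq> 0" "\<bar>T\<bar> \<le> C" shows "norm (rem T x) \<le> 3 * C"
proof -
  have "\<bar>rem T x $ i\<bar> \<le> C" for i
  proof -
    have "rem T x $ i = T * frac (x$i / T)" using assms by (simp add: rem_def frac_def field_simps)
    then have "\<bar>rem T x $ i\<bar> = \<bar>T\<bar> * frac (x$i / T)" by (simp add: abs_mult)
    also have "\<dots> \<le> \<bar>T\<bar> * 1" using frac_lt_1[of "x$i / T"] by (intro mult_left_mono) auto
    finally show ?thesis using assms by simp
  qed
  then have "(\<Sum>i\<in>UNIV. \<bar>rem T x $ i\<bar>) \<le> (\<Sum>i\<in>(UNIV::3 set). C)" by (intro sum_mono)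
  then show ?thesis using norm_le_l1_cart[of "rem T x"] by simp
qed

lemma finite_Ints_bounded: "finite {x::real. x \<in> \<int> \<and> \<bar>x\<bar> \<le> C}"
proof (rule finite_subset)
  show "{x::real. x \<in> \<int> \<and> \<bar>x\<bar> \<le> C} \<subseteq> of_int ` {- \<lceil>C\<rceil>..\<lceil>C\<rceil>}"
  proof
    fix x :: real assume "x \<in> {x. x \<in> \<int> \<and> \<bar>x\<bar> \<le> C}"
    then obtain m where m: "x = of_int m" "\<bar>x\<bar> \<le> C" by (auto elim: Ints_cases)
    then have "m \<in> {- \<lceil>C\<rceil>..\<lceil>C\<rceil>}" by (auto simp: abs_le_iff le_ceiling_iff minus_le_iff)
    then show "x \<in> of_int ` {- \<lceil>C\<rceil>..\<lceil>C\<rceil>}" using m by blast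
  qed
qed simp

lemma finite_lat_norm: "finite {x\<in>lat. norm x \<le> C}"
  by (rule finite_lat_bounded[where C = C]) auto

lemma tri_lat: "x \<in> lat \<Longrightarrow> y \<in> lat \<Longrightarrow> z \<in> lat \<Longrightarrow> tri x y z \<in> \<int>"
  unfolding tri_def lat_iff by (intro Ints_add Ints_mult Ints_diff) auto

context hypV
begin

text \<open>On the lattice the map differs from the identity by integral combinations of the vectors
  (a_i' - a_i)/T. Congruence modulo the determinant thus makes it integral although the triples may
  span proper sublattices.\<close>

lemma transport:
  assumes lat: "a1 \<in> lat" "a2 \<in> lat" "a3 \<in> lat" "a1' \<in> lat" "a2' \<in> lat" "a3' \<in> lat"
    and T: "tri a1 a2 a3 = T" "tri a1' a2' a3' = T" "T \<noteq> 0"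
    and c: "rem T a1 = rem T a1'" "rem T a2 = rem T a2'" "rem T a3 = rem T a3'"
    and g: "b a1 a1 = b a1' a1'" "b a1 a2 = b a1' a2'" "b a1 a3 = b a1' a3'"
      "b a2 a2 = b a2' a2'" "b a2 a3 = b a2' a3'" "b a3 a3 = b a3' a3'"
  obtains f where "iso f" "f a1 = a1'" "f a2 = a2'" "f a3 = a3'"
proof -
  define F where "F a1 a2 a3 a1' a2' a3' x =
    (tri x a2 a3 / T) *\<^sub>R a1' + (tri a1 x a3 / T) *\<^sub>R a2' + (tri a1 a2 x / T) *\<^sub>R a3'" for a1 a2 a3 a1' a2' a3' x :: "real^3"
  define f where "f = F a1 a2 a3 a1' a2' a3'"
  define h where "h = F a1' a2' a3' a1 a2 a3"
  have Flin: "linear (F a1 a2 a3 a1' a2' a3')" for a1 a2 a3 a1' a2' a3'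
    by (rule linearI) (simp_all add: F_def tri_lin vec_eq_iff add_divide_distrib algebra_simps)
  have Fv: "F a1 a2 a3 a1' a2' a3' a1 = a1'" "F a1 a2 a3 a1' a2' a3' a2 = a2'" "F a1 a2 a3 a1' a2' a3' a3 = a3'"
    if "tri a1 a2 a3 = T" for a1 a2 a3 a1' a2' a3'
    using that T(3) by (simp_all add: F_def tri_same)
  have ex: "x = (tri x a2 a3 / T) *\<^sub>R a1 + (tri a1 x a3 / T) *\<^sub>R a2 + (tri a1 a2 x / T) *\<^sub>R a3"
    if "tri a1 a2 a3 = T" for a1 a2 a3 x using tri_expand[of a1 a2 a3 x] that T(3) by simp
  have Flat: "F a1 a2 a3 a1' a2' a3' x \<in> lat"
    if "a1 \<in> lat" "a2 \<in> lat" "a3 \<in> lat" "tri a1 a2 a3 = T" "x \<in> lat"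
      "rem T a1 = rem T a1'" "rem T a2 = rem T a2'" "rem T a3 = rem T a3'" for a1 a2 a3 a1' a2' a3' x
  proof -
    have "F a1 a2 a3 a1' a2' a3' x = x + (tri x a2 a3 *\<^sub>R ((1/T) *\<^sub>R (a1' - a1)) + tri a1 x a3 *\<^sub>R ((1/T) *\<^sub>R (a2' - a2))
      + tri a1 a2 x *\<^sub>R ((1/T) *\<^sub>R (a3' - a3)))"
      by (subst (2) ex[OF that(4), of x]) (simp add: F_def algebra_simps)
    also have "\<dots> \<in> lat" using that T(3) by (intro lat_add lat_scale rem_eq tri_lat)
    finally show ?thesis .
  qed
  have comp: "F a1' a2' a3' a1 a2 a3 (F a1 a2 a3 a1' a2' a3' x) = x"
    if "tri a1 a2 a3 = T" "tri a1' a2' a3' = T" for a1 a2 a3 a1' a2' a3' x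
  proof -
    let ?h = "F a1' a2' a3' a1 a2 a3"
    have "?h (F a1 a2 a3 a1' a2' a3' x) = (tri x a2 a3 / T) *\<^sub>R ?h a1' + (tri a1 x a3 / T) *\<^sub>R ?h a2' + (tri a1 a2 x / T) *\<^sub>R ?h a3'"
      using Flin[of a1' a2' a3' a1 a2 a3] by (simp add: F_def[of a1 a2 a3 a1' a2' a3' x] linear_add linear_scale)
    also have "\<dots> = x" unfolding Fv[OF that(2)] by (rule ex[OF that(1), symmetric])
    finally show ?thesis .
  qed
  have hf: "h (f x) = x" and fh: "f (h x) = x" for x
    unfolding f_def h_def using comp T by auto
  have fl: "f x \<in> lat" "h x \<in> lat" if "x \<in> lat" for x
    unfolding f_def h_def using lat T c that by (auto intro!: Flat)
  have "bij f" by (rule bijI') (metis hf, metis fh)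
  moreover have "f ` lat = lat" using fl fh by (metis (no_types, lifting) image_eqI image_subsetI subsetI subset_antisym)
  moreover have "b (f x) (f y) = b x y" for x y
  proof -
    have key: "b (p *\<^sub>R a1' + q *\<^sub>R a2' + r *\<^sub>R a3') (p' *\<^sub>R a1' + q' *\<^sub>R a2' + r' *\<^sub>R a3')
        = b (p *\<^sub>R a1 + q *\<^sub>R a2 + r *\<^sub>R a3) (p' *\<^sub>R a1 + q' *\<^sub>R a2 + r' *\<^sub>R a3)" for p q r p' q' r'
      using g sym[of a2 a1] sym[of a3 a1] sym[of a3 a2] sym[of a2' a1'] sym[of a3' a1'] sym[of a3' a2']
      by (simp add: bf_lin)
    show ?thesis by (simp only: f_def F_def key ex[OF T(1), symmetric])
  qed
  moreover have "linear f" unfolding f_def by (rule Flin)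
  ultimately have "iso f" unfolding iso_def by blast
  then show thesis using that[of f] Fv[OF T(1)] by (simp add: f_def)
qed

end

section \<open>Walls fall into finitely many types up to symmetries of the polygon\<close>

context refl
begin

lemma iso_V_cone:
  assumes f: "iso f" and n: "b n n \<ge> 0" "b x0 n > 0" "b x0 (f n) > 0" shows "f x0 \<in> V"
proof -
  have B: "b (f x) (f y) = b x y" for x y using f by (simp add: iso_def)
  have ff: "b (f x0) (f x0) > 0" using B V_pos x0 by simp
  have p: "b (f x0) (f n) > 0" using B n by simp
  have "b x0 (f x0) \<noteq> 0" using neg_orth'[OF V_pos[OF x0(1)], of "f x0"] ff by auto
  moreover have "\<not> b x0 (f x0) < 0"
  proof
    assume "b x0 (f x0) < 0"
    then have "- f x0 \<in> V" using V_I[of "- f x0" x0] x0 ff by (simp add: bf_lin)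
    then have "b (- f x0) (f n) > 0" using cone_pos[of "- f x0" "f n" x0] n x0 B by simp
    then show False using p by (simp add: bf_lin)
  qed
  ultimately show ?thesis using V_I[of "f x0" x0] x0 ff by simp
qed

text \<open>A vertex on the side \<open>e\<close>, with a lattice vector \<open>Q\<close> on its
  ray. The bound on the determinant leaves finitely many moduli and residues for
  \<open>transport\<close>.\<close>

definition meet_data where
  "meet_data e e1 Q \<longleftrightarrow> wall e \<and> wall e1 \<and> Q \<in> lat \<and> Q \<in> Ch \<and> b e Q = 0 \<and> b e1 Q = 0 \<and> tri e e1 Q \<noteq> 0
     \<and> \<bar>tri e e1 Q\<bar> \<le> (2*d)^2 \<and> b Q Q = d * \<bar>tri e e1 Q\<bar>"

text \<open>The analogue at a cusp \<open>c\<close>: \<open>y\<close> completes \<open>e\<close> and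
  \<open>c\<close> to a basis of the real space, normalised so that its Gram entries are
  bounded.\<close>

definition cusp_data where
  "cusp_data e c y \<longleftrightarrow> wall e \<and> prim c \<and> y \<in> lat \<and> (\<forall>r\<in>Rp. b c r \<ge> 0) \<and> b c c = 0 \<and> b e c = 0 \<and> b x0 c > 0
     \<and> b c y = d \<and> \<bar>b e y\<bar> \<le> 2*d \<and> \<bar>b y y\<bar> \<le> 2*d \<and> tri e c y \<noteq> 0 \<and> \<bar>tri e c y\<bar> \<le> 2*d"

text \<open>\<open>Q\<close> is \<open>cr G e e1\<close> up to sign, hence a multiple of
  \<open>P\<close>. The determinant is, up to sign, the Gram determinant of \<open>e\<close> and
  \<open>e1\<close>, at most the product of their squares.\<close>

lemma meet_data_ex:
  assumes e: "wall e" "wall e1" "e1 \<noteq> e" and P: "P \<in> Ch" "b P e = 0" "b P e1 = 0"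
  shows "\<exists>Q. meet_data e e1 Q"
proof -
  have PP: "b P P > 0" using P V_pos Ch_V by blast
  have ee: "b e e < 0" using root_neg wall_root e by auto
  have el: "e \<in> lat" "e1 \<in> lat" using root_lat wall_root e by auto
  let ?C = "cr G e e1" and ?D = "b e e * b e1 e1 - (b e e1)^2"
  have pos: "?D > 0"
  proof -
    let ?z = "b e e *\<^sub>R e1 - b e e1 *\<^sub>R e"
    have "?z \<noteq> 0"
    proof
      assume "?z = 0"
      then have "e1 = (b e e1 / b e e) *\<^sub>R e" using ee by (simp add: vec_eq_iff field_simps)
      then show False using Rp_scale wall_Rp e by blast
    qed
    moreover have "b P ?z = 0" using P by (simp add: bf_lin)
    ultimately have "b ?z ?z < 0" using neg_orth[OF PP] by blast
    moreover have "b ?z ?z = b e e * ?D" using sym[of e1 e] by (simp add: bf_lin power2_eq_square algebra_simps)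
    ultimately show ?thesis using ee by (simp add: mult_less_0_iff)
  qed
  have CC: "b ?C ?C = d * ?D" by (simp add: cr_norm)
  have tC: "tri e e1 ?C = ?D" using sym[of e1 e] by (simp add: tcr power2_eq_square)
  have "b P ?C \<noteq> 0"
  proof
    assume z: "b P ?C = 0"
    have "P = 0" by (rule nondeg3[of e e1 ?C]) (use z P pos tC in auto)
    then show False using PP by (simp add: bf_lin)
  qed
  define s :: real where "s = (if b P ?C > 0 then 1 else -1)"
  define Q where "Q = s *\<^sub>R ?C"
  have ss: "s * s = 1" "s \<in> \<int>" "\<bar>s\<bar> = 1" by (auto simp: s_def)
  have PQ: "b P Q > 0" using \<open>b P ?C \<noteq> 0\<close> by (auto simp: Q_def s_def bf_lin)
  have QQ: "b Q Q = d * ?D" using CC ss by (simp add: Q_def bf_lin)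
  have Qo: "b e Q = 0" "b e1 Q = 0" by (simp_all add: Q_def bf_lin b_cr' tri_same)
  have tQ: "tri e e1 Q = s * ?D" by (simp add: Q_def tri_lin tC)
  have QP: "Q = (b Q Q / b P Q) *\<^sub>R P"
  proof -
    have "b P Q *\<^sub>R Q - b Q Q *\<^sub>R P = 0"
      by (rule nondeg3[of e e1 Q]) (use pos tQ P Qo sym[of Q e] sym[of Q e1] ss in \<open>auto simp: bf_lin s_def split: if_splits\<close>)
    then show ?thesis using PQ by (simp add: vec_eq_iff field_simps)
  qed
  define l where "l = b Q Q / b P Q"
  have l: "l > 0" using PQ QQ pos d_pos by (simp add: l_def)
  have Ql: "Q = l *\<^sub>R P" using QP by (simp add: l_def)
  have QCh: "Q \<in> Ch" using P l unfolding Ql Ch_def by (auto simp: V_scale bf_lin)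
  have D: "?D \<le> (2*d)^2"
  proof -
    have "- b e e \<le> 2*d" "- b e1 e1 \<le> 2*d" using root_bound wall_root e by auto
    then have "(- b e e) * (- b e1 e1) \<le> (2*d) * (2*d)" using root_neg[OF wall_root[OF e(2)]] d_pos by (intro mult_mono) auto
    moreover have "(b e e1)^2 \<ge> 0" by simp
    ultimately show ?thesis unfolding power2_eq_square by linarith
  qed
  have "Q \<in> lat" unfolding Q_def using el ss by (intro lat_scale cr_lat)
  then have "meet_data e e1 Q" unfolding meet_data_def tQ using e QCh Qo ss pos D QQ
    by (auto simp: abs_mult s_def)
  then show ?thesis by blast
qed

lemma cusp_data_ex:
  assumes e: "wall e" and c: "prim c" "\<And>r. r \<in> Rp \<Longrightarrow> b c r \<ge> 0" "b c c = 0" "b e c = 0" "b x0 c > 0"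
  shows "\<exists>y. cusp_data e c y"
proof -
  have er: "is_root G e" by (rule wall_root[OF e])
  have ee: "b e e < 0" "- b e e \<le> 2 * d" using root_neg[OF er] root_bound[OF er] by auto
  have el: "e \<in> lat" "c \<in> lat" using root_lat[OF er] c(1) by (auto simp: prim_def)
  obtain y0 where y0: "y0 \<in> lat" "b c y0 = d" using exists_dual[OF c(1)] by blast
  have ce: "b c e = 0" using c sym by simp
  \<comment> \<open>Adding multiples of \<open>e\<close> reduces \<open>b e y\<close> modulo e^2 and
    keeps \<open>b c y\<close>.\<close>
  define i where "i = real_of_int \<lfloor>b e y0 / (- b e e)\<rfloor>"
  define y1 where "y1 = y0 + i *\<^sub>R e"
  have y1: "y1 \<in> lat" "b c y1 = d" using y0 el ce by (auto simp: y1_def i_def bf_lin intro!: lat_intros)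
  have ey: "\<bar>b e y1\<bar> \<le> 2 * d"
  proof -
    have "b e y1 = (- b e e) * frac (b e y0 / (- b e e))" using ee by (simp add: y1_def i_def bf_lin frac_def field_simps)
    moreover have "0 \<le> frac (b e y0 / (- b e e))" "frac (b e y0 / (- b e e)) \<le> 1" using frac_lt_1 frac_ge_0 less_imp_le by auto
    ultimately have "0 \<le> b e y1" "b e y1 \<le> - b e e" using ee by (auto simp: mult_nonneg_nonneg mult_nonpos_nonneg mult_le_cancel_left1)
    then show ?thesis using ee by linarith
  qed
  \<comment> \<open>Adding \<open>c\<close> changes y^2 by 2d and keeps \<open>b e y\<close> and
    \<open>b c y\<close>.\<close>
  define j where "j = - real_of_int \<lfloor>b y1 y1 / (2 * d)\<rfloor>"
  define y where "y = y1 + j *\<^sub>R c"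
  have y: "y \<in> lat" "b c y = d" "b e y = b e y1" using y1 el c by (auto simp: y_def j_def bf_lin intro!: lat_intros)
  have yy: "\<bar>b y y\<bar> \<le> 2 * d"
  proof -
    have "b y y = b y1 y1 + j * (2 * d)" using y1(2) c(3) sym[of y1 c] by (simp add: y_def bf_lin)
    also have "\<dots> = (2 * d) * frac (b y1 y1 / (2 * d))" using d_pos by (simp add: j_def frac_def field_simps)
    finally have "b y y = (2 * d) * frac (b y1 y1 / (2 * d))" .
    moreover have "0 \<le> frac (b y1 y1 / (2 * d))" "frac (b y1 y1 / (2 * d)) \<le> 1" using frac_lt_1 frac_ge_0 less_imp_le by auto
    ultimately show ?thesis using d_pos by (simp add: abs_mult)
  qed
  have c0: "c \<noteq> 0" by (rule prim_nonzero[OF c(1)])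
  obtain a where a: "cr G e c = a *\<^sub>R c" "a^2 = - d * b e e" using cr_null[OF c(3,4) c0] by blast
  have "d * tri e c y = a * d" unfolding b_cr[symmetric] a(1) bf_scale_left y(2) ..
  then have T: "tri e c y = a" using d_pos by simp
  have "a^2 \<le> (2 * d)^2"
  proof -
    have "d * (- b e e) \<le> d * (2 * d)" using ee d_pos by (intro mult_left_mono) auto
    then have "a^2 \<le> d * (2 * d)" unfolding a(2) by simp
    also have "\<dots> \<le> (2 * d)^2" by (simp add: power2_eq_square)
    finally show ?thesis .
  qed
  then have "\<bar>a\<bar> \<le> \<bar>2 * d\<bar>" by (simp only: abs_le_square_iff)
  then have "\<bar>a\<bar> \<le> 2 * d" using d_pos by simp
  moreover have "a \<noteq> 0" using a ee d_pos by auto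
  ultimately have "cusp_data e c y" unfolding cusp_data_def T using assms y yy ey by auto
  then show ?thesis by blast
qed

lemma wall_data:
  assumes e: "wall e" "\<nexists>a. \<rho> = a *\<^sub>R e" "\<exists>n. b n n = 0 \<and> b e n = 0 \<and> b x0 n > 0"
  shows "(\<exists>e1 Q. meet_data e e1 Q) \<or> (\<exists>c y. cusp_data e c y)"
proof -
  obtain n where n: "b n n = 0" "b e n = 0" "b x0 n > 0" using e(3) by blast
  show ?thesis
  proof (rule next_wall[OF e(1,2) n])
    fix e1 P assume "wall e1" "e1 \<noteq> e" "P \<in> Ch" "b P e = 0" "b P e1 = 0"
    then show ?thesis using meet_data_ex[of e e1 P] e by blast
  next
    fix e1 c l assume h: "prim c" "n = l *\<^sub>R c" "l > 0" "\<And>r. r \<in> Rp \<Longrightarrow> b c r \<ge> 0"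
    have "b c c = 0" "b e c = 0" "b x0 c > 0" using n h(3) unfolding h(2) by (auto simp: bf_lin zero_less_mult_iff)
    then show ?thesis using cusp_data_ex[OF e(1) h(1,4)] by blast
  qed
qed

text \<open>The Gram entries not listed are determined by \<open>meet_data\<close>: those with
  \<open>Q\<close> vanish or equal d|T|.\<close>

definition meet_type where
  "meet_type e e1 Q = (let T = tri e e1 Q in (b e e, b e e1, b e1 e1, T, rem T e, rem T e1, rem T Q))"
definition cusp_type where
  "cusp_type e c y = (let T = tri e c y in (b e e, b e y, b y y, T, rem T e, rem T c, rem T y))"

definition BB where "BB = {x::real. x \<in> \<int> \<and> \<bar>x\<bar> \<le> (2*d)^2 + 2*d}"
definition LL where "LL = {x\<in>lat. norm x \<le> 3 * ((2*d)^2 + 2*d)}"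
definition types where "types = BB \<times> BB \<times> BB \<times> BB \<times> LL \<times> LL \<times> LL"

lemma finite_types: "finite types"
  unfolding types_def BB_def LL_def using finite_Ints_bounded finite_lat_norm by (intro finite_cartesian_product) auto

lemma BB_I: "x \<in> \<int> \<Longrightarrow> \<bar>x\<bar> \<le> 2*d \<or> \<bar>x\<bar> \<le> (2*d)^2 \<Longrightarrow> x \<in> BB"
  using d_pos by (auto simp: BB_def add_increasing add_increasing2)

lemma LL_I: "x \<in> lat \<Longrightarrow> T \<in> BB \<Longrightarrow> T \<noteq> 0 \<Longrightarrow> rem T x \<in> LL"
  unfolding LL_def BB_def by (blast intro: rem_lat rem_norm)

lemma root_BB: "is_root G e \<Longrightarrow> b e e \<in> BB"
  using root_bound[of e] root_neg[of e] root_lat[of e] by (intro BB_I bf_lat_Ints) auto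

lemma meet_type_in: assumes "meet_data e e1 Q" shows "meet_type e e1 Q \<in> types"
proof -
  have r: "is_root G e" "is_root G e1" and Q: "Q \<in> lat" "tri e e1 Q \<noteq> 0" "\<bar>tri e e1 Q\<bar> \<le> (2*d)^2"
    and o: "Q \<in> Ch" "b e Q = 0" "b e1 Q = 0"
    using assms wall_root by (auto simp: meet_data_def)
  have l: "e \<in> lat" "e1 \<in> lat" using r root_lat by auto
  have T: "tri e e1 Q \<in> BB" using Q l by (intro BB_I tri_lat) auto
  have QQ: "b Q Q > 0" using V_pos[OF Ch_V[OF o(1)]] .
  have "(b e e1)^2 \<le> b e e * b e1 e1"
  proof (rule cs_cone)
    show "Q \<noteq> 0" using QQ by (auto simp: bf_lin)
  qed (use QQ o sym[of Q e] sym[of Q e1] in auto)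
  also have "\<dots> = (- b e e) * (- b e1 e1)" by simp
  also have "\<dots> \<le> (2*d) * (2*d)" using r root_bound root_neg[OF r(2)] d_pos by (intro mult_mono) auto
  finally have "(b e e1)^2 \<le> (2*d)^2" by (simp add: power2_eq_square)
  then have "\<bar>b e e1\<bar> \<le> \<bar>2*d\<bar>" by (simp only: abs_le_square_iff)
  then have "\<bar>b e e1\<bar> \<le> 2*d" using d_pos by simp
  then have "b e e1 \<in> BB" using l by (intro BB_I bf_lat_Ints) auto
  then show ?thesis unfolding types_def meet_type_def Let_def
    by (intro SigmaI root_BB r T LL_I[OF _ T Q(2)] l Q(1))
qed

lemma cusp_type_in: assumes "cusp_data e c y" shows "cusp_type e c y \<in> types"
proof -
  have r: "is_root G e" "prim c" and y: "y \<in> lat" "tri e c y \<noteq> 0" "\<bar>tri e c y\<bar> \<le> 2*d" "\<bar>b e y\<bar> \<le> 2*d" "\<bar>b y y\<bar> \<le> 2*d"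
    using assms wall_root by (auto simp: cusp_data_def)
  have l: "e \<in> lat" "c \<in> lat" using r root_lat by (auto simp: prim_def)
  have T: "tri e c y \<in> BB" using y l by (intro BB_I tri_lat) auto
  have B: "b e y \<in> BB" "b y y \<in> BB" using y l by (auto intro!: BB_I bf_lat_Ints)
  show ?thesis unfolding types_def cusp_type_def Let_def
    by (intro SigmaI B root_BB[OF r(1)] T LL_I[OF _ T y(2)] l y(1))
qed

text \<open>The isometry from \<open>transport\<close> preserves the polygon: a positive root is
  positive at the vertex, or it vanishes there and is a nonnegative combination of the two
  walls.\<close>

lemma meet_transport:
  assumes D: "meet_data e e1 Q" "meet_data e' e1' Q'" and t: "meet_type e e1 Q = meet_type e' e1' Q'"
  shows "\<exists>f\<in>AM. f e = e'"
proof -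
  note D1 = D(1)[unfolded meet_data_def] and D2 = D(2)[unfolded meet_data_def]
  let ?T = "tri e e1 Q"
  have T: "tri e' e1' Q' = ?T" using t by (simp add: meet_type_def Let_def)
  have l: "e \<in> lat" "e1 \<in> lat" "Q \<in> lat" "e' \<in> lat" "e1' \<in> lat" "Q' \<in> lat"
    using D1 D2 root_lat wall_root by auto
  obtain f where f: "iso f" "f e = e'" "f e1 = e1'" "f Q = Q'"
    by (rule transport[OF l _ T]) (use D1 D2 t T in \<open>auto simp: meet_type_def Let_def\<close>)
  have lin: "linear f" and B: "b (f x) (f y) = b x y" for x y using f by (auto simp: iso_def)
  have QV: "Q \<in> V" "f Q \<in> V" using D1 D2 f Ch_V by auto
  have "f \<in> AM"
  proof (rule A_M_I[OF f(1) QV])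
    fix r assume r: "r \<in> Rp"
    have fr: "is_root G (f r)" by (rule iso_root[OF f(1) Rp_root[OF r]])
    show "f r \<in> Rp"
    proof (cases "b Q r = 0")
      case False
      then have "b Q r > 0" using D1 Ch_ge[of Q r] r by simp
      then have "b Q' (f r) > 0" using B[of Q r] f by simp
      then show ?thesis using Rp_if_pos[OF fr, of Q'] D2 by blast
    next
      case True
      define a c k where "a = tri r e1 Q / ?T" and "c = tri e r Q / ?T" and "k = tri e e1 r / ?T"
      have ex: "r = a *\<^sub>R e + c *\<^sub>R e1 + k *\<^sub>R Q" unfolding a_def c_def k_def using tri_expand[of e e1 Q r] D1 by blast
      have QQ: "b Q Q > 0" using V_pos QV by blast
      have "b Q r = k * b Q Q" by (subst ex) (use D1 sym[of Q e] sym[of Q e1] in \<open>simp add: bf_lin\<close>)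
      then have "k = 0" using True QQ by simp
      then have ex: "r = a *\<^sub>R e + c *\<^sub>R e1" using ex by simp
      have ne: "e \<noteq> e1" using D1 by (auto simp: tri_same)
      obtain x x1 where x: "wall_at e x" "wall_at e1 x1" using D1 by (auto simp: wall_def)
      have "b x r = c * b x e1" using x by (subst ex) (simp add: bf_lin wall_at_def)
      moreover have "b x e1 > 0" using x ne wall_Rp[of e1] D1 by (auto simp: wall_at_def)
      ultimately have c0: "c \<ge> 0" using Ch_ge[OF wall_at_Ch[OF x(1)] r] by (simp add: zero_le_mult_iff)
      have "b x1 r = a * b x1 e" using x by (subst ex) (simp add: bf_lin wall_at_def)
      moreover have "b x1 e > 0" using x ne wall_Rp[of e] D1 by (auto simp: wall_at_def)
      ultimately have a0: "a \<ge> 0" using Ch_ge[OF wall_at_Ch[OF x(2)] r] by (simp add: zero_le_mult_iff)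
      have "a > 0 \<or> c > 0"
      proof (rule ccontr)
        assume "\<not> ?thesis"
        then have "r = 0" using a0 c0 ex by simp
        then show False using r by (simp add: Rp_def bf_lin)
      qed
      moreover have "b x0 e' > 0" "b x0 e1' > 0" using D2 wall_Rp by (auto simp: Rp_def)
      ultimately have "a * b x0 e' + c * b x0 e1' > 0" using a0 c0
        by (metis add_nonneg_pos add_pos_nonneg less_imp_le mult_nonneg_nonneg mult_pos_pos)
      then have "b x0 (f r) > 0" using f lin by (subst ex) (simp add: linear_add linear_scale bf_lin)
      then show ?thesis using fr by (simp add: Rp_def)
    qed
  qed
  then show ?thesis using f by blast
qed

text \<open>As at a vertex, except that a positive root vanishing at the cusp is \<open>e\<close>
  itself or a e + g c with g > 0; the image of the latter is positive at a point of the side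
  \<open>e'\<close>.\<close>

lemma cusp_transport:
  assumes D: "cusp_data e c y" "cusp_data e' c' y'" and t: "cusp_type e c y = cusp_type e' c' y'"
  shows "\<exists>f\<in>AM. f e = e'"
proof -
  note D1 = D(1)[unfolded cusp_data_def] and D2 = D(2)[unfolded cusp_data_def]
  let ?T = "tri e c y"
  have T: "tri e' c' y' = ?T" using t by (simp add: cusp_type_def Let_def)
  have l: "e \<in> lat" "c \<in> lat" "y \<in> lat" "e' \<in> lat" "c' \<in> lat" "y' \<in> lat"
    using D1 D2 root_lat wall_root by (auto simp: prim_def)
  obtain f where f: "iso f" "f e = e'" "f c = c'" "f y = y'"
    by (rule transport[OF l _ T]) (use D1 D2 t T in \<open>auto simp: cusp_type_def Let_def\<close>)
  have lin: "linear f" and B: "b (f x) (f y) = b x y" for x y using f by (auto simp: iso_def)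
  have V1: "f x0 \<in> V" by (rule iso_V_cone[OF f(1), of c]) (use D1 D2 f in auto)
  have "f \<in> AM"
  proof (rule A_M_I[OF f(1) x0(1) V1])
    fix r assume r: "r \<in> Rp"
    have fr: "is_root G (f r)" by (rule iso_root[OF f(1) Rp_root[OF r]])
    show "f r \<in> Rp"
    proof (cases "b c r = 0")
      case False
      then have "b c r > 0" using D1 r by force
      then have p: "b c' (f r) > 0" using B[of c r] f by simp
      show ?thesis using root_Rp[OF fr] D2 p by (force simp: bf_lin)
    next
      case True
      define a g k where "a = tri r c y / ?T" and "g = tri e r y / ?T" and "k = tri e c r / ?T"
      have ex: "r = a *\<^sub>R e + g *\<^sub>R c + k *\<^sub>R y" unfolding a_def g_def k_def using tri_expand[of e c y r] D1 by blast
      have "b c r = k * d" by (subst ex) (use D1 sym[of c e] in \<open>simp add: bf_lin\<close>)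
      then have "k = 0" using True d_pos by simp
      then have ex: "r = a *\<^sub>R e + g *\<^sub>R c" using ex by simp
      obtain x x' where x: "wall_at e x" "wall_at e' x'" using D1 D2 by (auto simp: wall_def)
      have xc: "b x c > 0" "b x' c' > 0"
        using cone_pos[of x c x0] cone_pos[of x' c' x0] x x0 D1 D2 by (auto simp: wall_at_def)
      have "b x r = g * b x c" using x by (subst ex) (simp add: bf_lin wall_at_def)
      then have g0: "g \<ge> 0" using Ch_ge[OF wall_at_Ch[OF x(1)] r] xc by (simp add: zero_le_mult_iff)
      show ?thesis
      proof (cases "g = 0")
        case True
        then have "r = a *\<^sub>R e" using ex by simp
        then have "r = e" using Rp_scale[of e r a] r D1 wall_Rp by auto
        then show ?thesis using f D2 wall_Rp by simp
      next
        case False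
        have "b x' (f r) = g * b x' c'" using x f lin by (subst ex) (simp add: linear_add linear_scale bf_lin wall_at_def)
        then have "b x' (f r) > 0" using False g0 xc by simp
        then show ?thesis using Rp_if_pos[OF fr wall_at_Ch[OF x(2)]] by blast
      qed
    qed
  qed
  then show ?thesis using f by blast
qed

text \<open>\<open>f \<rho>\<close> depends only on the coset of \<open>f\<close> modulo
  \<open>H\<close>.\<close>

lemma finite_orbit_\<rho>: "finite {f \<rho> | f. f \<in> AM}"
proof -
  have "{f \<rho> | f. f \<in> AM} \<subseteq> (\<lambda>S. (THE x. \<forall>f\<in>S. f \<rho> = x)) ` (\<lambda>f. (\<lambda>h. f \<circ> h) ` H) ` AM"
  proof
    fix x assume "x \<in> {f \<rho> | f. f \<in> AM}"
    then obtain f where f: "f \<in> AM" "x = f \<rho>" by blast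
    have all: "\<forall>g\<in>(\<lambda>h. f \<circ> h) ` H. g \<rho> = x"
    proof
      fix g assume "g \<in> (\<lambda>h. f \<circ> h) ` H"
      then obtain h where h: "h \<in> H" "g = f \<circ> h" by blast
      then show "g \<rho> = x" using f(2) by (simp add: H(2)[OF h(1)])
    qed
    have "id \<in> H" by (rule H_id)
    then have "(THE x. \<forall>g\<in>(\<lambda>h. f \<circ> h) ` H. g \<rho> = x) = x" using all by (intro the_equality) auto
    then show "x \<in> (\<lambda>S. (THE x. \<forall>f\<in>S. f \<rho> = x)) ` (\<lambda>f. (\<lambda>h. f \<circ> h) ` H) ` AM" using f by force
  qed
  then show ?thesis using H_fin finite_subset by blast
qed

definition W where "W = {e. wall e \<and> (\<nexists>a. \<rho> = a *\<^sub>R e) \<and> (\<exists>n. b n n = 0 \<and> b e n = 0 \<and> b x0 n > 0)}"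

text \<open>Each wall is \<open>f e'\<close> for one of finitely many representatives, one per type,
  and its product with \<rho> is that of \<open>e'\<close> with \<open>inv f \<rho>\<close>, which
  runs through a finite orbit.\<close>

lemma finite_heights: "finite {b e \<rho> | e. e \<in> W}"
proof -
  define rm where "rm \<tau> = (SOME e. \<exists>e1 Q. meet_data e e1 Q \<and> meet_type e e1 Q = \<tau>)" for \<tau>
  define rc where "rc \<tau> = (SOME e. \<exists>c y. cusp_data e c y \<and> cusp_type e c y = \<tau>)" for \<tau>
  define E where "E = rm ` types \<union> rc ` types"
  have finE: "finite E" unfolding E_def using finite_types by simp
  have orb: "\<exists>f\<in>AM. \<exists>e'\<in>E. f e' = e" if eW: "e \<in> W" for e
  proof -
    consider e1 Q where "meet_data e e1 Q" | c y where "cusp_data e c y"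
      using wall_data[of e] eW unfolding W_def by blast
    then show ?thesis
    proof cases
      case 1
      let ?t = "meet_type e e1 Q"
      have "\<exists>e' e1' Q'. meet_data e' e1' Q' \<and> meet_type e' e1' Q' = ?t" using 1 by blast
      then have "\<exists>e1' Q'. meet_data (rm ?t) e1' Q' \<and> meet_type (rm ?t) e1' Q' = ?t"
        unfolding rm_def by (rule someI_ex)
      then have "\<exists>f\<in>AM. f (rm ?t) = e" using meet_transport 1 by metis
      moreover have "rm ?t \<in> E" unfolding E_def using meet_type_in[OF 1] by blast
      ultimately show ?thesis by blast
    next
      case 2
      let ?t = "cusp_type e c y"
      have "\<exists>e' c' y'. cusp_data e' c' y' \<and> cusp_type e' c' y' = ?t" using 2 by blast
      then have "\<exists>c' y'. cusp_data (rc ?t) c' y' \<and> cusp_type (rc ?t) c' y' = ?t"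
        unfolding rc_def by (rule someI_ex)
      then have "\<exists>f\<in>AM. f (rc ?t) = e" using cusp_transport 2 by metis
      moreover have "rc ?t \<in> E" unfolding E_def using cusp_type_in[OF 2] by blast
      ultimately show ?thesis by blast
    qed
  qed
  have "{b e \<rho> | e. e \<in> W} \<subseteq> (\<lambda>(e', x). b e' x) ` (E \<times> {f \<rho> | f. f \<in> AM})"
  proof
    fix v assume "v \<in> {b e \<rho> | e. e \<in> W}"
    then obtain e where e: "e \<in> W" "v = b e \<rho>" by blast
    obtain f e' where f: "f \<in> AM" "e' \<in> E" "f e' = e" using orb[OF e(1)] by blast
    have bj: "bij f" and B: "\<And>x y. b (f x) (f y) = b x y" using f(1) by (auto simp: A_M_iff iso_def)
    have "v = b e' (inv f \<rho>)" using B[of e' "inv f \<rho>"] bj f e by (simp add: bij_is_surj surj_f_inv_f)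
    then show "v \<in> (\<lambda>(e', x). b e' x) ` (E \<times> {f \<rho> | f. f \<in> AM})"
      using f(2) A_M_inv[OF f(1)] by force
  qed
  then show ?thesis using finE finite_orbit_\<rho> finite_subset by blast
qed

end

section \<open>Chains of sides in hyperbolic coordinates\<close>

text \<open>For two walls: the cosine of their angle, 1 if they are parallel, and the hyperbolic
  cosine of their distance if they are disjoint.\<close>

definition nv :: "int^3^3 \<Rightarrow> real^3 \<Rightarrow> real^3 \<Rightarrow> real" where
  "nv G e f = bf G e f / sqrt (bf G e e * bf G f f)"

context hyp
begin

text \<open>The positive cone is open, so it contains a rational vector; clear denominators.\<close>

lemma pos_lat: "\<exists>x\<in>lat. b x x > 0"
proof -
  obtain x where x: "b x x > 0" using ex_pos by blast
  let ?f = "\<lambda>n. \<chi> i. real_of_int \<lfloor>real (Suc n) * x$i\<rfloor> / real (Suc n)"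
  have "(\<lambda>n. ?f n $ i) \<longlonglongrightarrow> x $ i" for i
  proof (rule real_tendsto_sandwich)
    show "\<forall>\<^sub>F n in sequentially. x$i - inverse (real (Suc n)) \<le> ?f n $ i"
    proof (intro always_eventually allI)
      fix n
      have "real (Suc n) * x$i - 1 \<le> of_int \<lfloor>real (Suc n) * x$i\<rfloor>" by linarith
      then have "(real (Suc n) * x$i - 1) / real (Suc n) \<le> of_int \<lfloor>real (Suc n) * x$i\<rfloor> / real (Suc n)"
        by (intro divide_right_mono) auto
      moreover have "(real (Suc n) * x$i - 1) / real (Suc n) = x$i - inverse (real (Suc n))"
        by (simp add: diff_divide_distrib inverse_eq_divide del: of_nat_Suc)
      ultimately show "x$i - inverse (real (Suc n)) \<le> ?f n $ i" by simp
    qed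
    show "\<forall>\<^sub>F n in sequentially. ?f n $ i \<le> x$i"
    proof (intro always_eventually allI)
      fix n
      have "of_int \<lfloor>real (Suc n) * x$i\<rfloor> \<le> real (Suc n) * x$i" by linarith
      then show "?f n $ i \<le> x$i" by (simp add: field_simps)
    qed
    show "(\<lambda>n. x$i - inverse (real (Suc n))) \<longlonglongrightarrow> x$i"
      using tendsto_diff[OF tendsto_const LIMSEQ_inverse_real_of_nat] by simp
  qed simp
  then have "?f \<longlonglongrightarrow> x" by (rule vec_tendstoI)
  moreover have "open {y. b y y > 0}" by (intro open_Collect_less continuous_intros)
  ultimately have "\<forall>\<^sub>F n in sequentially. ?f n \<in> {y. b y y > 0}"
    using x by (intro topological_tendstoD) auto
  then obtain n where n: "b (?f n) (?f n) > 0" unfolding eventually_sequentially by blast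
  let ?y = "real (Suc n) *\<^sub>R ?f n"
  have "b ?y ?y = (real (Suc n))^2 * b (?f n) (?f n)" by (simp only: bf_scale_left bf_scale_right power2_eq_square mult.assoc)
  then have "b ?y ?y > 0" using n by simp
  moreover have "?y \<in> lat" by (simp add: lat_def)
  ultimately show ?thesis by blast
qed

end

context refl
begin

lemma \<rho>_pq: "b pp \<rho> = 0" "b qq \<rho> = 0"
  using pq(7,8) \<rho>(2) by (auto simp: rh_def bf_lin)

text \<open>\<open>hc e\<close> and \<open>hs e\<close> are the hyperbolic cosine and sine of the distance between the disjoint geodesics \<open>e\<^sup>\<bottom>\<close> and
  \<open>\<rho>\<^sup>\<bottom>\<close>, \<open>ht e\<close> is the position of the foot of their common perpendicular on \<open>\<rho>\<^sup>\<bottom>\<close>, and \<open>hw e\<close> is half the length of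
  the projection of \<open>e\<^sup>\<bottom>\<close> to \<open>\<rho>\<^sup>\<bottom>\<close>. The point at infinity on the side \<open>\<sigma>\<close> over position \<open>t\<close> is \<open>nn \<sigma> t\<close>; \<open>good \<sigma>\<close>
  says that this side of \<open>\<rho>\<^sup>\<bottom>\<close> is not cut off by a mirror.\<close>
definition hc where "hc e = \<bar>b rh e\<bar> / sqrt (- b e e)"
definition hs where "hs e = sqrt (4 * b pp e * b qq e / - b e e)"
definition ht where "ht e = ln (b qq e / b pp e) / 2"
definition hw where "hw e = arsinh (1 / hs e)"

definition side where "side \<sigma> e \<longleftrightarrow> e \<in> Rp \<and> b pp e > 0 \<and> b qq e > 0 \<and> \<sigma> * b rh e < 0"
definition Wk where "Wk \<sigma> = {e. wall e \<and> side \<sigma> e}"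
definition nn where "nn \<sigma> t = exp t *\<^sub>R pp + exp (- t) *\<^sub>R qq + \<sigma> *\<^sub>R rh"
definition good where "good \<sigma> \<longleftrightarrow> (\<sigma> = 1 \<or> \<sigma> = -1) \<and> (\<forall>r\<in>Rp. (\<exists>a. r = a *\<^sub>R \<rho>) \<longrightarrow> \<sigma> * b rh r > 0)"

lemma side_neg: "side \<sigma> e \<Longrightarrow> b e e < 0" using Rp_root root_neg by (auto simp: side_def)

lemma hs_pos: assumes "side \<sigma> e" shows "hs e > 0"
proof -
  have "4 * b pp e * b qq e > 0" "- b e e > 0" using assms side_neg by (auto simp: side_def)
  then show ?thesis unfolding hs_def by (simp only: real_sqrt_gt_zero divide_pos_pos)
qed

lemma hc_pos: "side \<sigma> e \<Longrightarrow> hc e > 0"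
  using side_neg[of \<sigma> e] by (auto simp: hc_def side_def intro!: divide_pos_pos)

lemma hc_hs: assumes "side \<sigma> e" shows "(hc e)^2 = 1 + (hs e)^2"
proof -
  have k: "b e e < 0" by (rule side_neg[OF assms])
  have "b e e = 4 * b pp e * b qq e - (b rh e)^2" by (subst b_coords) (simp add: power2_eq_square)
  moreover have "4 * b pp e * b qq e / - b e e \<ge> 0" using assms k by (intro divide_nonneg_pos) (auto simp: side_def)
  ultimately show ?thesis using k by (simp add: hc_def hs_def power_divide field_simps)
qed

lemma h_exp:
  assumes "side \<sigma> e"
  shows "2 * b qq e = sqrt (- b e e) * hs e * exp (ht e)" "2 * b pp e = sqrt (- b e e) * hs e * exp (- ht e)"
proof -
  have k: "b e e < 0" and p: "b pp e > 0" "b qq e > 0" using assms side_neg by (auto simp: side_def)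
  have e1: "exp (ht e) = sqrt (b qq e / b pp e)"
    using p by (simp add: ht_def ln_sqrt[symmetric])
  have e2: "exp (- ht e) = sqrt (b pp e / b qq e)"
    using p by (simp add: exp_minus e1 real_sqrt_inverse[symmetric])
  have s: "sqrt (- b e e) * hs e = 2 * sqrt (b pp e) * sqrt (b qq e)"
    using k p by (simp add: hs_def real_sqrt_divide real_sqrt_mult real_sqrt_minus)
  show "2 * b qq e = sqrt (- b e e) * hs e * exp (ht e)"
    unfolding s e1 using p by (simp add: real_sqrt_divide)
  show "2 * b pp e = sqrt (- b e e) * hs e * exp (- ht e)"
    unfolding s e2 using p by (simp add: real_sqrt_divide)
qed

lemma rh_side: assumes "side \<sigma> e" "\<sigma> = 1 \<or> \<sigma> = -1" shows "b rh e = - \<sigma> * sqrt (- b e e) * hc e"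
  using side_neg[OF assms(1)] assms by (auto simp: hc_def side_def abs_if)

text \<open>Expand both roots in \<open>pp\<close>, \<open>qq\<close>, \<open>rh\<close>. Lines on
  the same side of the geodesic get the minus sign, lines on opposite sides the plus sign.\<close>

lemma nv_formula:
  assumes e: "side \<sigma> e" "\<sigma> = 1 \<or> \<sigma> = -1" and f: "side \<tau> f" "\<tau> = 1 \<or> \<tau> = -1"
  shows "nv G e f = hs e * hs f * cosh (ht e - ht f) - \<sigma> * \<tau> * hc e * hc f"
proof -
  let ?k = "sqrt (- b e e)" and ?l = "sqrt (- b f f)"
  have kl: "?k > 0" "?l > 0" using side_neg e f by auto
  have kk: "sqrt (b e e * b f f) = ?k * ?l" by (simp add: real_sqrt_mult[symmetric])
  have "2 * b e f = 2 * b qq e * (2 * b pp f) + 2 * b pp e * (2 * b qq f) - 2 * (b rh e * b rh f)"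
    by (subst b_coords) (simp add: algebra_simps)
  also have "\<dots> = ?k * ?l * (hs e * hs f * (exp (ht e) * exp (- ht f) + exp (- ht e) * exp (ht f)) - 2 * (\<sigma> * \<tau> * hc e * hc f))"
    unfolding h_exp[OF e(1)] h_exp[OF f(1)] rh_side[OF e] rh_side[OF f] by (simp add: algebra_simps)
  also have "exp (ht e) * exp (- ht f) + exp (- ht e) * exp (ht f) = 2 * cosh (ht e - ht f)"
    by (simp add: cosh_def exp_add[symmetric] exp_diff exp_minus field_simps)
  finally have "2 * b e f = 2 * (?k * ?l * (hs e * hs f * cosh (ht e - ht f) - \<sigma> * \<tau> * hc e * hc f))"
    by (simp only: algebra_simps)
  then have "b e f = ?k * ?l * (hs e * hs f * cosh (ht e - ht f) - \<sigma> * \<tau> * hc e * hc f)" by simp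
  then show ?thesis using kl by (simp add: nv_def kk)
qed

lemma hw: assumes "side \<sigma> e" shows "sinh (hw e) = 1 / hs e" "cosh (hw e) = hc e / hs e" "hw e > 0"
proof -
  have s: "hs e > 0" "hc e > 0" using hs_pos hc_pos assms by auto
  show sw: "sinh (hw e) = 1 / hs e" by (simp add: hw_def)
  have "(cosh (hw e))^2 = (hc e / hs e)^2"
    unfolding cosh_square_eq sw using s hc_hs[OF assms] by (simp add: field_simps)
  then show "cosh (hw e) = hc e / hs e" using s by (simp add: power2_eq_iff_nonneg)
  show "hw e > 0" using sw s by (metis sinh_real_pos_iff zero_less_divide_1_iff)
qed

lemma b_nn: assumes "side \<sigma>' e" shows "b (nn \<sigma> t) e = sqrt (- b e e) * hs e * cosh (t - ht e) + \<sigma> * b rh e"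
proof -
  have "2 * b (nn \<sigma> t) e = exp t * (2 * b pp e) + exp (- t) * (2 * b qq e) + 2 * \<sigma> * b rh e"
    by (simp add: nn_def bf_lin)
  also have "\<dots> = sqrt (- b e e) * hs e * (exp t * exp (- ht e) + exp (- t) * exp (ht e)) + 2 * \<sigma> * b rh e"
    unfolding h_exp[OF assms] by (simp add: algebra_simps)
  also have "exp t * exp (- ht e) + exp (- t) * exp (ht e) = 2 * cosh (t - ht e)"
    by (simp add: cosh_def exp_add[symmetric] exp_diff exp_minus field_simps)
  finally show ?thesis by simp
qed

lemma b_nn': assumes "side \<sigma> e" "\<sigma> = 1 \<or> \<sigma> = -1"
  shows "b (nn \<sigma> t) e = sqrt (- b e e) * (hs e * cosh (t - ht e) - hc e)"
  using assms(2) by (auto simp: b_nn[OF assms(1)] rh_side[OF assms] algebra_simps)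

lemma nn_props:
  assumes "\<sigma> = 1 \<or> \<sigma> = -1"
  shows "b (nn \<sigma> t) (nn \<sigma> t) = 0" "b uu (nn \<sigma> t) > 0" "b x0 (nn \<sigma> t) > 0" "nn \<sigma> t \<noteq> 0"
proof -
  show n: "b (nn \<sigma> t) (nn \<sigma> t) = 0"
    using assms by (auto simp: nn_def bf_lin pq rh_norm exp_minus)
  show u: "b uu (nn \<sigma> t) > 0" using uu_props sym[of uu rh] by (simp add: nn_def bf_lin pq add_pos_pos)
  show "b x0 (nn \<sigma> t) > 0" using cone_pos[of x0 "nn \<sigma> t" uu] n u uu_props x0 by simp
  show "nn \<sigma> t \<noteq> 0" using u by (auto simp: bf_lin)
qed

lemma side_not_\<rho>: assumes "side \<sigma> e" shows "\<nexists>a. e = a *\<^sub>R \<rho>" "\<nexists>a. \<rho> = a *\<^sub>R e"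
proof -
  have *: "e \<noteq> a *\<^sub>R \<rho>" for a
  proof
    assume "e = a *\<^sub>R \<rho>"
    then have "b pp e = 0" by (simp add: bf_lin \<rho>_pq)
    then show False using assms by (simp add: side_def)
  qed
  then show "\<nexists>a. e = a *\<^sub>R \<rho>" by blast
  show "\<nexists>a. \<rho> = a *\<^sub>R e"
  proof
    assume "\<exists>a. \<rho> = a *\<^sub>R e"
    then obtain a where a: "\<rho> = a *\<^sub>R e" by blast
    then have "a \<noteq> 0" using \<rho> by (auto simp: bf_lin)
    then have "e = (1/a) *\<^sub>R \<rho>" using a by simp
    then show False using * by blast
  qed
qed

text \<open>The shadow of the line of \<open>e\<close>, its projection to the geodesic, is the
  interval of radius \<open>hw e\<close> about \<open>ht e\<close>; the ideal ends of the line lie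
  over the ends of this interval.\<close>

lemma nn_end: assumes "side \<sigma> e" "\<sigma> = 1 \<or> \<sigma> = -1" "\<epsilon> = 1 \<or> \<epsilon> = -1"
  shows "b e (nn \<sigma> (ht e + \<epsilon> * hw e)) = 0"
proof -
  have "cosh (\<epsilon> * hw e) = cosh (hw e)" using assms(3) by auto
  then have "b (nn \<sigma> (ht e + \<epsilon> * hw e)) e = 0"
    using hw[OF assms(1)] hs_pos[OF assms(1)] by (simp add: b_nn'[OF assms(1,2)])
  then show ?thesis using sym by simp
qed

lemma side_trichotomy:
  assumes "r \<in> Rp" "\<nexists>a. r = a *\<^sub>R \<rho>" "\<sigma> * b rh r < 0" shows "side \<sigma> r"
  using assms Rp_sides[OF assms(1,2)] by (simp add: side_def)

text \<open>\<open>next_wall\<close> at the chosen end of \<open>e\<close>. \<open>good\<close>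
  prevents the new wall from being the mirror of \<rho>, and \<open>Rp_sides\<close> then puts it on
  the same side.\<close>

lemma neighbour:
  assumes g: "good \<sigma>" and e: "e \<in> Wk \<sigma>" and \<epsilon>: "\<epsilon> = 1 \<or> \<epsilon> = -1"
  shows "\<exists>f\<in>Wk \<sigma>. \<epsilon> * ht e < \<epsilon> * ht f \<and> 0 \<le> nv G e f \<and> nv G e f \<le> 1"
proof -
  have \<sigma>: "\<sigma> = 1 \<or> \<sigma> = -1" using g by (simp add: good_def)
  have se: "side \<sigma> e" and we: "wall e" using e by (auto simp: Wk_def)
  let ?n = "nn \<sigma> (ht e + \<epsilon> * hw e)"
  have n: "b ?n ?n = 0" "b e ?n = 0" "b x0 ?n > 0" and n0: "?n \<noteq> 0" using nn_props[OF \<sigma>] nn_end[OF se \<sigma> \<epsilon>] by auto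
  have ee: "b e e < 0" by (rule side_neg[OF se])
  obtain f where f: "wall f" "f \<noteq> e" "b ?n f \<le> 0" "(b e f)^2 \<le> b e e * b f f"
  proof (rule next_wall[OF we side_not_\<rho>(2)[OF se] n])
    fix f P assume h: "wall f" "f \<noteq> e" "b ?n f < 0" "P \<in> Ch" "b P e = 0" "b P f = 0"
    have "b P P > 0" using h(4) Ch_V V_pos by blast
    then have "(b e f)^2 \<le> b e e * b f f" using h by (intro cs_cone[of P]) (auto simp: bf_lin)
    then show thesis using that h by force
  next
    fix f c l assume h: "wall f" "f \<noteq> e" "b ?n f = 0"
    have "(b e f)^2 \<le> b e e * b f f" using h n n0 sym[of ?n e] by (intro cs_cone[of ?n]) auto
    then show thesis using that h by force
  qed
  have fR: "f \<in> Rp" by (rule wall_Rp[OF f(1)])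
  have np: "\<nexists>a. f = a *\<^sub>R \<rho>"
  proof
    assume ex: "\<exists>a. f = a *\<^sub>R \<rho>"
    then obtain a where a: "f = a *\<^sub>R \<rho>" by blast
    have pos: "\<sigma> * b rh f > 0" using g ex fR by (auto simp: good_def)
    have "b pp f = 0" "b qq f = 0" unfolding a by (simp_all add: bf_lin \<rho>_pq)
    then have "b ?n f = \<sigma> * b rh f" by (simp add: nn_def bf_lin)
    then show False using pos f(3) by simp
  qed
  have pf: "b pp f > 0" "b qq f > 0" using Rp_sides[OF fR np] by auto
  have sf: "side \<sigma> f"
  proof (rule side_trichotomy[OF fR np])
    have "exp (ht e + \<epsilon> * hw e) * b pp f + exp (- (ht e + \<epsilon> * hw e)) * b qq f > 0" using pf by (intro add_pos_pos) auto
    then show "\<sigma> * b rh f < 0" using f(3) by (simp add: nn_def bf_lin)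
  qed
  have ff: "b f f < 0" by (rule side_neg[OF sf])
  have kl: "sqrt (b e e * b f f) > 0" using ee ff by (simp add: mult_neg_neg)
  have ge: "nv G e f \<ge> 0" using wall_acute[OF we f(1)] f(2) kl by (auto simp: nv_def)
  have "\<bar>b e f\<bar> \<le> sqrt (b e e * b f f)" using f(4) by (simp add: real_le_rsqrt)
  then have le: "nv G e f \<le> 1" using kl by (simp add: nv_def divide_le_eq)
  have sc: "hs f > 0" "hc f > 0" "hs e > 0" "hc e > 0" using hs_pos hc_pos sf se by auto
  \<comment> \<open>If the foot of \<open>f\<close> did not lie beyond that of \<open>e\<close>, the
    shadow of \<open>f\<close> would contain the shadow of \<open>e\<close>. For such nested lines
    the entry is at most -1, against \<open>wall_acute\<close>.\<close>
  have "\<epsilon> * ht e < \<epsilon> * ht f"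
  proof (rule ccontr)
    assume n: "\<not> \<epsilon> * ht e < \<epsilon> * ht f"
    let ?D = "\<epsilon> * ht e - \<epsilon> * ht f"
    have D0: "?D \<ge> 0" using n by simp
    have "sqrt (- b f f) * (hs f * cosh (ht e + \<epsilon> * hw e - ht f) - hc f) \<le> 0" using f(3) unfolding b_nn'[OF sf \<sigma>] .
    then have "hs f * cosh (ht e + \<epsilon> * hw e - ht f) \<le> hc f" using ff by (simp add: mult_le_0_iff)
    then have "cosh (ht e + \<epsilon> * hw e - ht f) \<le> cosh (hw f)" unfolding hw(2)[OF sf] using sc by (simp add: pos_le_divide_eq mult.commute)
    moreover have "cosh (ht e + \<epsilon> * hw e - ht f) = cosh (?D + hw e)"
      using \<epsilon>
    proof
      assume "\<epsilon> = 1" then show ?thesis by (simp add: algebra_simps)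
    next
      assume e1: "\<epsilon> = - 1"
      have "ht e + \<epsilon> * hw e - ht f = - (?D + hw e)" unfolding e1 by simp
      then show ?thesis by (metis cosh_minus)
    qed
    ultimately have "?D + hw e \<le> hw f" using D0 hw(3)[OF se] hw(3)[OF sf] by (simp add: cosh_real_nonneg_le_iff)
    then have "cosh ?D \<le> cosh (hw f - hw e)" using D0 by (simp add: cosh_real_nonneg_le_iff)
    moreover have "cosh ?D = cosh (ht e - ht f)" using \<epsilon>
    proof
      assume "\<epsilon> = - 1"
      then have "?D = - (ht e - ht f)" by simp
      then show ?thesis by (metis cosh_minus)
    qed simp
    ultimately have "hs e * hs f * cosh (ht e - ht f) \<le> hs e * hs f * cosh (hw f - hw e)" using sc by simp
    also have "\<dots> = hc e * hc f - 1" using sc by (simp add: cosh_diff hw[OF se] hw[OF sf] field_simps)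
    finally have "nv G e f \<le> - 1" using \<sigma> by (auto simp: nv_formula[OF se \<sigma> sf \<sigma>])
    then show False using ge by simp
  qed
  then show ?thesis using f(1) sf ge le by (auto simp: Wk_def)
qed

text \<open>\<open>hs\<close>^2 is a function of the product with \<rho> and of the square of the
  root, both of which take finitely many values.\<close>

lemma finite_hs: assumes "\<sigma> = 1 \<or> \<sigma> = -1" shows "finite (hs ` Wk \<sigma>)"
proof -
  let ?g = "\<lambda>(x, k). sqrt (x^2 / (- b \<rho> \<rho> * k) - 1)"
  have "hs ` Wk \<sigma> \<subseteq> ?g ` ({b e \<rho> | e. e \<in> W} \<times> {x. x \<in> \<int> \<and> \<bar>x\<bar> \<le> 2 * d})"
  proof
    fix s assume "s \<in> hs ` Wk \<sigma>"
    then obtain e where e: "wall e" "side \<sigma> e" "s = hs e" by (auto simp: Wk_def)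
    have k: "b e e < 0" by (rule side_neg[OF e(2)])
    have "(hs e)^2 = (b rh e)^2 / (- b e e) - 1"
      using hc_hs[OF e(2)] k by (simp add: hc_def power_divide)
    also have "(b rh e)^2 = (b e \<rho>)^2 / (- b \<rho> \<rho>)"
      using \<rho> sym[of e \<rho>] by (simp add: rh_def bf_lin power_divide)
    finally have "(hs e)^2 = (b e \<rho>)^2 / (- b \<rho> \<rho> * (- b e e)) - 1" by (simp add: field_simps)
    then have "hs e = ?g (b e \<rho>, - b e e)" using hs_pos[OF e(2)] by (simp add: real_sqrt_unique[symmetric] del: minus_mult_minus)
    moreover have "e \<in> W" unfolding W_def
      using e side_not_\<rho>[OF e(2)] nn_props[OF assms] nn_end[OF e(2) assms, of 1] by blast
    moreover have "- b e e \<in> \<int>" "\<bar>- b e e\<bar> \<le> 2 * d"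
      using wall_root[OF e(1)] root_lat root_bound k by (auto intro!: Ints_minus bf_lat_Ints)
    ultimately show "s \<in> ?g ` ({b e \<rho> | e. e \<in> W} \<times> {x. x \<in> \<int> \<and> \<bar>x\<bar> \<le> 2 * d})"
      unfolding e(3) by (intro image_eqI[of _ _ "(b e \<rho>, - b e e)"]) auto
  qed
  then show ?thesis using finite_heights finite_Ints_bounded by (meson finite_SigmaI finite_imageI finite_subset)
qed

text \<open>Bounded positions and, by \<open>finite_hs\<close>, bounded distances would confine
  infinitely many walls to a finite set of lattice vectors.\<close>

lemma escapes:
  assumes \<sigma>: "\<sigma> = 1 \<or> \<sigma> = -1" and e: "\<And>i::nat. e i \<in> Wk \<sigma>"
    and mono: "\<And>i j. i < j \<Longrightarrow> \<epsilon> * ht (e i) < \<epsilon> * ht (e j)" and \<epsilon>: "\<epsilon> = 1 \<or> \<epsilon> = -1"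
  shows "\<exists>i. \<epsilon> * ht (e i) > T"
proof (rule ccontr)
  assume "\<not> ?thesis"
  then have T: "\<epsilon> * ht (e i) \<le> T" for i by (meson not_less)
  have lo: "\<epsilon> * ht (e i) \<ge> \<epsilon> * ht (e 0)" for i using mono[of 0 i] by (cases i) auto
  let ?B = "\<bar>T\<bar> + \<bar>ht (e 0)\<bar>"
  have tB: "\<bar>ht (e i)\<bar> \<le> ?B" for i using T[of i] lo[of i] \<epsilon> by auto
  define S where "S = Max (hs ` Wk \<sigma>)"
  have S: "hs (e i) \<le> S" for i unfolding S_def using finite_hs[OF \<sigma>] e by (intro Max_ge) auto
  let ?C = "sqrt (2 * d) * S * exp ?B"
  have "range e \<subseteq> {r\<in>lat. \<bar>b uu r\<bar> \<le> ?C \<and> - b r r \<le> 2 * d}"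
  proof
    fix r assume "r \<in> range e"
    then obtain i where r: "r = e i" by blast
    have s: "side \<sigma> r" and w: "wall r" using e r by (auto simp: Wk_def)
    have rt: "is_root G r" by (rule wall_root[OF w])
    have kb: "sqrt (- b r r) \<le> sqrt (2 * d)" "sqrt (- b r r) \<ge> 0" using root_bound[OF rt] root_neg[OF rt] by auto
    have sb: "0 \<le> hs r" "hs r \<le> S" using hs_pos[OF s] S[of i] r by auto
    have "2 * b uu r = sqrt (- b r r) * hs r * (exp (ht r) + exp (- ht r))"
      using h_exp[OF s] by (simp add: uu_pq bf_lin algebra_simps)
    also have "\<dots> \<le> sqrt (2 * d) * S * (exp ?B + exp ?B)"
      using kb sb tB[of i] r by (intro mult_mono add_mono) auto
    finally have "b uu r \<le> ?C" by simp
    moreover have "b uu r > 0" using s by (simp add: uu_pq bf_lin side_def)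
    ultimately show "r \<in> {r\<in>lat. \<bar>b uu r\<bar> \<le> ?C \<and> - b r r \<le> 2 * d}" using root_lat[OF rt] root_bound[OF rt] by simp
  qed
  moreover have "finite {r\<in>lat. \<bar>b uu r\<bar> \<le> ?C \<and> - b r r \<le> 2 * d}"
    by (rule finite_lat_form_bounded) (simp add: uu_props)
  ultimately have "finite (range e)" using finite_subset by blast
  moreover have "inj e" by (rule injI) (metis mono less_irrefl linorder_neqE_nat)
  ultimately show False using finite_imageD infinite_UNIV_nat by blast
qed

lemma side_wall_ex: assumes g: "good \<sigma>" shows "Wk \<sigma> \<noteq> {}"
proof -
  have \<sigma>: "\<sigma> = 1 \<or> \<sigma> = -1" and gp: "\<And>r a. r \<in> Rp \<Longrightarrow> r = a *\<^sub>R \<rho> \<Longrightarrow> \<sigma> * b rh r > 0" using g by (auto simp: good_def)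
  have \<rho>0: "b pp r = 0 \<and> b qq r = 0" if "r = a *\<^sub>R \<rho>" for r a
    unfolding that by (simp add: bf_lin \<rho>_pq)
  have "\<exists>r. side \<sigma> r"
  proof (rule ccontr)
    assume no: "\<nexists>r. side \<sigma> r"
    obtain y' where y': "y' \<in> lat" "b y' y' > 0" using pos_lat by blast
    define y where "y = (if b uu y' > 0 then y' else - y')"
    have uy': "b uu y' \<noteq> 0" using neg_orth'[of uu y'] uu_props y' by auto
    have y: "y \<in> lat" "b y y > 0" "b uu y > 0" using y' uy' lat_minus by (auto simp: y_def bf_lin)
    have yV: "y \<in> V" using V_I[OF y(2) uu_props(3) y(3)] .
    have py: "b pp y > 0" "b qq y > 0" using pq_cone[OF yV] by auto
    \<comment> \<open>The geodesic through the rational point \<open>y\<close> perpendicular to that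
      of \<rho>. Its end on the side \<sigma> is strictly positive on all positive roots, which
      \<open>rational_end\<close> or \<open>irrational_end\<close> forbids.\<close>
    let ?v = "cr G \<rho> y"
    have v: "?v \<in> lat" using \<rho> y cr_lat by blast
    have "b \<rho> \<rho> * b y y < 0" using \<rho>(2) y(2) by (simp add: mult_neg_pos)
    then have vv: "b ?v ?v < 0" unfolding cr_norm using d_pos by (intro mult_pos_neg) (auto simp: add_neg_nonpos diff_less_eq intro: less_le_trans)
    have v\<rho>: "b ?v \<rho> = 0" "b ?v y = 0" "b ?v rh = 0" by (simp_all add: rh_def bf_lin b_cr tri_same)
    define t where "t = ln (b qq y / b pp y) / 2"
    have et: "exp t * b pp y = exp (- t) * b qq y"
    proof -
      have "exp t = sqrt (b qq y / b pp y)" unfolding t_def using py by (simp add: ln_sqrt[symmetric])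
      then have "exp t * exp t * b pp y = b qq y" using py by simp
      then show ?thesis by (simp add: exp_minus field_simps)
    qed
    let ?n = "nn \<sigma> t"
    have vn: "b ?v ?n = 0"
    proof -
      have "b ?v y = 2 * (b qq ?v * b pp y + b pp ?v * b qq y) - b rh ?v * b rh y"
        using b_coords[of ?v y] by simp
      then have z: "b qq ?v * b pp y + b pp ?v * b qq y = 0" using v\<rho> sym[of rh ?v] by simp
      have "exp t * (exp t * b pp ?v + exp (- t) * b qq ?v) * b pp y
        = exp t * b pp ?v * (exp t * b pp y) + exp t * exp (-t) * b qq ?v * b pp y" by (simp add: algebra_simps)
      also have "\<dots> = b pp ?v * b qq y + b qq ?v * b pp y" unfolding et by (simp add: exp_minus)
      also have "\<dots> = 0" using z by simp
      finally have "exp t * b pp ?v + exp (- t) * b qq ?v = 0" using py by simp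
      then show ?thesis using v\<rho> sym[of ?v pp] sym[of ?v qq] by (simp add: nn_def bf_lin)
    qed
    have pos: "b ?n r > 0" if r: "r \<in> Rp" for r
    proof (cases "\<exists>a. r = a *\<^sub>R \<rho>")
      case True
      then obtain a where a: "r = a *\<^sub>R \<rho>" by blast
      show ?thesis using gp[OF r a] \<rho>0[OF a] by (simp add: nn_def bf_lin)
    next
      case False
      then have "b pp r > 0" "b qq r > 0" using Rp_sides[OF r] by auto
      moreover have "\<not> \<sigma> * b rh r < 0" using no side_trichotomy[OF r False] by blast
      then have "\<sigma> * b rh r \<ge> 0" by simp
      ultimately show ?thesis unfolding nn_def bf_lin by (intro add_pos_nonneg add_pos_pos mult_pos_pos) auto
    qed
    show False
    proof (cases "\<exists>m. - d * b ?v ?v = real (m^2)")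
      case True
      then obtain m where m: "- d * b ?v ?v = real (m^2)" by blast
      obtain c l where c: "prim c" "?n = l *\<^sub>R c" "l > 0"
        using rational_end_vector[OF v vv nn_props(1)[OF \<sigma>] vn nn_props(4)[OF \<sigma>] m] by metis
      have n3: "b ?n ?n = 0" "b x0 ?n > 0" using nn_props[OF \<sigma>] by auto
      have "b c r > 0" if "r \<in> Rp" for r using pos[OF that] c(3) unfolding c(2) by (simp add: bf_lin zero_less_mult_iff)
      moreover have "b c c = 0" "b x0 c > 0" using n3 c(3) unfolding c(2) by (auto simp: bf_lin zero_less_mult_iff)
      moreover have "c \<in> lat" using c(1) by (simp add: prim_def)
      ultimately show False using rational_end by blast
    next
      case False
      obtain a where "\<rho> = a *\<^sub>R ?v"
        using irrational_end[OF v vv nn_props(1)[OF \<sigma>] vn nn_props(3)[OF \<sigma>] _ False] pos by blast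
      then have "b \<rho> \<rho> = a * b ?v \<rho>" by (metis bf_scale_left)
      then show False using v\<rho> \<rho> by simp
    qed
  qed
  then obtain r where r: "side \<sigma> r" by blast
  \<comment> \<open>The foot, on the geodesic of \<rho>, of the common perpendicular with the mirror
    of \<open>r\<close>.\<close>
  let ?x = "exp (ht r) *\<^sub>R pp + exp (- ht r) *\<^sub>R qq"
  have xx: "b ?x ?x = 1" by (simp add: bf_lin pq exp_minus)
  have ux: "b uu ?x > 0" by (simp add: bf_lin pq add_pos_pos)
  have xV: "?x \<in> V" using V_I[OF _ uu_props(3) ux] xx by simp
  have xpos: "b ?x s > 0" if "s \<in> Rp" "\<nexists>a. s = a *\<^sub>R \<rho>" for s
    using Rp_sides[OF that] by (simp add: bf_lin add_pos_pos)
  have x\<rho>: "b ?x s = 0" if "s = a *\<^sub>R \<rho>" for s a using \<rho>0[OF that] by (simp add: bf_lin)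
  have xCh: "?x \<in> Ch" unfolding Ch_def using xV xpos x\<rho> by fastforce
  \<comment> \<open>\<open>hs r / hc r\<close> is the hyperbolic tangent of the distance of the
    mirror of \<open>r\<close>; a value between it and 1 gives a point of \<open>V\<close> beyond
    this mirror.\<close>
  define l where "l = (hs r / hc r + 1) / 2"
  have sc: "hs r > 0" "hc r > 0" "hs r < hc r"
    using hs_pos[OF r] hc_pos[OF r] hc_hs[OF r] by (auto intro: power2_less_imp_less)
  have l: "0 < l" "l < 1" "hs r < l * hc r" using sc by (auto simp: l_def field_simps)
  let ?y = "?x + (l * \<sigma>) *\<^sub>R rh"
  have yy: "b ?y ?y = 1 - l^2" using \<sigma> by (auto simp: bf_lin pq rh_norm exp_minus power2_eq_square)
  have yV: "?y \<in> V"
  proof (rule V_I[OF _ uu_props(3)])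
    show "b ?y ?y > 0" unfolding yy using l by (simp add: power_less_one_iff)
    show "b uu ?y > 0" using ux uu_props sym[of uu rh] by (simp add: bf_lin)
  qed
  have yr: "b ?y r < 0"
  proof -
    have "2 * b ?x r = exp (ht r) * (2 * b pp r) + exp (- ht r) * (2 * b qq r)" by (simp add: bf_lin)
    also have "\<dots> = 2 * (sqrt (- b r r) * hs r)" unfolding h_exp[OF r] by (simp add: exp_minus)
    finally have bx: "b ?x r = sqrt (- b r r) * hs r" by simp
    have "b ?y r = sqrt (- b r r) * (hs r - l * hc r)"
      unfolding bf_add_left[of _ ?x] bx bf_scale_left rh_side[OF r \<sigma>] using \<sigma> by (auto simp: algebra_simps)
    then show ?thesis using l side_neg[OF r] by (simp add: mult_less_0_iff)
  qed
  have rR: "r \<in> Rp" using r by (simp add: side_def)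
  have xy: "b ?y s \<ge> 0" if s: "s \<in> Rp" "b ?x s = 0" for s
  proof -
    obtain a where a: "s = a *\<^sub>R \<rho>" using xpos[OF s(1)] s(2) by fastforce
    have "b ?y s = l * (\<sigma> * b rh s)" unfolding bf_add_left[of _ ?x] s(2) by (simp add: bf_lin)
    moreover have "\<sigma> * b rh s > 0" by (rule gp[OF s(1) a])
    ultimately show ?thesis using l by simp
  qed
  obtain e m where e: "wall e" "0 < m" "m < 1" "(1 - m) *\<^sub>R ?x + m *\<^sub>R ?y \<in> Ch"
    "b ((1 - m) *\<^sub>R ?x + m *\<^sub>R ?y) e = 0" "b ?x e > 0"
    by (rule first_wall[OF xCh yV rR yr xy])
  have "(1 - m) * b ?x e + m * (b ?x e + l * (\<sigma> * b rh e)) = 0"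
    using e(5) unfolding bf_add_left[of _ "(1 - m) *\<^sub>R ?x"] bf_scale_left bf_add_left[of _ ?x] by (simp add: mult.assoc)
  then have "m * l * (\<sigma> * b rh e) = - b ?x e" by (simp add: algebra_simps)
  then have neg: "\<sigma> * b rh e < 0" using e l by (smt (verit) mult_nonneg_nonneg mult_pos_pos)
  have "\<nexists>a. e = a *\<^sub>R \<rho>" using e(6) x\<rho> by fastforce
  then have "side \<sigma> e" using side_trichotomy wall_Rp[OF e(1)] neg by blast
  then show ?thesis using e(1) by (auto simp: Wk_def)
qed

lemma chain_ex:
  assumes g: "good \<sigma>"
  obtains e :: "int \<Rightarrow> real^3" where "\<And>i. e i \<in> Wk \<sigma>" "\<And>i. ht (e i) < ht (e (i+1))"
    "\<And>i. 0 \<le> nv G (e i) (e (i+1)) \<and> nv G (e i) (e (i+1)) \<le> 1"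
    "\<And>T. \<exists>i. ht (e i) > T" "\<And>T. \<exists>i. ht (e i) < T"
proof -
  have \<sigma>: "\<sigma> = 1 \<or> \<sigma> = -1" using g by (simp add: good_def)
  obtain e0 where e0: "e0 \<in> Wk \<sigma>" using side_wall_ex[OF g] by blast
  define R where "R e f \<longleftrightarrow> f \<in> Wk \<sigma> \<and> ht e < ht f \<and> 0 \<le> nv G e f \<and> nv G e f \<le> 1" for e f
  define L where "L e f \<longleftrightarrow> f \<in> Wk \<sigma> \<and> ht f < ht e \<and> 0 \<le> nv G e f \<and> nv G e f \<le> 1" for e f
  have "\<forall>e\<in>Wk \<sigma>. \<exists>f. R e f" using neighbour[OF g, of _ 1] by (auto simp: R_def)
  then obtain r where r: "\<And>e. e \<in> Wk \<sigma> \<Longrightarrow> R e (r e)" by metis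
  have "\<forall>e\<in>Wk \<sigma>. \<exists>f. L e f" using neighbour[OF g, of _ "-1"] by (auto simp: L_def)
  then obtain l where l: "\<And>e. e \<in> Wk \<sigma> \<Longrightarrow> L e (l e)" by metis
  have rW: "(r ^^ n) e0 \<in> Wk \<sigma>" for n by (induction n) (use e0 r in \<open>auto simp: R_def\<close>)
  have lW: "(l ^^ n) e0 \<in> Wk \<sigma>" for n by (induction n) (use e0 l in \<open>auto simp: L_def\<close>)
  define e where "e i = (if i \<ge> 0 then (r ^^ nat i) e0 else (l ^^ nat (- i)) e0)" for i :: int
  have nvs: "nv G x y = nv G y x" for x y using sym by (simp add: nv_def mult.commute)
  have W: "e i \<in> Wk \<sigma>" for i using rW lW by (simp add: e_def)
  have step: "ht (e i) < ht (e (i+1)) \<and> 0 \<le> nv G (e i) (e (i+1)) \<and> nv G (e i) (e (i+1)) \<le> 1" for i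
  proof (cases "i \<ge> 0")
    case True
    then have "e (i+1) = r (e i)" by (simp add: e_def nat_add_distrib)
    then show ?thesis using r[OF W[of i]] by (simp add: R_def)
  next
    case False
    then have "nat (- i) = Suc (nat (- (i+1)))" by simp
    then have "e i = l (e (i+1))" using False by (auto simp: e_def)
    then show ?thesis using l[OF W[of "i+1"]] nvs by (simp add: L_def)
  qed
  have m1: "ht ((r ^^ i) e0) < ht ((r ^^ j) e0)" if "i < j" for i j
    by (rule lift_Suc_mono_less[OF _ that]) (use r[OF rW] in \<open>simp add: R_def\<close>)
  have m2: "- ht ((l ^^ i) e0) < - ht ((l ^^ j) e0)" if "i < j" for i j
    by (rule lift_Suc_mono_less[of "\<lambda>n. - ht ((l ^^ n) e0)", OF _ that]) (use l[OF lW] in \<open>simp add: L_def\<close>)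
  have up: "\<exists>i. ht (e i) > T" for T
  proof -
    obtain n where "1 * ht ((r ^^ n) e0) > T" using escapes[OF \<sigma>, where e = "\<lambda>n. (r ^^ n) e0" and \<epsilon> = 1 and T = T] rW m1 by auto
    then show ?thesis by (intro exI[of _ "int n"]) (simp add: e_def)
  qed
  have down: "\<exists>i. ht (e i) < T" for T
  proof -
    obtain n where "- 1 * ht ((l ^^ n) e0) > - T" using escapes[OF \<sigma>, where e = "\<lambda>n. (l ^^ n) e0" and \<epsilon> = "-1" and T = "- T"] lW m2 by auto
    then show ?thesis by (intro exI[of _ "- int n"]) (auto simp: e_def)
  qed
  show thesis using that[of e] W step up down by blast
qed

end

section \<open>Arithmetic criteria from few walls\<close>

lemma prod_primes_dvd:
  assumes "finite S" "\<And>p. p \<in> S \<Longrightarrow> prime p \<and> p dvd (N::nat)" shows "\<Prod>S dvd N"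
  using assms
proof (induction S rule: finite_induct)
  case (insert p S)
  have "coprime p (\<Prod>S)"
    by (intro prod_coprime_right primes_coprime) (use insert in auto)
  then show ?case using insert by (simp add: divides_mult)
qed simp

lemma odd_rad_dvd:
  assumes "N > 0" "\<And>p. prime p \<Longrightarrow> p dvd n \<Longrightarrow> odd p \<Longrightarrow> p dvd N" shows "odd_rad n dvd N"
  unfolding odd_rad_def
proof (rule prod_primes_dvd)
  show "finite {p. prime p \<and> p dvd n \<and> odd p}"
    by (rule finite_subset[OF _ finite_divisors_nat[OF assms(1)]]) (use assms(2) in auto)
qed (use assms in auto)

lemma odd_prime_not_dvd_2: "prime (p::nat) \<Longrightarrow> odd p \<Longrightarrow> \<not> p dvd 2"
  by (metis primes_dvd_imp_eq two_is_prime_nat dvd_refl)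

lemma odd_odd_rad: "odd (odd_rad n)"
proof (cases "finite {p. prime p \<and> p dvd n \<and> odd p}")
  case True
  have "coprime 2 (\<Prod>{p. prime p \<and> p dvd n \<and> odd p})" by (intro prod_coprime_right) auto
  then show ?thesis by (simp add: odd_rad_def)
qed (simp add: odd_rad_def)

text \<open>The radical is odd, so a known power of 2 dividing \<open>N\<close> is gained.\<close>

lemma odd_rad_le:
  assumes "N > 0" "2^k dvd N" "\<And>p. prime p \<Longrightarrow> p dvd n \<Longrightarrow> odd p \<Longrightarrow> p dvd N"
  shows "2^k * odd_rad n \<le> N"
proof -
  have "coprime (2^k) (odd_rad n)" using odd_odd_rad by simp
  then have "2^k * odd_rad n dvd N" using odd_rad_dvd[OF assms(1,3)] assms(2) by (simp add: divides_mult)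
  then show ?thesis using assms(1) by (simp add: dvd_imp_le)
qed

lemma max_prime_div_le:
  assumes "n > 0" "B \<ge> 2" "\<And>p. prime p \<Longrightarrow> p dvd n \<Longrightarrow> odd p \<Longrightarrow> p \<le> B" shows "max_prime_div n \<le> B"
proof -
  have "finite {p. prime p \<and> p dvd n}" using assms(1) by (auto intro: finite_subset[OF _ finite_divisors_nat])
  moreover have "p \<le> B" if "prime p" "p dvd n" for p
  proof (cases "odd p")
    case True then show ?thesis using assms that by blast
  next
    case False
    then have "p = 2" using that by (metis primes_dvd_imp_eq two_is_prime_nat)
    then show ?thesis using assms by simp
  qed
  ultimately show ?thesis using assms(2) by (auto simp: max_prime_div_def)
qed

section \<open>The Cartan matrix of three vectors\<close>

context hyp
begin

text \<open>Pair the Cramer expansion of \<open>cr G x y\<close> in \<open>x\<close>,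
  \<open>y\<close>, \<open>z\<close> with \<open>z\<close>.\<close>

lemma gram3: "d * (tri x y z)^2 = b x x * (b y y * b z z - (b y z)^2) - b x y * (b x y * b z z - b y z * b x z)
   + b x z * (b x y * b y z - b y y * b x z)"
proof -
  let ?w = "cr G x y"
  have "tri x y z * ?w$i = tri ?w y z * x$i + tri x ?w z * y$i + tri x y ?w * z$i" for i
    using exhaust_3[of i] by (elim disjE) (simp_all add: tri_def algebra_simps)
  then have "tri x y z *\<^sub>R ?w = tri ?w y z *\<^sub>R x + tri x ?w z *\<^sub>R y + tri x y ?w *\<^sub>R z"
    by (simp add: vec_eq_iff)
  then have "b (tri x y z *\<^sub>R ?w) z = b (tri ?w y z *\<^sub>R x + tri x ?w z *\<^sub>R y + tri x y ?w *\<^sub>R z) z" by simp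
  then have "tri x y z * b ?w z = tri ?w y z * b x z + tri x ?w z * b y z + tri x y ?w * b z z" by (simp add: bf_lin)
  moreover have "tri ?w y z = tri y z ?w" "tri x ?w z = tri z x ?w" using tri_perm by metis+
  ultimately show ?thesis using sym[of y x] sym[of z x] sym[of z y]
    by (simp add: b_cr tcr power2_eq_square algebra_simps)
qed

text \<open>The Cartan number: an integer if \<open>e\<close> is a root and \<open>f\<close> a
  lattice vector, and not symmetric.\<close>

definition ca where "ca e f = 2 * b e f / b e e"

text \<open>\<open>cdet\<close> is the determinant of the matrix of the \<open>ca\<close>; the \<open>C\<^sub>i\<close> are the numerators in Cramer's rule.\<close>
definition cdet where "cdet e f g = 8 - 2 * (ca e f * ca f e + ca f g * ca g f + ca e g * ca g e)
  + ca e f * ca f g * ca g e + ca e g * ca g f * ca f e"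
definition C1 where "C1 e f g x y z = x * (4 - ca f g * ca g f) - ca e f * (2 * y - ca f g * z) + ca e g * (y * ca g f - 2 * z)"
definition C2 where "C2 e f g x y z = 2 * (2 * y - ca f g * z) - x * (2 * ca f e - ca f g * ca g e) + ca e g * (ca f e * z - y * ca g e)"
definition C3 where "C3 e f g x y z = 2 * (2 * z - y * ca g f) - ca e f * (ca f e * z - y * ca g e) + x * (ca f e * ca g f - 2 * ca g e)"

lemma cramer:
  assumes "tri e f g \<noteq> 0" "b e e \<noteq> 0" "b f f \<noteq> 0" "b g g \<noteq> 0"
  shows "cdet e f g *\<^sub>R x = C1 e f g (ca e x) (ca f x) (ca g x) *\<^sub>R e
    + C2 e f g (ca e x) (ca f x) (ca g x) *\<^sub>R f + C3 e f g (ca e x) (ca f x) (ca g x) *\<^sub>R g"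
proof -
  obtain p q r where x: "x = p *\<^sub>R e + q *\<^sub>R f + r *\<^sub>R g" using tri_expand[OF assms(1)] by blast
  have e: "ca e x = 2 * p + ca e f * q + ca e g * r" "ca f x = ca f e * p + 2 * q + ca f g * r"
    "ca g x = ca g e * p + ca g f * q + 2 * r"
    using assms(2-4) by (simp_all add: ca_def x bf_lin field_simps)
  have "C1 e f g (ca e x) (ca f x) (ca g x) = cdet e f g * p" "C2 e f g (ca e x) (ca f x) (ca g x) = cdet e f g * q"
    "C3 e f g (ca e x) (ca f x) (ca g x) = cdet e f g * r"
    unfolding e C1_def C2_def C3_def cdet_def by algebra+
  then show ?thesis by (simp add: x scaleR_add_right)
qed

lemma cdet_gram:
  assumes "b e e \<noteq> 0" "b f f \<noteq> 0" "b g g \<noteq> 0"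
  shows "cdet e f g * (b e e * b f f * b g g) = 8 * d * (tri e f g)^2"
proof -
  have p: "ca x y * ca y x = 4 * (b x y)^2 / (b x x * b y y)" for x y using sym[of x y] by (simp add: ca_def power2_eq_square)
  have t: "ca e f * ca f g * ca g e = 8 * b e f * b f g * b e g / (b e e * b f f * b g g)"
    "ca e g * ca g f * ca f e = 8 * b e f * b f g * b e g / (b e e * b f f * b g g)"
    using sym[of g e] sym[of g f] sym[of f e] by (simp_all add: ca_def mult_ac)
  have "cdet e f g = 8 - 2 * (4 * (b e f)^2 / (b e e * b f f) + 4 * (b f g)^2 / (b f f * b g g) + 4 * (b e g)^2 / (b e e * b g g))
    + 16 * b e f * b f g * b e g / (b e e * b f f * b g g)" unfolding cdet_def t p[of e f] p[of f g] p[of e g] by (simp add: mult_ac)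
  then have "cdet e f g * (b e e * b f f * b g g) = 8 * (b e e * (b f f * b g g - (b f g)^2) - b e f * (b e f * b g g - b f g * b e g)
   + b e g * (b e f * b f g - b f f * b e g))"
    using assms by (simp add: field_simps power2_eq_square)
  then show ?thesis using gram3[of e f g] by simp
qed

end

section \<open>The discriminant exponent from three independent roots\<close>

context hypV
begin

lemma ca_int: "is_root G e \<Longrightarrow> f \<in> lat \<Longrightarrow> ca e f \<in> \<int>"
  using root_int by (simp add: ca_def)

definition kk where "kk e = nat \<lfloor>- b e e\<rfloor>"

lemma kk: assumes "is_root G e" shows "real (kk e) = - b e e" "kk e > 0"
proof -
  have "- b e e \<in> \<int>" using root_lat[OF assms] by (intro Ints_minus bf_lat_Ints) auto
  then obtain m where m: "- b e e = of_int m" by (rule Ints_cases)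
  then show "real (kk e) = - b e e" "kk e > 0" using root_neg[OF assms] by (auto simp: kk_def)
qed

lemma exponent_dvd:
  assumes "m > 0" "\<And>x. x \<in> dual_lat G \<Longrightarrow> real m *\<^sub>R x \<in> lat"
  shows "disc_exponent G dvd m" "disc_exponent G > 0"
proof -
  let ?P = "\<lambda>m::nat. m > 0 \<and> (\<forall>x\<in>dual_lat G. real m *\<^sub>R x \<in> lat)"
  let ?a = "disc_exponent G"
  have a: "?P ?a" unfolding disc_exponent_def by (rule LeastI[of ?P m]) (use assms in auto)
  then show "?a > 0" by simp
  show "?a dvd m"
  proof (rule ccontr)
    assume "\<not> ?a dvd m"
    then have r: "m mod ?a > 0" by (simp add: mod_greater_zero_iff_not_dvd)
    have "real (m mod ?a) *\<^sub>R x \<in> lat" if x: "x \<in> dual_lat G" for x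
    proof -
      have "real m = real (m div ?a) * real ?a + real (m mod ?a)" by (metis div_mult_mod_eq of_nat_add of_nat_mult)
      then have "real (m mod ?a) *\<^sub>R x = real m *\<^sub>R x - real (m div ?a) *\<^sub>R (real ?a *\<^sub>R x)"
        by (simp add: vec_eq_iff algebra_simps)
      also have "\<dots> \<in> lat" using a x by (intro lat_diff assms(2) lat_scale[of "real (disc_exponent G) *\<^sub>R x"]) auto
      finally show ?thesis .
    qed
    then have "?P (m mod ?a)" using r by blast
    then have "?a \<le> m mod ?a" unfolding disc_exponent_def by (rule Least_le)
    moreover have "m mod ?a < ?a" using a by (intro mod_less_divisor) simp
    ultimately show False by linarith
  qed
qed

text \<open>For \<open>x\<close> in the dual lattice and a root \<open>h\<close> the product of
  \<open>kk h\<close> and \<open>ca h x\<close> is integral. So \<open>L\<close> clears the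
  denominators of the numerators in Cramer's rule, and \<open>D\<close> is the determinant.\<close>

lemma exponent_dvd_roots:
  assumes r: "is_root G e" "is_root G f" "is_root G g" and T: "tri e f g \<noteq> 0"
    and D: "real D = \<bar>cdet e f g\<bar>" "D > 0" and L: "L > 0" "kk e dvd L" "kk f dvd L" "kk g dvd L"
  shows "disc_exponent G dvd D * L" "disc_exponent G > 0"
proof -
  have nz: "b e e \<noteq> 0" "b f f \<noteq> 0" "b g g \<noteq> 0" using r root_neg by force+
  have l: "e \<in> lat" "f \<in> lat" "g \<in> lat" using r root_lat by auto
  have "real (D * L) *\<^sub>R x \<in> lat" if x: "x \<in> dual_lat G" for x
  proof -
    have z: "real L * ca h x \<in> \<int>" if h: "is_root G h" "kk h dvd L" for h
    proof -
      obtain t where t: "L = kk h * t" using h(2) by blast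
      have "b x h \<in> \<int>" using x root_lat[OF h(1)] by (auto simp: dual_lat_def)
      then have "b h x \<in> \<int>" using sym by simp
      moreover have "real L * ca h x = - 2 * real t * b h x"
        using kk[OF h(1)] root_neg[OF h(1)] by (simp add: t ca_def)
      ultimately show ?thesis by (metis Ints_minus Ints_mult Ints_numeral Ints_of_nat)
    qed
    define X Y Z where "X = real L * ca e x" and "Y = real L * ca f x" and "Z = real L * ca g x"
    have I: "X \<in> \<int>" "Y \<in> \<int>" "Z \<in> \<int>" unfolding X_def Y_def Z_def using z r L by auto
    have C: "real L * C1 e f g (ca e x) (ca f x) (ca g x) = C1 e f g X Y Z"
      "real L * C2 e f g (ca e x) (ca f x) (ca g x) = C2 e f g X Y Z"
      "real L * C3 e f g (ca e x) (ca f x) (ca g x) = C3 e f g X Y Z"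
      by (simp_all add: C1_def C2_def C3_def X_def Y_def Z_def algebra_simps)
    have "real L *\<^sub>R (cdet e f g *\<^sub>R x) = C1 e f g X Y Z *\<^sub>R e + C2 e f g X Y Z *\<^sub>R f + C3 e f g X Y Z *\<^sub>R g"
      unfolding cramer[OF T nz, of x] C[symmetric] by (simp add: scaleR_add_right)
    also have "\<dots> \<in> lat" unfolding C1_def C2_def C3_def using I l r ca_int
      by (intro lat_add lat_scale Ints_add Ints_mult Ints_diff) auto
    finally have *: "real L *\<^sub>R (cdet e f g *\<^sub>R x) \<in> lat" .
    show ?thesis
    proof (cases "cdet e f g \<ge> 0")
      case True then show ?thesis using * D by (simp add: mult.commute)
    next
      case False
      then have "real (D * L) *\<^sub>R x = - (real L *\<^sub>R (cdet e f g *\<^sub>R x))" using D by (simp add: mult.commute)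
      then show ?thesis using * lat_minus by metis
    qed
  qed
  then show "disc_exponent G dvd D * L" "disc_exponent G > 0" using exponent_dvd[of "D * L"] D L by auto
qed

text \<open>By Cramer's rule \<open>h\<close> divides 2D times every value of the form. The part of
  \<open>h\<close> not absorbed by 2D then divides the form, so it is 1 by primitivity.\<close>

lemma common_divisor_roots:
  assumes r: "is_root G e" "is_root G f" "is_root G g" and T: "tri e f g \<noteq> 0"
    and D: "real D = \<bar>cdet e f g\<bar>" "D > 0" and p: "primitive_form G"
    and h: "h > 0" "h dvd kk e" "h dvd kk f" "h dvd kk g"
  shows "h dvd 2 * D"
proof -
  have nz: "b e e \<noteq> 0" "b f f \<noteq> 0" "b g g \<noteq> 0" using r root_neg by force+
  have l: "e \<in> lat" "f \<in> lat" "g \<in> lat" using r root_lat by auto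
  have div: "\<exists>t::int. real (2 * D) * b x w = real h * of_int t" if x: "x \<in> lat" and w: "w \<in> lat" for x w
  proof -
    have q: "\<exists>t::int. 2 * b k w = real h * of_int t" if k: "is_root G k" "h dvd kk k" for k
    proof -
      obtain t where t: "kk k = h * t" using k(2) by blast
      obtain u where u: "ca k w = of_int u" using ca_int[OF k(1) w] by (rule Ints_cases)
      have "2 * b k w = - (real (kk k) * ca k w)" using kk[OF k(1)] root_neg[OF k(1)] by (simp add: ca_def)
      also have "\<dots> = real h * of_int (- (int t * u))" by (simp add: t u)
      finally show ?thesis by blast
    qed
    obtain t1 t2 t3 :: int where t: "2 * b e w = real h * of_int t1" "2 * b f w = real h * of_int t2" "2 * b g w = real h * of_int t3"
      using q r h by metis
    let ?X = "ca e x" and ?Y = "ca f x" and ?Z = "ca g x"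
    have I: "ca e x \<in> \<int>" "ca f x \<in> \<int>" "ca g x \<in> \<int>" using ca_int r x by auto
    obtain u1 u2 u3 where u: "C1 e f g ?X ?Y ?Z = of_int u1" "C2 e f g ?X ?Y ?Z = of_int u2" "C3 e f g ?X ?Y ?Z = of_int u3"
    proof -
      have "C1 e f g ?X ?Y ?Z \<in> \<int>" "C2 e f g ?X ?Y ?Z \<in> \<int>" "C3 e f g ?X ?Y ?Z \<in> \<int>"
        unfolding C1_def C2_def C3_def using I l r ca_int by (auto intro!: Ints_add Ints_mult Ints_diff)
      then show thesis using that by (metis Ints_cases)
    qed
    have "2 * cdet e f g * b x w = b (cdet e f g *\<^sub>R x) (2 *\<^sub>R w)" by (simp add: bf_lin)
    also have "\<dots> = of_int u1 * (2 * b e w) + of_int u2 * (2 * b f w) + of_int u3 * (2 * b g w)"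
      unfolding cramer[OF T nz, of x] u by (simp add: bf_lin)
    also have "\<dots> = real h * of_int (u1 * t1 + u2 * t2 + u3 * t3)" unfolding t by (simp add: algebra_simps)
    finally have *: "2 * cdet e f g * b x w = real h * of_int (u1 * t1 + u2 * t2 + u3 * t3)" .
    show ?thesis
    proof (cases "cdet e f g \<ge> 0")
      case True
      then show ?thesis using * D by (intro exI[of _ "u1 * t1 + u2 * t2 + u3 * t3"]) simp
    next
      case False
      then have "real (2 * D) * b x w = real h * of_int (- (u1 * t1 + u2 * t2 + u3 * t3))" using * D by (simp add: algebra_simps)
      then show ?thesis by blast
    qed
  qed
  define c where "c = gcd h (2 * D)"
  have c: "c > 0" "c dvd h" "c dvd 2 * D" using h(1) by (auto simp: c_def)
  define m where "m = h div c"
  have hm: "h = c * m" using c by (simp add: m_def)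
  have cop: "coprime m (2 * D div c)" unfolding m_def c_def using h(1) by (intro div_gcd_coprime) auto
  have "\<not> int m > 1"
  proof
    assume m1: "int m > 1"
    have "b x y / of_int (int m) \<in> \<int>" if xy: "x \<in> lat" "y \<in> lat" for x y
    proof -
      obtain t where t: "real (2 * D) * b x y = real h * of_int t" using div xy by blast
      obtain s where s: "b x y = of_int s" using bf_lat_Ints xy by (metis Ints_cases)
      have "of_int (int (2 * D) * s) = (of_int (int h * t) :: real)" using t s by simp
      then have eq: "int (2 * D) * s = int h * t" by linarith
      have e: "int (2 * D) = int c * int (2 * D div c)" using c by (metis dvd_mult_div_cancel of_nat_mult)
      have "int c * (int (2 * D div c) * s) = int (2 * D) * s" by (metis e mult.assoc)
      also have "\<dots> = int c * (int m * t)" unfolding eq by (simp add: hm mult.assoc)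
      finally have "int c * (int (2 * D div c) * s) = int c * (int m * t)" .
      then have "int (2 * D div c) * s = int m * t" using c by simp
      then have "int m dvd int (2 * D div c) * s" by simp
      then have "int m dvd s" using cop by (simp add: coprime_dvd_mult_right_iff)
      then obtain v where "s = int m * v" by blast
      then show ?thesis using m1 by (simp add: s)
    qed
    then show False using p m1 unfolding primitive_form_def by blast
  qed
  moreover have "m > 0" using hm h(1) by (cases m) auto
  ultimately have "m = 1" by simp
  then show ?thesis using hm c by simp
qed

text \<open>\<open>X\<close> and \<open>Y\<close> measure how far the three squares are from being
  equal. Their gcd divides 2D, so \<open>kk e\<close> is at most 2DX, while \<open>Y * kk e\<close>
  is a common multiple.\<close>

lemma exponent_le:
  assumes r: "is_root G e" "is_root G f" "is_root G g" and T: "tri e f g \<noteq> 0"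
    and D: "real D = \<bar>cdet e f g\<bar>" "D > 0" and p: "primitive_form G"
    and XY: "X > 0" "Y > 0" "kk e dvd X * kk f" "kk e dvd X * kk g" "kk f dvd Y * kk e" "kk g dvd Y * kk e"
  shows "disc_exponent G \<le> 2 * D^2 * (X * Y)" "disc_exponent G > 0"
proof -
  let ?g = "gcd (gcd (kk e) (kk f)) (kk g)"
  have gp: "?g > 0" using kk[OF r(1)] by simp
  have "?g dvd 2 * D" by (rule common_divisor_roots[OF r T D p gp]) (auto intro: dvd_trans)
  then have gD: "?g \<le> 2 * D" using D by (intro dvd_imp_le) auto
  have "kk e dvd X * kk e" by simp
  then have "kk e dvd gcd (gcd (X * kk e) (X * kk f)) (X * kk g)" using XY by simp
  also have "\<dots> = X * ?g" by (simp add: gcd_mult_distrib_nat)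
  finally have "kk e \<le> X * ?g" using XY gp by (intro dvd_imp_le) auto
  then have ke: "kk e \<le> X * (2 * D)" using gD by (meson le_trans mult_le_mono2)
  have "disc_exponent G dvd D * (Y * kk e)" and pos: "disc_exponent G > 0"
    using exponent_dvd_roots[OF r T D, of "Y * kk e"] XY kk[OF r(1)] by auto
  then have "disc_exponent G \<le> D * (Y * kk e)" using D XY kk[OF r(1)] by (intro dvd_imp_le) auto
  also have "\<dots> \<le> D * (Y * (X * (2 * D)))" using ke by simp
  finally show "disc_exponent G \<le> 2 * D^2 * (X * Y)" by (simp add: power2_eq_square mult_ac)
  show "disc_exponent G > 0" by (rule pos)
qed

text \<open>If \<open>p\<close> divides all three squares, it divides 2D by primitivity. If it
  divides none, it does not divide the multiple D kk(e) kk(f) kk(g) of the exponent.\<close>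

lemma prime_not_dvd_exponent:
  assumes r: "is_root G e" "is_root G f" "is_root G g" and T: "tri e f g \<noteq> 0"
    and D: "real D = \<bar>cdet e f g\<bar>" "D > 0" and P: "primitive_form G"
    and p: "prime p" "odd p" "\<not> p dvd D" "p dvd kk e \<longleftrightarrow> p dvd kk f" "p dvd kk e \<longleftrightarrow> p dvd kk g"
  shows "\<not> p dvd disc_exponent G"
proof
  assume a: "p dvd disc_exponent G"
  have n: "\<not> p dvd kk e"
  proof
    assume "p dvd kk e"
    then have "p dvd 2 * D" using common_divisor_roots[OF r T D P] p prime_gt_0_nat by blast
    then show False using p odd_prime_not_dvd_2 by (auto simp: prime_dvd_mult_iff)
  qed
  have "disc_exponent G dvd D * (kk e * kk f * kk g)"
    using exponent_dvd_roots(1)[OF r T D, of "kk e * kk f * kk g"] kk r by auto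
  then have "p dvd D * (kk e * kk f * kk g)" using a dvd_trans by blast
  then show False using n p by (auto simp: prime_dvd_mult_iff)
qed

end

section \<open>Criteria for three and four walls\<close>

context chamber
begin

text \<open>The number under the floor is an integer for roots, so nothing is lost by the truncation.\<close>
definition al where "al e f = nat \<lfloor>4 * (nv G e f)^2\<rfloor>"

lemma nv_sym: "nv G e f = nv G f e" using sym by (simp add: nv_def mult.commute)
lemma al_sym: "al e f = al f e" by (simp add: al_def nv_sym)

lemma ca_ca: assumes "is_root G e" "is_root G f" shows "ca e f * ca f e = 4 * (nv G e f)^2"
proof -
  have "b e e * b f f > 0" using assms root_neg by (simp add: mult_neg_neg)
  then show ?thesis using sym[of f e] by (simp add: ca_def nv_def power_divide power2_eq_square)
qed

lemma al: assumes "is_root G e" "is_root G f" shows "real (al e f) = 4 * (nv G e f)^2"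
proof -
  have "ca e f * ca f e \<in> \<int>" using assms ca_int root_lat by (intro Ints_mult) auto
  then have "4 * (nv G e f)^2 \<in> \<int>" using ca_ca[OF assms] by simp
  then obtain m where "4 * (nv G e f)^2 = of_int m" by (rule Ints_cases)
  moreover have "4 * (nv G e f)^2 \<ge> 0" by simp
  ultimately show ?thesis by (simp add: al_def)
qed

text \<open>\<open>x\<close> and \<open>y\<close> are the absolute values of \<open>ca e f\<close>
  and \<open>ca f e\<close>; the relation is the symmetry of the form. For orthogonal roots both
  would vanish and say nothing about the squares.\<close>

lemma kk_relation:
  assumes "is_root G e" "is_root G f" "al e f \<noteq> 0"
  obtains x y :: nat where "kk e * x = kk f * y" "x * y = al e f"
proof -
  obtain u where u: "ca e f = of_int u" using ca_int assms root_lat by (metis Ints_cases)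
  obtain v where v: "ca f e = of_int v" using ca_int assms root_lat by (metis Ints_cases)
  have uv: "of_int (u * v) = (of_int (int (al e f)) :: real)" using al[OF assms(1,2)] ca_ca[OF assms(1,2)] u v by simp
  then have uv: "u * v = int (al e f)" by linarith
  have "real (kk e) * ca e f = real (kk f) * ca f e"
    using kk assms root_neg[of e] root_neg[of f] sym[of e f] by (simp add: ca_def)
  then have "of_int (int (kk e) * u) = (of_int (int (kk f) * v) :: real)" using u v by simp
  then have "int (kk e) * u = int (kk f) * v" by linarith
  then have "\<bar>int (kk e) * u\<bar> = \<bar>int (kk f) * v\<bar>" by simp
  then have "int (kk e * nat \<bar>u\<bar>) = int (kk f * nat \<bar>v\<bar>)" by (simp add: abs_mult)
  then have "kk e * nat \<bar>u\<bar> = kk f * nat \<bar>v\<bar>" by (simp only: of_nat_eq_iff)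
  moreover have "int (nat \<bar>u\<bar> * nat \<bar>v\<bar>) = int (al e f)" using uv by (simp add: abs_mult[symmetric])
  then have "nat \<bar>u\<bar> * nat \<bar>v\<bar> = al e f" by (simp only: of_nat_eq_iff)
  ultimately show thesis by (rule that)
qed

lemma kk_prime_iff:
  assumes "is_root G e" "is_root G f" "prime p" "\<not> p dvd al e f" shows "p dvd kk e \<longleftrightarrow> p dvd kk f"
proof -
  have "al e f \<noteq> 0" using assms by (metis dvd_0_right)
  then obtain x y where xy: "kk e * x = kk f * y" "x * y = al e f" using kk_relation assms by metis
  then have "\<not> p dvd x" "\<not> p dvd y" using assms by (metis dvd_mult dvd_mult2)+
  then show ?thesis using xy(1) assms(3) by (metis prime_dvd_mult_iff)
qed

text \<open>A linear relation between three distinct walls has two coefficients of equal sign;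
  evaluate it at a point of the third wall.\<close>
lemma walls_independent:
  assumes w: "wall e" "wall f" "wall g" and ne: "e \<noteq> f" "f \<noteq> g" "e \<noteq> g" shows "tri e f g \<noteq> 0"
proof
  assume T: "tri e f g = 0"
  have R: "e \<in> Rp" "f \<in> Rp" "g \<in> Rp" using w wall_Rp by auto
  obtain x y z where x: "wall_at e x" "wall_at f y" "wall_at g z" using w by (auto simp: wall_def)
  have p: "b x e = 0" "b x f > 0" "b x g > 0" "b y e > 0" "b y f = 0" "b y g > 0" "b z e > 0" "b z f > 0" "b z g = 0"
    using x R ne by (auto simp: wall_at_def)
  have e0: "e \<noteq> 0" using R by (auto simp: Rp_def bf_lin)
  have "\<exists>u. tri e f u \<noteq> 0"
  proof (rule ccontr)
    assume "\<nexists>u. tri e f u \<noteq> 0"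
    then obtain a where "f = a *\<^sub>R e" using tri_zero_right[of e f] e0 by blast
    then show False using Rp_scale[of e f a] R ne by auto
  qed
  then obtain u where u: "tri e f u \<noteq> 0" by blast
  obtain p' q' where g: "g = p' *\<^sub>R e + q' *\<^sub>R f" using tri_expand[OF u, of g] T by simp
  have "b x g = q' * b x f" "b y g = p' * b y e" "b z g = p' * b z e + q' * b z f" using p by (simp_all add: g bf_lin)
  then have "q' > 0" "p' > 0" using p by (simp_all add: zero_less_mult_iff)
  then have "p' * b z e + q' * b z f > 0" using p by (intro add_pos_pos mult_pos_pos)
  then show False using p \<open>b z g = p' * b z e + q' * b z f\<close> by simp
qed

lemma wall_nv_ge: assumes "wall e" "wall f" "e \<noteq> f" shows "nv G e f \<ge> 0"
proof -
  have "b e e * b f f > 0" using assms wall_root root_neg by (simp add: mult_neg_neg)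
  then show ?thesis using wall_acute[OF assms] by (simp add: nv_def)
qed

lemma ca_triple:
  assumes "wall e" "wall f" "wall g"
  shows "ca e f * ca f g * ca g e = - 8 * (nv G e f * nv G f g * nv G g e)"
proof -
  have n: "b e e < 0" "b f f < 0" "b g g < 0" using assms wall_root root_neg by auto
  have "sqrt (b e e * b f f) * sqrt (b f f * b g g) * sqrt (b g g * b e e)
      = sqrt ((b e e * b f f * b g g)^2)" by (simp add: real_sqrt_mult[symmetric] power2_eq_square mult_ac)
  also have "\<dots> = - (b e e * b f f * b g g)" using n by (simp add: abs_mult)
  finally show ?thesis using n by (simp add: ca_def nv_def times_divide_times_eq)
qed

text \<open>Four times the Gram determinant of the three roots scaled to square -1.\<close>

definition DD where "DD e f g = 4 * ((nv G e f)^2 + (nv G f g)^2 + (nv G e g)^2 + 2 * nv G e f * nv G f g * nv G e g - 1)"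

lemma cdet_DD:
  assumes w: "wall e" "wall f" "wall g" shows "cdet e f g = - 2 * DD e f g"
proof -
  have r: "is_root G e" "is_root G f" "is_root G g" using w wall_root by auto
  have "ca e f * ca f g * ca g e = - 8 * (nv G e f * nv G f g * nv G e g)" "ca e g * ca g f * ca f e = - 8 * (nv G e f * nv G f g * nv G e g)"
    using ca_triple[OF w] ca_triple[OF w(1,3,2)] nv_sym by (auto simp: mult_ac)
  then show ?thesis unfolding cdet_def DD_def ca_ca[OF r(1,2)] ca_ca[OF r(2,3)] ca_ca[OF r(1,3)] by (simp add: algebra_simps)
qed

text \<open>Positive because the Gram determinant of the lattice is, by the signature; integral
  because it is a polynomial in Cartan numbers.\<close>

lemma DD_nat:
  assumes w: "wall e" "wall f" "wall g" and ne: "e \<noteq> f" "f \<noteq> g" "e \<noteq> g"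
  obtains n where "real n = DD e f g" "n > 0"
proof -
  have r: "is_root G e" "is_root G f" "is_root G g" using w wall_root by auto
  have n: "b e e < 0" "b f f < 0" "b g g < 0" using r root_neg by auto
  have T: "tri e f g \<noteq> 0" by (rule walls_independent[OF w ne])
  have "8 * d * (tri e f g)^2 > 0" using T d_pos by simp
  then have "cdet e f g * (b e e * b f f * b g g) > 0" using cdet_gram[of e f g] n by simp
  moreover have "b e e * b f f * b g g < 0" using n by (simp add: mult_neg_neg mult_pos_neg)
  ultimately have "cdet e f g < 0" by (metis mult_less_0_iff not_less_iff_gr_or_eq zero_less_mult_iff)
  then have pos: "DD e f g > 0" using cdet_DD[OF w] by simp
  have "DD e f g = real (al e f) + real (al f g) + real (al e g) - 4 - ca e f * ca f g * ca g e"
    using ca_triple[OF w] nv_sym[of g e] by (simp add: DD_def al r algebra_simps)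
  also have "\<dots> \<in> \<int>" using r ca_int root_lat by (intro Ints_add Ints_diff Ints_mult) auto
  finally obtain m where m: "DD e f g = of_int m" by (rule Ints_cases)
  then show thesis using pos that[of "nat m"] by simp
qed

definition disc_bounds where "disc_bounds \<longleftrightarrow> disc_exponent G \<le> 8 * 16144800^2 \<and> odd_rad (disc_exponent G) \<le> 2834349
         \<and> max_prime_div (disc_exponent G) \<le> 4561"

text \<open>The middle wall \<open>f\<close> links the squares of \<open>e\<close> and
  \<open>g\<close>, which \<open>exponent_le\<close> turns into a bound for the exponent. An odd
  prime dividing the exponent divides \<open>DD e f g\<close> or one of the two link
  numbers.\<close>

lemma three_walls:
  assumes P: "primitive_form G" and w: "wall e" "wall f" "wall g" and ne: "e \<noteq> f" "f \<noteq> g" "e \<noteq> g"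
    and c: "al e f \<noteq> 0" "al f g \<noteq> 0" "al e f \<le> 4561" "al f g \<le> 4561"
    and D: "DD e f g \<le> 4561" "DD e f g * real (al e f * al f g) \<le> 2834349"
  shows disc_bounds
proof -
  obtain n where n: "real n = DD e f g" "n > 0" using DD_nat[OF w ne] by blast
  have r: "is_root G e" "is_root G f" "is_root G g" using w wall_root by auto
  have T: "tri e f g \<noteq> 0" by (rule walls_independent[OF w ne])
  let ?D = "2 * n"
  have Dn: "real ?D = \<bar>cdet e f g\<bar>" "?D > 0" using n cdet_DD[OF w] by auto
  let ?a = "disc_exponent G" and ?N = "n * (al e f * al f g)"
  have n4: "n \<le> 4561" using D(1) n by linarith
  have "real ?N \<le> 2834349" using D(2) n by simp
  then have N: "?N \<le> 2834349" by linarith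
  obtain x y where xy: "kk e * x = kk f * y" "x * y = al e f" using kk_relation r c by metis
  obtain s t where st: "kk f * s = kk g * t" "s * t = al f g" using kk_relation r c by metis
  have pos: "x > 0" "y > 0" "s > 0" "t > 0" using xy st c by (auto intro!: Nat.gr0I)
  have "?a \<le> 2 * ?D^2 * ((y * t) * (x * s))" and ap: "?a > 0"
  proof -
    have d1: "kk e dvd (y * t) * kk f" by (metis dvd_triv_left dvd_mult2 mult.commute mult.left_commute xy(1))
    have "(y * t) * kk g = kk e * (x * s)" using xy(1) st(1) by (metis mult.assoc mult.commute)
    then have d2: "kk e dvd (y * t) * kk g" by simp
    have d3: "kk f dvd (x * s) * kk e" by (metis dvd_triv_left dvd_mult2 mult.commute mult.left_commute xy(1))
    have "(x * s) * kk e = kk g * (y * t)" using xy(1) st(1) by (metis mult.assoc mult.commute)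
    then have d4: "kk g dvd (x * s) * kk e" by simp
    show "?a \<le> 2 * ?D^2 * ((y * t) * (x * s))" "?a > 0"
      using exponent_le[OF r T Dn P _ _ d1 d2 d3 d4] pos by auto
  qed
  moreover have "(y * t) * (x * s) = al e f * al f g" unfolding xy(2)[symmetric] st(2)[symmetric] by (simp add: mult_ac)
  ultimately have "?a \<le> 2 * ?D^2 * (al e f * al f g)" by metis
  also have "\<dots> = 8 * n * ?N" by (simp add: power2_eq_square)
  finally have "?a \<le> 8 * n * ?N" .
  also have "\<dots> \<le> 8 * 4561 * 2834349" using n4 N by (intro mult_le_mono) auto
  finally have a: "?a \<le> 8 * 16144800^2" by simp
  have pr: "p dvd n \<or> p dvd al e f \<or> p dvd al f g" if p: "prime p" "p dvd ?a" "odd p" for p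
  proof (rule ccontr)
    assume h: "\<not> ?thesis"
    then have "\<not> p dvd ?D" using p by (auto simp: prime_dvd_mult_iff dest: odd_prime_not_dvd_2)
    moreover have "p dvd kk e \<longleftrightarrow> p dvd kk f" "p dvd kk f \<longleftrightarrow> p dvd kk g" using kk_prime_iff r p h by blast+
    ultimately show False using prime_not_dvd_exponent[OF r T Dn P p(1,3)] p(2) by blast
  qed
  have Np: "?N > 0" using n c by simp
  have "2^0 * odd_rad ?a \<le> ?N"
  proof (rule odd_rad_le[OF Np])
    fix p assume "prime p" "p dvd ?a" "odd p"
    then show "p dvd ?N" using pr by (metis dvd_mult dvd_mult2)
  qed simp
  then have rad: "odd_rad ?a \<le> 2834349" using N by simp
  have "max_prime_div ?a \<le> 4561"
  proof (rule max_prime_div_le[OF ap])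
    fix p assume "prime p" "p dvd ?a" "odd p"
    then have "p dvd n \<or> p dvd al e f \<or> p dvd al f g" by (rule pr)
    then show "p \<le> 4561" using n(2) n4 c by (auto dest!: dvd_imp_le)
  qed simp
  then show ?thesis using a rad by (simp add: disc_bounds_def)
qed

text \<open>With \<open>A = al x y\<close> and \<open>B = al e z\<close>, the vanishing Gram determinant of the four vectors gives \<open>(A - 4)(B - 4) = 4 (\<dots>)\<close>.\<close>
lemma four_walls:
  assumes P: "primitive_form G" and w: "wall e" "wall x" "wall y" "wall z"
    and ne: "e \<noteq> x" "e \<noteq> y" "x \<noteq> y" "e \<noteq> z" and o: "nv G e x = 0" "nv G e y = 0" "nv G e z \<noteq> 0"
    and A: "al x y \<le> 100" and B: "al e z \<le> 4561"
    and N: "al x y * (al x y - 4) * (al e z * (al e z - 4)) \<le> 16 * 2834349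
      \<or> al x y mod 4 \<noteq> 2 \<and> al x y * (al x y - 4) * (al e z * (al e z - 4)) \<le> 32 * 2834349"
  shows disc_bounds
proof -
  have r: "is_root G e" "is_root G x" "is_root G y" "is_root G z" using w wall_root by auto
  have ne': "z \<noteq> x" "z \<noteq> y" using o by auto
  have T: "tri x y e \<noteq> 0" by (rule walls_independent) (use w ne in auto)
  define A B p q where "A = al x y" and "B = al e z" and "p = al z x" and "q = al z y"
  have nz: "b e e \<noteq> 0" "b x x \<noteq> 0" "b y y \<noteq> 0" "b z z \<noteq> 0" using r root_neg by force+
  have ca0: "ca e x = 0" "ca x e = 0" "ca e y = 0" "ca y e = 0"
    using o nz sym[of x e] sym[of y e] by (auto simp: nv_def ca_def)
  have DDxye: "DD x y e = real A - 4" using o nv_sym[of x e] nv_sym[of y e] al[OF r(2,3)] by (simp add: DD_def A_def)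
  obtain n where n: "real n = DD x y e" "n > 0" using DD_nat[OF w(2,3,1)] ne by metis
  have nA: "A = n + 4" using n(1) DDxye by simp
  let ?D = "2 * n"
  have Dn: "real ?D = \<bar>cdet x y e\<bar>" "?D > 0" using n cdet_DD[OF w(2,3,1)] by auto
  \<comment> \<open>Eight times the product of the normalised Gram entries of \<open>x\<close>,
    \<open>y\<close>, \<open>z\<close>: a nonnegative integer with square A p q.\<close>
  define t where "t = - (ca z x * ca x y * ca y z)"
  have t0: "t \<ge> 0" using ca_triple[OF w(4,2,3)] wall_nv_ge w ne ne' by (simp add: t_def)
  have t2: "t = - (ca x z * ca z y * ca y x)" using ca_triple[OF w(4,2,3)] ca_triple[OF w(2,4,3)] nv_sym by (simp add: t_def mult_ac)
  have tt: "t^2 = real (A * p * q)"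
  proof -
    have "t^2 = (ca x y * ca y x) * (ca z x * ca x z) * (ca z y * ca y z)"
      unfolding power2_eq_square by (subst (1) t_def, subst t2) (simp add: mult_ac)
    then show ?thesis by (simp add: A_def p_def q_def al r ca_ca)
  qed
  have caA: "ca x y * ca y x = real A" "ca z x * ca x z = real p" "ca z y * ca y z = real q" "ca z e * ca e z = real B"
    using nv_sym[of z e] by (simp_all add: A_def p_def q_def B_def al r ca_ca)
  \<comment> \<open>Expand \<open>z\<close> by Cramer's rule in \<open>x\<close>, \<open>y\<close>,
    \<open>e\<close> and pair the result with \<open>z\<close>.\<close>
  have rel: "(real A - 4) * (real B - 4) = 4 * (real p + real q + t)"
  proof -
    have "ca z (cdet x y e *\<^sub>R z) = ca z (C1 x y e (ca x z) (ca y z) (ca e z) *\<^sub>R x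
      + C2 x y e (ca x z) (ca y z) (ca e z) *\<^sub>R y + C3 x y e (ca x z) (ca y z) (ca e z) *\<^sub>R e)"
      using cramer[OF T nz(2,3,1), of z] by simp
    then have "cdet x y e * 2 = C1 x y e (ca x z) (ca y z) (ca e z) * ca z x + C2 x y e (ca x z) (ca y z) (ca e z) * ca z y
       + C3 x y e (ca x z) (ca y z) (ca e z) * ca z e"
      using nz by (simp add: ca_def bf_lin add_divide_distrib algebra_simps)
    moreover have "cdet x y e = 8 - 2 * real A" using cdet_DD[OF w(2,3,1)] DDxye by simp
    moreover have "C1 x y e (ca x z) (ca y z) (ca e z) * ca z x = 4 * real p + 2 * t"
      using caA(2) by (simp add: C1_def ca0 t_def algebra_simps)
    moreover have "C2 x y e (ca x z) (ca y z) (ca e z) * ca z y = 4 * real q + 2 * t"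
      using caA(3) by (simp add: C2_def ca0 t2 algebra_simps)
    moreover have "C3 x y e (ca x z) (ca y z) (ca e z) * ca z e = (4 - real A) * real B"
    proof -
      have "C3 x y e (ca x z) (ca y z) (ca e z) * ca z e = (4 - ca x y * ca y x) * (ca z e * ca e z)"
        by (simp add: C3_def ca0 algebra_simps)
      then show ?thesis by (simp only: caA)
    qed
    ultimately show ?thesis by (simp add: algebra_simps)
  qed
  have "t \<in> \<int>" unfolding t_def using r ca_int root_lat by (intro Ints_minus Ints_mult) auto
  then obtain ti where ti: "t = of_int ti" by (rule Ints_cases)
  define tn where "tn = nat ti"
  have tn: "t = real tn" using ti t0 by (simp add: tn_def)
  have tn2: "tn^2 = A * p * q" using tt tn by (metis of_nat_eq_iff of_nat_power)
  \<comment> \<open>If \<open>z\<close> were orthogonal to \<open>x\<close> and \<open>y\<close>, it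
    would be proportional to \<open>e\<close>.\<close>
  have pq: "p \<noteq> 0 \<or> q \<noteq> 0"
  proof (rule ccontr)
    assume h: "\<not> ?thesis"
    then have "nv G z x = 0" "nv G z y = 0" using al[OF r(4,2)] al[OF r(4,3)] by (auto simp: p_def q_def)
    then have "ca x z = 0" "ca y z = 0" using nz sym[of z x] sym[of z y] by (auto simp: nv_def ca_def)
    then have "cdet x y e *\<^sub>R z = C3 x y e 0 0 (ca e z) *\<^sub>R e"
      using cramer[OF T nz(2,3,1), of z] by (simp add: C1_def C2_def ca0)
    moreover have "cdet x y e \<noteq> 0" using Dn by auto
    ultimately have "z = (C3 x y e 0 0 (ca e z) / cdet x y e) *\<^sub>R e" by (simp add: vec_eq_iff field_simps)
    then have "z = e" by (rule Rp_scale[OF wall_Rp[OF w(1)] wall_Rp[OF w(4)]])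
    then show False using ne by simp
  qed
  have Bpos: "real B - 4 > 0"
  proof -
    have "real p + real q + t > 0" using pq t0 by (auto simp: add_pos_nonneg add_nonneg_pos)
    then have "real n * (real B - 4) > 0" using rel nA by simp
    then show ?thesis by (rule zero_less_mult_pos) (use n in simp)
  qed
  define m where "m = B - 4"
  have mB: "B = m + 4" "m > 0" using Bpos by (auto simp: m_def)
  have rel': "n * m = 4 * (p + q + tn)"
  proof -
    have "real (n * m) = real (4 * (p + q + tn))" using rel nA mB tn by simp
    then show ?thesis by linarith
  qed
  let ?a = "disc_exponent G"
  have B0: "al e z \<noteq> 0" using mB by (simp add: B_def)
  \<comment> \<open>A prime dividing none of the four numbers cannot divide both \<open>p\<close>
    and \<open>q\<close>, since it would divide \<open>tn\<close> and so n m. Hence \<open>z\<close>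
    links \<open>e\<close> to \<open>x\<close> or \<open>y\<close> modulo this prime, and it divides
    all three squares or none.\<close>
  have pr: "pp dvd A \<or> pp dvd n \<or> pp dvd B \<or> pp dvd m" if pp: "prime pp" "pp dvd ?a" "odd pp" for pp
  proof (rule ccontr)
    assume h: "\<not> ?thesis"
    have "\<not> pp dvd p \<or> \<not> pp dvd q"
    proof (rule ccontr)
      assume "\<not> ?thesis"
      then have d: "pp dvd p" "pp dvd q" by auto
      then have "pp dvd tn^2" by (simp add: tn2)
      then have "pp dvd tn" using pp(1) prime_dvd_power by blast
      then have "pp dvd n * m" using d rel' by simp
      then show False using h pp(1) by (simp add: prime_dvd_mult_iff)
    qed
    moreover have "pp dvd kk x \<longleftrightarrow> pp dvd kk y" "pp dvd kk e \<longleftrightarrow> pp dvd kk z"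
      using kk_prime_iff r pp h unfolding A_def B_def by blast+
    moreover have "\<not> pp dvd p \<Longrightarrow> pp dvd kk z \<longleftrightarrow> pp dvd kk x" "\<not> pp dvd q \<Longrightarrow> pp dvd kk z \<longleftrightarrow> pp dvd kk y"
      using kk_prime_iff r pp unfolding p_def q_def by blast+
    ultimately have "pp dvd kk x \<longleftrightarrow> pp dvd kk y" "pp dvd kk x \<longleftrightarrow> pp dvd kk e" by blast+
    moreover have "\<not> pp dvd ?D" using pp h by (auto simp: prime_dvd_mult_iff dest: odd_prime_not_dvd_2)
    ultimately show False using prime_not_dvd_exponent[OF r(2,3,1) T Dn P pp(1,3)] pp(2) by blast
  qed
  define N where "N = A * n * (B * m)"
  have Np: "N > 0" using nA mB n(2) by (simp add: N_def)
  have Ncase: "N \<le> 16 * 2834349 \<or> A mod 4 \<noteq> 2 \<and> N \<le> 32 * 2834349"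
    using N unfolding N_def A_def[symmetric] B_def[symmetric] nA mB by simp
  \<comment> \<open>The factor 4 yields 16 dividing \<open>N\<close>, and even 32 unless
    \<open>A\<close> is 2 modulo 4. Powers of 2 do not count in the odd radical, whence the factors
    16 and 32 in the hypothesis.\<close>
  have d4: "4 dvd n * m" using rel' by simp
  have even2: "32 dvd k * (k + 4)" if k: "4 dvd k" for k :: nat
  proof -
    obtain j where j: "k = 4 * j" using k by blast
    have "even (j * (j + 1))" by simp
    then obtain i where "j * (j + 1) = 2 * i" by blast
    then have "k * (k + 4) = 32 * i" unfolding j by (simp add: algebra_simps)
    then show ?thesis by simp
  qed
  have rad: "odd_rad ?a \<le> 2834349"
  proof -
    have pN: "pp dvd N" if "prime pp" "pp dvd ?a" "odd pp" for pp
      using pr[OF that] by (auto simp: N_def)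
    have "16 dvd N \<and> (A mod 4 \<noteq> 2 \<longrightarrow> 32 dvd N)"
    proof (cases "4 dvd n")
      case True
      then have "32 dvd n * (n + 4)" by (rule even2)
      then have "32 dvd N" unfolding N_def nA by (metis dvd_mult2 mult.commute)
      then show ?thesis using dvd_trans[of 16 32 N] by simp
    next
      case False
      show ?thesis
      proof (cases "even n")
        case ev: True
        then obtain j where j: "n = 2 * j" by blast
        then have oj: "odd j" using False by (auto elim!: evenE)
        then have A2: "A mod 4 = 2" unfolding nA j by (auto elim!: oddE simp: mod_mult_right_eq) presburger
        have "even m" using d4 oj unfolding j by (metis dvd_mult_cancel1 even_mult_iff mult.assoc nat_mult_dvd_cancel_disj numeral_Bit0_eq_double zero_neq_numeral)
        then obtain i where i: "m = 2 * i" by blast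
        have "N = 16 * ((j + 2) * j * ((i + 2) * i))" unfolding N_def nA mB j i by (simp add: algebra_simps)
        then show ?thesis using A2 by simp
      next
        case od: False
        then have "coprime 4 n" by (metis coprime_power_left_iff coprime_left_2_iff_odd numeral_Bit0_eq_double power2_eq_square mult_2 one_add_one num_double)
        then have "4 dvd m" using d4 by (simp add: coprime_dvd_mult_right_iff)
        then have "32 dvd m * (m + 4)" by (rule even2)
        then have "32 dvd N" unfolding N_def mB by (metis dvd_mult mult.commute)
        then show ?thesis using dvd_trans[of 16 32 N] by simp
      qed
    qed
    then consider "2^4 dvd N" "N \<le> 16 * 2834349" | "2^5 dvd N" "N \<le> 32 * 2834349" using Ncase by auto
    then show ?thesis
    proof cases
      case 1 show ?thesis using odd_rad_le[OF Np 1(1), of ?a] pN 1(2) by simp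
    next
      case 2 show ?thesis using odd_rad_le[OF Np 2(1), of ?a] pN 2(2) by simp
    qed
  qed
  have n96: "n \<le> 96" using A nA unfolding A_def by simp
  have N32: "N \<le> 32 * 2834349" using Ncase by auto
  \<comment> \<open>The squares are compared along the path \<open>e\<close>, \<open>z\<close>,
    \<open>u\<close>, \<open>v\<close>, where \<open>u\<close> is the one of \<open>x\<close>,
    \<open>y\<close> known not to be orthogonal to \<open>z\<close>.\<close>
  have size: "?a \<le> 8 * n^2 * (B * s * A) \<and> ?a > 0"
    if uv: "u = x \<and> v = y \<or> u = y \<and> v = x" and s: "s = al z u" "s \<noteq> 0" for u v s
  proof -
    have ru: "is_root G u" "is_root G v" using uv r by auto
    have Auv: "al u v = A" using uv al_sym by (auto simp: A_def)
    have Tu: "tri e u v \<noteq> 0" using uv walls_independent[of e u v] w ne by auto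
    have cd: "cdet e u v = cdet x y e" using uv by (auto simp: cdet_def)
    have Dn': "real ?D = \<bar>cdet e u v\<bar>" using Dn cd by simp
    obtain a1 a2 where a: "kk e * a1 = kk z * a2" "a1 * a2 = al e z" using kk_relation[OF r(1,4) B0] by metis
    obtain b1 b2 where bb: "kk z * b1 = kk u * b2" "b1 * b2 = al z u" using kk_relation[OF r(4) ru(1)] s by metis
    have A0: "al u v \<noteq> 0" using Auv nA by simp
    obtain c1 c2 where c: "kk u * c1 = kk v * c2" "c1 * c2 = al u v" using kk_relation[OF ru A0] by metis
    have pos: "a1 > 0" "a2 > 0" "b1 > 0" "b2 > 0" "c1 > 0" "c2 > 0"
      using a(2) bb(2) c(2) B0 s A0 by (auto intro!: Nat.gr0I)
    let ?X = "a2 * b2 * c2" and ?Y = "a1 * b1 * c1"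
    have e1: "a2 * b2 * kk u = kk e * (a1 * b1)" using a(1) bb(1) by (metis mult.assoc mult.commute)
    have e2: "a2 * b2 * c2 * kk v = kk e * (a1 * b1 * c1)" using e1 c(1) by (metis mult.assoc mult.commute)
    have d1: "kk e dvd ?X * kk u" by (metis e1 dvd_triv_left dvd_mult2 mult.commute mult.left_commute)
    have d2: "kk e dvd ?X * kk v" using e2 by simp
    have d3: "kk u dvd ?Y * kk e" by (metis e1 dvd_triv_right dvd_mult mult.commute mult.left_commute)
    have d4: "kk v dvd ?Y * kk e" using e2 by (metis dvd_triv_right mult.commute)
    have XY: "?a \<le> 2 * ?D^2 * (?X * ?Y)" "?a > 0"
      using exponent_le[OF r(1) ru Tu Dn' Dn(2) P _ _ d1 d2 d3 d4] pos by auto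
    have e: "?X * ?Y = B * s * A" unfolding B_def s(1) Auv[symmetric] a(2)[symmetric] bb(2)[symmetric] c(2)[symmetric]
      by (simp add: mult_ac)
    have "2 * ?D^2 = 8 * n^2" by (simp add: power2_eq_square)
    then show ?thesis using XY unfolding e by simp
  qed
  obtain s where s: "?a \<le> 8 * n^2 * (B * s * A)" "?a > 0" "s \<le> n * m"
  proof (cases "p = 0")
    case True
    have "q \<le> n * m" using rel' by simp
    then show thesis using that[of q] size[of y x q] True pq by (auto simp: q_def)
  next
    case False
    have "p \<le> n * m" using rel' by simp
    then show thesis using that[of p] size[of x y p] False by (auto simp: p_def)
  qed
  have "?a \<le> 8 * n^2 * (B * (n * m) * A)" using s(1,3) by (meson le_trans mult_le_mono mult_le_mono1 mult_le_mono2 order_refl)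
  also have "\<dots> = 8 * n^2 * N" by (simp add: N_def mult_ac)
  also have "\<dots> \<le> 8 * 96^2 * (32 * 2834349)" using n96 N32 by (intro mult_le_mono power_mono) auto
  finally have a: "?a \<le> 8 * 16144800^2" by simp
  have "max_prime_div ?a \<le> 4561"
  proof (rule max_prime_div_le[OF s(2)])
    fix pp assume "prime pp" "pp dvd ?a" "odd pp"
    then have "pp dvd A \<or> pp dvd n \<or> pp dvd B \<or> pp dvd m" by (rule pr)
    moreover have "A > 0" "A \<le> 4561" "n \<le> 4561" "B > 0" "B \<le> 4561" "m \<le> 4561"
      using A B n96 nA mB by (auto simp: A_def[symmetric] B_def[symmetric])
    ultimately show "pp \<le> 4561" using n(2) mB(2) by (auto dest!: dvd_imp_le)
  qed simp
  then show ?thesis using a rad by (simp add: disc_bounds_def)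
qed

end

section \<open>Numerical estimates\<close>

text \<open>Both sides increase with \<open>x\<close>, so on a short interval the left side at the
  right end is compared with the right side at the left end. The lemmas below cut their ranges
  finely enough for this; 45349584 and 90699168 are 16 and 32 times 2834349.\<close>

lemma poly1_step:
  fixes x :: real
  assumes "a \<le> x" "x \<le> b" "0 \<le> a" "0 \<le> c" "256*(1+b)^2*(2+b)*(11/5*b+32/5)^4 \<le> c * a^3"
  shows "256*(1+x)^2*(2+x)*(11/5*x+32/5)^4 \<le> c * x^3"
proof -
  have "256*(1+x)^2*(2+x)*(11/5*x+32/5)^4 \<le> 256*(1+b)^2*(2+b)*(11/5*b+32/5)^4"
    using assms by (intro mult_mono power_mono) auto
  moreover have "c * a^3 \<le> c * x^3" using assms by (intro mult_left_mono power_mono) auto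
  ultimately show ?thesis using assms by linarith
qed

lemma poly2_step:
  fixes x :: real
  assumes "a \<le> x" "x \<le> b" "0 \<le> a" "16384*(1+b)^2*(2+b)*(32/3+b)^2 \<le> 45349584 * a"
  shows "16384*(1+x)^2*(2+x)*(32/3+x)^2 \<le> 45349584 * x"
proof -
  have "16384*(1+x)^2*(2+x)*(32/3+x)^2 \<le> 16384*(1+b)^2*(2+b)*(32/3+b)^2"
    using assms by (intro mult_mono power_mono) auto
  then show ?thesis using assms by linarith
qed

lemma poly3_step:
  fixes x :: real
  assumes "a \<le> x" "x \<le> b" "0 \<le> a" "1024*(1+b)^2*(2+b)*(b+16/3)^2*(b+32/3)^2 \<le> 45349584 * a^3"
  shows "1024*(1+x)^2*(2+x)*(x+16/3)^2*(x+32/3)^2 \<le> 45349584 * x^3"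
proof -
  have "1024*(1+x)^2*(2+x)*(x+16/3)^2*(x+32/3)^2 \<le> 1024*(1+b)^2*(2+b)*(b+16/3)^2*(b+32/3)^2"
    using assms by (intro mult_mono power_mono) auto
  moreover have "45349584 * a^3 \<le> 45349584 * x^3" using assms by (intro mult_left_mono power_mono) auto
  ultimately show ?thesis using assms by linarith
qed

lemma poly1a:
  fixes x :: real assumes "807/2500 \<le> x" "x \<le> 1/2" shows "256*(1+x)^2*(2+x)*(11/5*x+32/5)^4 \<le> 90699168 * x^3"
proof -
  consider "807/2500 \<le> x" "x \<le> 1829/5000" | "1829/5000 \<le> x" "x \<le> 1227/2500" | "1227/2500 \<le> x" "x \<le> 1/2"
    using assms by linarith
  then show ?thesis
  proof cases
    case 1 show ?thesis by (rule poly1_step[OF 1]) (simp_all add: power2_eq_square eval_nat_numeral)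
  next
    case 2 show ?thesis by (rule poly1_step[OF 2]) (simp_all add: power2_eq_square eval_nat_numeral)
  next
    case 3 show ?thesis by (rule poly1_step[OF 3]) (simp_all add: power2_eq_square eval_nat_numeral)
  qed
qed

lemma poly1b:
  fixes x :: real assumes "581/1000 \<le> x" "x \<le> 398/125" shows "256*(1+x)^2*(2+x)*(11/5*x+32/5)^4 \<le> 45349584 * x^3"
proof -
  consider "581/1000 \<le> x" "x \<le> 743/1000" | "743/1000 \<le> x" "x \<le> 1043/1000" | "1043/1000 \<le> x" "x \<le> 759/500" | "759/500 \<le> x" "x \<le> 1069/500" | "1069/500 \<le> x" "x \<le> 1401/500" | "1401/500 \<le> x" "x \<le> 398/125"
    using assms by linarith
  then show ?thesis
  proof cases
    case 1 show ?thesis by (rule poly1_step[OF 1]) (simp_all add: power2_eq_square eval_nat_numeral)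
  next
    case 2 show ?thesis by (rule poly1_step[OF 2]) (simp_all add: power2_eq_square eval_nat_numeral)
  next
    case 3 show ?thesis by (rule poly1_step[OF 3]) (simp_all add: power2_eq_square eval_nat_numeral)
  next
    case 4 show ?thesis by (rule poly1_step[OF 4]) (simp_all add: power2_eq_square eval_nat_numeral)
  next
    case 5 show ?thesis by (rule poly1_step[OF 5]) (simp_all add: power2_eq_square eval_nat_numeral)
  next
    case 6 show ?thesis by (rule poly1_step[OF 6]) (simp_all add: power2_eq_square eval_nat_numeral)
  qed
qed

lemma poly2:
  fixes x :: real assumes "59/500 \<le> x" "x \<le> 1693/1000" shows "16384*(1+x)^2*(2+x)*(32/3+x)^2 \<le> 45349584 * x"
proof -
  consider "59/500 \<le> x" "x \<le> 71/500" | "71/500 \<le> x" "x \<le> 221/1000" | "221/1000 \<le> x" "x \<le> 429/1000" | "429/1000 \<le> x" "x \<le> 797/1000" | "797/1000 \<le> x" "x \<le> 151/125" | "151/125 \<le> x" "x \<le> 61/40" | "61/40 \<le> x" "x \<le> 1693/1000"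
    using assms by linarith
  then show ?thesis
  proof cases
    case 1 show ?thesis by (rule poly2_step[OF 1]) (simp_all add: power2_eq_square eval_nat_numeral)
  next
    case 2 show ?thesis by (rule poly2_step[OF 2]) (simp_all add: power2_eq_square eval_nat_numeral)
  next
    case 3 show ?thesis by (rule poly2_step[OF 3]) (simp_all add: power2_eq_square eval_nat_numeral)
  next
    case 4 show ?thesis by (rule poly2_step[OF 4]) (simp_all add: power2_eq_square eval_nat_numeral)
  next
    case 5 show ?thesis by (rule poly2_step[OF 5]) (simp_all add: power2_eq_square eval_nat_numeral)
  next
    case 6 show ?thesis by (rule poly2_step[OF 6]) (simp_all add: power2_eq_square eval_nat_numeral)
  next
    case 7 show ?thesis by (rule poly2_step[OF 7]) (simp_all add: power2_eq_square eval_nat_numeral)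
  qed
qed

lemma poly3a:
  fixes x :: real assumes "869/500 \<le> x" "x \<le> 2117/1000" shows "1024*(1+x)^2*(2+x)*(x+16/3)^2*(x+32/3)^2 \<le> 45349584 * x^3"
proof -
  consider "869/500 \<le> x" "x \<le> 179/100" | "179/100 \<le> x" "x \<le> 1853/1000" | "1853/1000 \<le> x" "x \<le> 241/125" | "241/125 \<le> x" "x \<le> 252/125" | "252/125 \<le> x" "x \<le> 2117/1000"
    using assms by linarith
  then show ?thesis
  proof cases
    case 1 show ?thesis by (rule poly3_step[OF 1]) (simp_all add: power2_eq_square eval_nat_numeral)
  next
    case 2 show ?thesis by (rule poly3_step[OF 2]) (simp_all add: power2_eq_square eval_nat_numeral)
  next
    case 3 show ?thesis by (rule poly3_step[OF 3]) (simp_all add: power2_eq_square eval_nat_numeral)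
  next
    case 4 show ?thesis by (rule poly3_step[OF 4]) (simp_all add: power2_eq_square eval_nat_numeral)
  next
    case 5 show ?thesis by (rule poly3_step[OF 5]) (simp_all add: power2_eq_square eval_nat_numeral)
  qed
qed

lemma poly3b:
  fixes x :: real assumes "2117/1000 \<le> x" "x \<le> 346/125" shows "1024*(1+x)^2*(2+x)*(x+16/3)^2*(x+32/3)^2 \<le> 45349584 * x^3"
proof -
  consider "2117/1000 \<le> x" "x \<le> 223/100" | "223/100 \<le> x" "x \<le> 1177/500" | "1177/500 \<le> x" "x \<le> 2487/1000" | "2487/1000 \<le> x" "x \<le> 1313/500" | "1313/500 \<le> x" "x \<le> 346/125"
    using assms by linarith
  then show ?thesis
  proof cases
    case 1 show ?thesis by (rule poly3_step[OF 1]) (simp_all add: power2_eq_square eval_nat_numeral)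
  next
    case 2 show ?thesis by (rule poly3_step[OF 2]) (simp_all add: power2_eq_square eval_nat_numeral)
  next
    case 3 show ?thesis by (rule poly3_step[OF 3]) (simp_all add: power2_eq_square eval_nat_numeral)
  next
    case 4 show ?thesis by (rule poly3_step[OF 4]) (simp_all add: power2_eq_square eval_nat_numeral)
  next
    case 5 show ?thesis by (rule poly3_step[OF 5]) (simp_all add: power2_eq_square eval_nat_numeral)
  qed
qed

lemma poly3c:
  fixes x :: real assumes "346/125 \<le> x" "x \<le> 398/125" shows "1024*(1+x)^2*(2+x)*(x+16/3)^2*(x+32/3)^2 \<le> 45349584 * x^3"
proof -
  consider "346/125 \<le> x" "x \<le> 2909/1000" | "2909/1000 \<le> x" "x \<le> 609/200" | "609/200 \<le> x" "x \<le> 1587/500" | "1587/500 \<le> x" "x \<le> 398/125"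
    using assms by linarith
  then show ?thesis
  proof cases
    case 1 show ?thesis by (rule poly3_step[OF 1]) (simp_all add: power2_eq_square eval_nat_numeral)
  next
    case 2 show ?thesis by (rule poly3_step[OF 2]) (simp_all add: power2_eq_square eval_nat_numeral)
  next
    case 3 show ?thesis by (rule poly3_step[OF 3]) (simp_all add: power2_eq_square eval_nat_numeral)
  next
    case 4 show ?thesis by (rule poly3_step[OF 4]) (simp_all add: power2_eq_square eval_nat_numeral)
  qed
qed

lemma poly3:
  fixes x :: real assumes "869/500 \<le> x" "x \<le> 398/125" shows "1024*(1+x)^2*(2+x)*(x+16/3)^2*(x+32/3)^2 \<le> 45349584 * x^3"
  using poly3a[of x] poly3b[of x] poly3c[of x] assms by linarith

section \<open>Estimates for a line between two others\<close>

lemma le_of_sq: fixes q v :: real assumes "q^2 \<le> v^2" "0 \<le> v" shows "q \<le> v"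
  using assms by (rule power2_le_imp_le)

text \<open>In the coordinates \<open>c, s\<close> (hyperbolic cosine and sine of the distance of a line from \<open>\<rho>\<^sup>\<bottom>\<close>)
  the Gram entry of two lines is a function of those with a line between them, monotone in all data.\<close>
lemma middle_line:
  fixes a b :: real
  assumes c: "c0^2 = 1 + s0^2" "c1^2 = 1 + s1^2" "c2^2 = 1 + s2^2" and pos: "s0 > 0" "s1 > 0" "s2 > 0"
    and ab: "a \<ge> 0" "b \<ge> 0" and u: "u = s1 * s0 * cosh a - c1 * c0" and w: "w = s0 * s2 * cosh b - c0 * c2"
    and V: "V = s1 * s2 * cosh (a + b) - c1 * c2"
  shows "s0^2 * V = u * w + c0 * (u * c2 + w * c1) + c1 * c2
    + sqrt (u^2 + 2*u*c1*c0 + c1^2 + s0^2) * sqrt (w^2 + 2*w*c2*c0 + c2^2 + s0^2)"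
proof -
  have sh: "s1 * s0 * sinh a = sqrt (u^2 + 2*u*c1*c0 + c1^2 + s0^2)"
    if "c1^2 = 1 + s1^2" "u = s1 * s0 * cosh a - c1 * c0" "a \<ge> 0" "s1 > 0" for u c1 s1 a
  proof -
    have e: "s1 * s0 * cosh a = u + c1 * c0" using that by simp
    have "(s1 * s0 * sinh a)^2 = (s1 * s0 * cosh a)^2 - s1^2 * s0^2"
      by (simp add: power_mult_distrib sinh_square_eq algebra_simps)
    also have "\<dots> = u^2 + 2*u*c1*c0 + (c1^2 * c0^2 - s1^2 * s0^2)" unfolding e by (simp add: power2_eq_square algebra_simps)
    also have "c1^2 * c0^2 - s1^2 * s0^2 = c1^2 + s0^2" unfolding that(1) c(1) by (simp add: algebra_simps)
    finally have "(s1 * s0 * sinh a)^2 = u^2 + 2*u*c1*c0 + c1^2 + s0^2" by (simp add: algebra_simps)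
    moreover have "s1 * s0 * sinh a \<ge> 0" using that pos by simp
    ultimately show ?thesis by (metis real_sqrt_unique)
  qed
  have w': "w = s2 * s0 * cosh b - c2 * c0" using w by (simp add: mult_ac)
  have "s0^2 * V = (s1 * s0 * cosh a) * (s2 * s0 * cosh b) + (s1 * s0 * sinh a) * (s2 * s0 * sinh b) - s0^2 * c1 * c2"
    unfolding V cosh_add by (simp add: power2_eq_square algebra_simps)
  also have "(s1 * s0 * cosh a) * (s2 * s0 * cosh b) = (u + c1 * c0) * (w + c2 * c0)" unfolding u w' by simp
  also have "(u + c1 * c0) * (w + c2 * c0) + (s1 * s0 * sinh a) * (s2 * s0 * sinh b) - s0^2 * c1 * c2
     = u * w + c0 * (u * c2 + w * c1) + c1 * c2 * (c0^2 - s0^2) + (s1 * s0 * sinh a) * (s2 * s0 * sinh b)"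
    by (simp add: algebra_simps power2_eq_square)
  finally show ?thesis unfolding sh[OF c(2) u ab(1) pos(2)] sh[OF c(3) w' ab(2) pos(3)] c(1) by simp
qed

lemma middle_line_le:
  fixes a b :: real
  assumes c: "c0^2 = 1 + s0^2" "c1^2 = 1 + s1^2" "c2^2 = 1 + s2^2" and pos: "s0 > 0" "s1 > 0" "s2 > 0" "c0 > 0" "c1 > 0" "c2 > 0"
    and ab: "a \<ge> 0" "b \<ge> 0" and u: "u = s1 * s0 * cosh a - c1 * c0" and w: "w = s0 * s2 * cosh b - c0 * c2"
    and V: "V = s1 * s2 * cosh (a + b) - c1 * c2"
    and le: "0 \<le> u" "u \<le> U" "0 \<le> w" "w \<le> W" "c1 \<le> C" "c2 \<le> C"
  shows "s0^2 * V \<le> U * W + c0 * C * (U + W) + C^2 + sqrt (U^2 + 2*U*C*c0 + C^2 + s0^2) * sqrt (W^2 + 2*W*C*c0 + C^2 + s0^2)"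
proof -
  have C: "C > 0" and UW: "U \<ge> 0" "W \<ge> 0" using le pos by linarith+
  have e: "s0^2 * V = u * w + c0 * (u * c2 + w * c1) + c1 * c2
    + sqrt (u^2 + 2*u*c1*c0 + c1^2 + s0^2) * sqrt (w^2 + 2*w*c2*c0 + c2^2 + s0^2)"
    by (rule middle_line[OF c pos(1-3) ab u w V])
  have 1: "u * w \<le> U * W" using le UW by (intro mult_mono) auto
  have 2: "c0 * (u * c2 + w * c1) \<le> c0 * (U * C + W * C)" using le UW pos C by (intro mult_left_mono add_mono mult_mono) auto
  have 3: "c1 * c2 \<le> C * C" using le pos C by (intro mult_mono) auto
  have 4: "u^2 + 2*u*c1*c0 + c1^2 + s0^2 \<le> U^2 + 2*U*C*c0 + C^2 + s0^2"
    using le UW pos C by (intro add_mono mult_mono power_mono) auto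
  have 5: "w^2 + 2*w*c2*c0 + c2^2 + s0^2 \<le> W^2 + 2*W*C*c0 + C^2 + s0^2"
    using le UW pos C by (intro add_mono mult_mono power_mono) auto
  have 6: "sqrt (u^2 + 2*u*c1*c0 + c1^2 + s0^2) * sqrt (w^2 + 2*w*c2*c0 + c2^2 + s0^2)
     \<le> sqrt (U^2 + 2*U*C*c0 + C^2 + s0^2) * sqrt (W^2 + 2*W*C*c0 + C^2 + s0^2)"
    using 4 5 le pos by (intro mult_mono real_sqrt_le_mono) auto
  show ?thesis unfolding e using 1 2 3 6 by (simp add: algebra_simps power2_eq_square)
qed

text \<open>From s0^2 >= 5/3 one may replace 1 by 3/5 s0^2 and c0^2 by 8/5 s0^2 as upper bounds,
  after which s0^2 cancels.\<close>

lemma middle_line_far: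
  fixes a b :: real
  assumes c: "c0^2 = 1 + s0^2" "c1^2 = 1 + s1^2" "c2^2 = 1 + s2^2" and pos: "s0 > 0" "s1 > 0" "s2 > 0" "c0 > 0" "c1 > 0" "c2 > 0"
    and ab: "a \<ge> 0" "b \<ge> 0" and u: "u = s1 * s0 * cosh a - c1 * c0" and w: "w = s0 * s2 * cosh b - c0 * c2"
    and V: "V = s1 * s2 * cosh (a + b) - c1 * c2"
    and le: "0 \<le> u" "u \<le> U" "0 \<le> w" "w \<le> W" "c1 \<le> c0" "c2 \<le> c0" and s0: "5/3 \<le> s0^2"
    and R: "0 \<le> R" "(U+1)*(3/5*(U+1)+2) * ((W+1)*(3/5*(W+1)+2)) \<le> R^2"
  shows "V \<le> 3/5*U*W + 8/5*(U+W+1) + R"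
proof -
  have UW: "U \<ge> 0" "W \<ge> 0" using le by linarith+
  have E: "U^2 + 2*U*c0*c0 + c0^2 + s0^2 \<le> s0^2 * ((U+1)*(3/5*(U+1)+2))" if "U \<ge> 0" for U
  proof -
    have "(U+1)^2 * 1 \<le> (U+1)^2 * (3/5 * s0^2)" using s0 by (intro mult_left_mono) auto
    moreover have "U^2 + 2*U*c0*c0 + c0^2 + s0^2 = U^2 + 2*U*c0^2 + c0^2 + s0^2" by (simp add: power2_eq_square)
    ultimately show ?thesis unfolding c(1) by (simp add: power2_eq_square algebra_simps)
  qed
  have "sqrt (U^2 + 2*U*c0*c0 + c0^2 + s0^2) * sqrt (W^2 + 2*W*c0*c0 + c0^2 + s0^2)
     \<le> sqrt (s0^2 * ((U+1)*(3/5*(U+1)+2))) * sqrt (s0^2 * ((W+1)*(3/5*(W+1)+2)))"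
    using E UW pos by (intro mult_mono real_sqrt_le_mono) auto
  also have "\<dots> = s0^2 * sqrt ((U+1)*(3/5*(U+1)+2) * ((W+1)*(3/5*(W+1)+2)))"
    using pos by (simp add: real_sqrt_mult power2_eq_square)
  also have "\<dots> \<le> s0^2 * R" using R by (intro mult_left_mono real_le_lsqrt) auto
  finally have 1: "sqrt (U^2 + 2*U*c0*c0 + c0^2 + s0^2) * sqrt (W^2 + 2*W*c0*c0 + c0^2 + s0^2) \<le> s0^2 * R" .
  have UW0: "U * W \<ge> 0" using UW by simp
  have "U * W * 1 \<le> U * W * (3/5 * s0^2)" using s0 UW0 by (intro mult_left_mono) auto
  then have 2: "U * W \<le> s0^2 * (3/5 * U * W)" by (simp add: mult_ac)
  have "(U + W + 1) * c0^2 \<le> (U + W + 1) * (8/5 * s0^2)" using s0 UW unfolding c(1) by (intro mult_left_mono) auto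
  then have 3: "c0 * c0 * (U + W) + c0^2 \<le> s0^2 * (8/5 * (U + W + 1))" by (simp add: power2_eq_square algebra_simps)
  have "s0^2 * V \<le> U * W + c0 * c0 * (U + W) + c0^2 + sqrt (U^2 + 2*U*c0*c0 + c0^2 + s0^2) * sqrt (W^2 + 2*W*c0*c0 + c0^2 + s0^2)"
    by (rule middle_line_le[OF c pos ab u w V le])
  also have "\<dots> \<le> s0^2 * (3/5*U*W) + s0^2 * (8/5*(U+W+1)) + s0^2 * R" using 1 2 3 by linarith
  also have "\<dots> = s0^2 * (3/5*U*W + 8/5*(U+W+1) + R)" by (simp add: algebra_simps)
  finally show ?thesis using pos by simp
qed

section \<open>Consecutive sides\<close>

text \<open>Turns bounds on the integer \<open>al\<close> into decimal bounds on the Gram entry;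
  \<open>q\<close> is sqrt m / 2 rounded to the safe side.\<close>

lemma quarter_square_nat:
  assumes "real n = 4 * v^2" "v \<ge> 0"
  shows "m \<le> n \<Longrightarrow> 4 * q^2 \<le> real m \<Longrightarrow> q \<le> v" "n \<le> m \<Longrightarrow> real m \<le> 4 * q^2 \<Longrightarrow> 0 \<le> q \<Longrightarrow> v \<le> q"
proof -
  show "q \<le> v" if "m \<le> n" "4 * q^2 \<le> real m"
  proof (rule le_of_sq[OF _ assms(2)])
    have "real m \<le> real n" using that by simp
    then show "q^2 \<le> v^2" using that assms(1) by linarith
  qed
  show "v \<le> q" if "n \<le> m" "real m \<le> 4 * q^2" "0 \<le> q"
  proof (rule le_of_sq[OF _ that(3)])
    have "real n \<le> real m" using that by simp
    then show "v^2 \<le> q^2" using that assms(1) by linarith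
  qed
qed

lemma nat_product_le:
  assumes "real n * (real n - 4) * (real B)^2 \<le> real C" "4 \<le> n"
  shows "n * (n - 4) * (B * (B - 4)) \<le> C"
proof -
  have "real (n * (n - 4) * (B * B)) \<le> real C" using assms by (simp add: of_nat_diff power2_eq_square)
  then have "n * (n - 4) * (B * B) \<le> C" by linarith
  moreover have "n * (n - 4) * (B * (B - 4)) \<le> n * (n - 4) * (B * B)" by (intro mult_le_mono2) auto
  ultimately show ?thesis by linarith
qed

text \<open>With x = v - 1 one has n - 4 = 4x(2 + x), a zero that softens the pole in the bound on
  \<open>V\<close>. For n = 7, 8, 9 the bound with the factor 32 is used, admissible as none of them
  is 2 modulo 4.\<close>

lemma two_bubbles_numeric:
  assumes n: "real n = 4 * v^2" "v \<ge> 0" "7 \<le> n" "n \<le> 70"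
    and V: "0 \<le> V" "V \<le> 11/5 + 32/5 / (v - 1)" "real B = 4 * V^2"
  shows "B \<le> 4561" "n * (n - 4) * (B * (B - 4)) \<le> 16 * 2834349
      \<or> n mod 4 \<noteq> 2 \<and> n * (n - 4) * (B * (B - 4)) \<le> 32 * 2834349"
proof -
  define x where "x = v - 1"
  have "1.3228 \<le> v" using quarter_square_nat(1)[OF n(1,2,3), of "1.3228"] by (simp add: power2_eq_square)
  then have x1: "0.3228 \<le> x" by (simp add: x_def)
  have "v \<le> 4.184" using quarter_square_nat(2)[OF n(1,2,4), of "4.184"] by (simp add: power2_eq_square)
  then have x2: "x \<le> 3.184" by (simp add: x_def)
  have x0: "x > 0" using x1 by simp
  have nv: "real n * (real n - 4) = 16 * ((1+x)^2 * (x * (2+x)))" unfolding n(1) x_def by (simp add: power2_eq_square algebra_simps)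
  have Vx: "V * x \<le> 11/5*x + 32/5" using V(2) x0 by (simp add: x_def[symmetric] field_simps)
  have "V \<le> 11/5 + 32/5/0.3228"
  proof -
    have "32/5 / x \<le> 32/5/0.3228" using x1 by (intro divide_left_mono) auto
    then show ?thesis using V(2) by (simp add: x_def)
  qed
  then have "V \<le> 23" by simp
  then have "V^2 \<le> 23^2" using V(1) by (intro power_mono)
  then have "real B \<le> 4 * 23^2" using V(3) by simp
  then show "B \<le> 4561" by simp
  have key: "n * (n - 4) * (B * (B - 4)) \<le> C"
    if "256*(1+x)^2*(2+x)*(11/5*x+32/5)^4 \<le> real C * x^3" for C
  proof (rule nat_product_le)
    have "x^3 * (real n * (real n - 4) * (real B)^2) = 256 * (1+x)^2 * (2+x) * (V*x)^4"
      unfolding nv V(3) by (simp add: power2_eq_square eval_nat_numeral)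
    also have "\<dots> \<le> 256 * (1+x)^2 * (2+x) * (11/5*x+32/5)^4"
      using Vx V(1) x0 by (intro mult_left_mono power_mono) auto
    also have "\<dots> \<le> x^3 * real C" using that by (simp add: mult.commute)
    finally show "real n * (real n - 4) * (real B)^2 \<le> real C" using x0 by simp
  qed (use n in simp)
  show "n * (n - 4) * (B * (B - 4)) \<le> 16 * 2834349
      \<or> n mod 4 \<noteq> 2 \<and> n * (n - 4) * (B * (B - 4)) \<le> 32 * 2834349"
  proof (cases "n \<le> 9")
    case True
    then have "n = 7 \<or> n = 8 \<or> n = 9" using n by auto
    then have m: "n mod 4 \<noteq> 2" by auto
    have "v \<le> 1.5" using quarter_square_nat(2)[OF n(1,2) True, of "1.5"] by (simp add: power2_eq_square)
    then have "x \<le> 1/2" by (simp add: x_def)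
    then show ?thesis using key[of "32 * 2834349"] poly1a[of x] x1 m by simp
  next
    case False
    then have "10 \<le> n" by simp
    then have "1.581 \<le> v" using quarter_square_nat(1)[OF n(1,2), of 10 "1.581"] by (simp add: power2_eq_square)
    then have "581/1000 \<le> x" by (simp add: x_def)
    then show ?thesis using key[of "16 * 2834349"] poly1b[of x] x2 by simp
  qed
qed

text \<open>The bounds on \<open>B\<close> are large only when v is close to 1, where n - 4 is
  small. From n = 30 on, v - 1 is at least 1.738, which makes s^2 small enough for the cruder bound
  with the factor 1 + s^2.\<close>

lemma bubble_cover_numeric:
  assumes n: "real n = 4 * v^2" "v \<ge> 0" "5 \<le> n" "n \<le> 70" and s: "s^2 * (v - 1) \<le> 16/3"
    and B: "n \<le> 29 \<Longrightarrow> real B \<le> 16 * (4 * s^2 + 2)" "n \<ge> 30 \<Longrightarrow> real B \<le> 4 * (1 + s^2) * (4 * s^2 + 2)"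
  shows "B \<le> 4561" "n * (n - 4) * (B * (B - 4)) \<le> 16 * 2834349"
proof -
  define x where "x = v - 1"
  have "1.118 \<le> v" using quarter_square_nat(1)[OF n(1,2,3), of "1.118"] by (simp add: power2_eq_square)
  then have x1: "0.118 \<le> x" by (simp add: x_def)
  have "v \<le> 4.184" using quarter_square_nat(2)[OF n(1,2,4), of "4.184"] by (simp add: power2_eq_square)
  then have x2: "x \<le> 3.184" by (simp add: x_def)
  have x0: "x > 0" using x1 by simp
  have nv: "real n * (real n - 4) = 16 * ((1+x)^2 * (x * (2+x)))" unfolding n(1) x_def by (simp add: power2_eq_square algebra_simps)
  have sx: "s^2 * x \<le> 16/3" using s by (simp add: x_def)
  have "B \<le> 4561 \<and> n * (n - 4) * (B * (B - 4)) \<le> 16 * 2834349"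
  proof (cases "n \<le> 29")
    case True
    have "v \<le> 2.693" using quarter_square_nat(2)[OF n(1,2) True, of "2.693"] by (simp add: power2_eq_square)
    then have x3: "x \<le> 1.693" by (simp add: x_def)
    have "real B * x \<le> 16 * (4 * s^2 + 2) * x" using B(1)[OF True] x0 by (intro mult_right_mono) auto
    also have "\<dots> \<le> 32 * (32/3 + x)" using sx by (simp add: algebra_simps)
    finally have Bx: "real B * x \<le> 32 * (32/3 + x)" .
    have "32 * (32/3 + x) \<le> 4000 * x" using x1 by simp
    then have "real B * x \<le> 4000 * x" using Bx by linarith
    then have "real B \<le> 4000" using x0 by simp
    moreover have "n * (n - 4) * (B * (B - 4)) \<le> 16 * 2834349"
    proof (rule nat_product_le)
      have "x * (real n * (real n - 4) * (real B)^2) = 16 * (1+x)^2 * (2+x) * (real B * x)^2"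
        unfolding nv by (simp add: power2_eq_square)
      also have "\<dots> \<le> 16 * (1+x)^2 * (2+x) * (32 * (32/3 + x))^2"
        using Bx x0 by (intro mult_left_mono power_mono) auto
      also have "\<dots> = 16384*(1+x)^2*(2+x)*(32/3+x)^2" unfolding power_mult_distrib[of 32] by simp
      also have "\<dots> \<le> 45349584 * x" by (rule poly2) (use x1 x3 in auto)
      finally have "x * (real n * (real n - 4) * (real B)^2) \<le> x * 45349584" by (simp add: mult.commute)
      then have "real n * (real n - 4) * (real B)^2 \<le> 45349584" using x0 by simp
      then show "real n * (real n - 4) * (real B)^2 \<le> real (16 * 2834349)" by simp
    qed (use n in simp)
    ultimately show ?thesis by simp
  next
    case False
    then have n30: "30 \<le> n" by simp
    have "2.738 \<le> v" using quarter_square_nat(1)[OF n(1,2) n30, of "2.738"] by (simp add: power2_eq_square)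
    then have x3: "1.738 \<le> x" by (simp add: x_def)
    have "real B * x^2 \<le> 4 * (1 + s^2) * (4 * s^2 + 2) * x^2" using B(2)[OF n30] x0 by (intro mult_right_mono) auto
    also have "\<dots> = 8 * ((x + s^2 * x) * (x + 2 * (s^2 * x)))" by (simp add: power2_eq_square algebra_simps)
    also have "\<dots> \<le> 8 * ((x + 16/3) * (x + 2 * (16/3)))"
      using sx x0 by (intro mult_left_mono mult_mono add_mono) auto
    finally have Bx: "real B * x^2 \<le> 8 * ((x + 16/3) * (x + 32/3))" by simp
    have "8 * ((x + 16/3) * (x + 32/3)) \<le> 8 * ((3.184 + 16/3) * (3.184 + 32/3))"
      using x2 x0 by (intro mult_left_mono mult_mono) auto
    also have "\<dots> \<le> 4000 * 1.738^2" by (simp add: power2_eq_square)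
    also have "\<dots> \<le> 4000 * x^2" using x3 by (intro mult_left_mono power_mono) auto
    finally have "real B * x^2 \<le> 4000 * x^2" using Bx by linarith
    then have "real B \<le> 4000" using x0 by simp
    moreover have "n * (n - 4) * (B * (B - 4)) \<le> 16 * 2834349"
    proof (rule nat_product_le)
      have "x^3 * (real n * (real n - 4) * (real B)^2) = 16 * (1+x)^2 * (2+x) * (real B * x^2)^2"
        unfolding nv by (simp add: power2_eq_square eval_nat_numeral)
      also have "\<dots> \<le> 16 * (1+x)^2 * (2+x) * (8 * ((x + 16/3) * (x + 32/3)))^2"
        using Bx x0 by (intro mult_left_mono power_mono) auto
      also have "\<dots> = 1024*(1+x)^2*(2+x)*(x+16/3)^2*(x+32/3)^2" by (simp add: power2_eq_square)
      also have "\<dots> \<le> 45349584 * x^3" by (rule poly3) (use x2 x3 in auto)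
      finally have "x^3 * (real n * (real n - 4) * (real B)^2) \<le> x^3 * 45349584" by (simp add: mult.commute)
      then have "real n * (real n - 4) * (real B)^2 \<le> 45349584" using x0 by simp
      then show "real n * (real n - 4) * (real B)^2 \<le> real (16 * 2834349)" by simp
    qed (use n in simp)
    ultimately show ?thesis by simp
  qed
  then show "B \<le> 4561" "n * (n - 4) * (B * (B - 4)) \<le> 16 * 2834349" by auto
qed

locale refl_prim = refl +
  assumes prim_form: "primitive_form G"
begin

text \<open>\<epsilon> orients the chain, so an estimate for the next side yields one for the
  previous side by reversal.\<close>

definition chn where
  "chn \<epsilon> \<sigma> e \<longleftrightarrow> (\<epsilon> = 1 \<or> \<epsilon> = -1) \<and> (\<sigma> = 1 \<or> \<sigma> = -1) \<and>
     (\<forall>i::int. e i \<in> Wk \<sigma> \<and> \<epsilon> * ht (e i) < \<epsilon> * ht (e (i+1)) \<and> nv G (e i) (e (i+1)) \<le> 1)"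

text \<open>Skipping bubbles keeps the Gram entries of consecutive sides bounded, and two adjacent bubbles
  already suffice for the four-walls criterion. So only the sides between bubbles have to be maximised over.\<close>
definition bubble :: "(int \<Rightarrow> real^3) \<Rightarrow> int \<Rightarrow> bool" where
  "bubble e i \<longleftrightarrow> nv G (e (i-1)) (e i) = 0 \<and> nv G (e i) (e (i+1)) = 0 \<and> al (e (i-1)) (e (i+1)) \<le> 70"

lemma chn_reverse: assumes "chn \<epsilon> \<sigma> e" shows "chn (- \<epsilon>) \<sigma> (\<lambda>i::int. e (- i))"
  unfolding chn_def
proof (intro conjI allI)
  fix i :: int
  have h: "e (- i - 1) \<in> Wk \<sigma>" "\<epsilon> * ht (e (- i - 1)) < \<epsilon> * ht (e (- i - 1 + 1))" "nv G (e (- i - 1)) (e (- i - 1 + 1)) \<le> 1"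
    using assms unfolding chn_def by blast+
  show "- \<epsilon> * ht (e (- i)) < - \<epsilon> * ht (e (- (i + 1)))" "nv G (e (- i)) (e (- (i + 1))) \<le> 1"
    using h nv_sym by simp_all
qed (use assms in \<open>auto simp: chn_def\<close>)

lemma bubble_reverse: "bubble (\<lambda>i. e (- i)) i \<longleftrightarrow> bubble e (- i)"
proof -
  have m: "- (i - 1) = - i + 1" "- (i + 1) = - i - 1" by simp_all
  show ?thesis unfolding bubble_def m
    using nv_sym[of "e (- i)" "e (- i - 1)"] nv_sym[of "e (- i)" "e (- i + 1)"] al_sym[of "e (- i - 1)" "e (- i + 1)"] by auto
qed

lemma Wk_side: "e \<in> Wk \<sigma> \<Longrightarrow> side \<sigma> e" and Wk_wall: "e \<in> Wk \<sigma> \<Longrightarrow> wall e" by (auto simp: Wk_def)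

lemma Wk_h: assumes "e \<in> Wk \<sigma>" shows "hs e > 0" "hc e > 0" "(hc e)^2 = 1 + (hs e)^2" "hc e > 1" "hs e < hc e"
proof -
  show p: "hs e > 0" "hc e > 0" "(hc e)^2 = 1 + (hs e)^2" using hs_pos hc_pos hc_hs Wk_side assms by blast+
  have "(hs e)^2 > 0" using p by simp
  then have "1^2 < (hc e)^2" by (simp add: p(3))
  then show "hc e > 1" by (rule power2_less_imp_less[OF _ less_imp_le[OF p(2)]])
  have "(hs e)^2 < (hc e)^2" by (simp add: p(3))
  then show "hs e < hc e" by (rule power2_less_imp_less[OF _ less_imp_le[OF p(2)]])
qed

lemma hc_mono: "x \<in> Wk \<sigma> \<Longrightarrow> y \<in> Wk \<tau> \<Longrightarrow> hs x \<le> hs y \<Longrightarrow> hc x \<le> hc y"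
proof -
  assume a: "x \<in> Wk \<sigma>" "y \<in> Wk \<tau>" "hs x \<le> hs y"
  have "(hs x)^2 \<le> (hs y)^2" using a Wk_h(1)[OF a(1)] by (intro power_mono) auto
  then have "(hc x)^2 \<le> (hc y)^2" by (simp add: Wk_h(3)[OF a(1)] Wk_h(3)[OF a(2)])
  then show "hc x \<le> hc y" by (rule power2_le_imp_le[OF _ less_imp_le[OF Wk_h(2)[OF a(2)]]])
qed

lemma al_wall: "wall e \<Longrightarrow> wall f \<Longrightarrow> real (al e f) = 4 * (nv G e f)^2"
  using al wall_root by blast

section \<open>Three lines in order on the same side of the geodesic\<close>

context
  fixes \<sigma> \<epsilon> :: real and x y z
  assumes \<sigma>: "\<sigma> = 1 \<or> \<sigma> = -1" and \<epsilon>: "\<epsilon> = 1 \<or> \<epsilon> = -1"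
    and W: "x \<in> Wk \<sigma>" "y \<in> Wk \<sigma>" "z \<in> Wk \<sigma>" and ord: "\<epsilon> * ht x < \<epsilon> * ht y" "\<epsilon> * ht y < \<epsilon> * ht z"
begin

lemma mid_facts:
  shows "nv G x y = hs x * hs y * cosh (\<epsilon> * (ht y - ht x)) - hc x * hc y"
    and "nv G y z = hs y * hs z * cosh (\<epsilon> * (ht z - ht y)) - hc y * hc z"
    and "nv G x z = hs x * hs z * cosh (\<epsilon> * (ht y - ht x) + \<epsilon> * (ht z - ht y)) - hc x * hc z"
    and "\<epsilon> * (ht y - ht x) \<ge> 0" "\<epsilon> * (ht z - ht y) \<ge> 0"
proof -
  have c: "cosh (\<epsilon> * (b - a)) = cosh (a - b)" for a b :: real
    using \<epsilon> cosh_minus[of "a - b"] by auto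
  have s: "side \<sigma> x" "side \<sigma> y" "side \<sigma> z" using W Wk_side by auto
  have ss: "\<sigma> * \<sigma> = 1" using \<sigma> by auto
  show "nv G x y = hs x * hs y * cosh (\<epsilon> * (ht y - ht x)) - hc x * hc y"
    "nv G y z = hs y * hs z * cosh (\<epsilon> * (ht z - ht y)) - hc y * hc z"
    using nv_formula[OF s(1) \<sigma> s(2) \<sigma>] nv_formula[OF s(2) \<sigma> s(3) \<sigma>] by (simp_all add: ss c)
  have "\<epsilon> * (ht y - ht x) + \<epsilon> * (ht z - ht y) = \<epsilon> * (ht z - ht x)" by (simp add: algebra_simps)
  then show "nv G x z = hs x * hs z * cosh (\<epsilon> * (ht y - ht x) + \<epsilon> * (ht z - ht y)) - hc x * hc z"
    using nv_formula[OF s(1) \<sigma> s(3) \<sigma>] by (simp add: ss c)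
  show "\<epsilon> * (ht y - ht x) \<ge> 0" "\<epsilon> * (ht z - ht y) \<ge> 0" using ord by (auto simp: algebra_simps)
qed

lemma mid_distinct: "x \<noteq> y" "y \<noteq> z" "x \<noteq> z" using ord by auto

lemma mid_nonneg: "nv G x y \<ge> 0" "nv G y z \<ge> 0" "nv G x z \<ge> 0"
  using mid_distinct W Wk_wall wall_nv_ge by auto

lemma mid_eq: "(hs y)^2 * nv G x z = nv G x y * nv G y z + hc y * (nv G x y * hc z + nv G y z * hc x) + hc x * hc z
    + sqrt ((nv G x y)^2 + 2*nv G x y*hc x*hc y + (hc x)^2 + (hs y)^2) * sqrt ((nv G y z)^2 + 2*nv G y z*hc z*hc y + (hc z)^2 + (hs y)^2)"
  by (rule middle_line[OF _ _ _ _ _ _ mid_facts(4,5,1,2,3)]) (use Wk_h W in auto)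

lemma mid_pos: "nv G x z > 0"
proof -
  have p: "hs y > 0" "hc x > 0" "hc y > 0" "hc z > 0" using Wk_h W by auto
  have "nv G x y * nv G y z + hc y * (nv G x y * hc z + nv G y z * hc x) \<ge> 0" "hc x * hc z > 0"
    using mid_nonneg p by simp_all
  moreover have "sqrt ((nv G x y)^2 + 2*nv G x y*hc x*hc y + (hc x)^2 + (hs y)^2) * sqrt ((nv G y z)^2 + 2*nv G y z*hc z*hc y + (hc z)^2 + (hs y)^2) \<ge> 0"
    using mid_nonneg p by (intro mult_nonneg_nonneg real_sqrt_ge_zero add_nonneg_nonneg) auto
  ultimately have "(hs y)^2 * nv G x z > 0" unfolding mid_eq by linarith
  then show ?thesis using Wk_h(1)[OF W(2)] by (simp add: zero_less_mult_iff)
qed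

text \<open>In \<open>mid_eq\<close> only the terms free of the two vanishing entries survive. Each
  square root is at least \<open>hs y\<close>, so the outer lines are disjoint, and a far middle
  line brings their entry close to 1.\<close>

lemma mid_right_angles:
  assumes "nv G x y = 0" "nv G y z = 0"
  shows "nv G x z > 1" "hc x \<le> C \<Longrightarrow> hc z \<le> C \<Longrightarrow> (hs y)^2 * (nv G x z - 1) \<le> 2 * C^2"
proof -
  have e: "(hs y)^2 * nv G x z = hc x * hc z + sqrt ((hc x)^2 + (hs y)^2) * sqrt ((hc z)^2 + (hs y)^2)"
    using mid_eq assms by simp
  have p: "hs y > 0" "hc x > 0" "hc z > 0" using Wk_h W by auto
  have "(hs y)^2 = sqrt ((hs y)^2) * sqrt ((hs y)^2)" by (simp add: power2_eq_square)
  also have "\<dots> \<le> sqrt ((hc x)^2 + (hs y)^2) * sqrt ((hc z)^2 + (hs y)^2)" using p by (intro mult_mono real_sqrt_le_mono) auto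
  finally have "(hs y)^2 * nv G x z > (hs y)^2 * 1" unfolding e using p by (simp add: add_pos_nonneg add.commute add_strict_increasing)
  then show "nv G x z > 1" using p by (simp only: mult_less_cancel_left_pos zero_less_power)
  assume C: "hc x \<le> C" "hc z \<le> C"
  have "sqrt ((hc x)^2 + (hs y)^2) * sqrt ((hc z)^2 + (hs y)^2) \<le> sqrt (C^2 + (hs y)^2) * sqrt (C^2 + (hs y)^2)"
    using p C by (intro mult_mono real_sqrt_le_mono add_mono power_mono) auto
  also have "\<dots> = C^2 + (hs y)^2" by simp
  finally have "(hs y)^2 * nv G x z \<le> C * C + (C^2 + (hs y)^2)" unfolding e using p C by (intro add_mono mult_mono) auto
  then show "(hs y)^2 * (nv G x z - 1) \<le> 2 * C^2" by (simp add: algebra_simps power2_eq_square)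
qed

lemma mid_far:
  assumes "nv G x y \<le> U" "nv G y z \<le> U'" "hs x \<le> hs y" "hs z \<le> hs y" "5/3 \<le> (hs y)^2"
    and "0 \<le> R" "(U+1)*(3/5*(U+1)+2) * ((U'+1)*(3/5*(U'+1)+2)) \<le> R^2"
  shows "nv G x z \<le> 3/5*U*U' + 8/5*(U+U'+1) + R"
proof -
  have h: "hc w \<le> hc y" if "hs w \<le> hs y" "w \<in> Wk \<sigma>" for w using hc_mono[OF that(2) W(2) that(1)] .
  show ?thesis
    by (rule middle_line_far[OF _ _ _ _ _ _ _ _ _ mid_facts(4,5,1,2,3) mid_nonneg(1) assms(1) mid_nonneg(2) assms(2)])
       (use Wk_h W h assms in auto)
qed

end

lemma chnD:
  assumes "chn \<epsilon> \<sigma> e"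
  shows "\<epsilon> = 1 \<or> \<epsilon> = -1" "\<sigma> = 1 \<or> \<sigma> = -1" "e i \<in> Wk \<sigma>" "\<epsilon> * ht (e i) < \<epsilon> * ht (e (i+1))" "nv G (e i) (e (i+1)) \<le> 1"
    "\<epsilon> * ht (e (i-1)) < \<epsilon> * ht (e i)" "nv G (e (i-1)) (e i) \<le> 1"
    "\<epsilon> * ht (e (i+1)) < \<epsilon> * ht (e (i+2))" "nv G (e (i+1)) (e (i+2)) \<le> 1"
proof -
  have *: "e i \<in> Wk \<sigma>" "\<epsilon> * ht (e i) < \<epsilon> * ht (e (i+1))" "nv G (e i) (e (i+1)) \<le> 1" for i
    using assms by (auto simp: chn_def)
  show "\<epsilon> = 1 \<or> \<epsilon> = -1" "\<sigma> = 1 \<or> \<sigma> = -1" using assms by (auto simp: chn_def)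
  show "e i \<in> Wk \<sigma>" "\<epsilon> * ht (e i) < \<epsilon> * ht (e (i+1))" "nv G (e i) (e (i+1)) \<le> 1"
    "\<epsilon> * ht (e (i-1)) < \<epsilon> * ht (e i)" "nv G (e (i-1)) (e i) \<le> 1"
    "\<epsilon> * ht (e (i+1)) < \<epsilon> * ht (e (i+2))" "nv G (e (i+1)) (e (i+2)) \<le> 1"
    using *[of i] *[of "i-1"] *[of "i+1"] by (simp_all add: add.assoc)
qed

text \<open>\<open>four_walls\<close> with \<open>e i\<close>, orthogonal to its two neighbours and
  linked to \<open>e (i+2)\<close>. Both entries are at most 70, and (70 * 66)^2 is below 16 *
  2834349.\<close>

lemma adjacent_bubbles:
  assumes c: "chn \<epsilon> \<sigma> e" and b: "bubble e i" "bubble e (i+1)" shows disc_bounds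
proof -
  note D = chnD[OF c]
  have W: "e j \<in> Wk \<sigma>" for j by (rule D(3))
  have b2: "nv G (e i) (e (i+1)) = 0" "nv G (e (i+1)) (e (i+2)) = 0" "al (e i) (e (i+2)) \<le> 70"
    using b(2) by (simp_all add: bubble_def add.assoc)
  have b1: "nv G (e (i-1)) (e i) = 0" "al (e (i-1)) (e (i+1)) \<le> 70" using b(1) by (simp_all add: bubble_def)
  have o: "\<epsilon> * ht (e (i-1)) < \<epsilon> * ht (e i)" "\<epsilon> * ht (e i) < \<epsilon> * ht (e (i+1))" "\<epsilon> * ht (e (i+1)) < \<epsilon> * ht (e (i+2))"
    using D(4,6,8)[of i] by auto
  have p: "nv G (e i) (e (i+2)) > 0" by (rule mid_pos[OF D(2,1) W W W o(2,3)])
  let ?A = "al (e (i-1)) (e (i+1))" and ?B = "al (e i) (e (i+2))"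
  have "?A * (?A - 4) * (?B * (?B - 4)) \<le> 70 * 66 * (70 * 66)" using b1 b2 by (intro mult_le_mono) auto
  then have N: "?A * (?A - 4) * (?B * (?B - 4)) \<le> 16 * 2834349" by linarith
  show disc_bounds
    by (rule four_walls[OF prim_form Wk_wall[OF W[of i]] Wk_wall[OF W[of "i-1"]] Wk_wall[OF W[of "i+1"]] Wk_wall[OF W[of "i+2"]]])
       (use o b1 b2 p N nv_sym in \<open>auto simp: less_imp_neq\<close>)
qed

definition nxt where "nxt e i = (if bubble e (i+1) then e (i+2) else e (i+1))" for e :: "int \<Rightarrow> real^3"
definition prv where "prv e i = (if bubble e (i-1) then e (i-2) else e (i-1))" for e :: "int \<Rightarrow> real^3"

lemma nxt_props:
  assumes c: "chn \<epsilon> \<sigma> e" and nc: "\<not> disc_bounds"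
  shows "nxt e i \<in> Wk \<sigma>" "\<epsilon> * ht (e i) < \<epsilon> * ht (nxt e i)" "al (e i) (nxt e i) \<le> 70" "\<exists>j. nxt e i = e j \<and> \<not> bubble e j"
    "\<not> bubble e (i+1) \<Longrightarrow> al (e i) (nxt e i) \<le> 4" "bubble e (i+1) \<Longrightarrow> al (e i) (nxt e i) \<ge> 5"
proof -
  note D = chnD[OF c]
  have vert: "al (e i) (e (i+1)) \<le> 4"
  proof -
    have ne: "e i \<noteq> e (i+1)" using D(4)[of i] by auto
    have "0 \<le> nv G (e i) (e (i+1))" using wall_nv_ge Wk_wall D(3) ne by blast
    then have "(nv G (e i) (e (i+1)))^2 \<le> 1^2" using D(5) by (intro power_mono) auto
    then have "real (al (e i) (e (i+1))) \<le> 4" using al_wall[OF Wk_wall[OF D(3)] Wk_wall[OF D(3)]] by simp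
    then show ?thesis by linarith
  qed
  have bub: "al (e i) (e (i+2)) \<le> 70 \<and> 5 \<le> al (e i) (e (i+2)) \<and> \<not> bubble e (i+2)" if b: "bubble e (i+1)"
  proof -
    have b': "nv G (e i) (e (i+1)) = 0" "nv G (e (i+1)) (e (i+2)) = 0" "al (e i) (e (i+2)) \<le> 70"
      using b by (simp_all add: bubble_def add.assoc)
    have "nv G (e i) (e (i+2)) > 1" by (rule mid_right_angles(1)[OF D(2,1) D(3) D(3) D(3) D(4) D(8) b'(1,2)])
    then have "(nv G (e i) (e (i+2)))^2 > 1^2" by (intro power_strict_mono) auto
    then have "real (al (e i) (e (i+2))) > 4" using al_wall[OF Wk_wall[OF D(3)] Wk_wall[OF D(3)]] by simp
    moreover have "\<not> bubble e (i+1+1)" using adjacent_bubbles[OF c b] nc by blast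
    ultimately show ?thesis using b' by (simp add: add.assoc)
  qed
  show "nxt e i \<in> Wk \<sigma>" using D(3) by (simp add: nxt_def)
  show "\<epsilon> * ht (e i) < \<epsilon> * ht (nxt e i)" using D(4)[of i] D(8)[of i] by (simp add: nxt_def)
  show "al (e i) (nxt e i) \<le> 70" "\<exists>j. nxt e i = e j \<and> \<not> bubble e j"
    "\<not> bubble e (i+1) \<Longrightarrow> al (e i) (nxt e i) \<le> 4" "bubble e (i+1) \<Longrightarrow> al (e i) (nxt e i) \<ge> 5"
    using vert bub by (auto simp: nxt_def)
qed

lemma prv_nxt: "prv e i = nxt (\<lambda>i. e (- i)) (- i)"
  by (simp add: prv_def nxt_def bubble_reverse)

end

section \<open>The farthest side between bubbles\<close>

context refl_prim
begin

text \<open>\<open>nxt e i\<close> is not orthogonal to \<open>e i\<close> and, if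
  \<open>prv e i\<close> is not either, has the smaller entry. For an entry up to 6,
  \<open>three_walls\<close> applies. Otherwise \<open>e (i+1)\<close> is a bubble, and
  \<open>four_walls\<close> uses it with its neighbours \<open>e i\<close>, \<open>e (i+2)\<close>
  and with \<open>e (i-1)\<close> as fourth wall.\<close>

lemma level1_aux:
  assumes c: "chn \<epsilon> \<sigma> e" and nc: "\<not> disc_bounds" and i: "\<not> bubble e i" "5/3 \<le> (hs (e i))^2"
    and mx: "\<And>j. \<not> bubble e j \<Longrightarrow> hs (e j) \<le> hs (e i)"
    and R: "al (e i) (nxt e i) \<noteq> 0" "al (e i) (prv e i) = 0 \<or> al (e i) (nxt e i) \<le> al (e i) (prv e i)"
  shows False
proof -
  note D = chnD[OF c]
  have \<sigma>: "\<sigma> = 1 \<or> \<sigma> = -1" and \<epsilon>: "\<epsilon> = 1 \<or> \<epsilon> = -1" using D by auto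
  have W: "e j \<in> Wk \<sigma>" for j by (rule D(3))
  have cr: "chn (- \<epsilon>) \<sigma> (\<lambda>i. e (- i))" by (rule chn_reverse[OF c])
  let ?x = "prv e i" and ?y = "nxt e i"
  have y: "?y \<in> Wk \<sigma>" "\<epsilon> * ht (e i) < \<epsilon> * ht ?y" "al (e i) ?y \<le> 70" using nxt_props[OF c nc] by auto
  have x: "?x \<in> Wk \<sigma>" "\<epsilon> * ht ?x < \<epsilon> * ht (e i)" "al (e i) ?x \<le> 70"
    using nxt_props[OF cr nc, of "- i"] by (auto simp: prv_nxt)
  have xk: "hs ?x \<le> hs (e i)"
  proof -
    obtain j where "?x = e (- j)" "\<not> bubble (\<lambda>i. e (- i)) j" using nxt_props(4)[OF cr nc, of "- i"] unfolding prv_nxt by auto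
    then show ?thesis using mx[of "- j"] by (simp add: bubble_reverse)
  qed
  have yk: "hs ?y \<le> hs (e i)" using nxt_props(4)[OF c nc, of i] mx by auto
  have wl: "wall ?x" "wall (e i)" "wall ?y" using x y W Wk_wall by auto
  have ne: "?x \<noteq> e i" "e i \<noteq> ?y" "?x \<noteq> ?y" using mid_distinct[OF \<sigma> \<epsilon> x(1) W y(1) x(2) y(2)] by auto
  define u w V where "u = nv G ?x (e i)" and "w = nv G (e i) ?y" and "V = nv G ?x ?y"
  have nn: "u \<ge> 0" "w \<ge> 0" "V > 0" using mid_nonneg[OF \<sigma> \<epsilon> x(1) W y(1) x(2) y(2)] mid_pos[OF \<sigma> \<epsilon> x(1) W y(1) x(2) y(2)]
    by (auto simp: u_def w_def V_def)
  define n m where "n = al (e i) ?y" and "m = al (e i) ?x"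
  have nr: "real n = 4 * w^2" "real m = 4 * u^2" using al_wall wl nv_sym[of "e i" ?x] by (auto simp: n_def m_def u_def w_def)
  have n0: "n \<noteq> 0" "n \<le> 70" "m \<le> 70" "m = 0 \<or> n \<le> m" using R x(3) y(3) by (auto simp: n_def m_def)
  have alV: "real (al ?x ?y) = 4 * V^2" using al_wall wl by (simp add: V_def)
  show False
  proof (cases "n \<le> 6")
    case True
    have w6: "w \<le> 1.22475" using quarter_square_nat(2)[OF nr(1) nn(2) True, of "1.22475"] by (simp add: power2_eq_square)
    show False
    proof (cases "m = 0")
      case True
      \<comment> \<open>Since \<open>prv e i\<close> is orthogonal to \<open>e i\<close>, the links
        run through \<open>nxt e i\<close>. The constant 4.3922 is the square root needed in
        \<open>mid_far\<close>, rounded up.\<close>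
      then have u0: "u = 0" using nr by simp
      have "V \<le> 3/5*0*1.22475 + 8/5*(0+1.22475+1) + 4.3922" unfolding V_def
        by (rule mid_far[OF \<sigma> \<epsilon> x(1) W y(1) x(2) y(2)]) (use u0 w6 xk yk i in \<open>simp_all add: u_def w_def power2_eq_square\<close>)
      then have V8: "V \<le> 8" by simp
      then have V2: "V^2 \<le> 64" using nn power_mono[of V 8 2] by simp
      have DD: "DD (e i) ?y ?x = 4 * (w^2 + V^2 - 1)"
        using u0 nv_sym[of ?y ?x] nv_sym[of "e i" ?x] by (simp add: DD_def u_def w_def V_def)
      have w2: "4 * w^2 \<le> 6" using True nr(1) \<open>n \<le> 6\<close> by (metis of_nat_le_iff of_nat_numeral)
      have dd: "DD (e i) ?y ?x \<le> 258" unfolding DD using w2 V2 by simp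
      have av: "al ?y ?x \<le> 256" using alV V2 al_sym[of ?y ?x] by simp
      have "real (al (e i) ?y * al ?y ?x) \<le> real (6 * 256)" using av \<open>n \<le> 6\<close> unfolding n_def by (intro of_nat_mono mult_le_mono)
      then have pr: "real (al (e i) ?y * al ?y ?x) \<le> 1536" by simp
      have "DD (e i) ?y ?x * real (al (e i) ?y * al ?y ?x) \<le> 258 * 1536"
        using dd pr w2 by (intro mult_mono) auto
      moreover have a0: "al ?y ?x \<noteq> 0"
      proof
        assume "al ?y ?x = 0"
        then show False using nn(3) alV al_sym[of ?y ?x] by simp
      qed
      ultimately have "DD (e i) ?y ?x * real (al (e i) ?y * al ?y ?x) \<le> 2834349" by linarith
      moreover have "al (e i) ?y \<le> 4561" "al ?y ?x \<le> 4561" "DD (e i) ?y ?x \<le> 4561" using dd av n0 by (simp_all add: n_def)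
      moreover have "al (e i) ?y \<noteq> 0" by (rule R(1))
      ultimately have disc_bounds using three_walls[OF prim_form wl(2,3,1) ne(2) ne(3)[symmetric] ne(1)[symmetric] R(1) a0] by blast
      then show False using nc by simp
    next
      case m0: False
      have u70: "u \<le> 4.18331" using quarter_square_nat(2)[OF nr(2) nn(1) n0(3), of "4.18331"] by (simp add: power2_eq_square)
      have "V \<le> 3/5*4.18331*1.22475 + 8/5*(4.18331+1.22475+1) + 14.0184" unfolding V_def
        by (rule mid_far[OF \<sigma> \<epsilon> x(1) W y(1) x(2) y(2)]) (use u70 w6 xk yk i in \<open>simp_all add: u_def w_def power2_eq_square\<close>)
      then have V8: "V \<le> 27.346" by simp
      then have V2: "V^2 \<le> 27.346^2" using nn by (intro power_mono) auto
      have uwV: "u * w * V \<le> 4.18331 * 1.22475 * 27.346" using u70 w6 V8 nn by (intro mult_mono) auto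
      have w2: "4 * w^2 \<le> 6" using nr(1) \<open>n \<le> 6\<close> by (metis of_nat_le_iff of_nat_numeral)
      have u2: "4 * u^2 \<le> 70" using nr(2) n0(3) by (metis of_nat_le_iff of_nat_numeral)
      have DD: "DD ?x (e i) ?y = 4 * (u^2 + w^2 + V^2 + 2 * (u * w * V) - 1)" by (simp add: DD_def u_def w_def V_def)
      have dd: "DD ?x (e i) ?y \<le> 4200" unfolding DD using w2 u2 V2 uwV by (simp add: power2_eq_square)
      have "real (al ?x (e i) * al (e i) ?y) \<le> real (70 * 6)"
        using \<open>n \<le> 6\<close> n0(3) al_sym[of ?x "e i"] unfolding n_def m_def by (intro of_nat_mono mult_le_mono) auto
      then have pr: "real (al ?x (e i) * al (e i) ?y) \<le> 420" by simp
      have "DD ?x (e i) ?y * real (al ?x (e i) * al (e i) ?y) \<le> 4200 * 420"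
        using dd pr by (intro mult_mono) auto
      then have "disc_bounds" using m0 dd n0 \<open>n \<le> 6\<close> al_sym[of ?x "e i"]
        by (intro three_walls[OF prim_form wl]) (use ne in \<open>auto simp: n_def[symmetric] m_def[symmetric]\<close>)
      then show False using nc by simp
    qed
  next
    case False
    then have n7: "7 \<le> n" by simp
    have br: "bubble e (i+1)" using nxt_props(5)[OF c nc, of i] n7 by (fastforce simp: n_def)
    then have ye: "?y = e (i+2)" by (simp add: nxt_def)
    have b: "nv G (e i) (e (i+1)) = 0" "nv G (e (i+1)) (e (i+2)) = 0" using br by (simp_all add: bubble_def add.assoc)
    have o: "\<epsilon> * ht (e (i-1)) < \<epsilon> * ht (e i)" "\<epsilon> * ht (e i) < \<epsilon> * ht (e (i+1))" "\<epsilon> * ht (e (i+1)) < \<epsilon> * ht (e (i+2))"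
      using D(4,6,8)[of i] by auto
    let ?s = "hs (e i)" and ?c = "hc (e i)"
    have s0: "?s > 0" "5/3 \<le> ?s^2" "?c^2 = 1 + ?s^2" using Wk_h[OF W[of i]] i by auto
    define t where "t = w - 1"
    have "1.3228 \<le> w" using quarter_square_nat(1)[OF nr(1) nn(2) n7, of "1.3228"] by (simp add: power2_eq_square)
    then have t0: "t > 0" by (simp add: t_def)
    have "w \<le> 4.184" using quarter_square_nat(2)[OF nr(1) nn(2) n0(2), of "4.184"] by (simp add: power2_eq_square)
    then have t3: "t \<le> 3.2" by (simp add: t_def)
    \<comment> \<open>A common bound for \<open>hc\<close> of both sides adjacent to
      \<open>e i\<close>: \<open>mid_right_angles\<close> bounds a bubble whose neighbours have
      \<open>hc\<close> at most that of \<open>e i\<close> and entry at least \<open>w\<close>, and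
      \<open>hc\<close>^2 is at most 8/5 \<open>hs\<close>^2.\<close>
    define C where "C = sqrt (?s^2 * (3/5 + 16/5 / t))"
    have C2: "C^2 = ?s^2 * (3/5 + 16/5 / t)" using t0 by (simp add: C_def)
    have C0: "C \<ge> 0" using t0 by (simp add: C_def)
    have bub: "hc f \<le> C" if f: "f \<in> Wk \<sigma>" and h: "(hs f)^2 * (w' - 1) \<le> 2 * ?c^2" and w': "w \<le> w'" for f w'
    proof -
      have "(hs f)^2 * t \<le> (hs f)^2 * (w' - 1)" using w' by (intro mult_left_mono) (auto simp: t_def)
      then have "(hs f)^2 * t \<le> 2 * ?c^2" using h by linarith
      then have "(hs f)^2 \<le> 2 * ?c^2 / t" using t0 by (simp add: pos_le_divide_eq)
      also have "\<dots> \<le> (16/5 * ?s^2) / t" using s0 t0 by (intro divide_right_mono) auto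
      finally have "(hc f)^2 \<le> 3/5 * ?s^2 + (16/5 * ?s^2) / t" using Wk_h(3)[OF f] s0 by simp
      then have "(hc f)^2 \<le> C^2" unfolding C2 by (simp add: algebra_simps)
      then show ?thesis using C0 by (rule power2_le_imp_le)
    qed
    have cR: "hc (e (i+1)) \<le> C"
    proof (rule bub[OF W])
      have "hc (e (i+2)) \<le> ?c" using hc_mono[OF y(1) W] yk ye by simp
      then show "(hs (e (i+1)))^2 * (w - 1) \<le> 2 * ?c^2"
        using mid_right_angles(2)[OF \<sigma> \<epsilon> W W W o(2,3) b, of ?c] ye by (simp add: w_def)
    qed simp
    \<comment> \<open>If \<open>e (i-1)\<close> is a bubble, its neighbours have entry at least
      \<open>w\<close> by the choice of \<open>nxt e i\<close>. If not, its link number is at most 4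
      and so below \<open>n\<close>, which forces it to be 0.\<close>
    have left: "nv G (e (i-1)) (e i) = 0 \<and> hc (e (i-1)) \<le> C"
    proof (cases "bubble e (i-1)")
      case True
      then have xe: "?x = e (i-2)" by (simp add: prv_def)
      have b': "nv G (e (i-2)) (e (i-1)) = 0" "nv G (e (i-1)) (e i) = 0" using True by (simp_all add: bubble_def)
      have bub': "bubble (\<lambda>i. e (- i)) (- i + 1)" using True by (simp add: bubble_reverse)
      have "al (e i) ?x \<ge> 5" using nxt_props(6)[OF cr nc bub'] by (simp add: prv_nxt)
      then have "n \<le> m" using n0(4) by (auto simp: m_def)
      then have "4 * w^2 \<le> 4 * u^2" using nr by (metis of_nat_le_iff)
      then have wu: "w \<le> u" by (intro le_of_sq[OF _ nn(1)]) simp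
      have o': "\<epsilon> * ht (e (i-2)) < \<epsilon> * ht (e (i-1))" using D(6)[of "i-1"] by simp
      have cx: "hc (e (i-2)) \<le> ?c" using hc_mono[OF x(1) W] xk xe by simp
      have "(hs (e (i-1)))^2 * (u - 1) \<le> 2 * ?c^2"
        using mid_right_angles(2)[OF \<sigma> \<epsilon> W W W o' o(1) b' cx] xe by (simp add: u_def)
      then show ?thesis using b' bub[OF W _ wu] by simp
    next
      case False
      then have xe: "?x = e (i-1)" by (simp add: prv_def)
      have bub': "\<not> bubble (\<lambda>i. e (- i)) (- i + 1)" using False by (simp add: bubble_reverse)
      have "al (e i) ?x \<le> 4" using nxt_props(5)[OF cr nc bub'] by (simp add: prv_nxt)
      then have "m = 0" using n0(4) n7 by (auto simp: m_def)
      then have u0: "u = 0" using nr by simp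
      have "hc (e (i-1)) \<le> ?c" using hc_mono[OF x(1) W] xk xe by simp
      moreover have "?c \<le> C"
      proof (rule power2_le_imp_le[OF _ C0])
        have "1 \<le> 16/5 / t" using t0 t3 by simp
        then have "?s^2 * (3/5 + 1) \<le> C^2" unfolding C2 by (intro mult_left_mono) auto
        then show "?c^2 \<le> C^2" using s0 by simp
      qed
      ultimately show ?thesis using u0 xe by (simp add: u_def)
    qed
    let ?V = "nv G (e (i-1)) (e (i+1))"
    have Vp: "?V > 1" using mid_right_angles(1)[OF \<sigma> \<epsilon> W W W o(1,2)] left b by blast
    have "?s^2 * (?V - 1) \<le> 2 * C^2" using mid_right_angles(2)[OF \<sigma> \<epsilon> W W W o(1,2)] left b cR by blast
    then have "?s^2 * (?V - 1) \<le> ?s^2 * (2 * (3/5 + 16/5 / t))" unfolding C2 by (simp only: mult_ac)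
    then have "?V - 1 \<le> 2 * (3/5 + 16/5 / t)" using s0 by simp
    then have Vle: "?V \<le> 11/5 + 32/5 / (w - 1)" by (simp add: t_def)
    have aB: "real (al (e (i+1)) (e (i-1))) = 4 * ?V^2" using al_wall Wk_wall W nv_sym by metis
    have nye: "n = al (e i) (e (i+2))" using ye by (simp add: n_def)
    have V0: "0 \<le> ?V" using Vp by simp
    note num = two_bubbles_numeric[OF nr(1) nn(2) n7 n0(2) V0 Vle aB]
    have disc_bounds
      by (rule four_walls[OF prim_form Wk_wall[OF W[of "i+1"]] Wk_wall[OF W[of i]] Wk_wall[OF W[of "i+2"]] Wk_wall[OF W[of "i-1"]]])
         (use num nye n0 o b Vp nv_sym in \<open>auto simp: less_imp_neq\<close>)
    then show False using nc by simp
  qed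
qed

text \<open>If both reduced neighbours are orthogonal to the side, it is a bubble itself, because 4
  * 4.2^2 is below 71. Otherwise \<open>level1_aux\<close> applies to the chain or to its
  reversal.\<close>

lemma level1:
  assumes c: "chn \<epsilon> \<sigma> e" and nc: "\<not> disc_bounds" and i: "\<not> bubble e i" "5/3 \<le> (hs (e i))^2"
    and mx: "\<And>j. \<not> bubble e j \<Longrightarrow> hs (e j) \<le> hs (e i)"
  shows False
proof -
  note D = chnD[OF c]
  have cr: "chn (- \<epsilon>) \<sigma> (\<lambda>i. e (- i))" by (rule chn_reverse[OF c])
  let ?n = "al (e i) (nxt e i)" and ?m = "al (e i) (prv e i)"
  have sw: "prv (\<lambda>i. e (- i)) (- i) = nxt e i" "nxt (\<lambda>i. e (- i)) (- i) = prv e i"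
    using prv_nxt[of "\<lambda>i. e (- i)" "- i"] prv_nxt[of e i] by simp_all
  consider "?n = 0" "?m = 0" | "?n \<noteq> 0" "?m = 0 \<or> ?n \<le> ?m" | "?m \<noteq> 0" "?n = 0 \<or> ?m \<le> ?n" by linarith
  then show False
  proof cases
    case 1
    have W: "e j \<in> Wk \<sigma>" for j by (rule D(3))
    have nb: "\<not> bubble e (i+1)" using nxt_props(6)[OF c nc, of i] 1 by auto
    have "\<not> bubble (\<lambda>i. e (- i)) (- i + 1)" using nxt_props(6)[OF cr nc, of "- i"] 1(2) by (auto simp: sw)
    then have nb': "\<not> bubble e (i-1)" by (simp add: bubble_reverse)
    have z: "nv G (e i) (e (i+1)) = 0" "nv G (e (i-1)) (e i) = 0"
      using 1 nb nb' al_wall[OF Wk_wall[OF W] Wk_wall[OF W], of i "i+1"] al_wall[OF Wk_wall[OF W] Wk_wall[OF W], of i "i-1"] nv_sym[of "e i" "e (i-1)"]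
      by (simp_all add: nxt_def prv_def)
    have cc: "hc (e (i-1)) \<le> hc (e i)" "hc (e (i+1)) \<le> hc (e i)" using hc_mono[OF W W] mx nb nb' by blast+
    note ang = mid_right_angles[OF D(2,1) W W W D(6) D(4) z(2,1)]
    have s: "hs (e i) > 0" "(hc (e i))^2 = 1 + (hs (e i))^2" using Wk_h[OF W] by auto
    have "(hs (e i))^2 * (nv G (e (i-1)) (e (i+1)) - 1) \<le> 2 * (hc (e i))^2" using ang(2) cc by blast
    also have "\<dots> \<le> (hs (e i))^2 * 3.2" using s i(2) by simp
    finally have "nv G (e (i-1)) (e (i+1)) - 1 \<le> 3.2" using s(1) by simp
    then have "nv G (e (i-1)) (e (i+1)) \<le> 4.2" by simp
    then have "(nv G (e (i-1)) (e (i+1)))^2 \<le> 4.2^2" using ang(1) by (intro power_mono) auto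
    then have "real (al (e (i-1)) (e (i+1))) < 71" using al_wall[OF Wk_wall[OF W] Wk_wall[OF W]] by (simp add: power2_eq_square)
    then have "bubble e i" using z by (simp add: bubble_def)
    then show False using i by simp
  next
    case 2 then show False using level1_aux[OF c nc i mx] by blast
  next
    case 3
    show False
      by (rule level1_aux[OF cr nc, of "- i"]) (use 3 i mx in \<open>auto simp: bubble_reverse sw\<close>)
  qed
qed

end

section \<open>Sides on opposite sides of the geodesic\<close>

text \<open>Two orthogonal lines meet at a vertex; \<open>a\<close> and \<open>b\<close> are the
  distances from the foot of this vertex to the feet of the two lines, and \<open>k\<close> and
  \<open>m\<close> are the hyperbolic tangent and cosine of its height.\<close>

lemma right_angle_split:
  fixes D :: real
  assumes c: "c0^2 = 1 + s0^2" "c1^2 = 1 + s1^2" "s0 > 0" "s1 > 0" "c0 > 0" "c1 > 0"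
    and D: "s0 * s1 * cosh D = c0 * c1" "D \<ge> 0"
  obtains a b m k where "D = a + b" "m > 0" "m^2 = c0^2 + c1^2" "k \<ge> 0" "m^2 * k^2 = m^2 - 1"
    "s0 * sinh a = c1 / m" "s0 * cosh a = c0 * k" "s1 * sinh b = c0 / m" "s1 * cosh b = c1 * k"
proof -
  define m where "m = sqrt (c0^2 + c1^2)"
  define k where "k = sqrt (1 - 1 / m^2)"
  have m2: "m^2 = c0^2 + c1^2" and m0: "m > 0" using c by (auto simp: m_def add_pos_pos)
  have "c0^2 + c1^2 \<ge> 1" using c(1,2) by simp
  then have m1: "m^2 \<ge> 1" by (simp add: m2)
  then have m3: "1 / m^2 \<le> 1" using m0 by (simp add: divide_le_eq_1_pos)
  then have k2: "k^2 = 1 - 1 / m^2" by (simp add: k_def)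
  have k0: "k \<ge> 0" using m3 by (simp add: k_def)
  have mk: "m^2 * k^2 = m^2 - 1" unfolding k2 using m0 by (simp add: field_simps)
  have ch: "s * cosh (arsinh (c' / (m * s))) = c * k" if h: "c^2 = 1 + s^2" "s > 0" "c > 0" "m^2 = c^2 + c'^2" for s c c' :: real
  proof -
    let ?x = "c' / (m * s)"
    have "(s * cosh (arsinh ?x))^2 = s^2 * (1 + ?x^2)" by (simp add: power_mult_distrib cosh_square_eq)
    also have "\<dots> = s^2 + c'^2 / m^2" using h(2) m0 by (simp add: power_mult_distrib power_divide distrib_left)
    also have "c'^2 / m^2 = 1 - c^2 / m^2"
    proof -
      have "c'^2 = m^2 - c^2" using h(4) by simp
      then show ?thesis using m0 by (simp add: diff_divide_distrib)
    qed
    also have "s^2 + (1 - c^2 / m^2) = (c * k)^2" unfolding power_mult_distrib k2 using h(1) by (simp add: algebra_simps)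
    finally have "(s * cosh (arsinh ?x))^2 = (c * k)^2" .
    then show ?thesis using h k0 by (simp add: power2_eq_iff_nonneg cosh_real_nonneg)
  qed
  define a b where "a = arsinh (c1 / (m * s0))" and "b = arsinh (c0 / (m * s1))"
  have sa: "s0 * sinh a = c1 / m" "s1 * sinh b = c0 / m" using c by (simp_all add: a_def b_def)
  have ca: "s0 * cosh a = c0 * k" unfolding a_def by (rule ch) (use c m2 in auto)
  have cb: "s1 * cosh b = c1 * k" unfolding b_def by (rule ch) (use c m2 in auto)
  have "sinh a \<ge> 0" "sinh b \<ge> 0" using c m0 by (auto simp: a_def b_def)
  then have ab: "a \<ge> 0" "b \<ge> 0" by simp_all
  have "s0 * s1 * cosh (a + b) = (s0 * cosh a) * (s1 * cosh b) + (s0 * sinh a) * (s1 * sinh b)"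
    by (simp add: cosh_add algebra_simps)
  also have "\<dots> = c0 * c1 * (k^2 + 1 / m^2)" unfolding sa ca cb by (simp add: power2_eq_square algebra_simps)
  also have "k^2 + 1 / m^2 = 1" by (simp add: k2)
  finally have "s0 * s1 * cosh (a + b) = s0 * s1 * cosh D" using D by simp
  then have "cosh (a + b) = cosh D" using c by simp
  then have "D = a + b" using ab D by (metis add_nonneg_nonneg cosh_real_nonneg_le_iff order_antisym order_refl)
  then show thesis using that[of a b m k] m0 m2 k0 mk sa ca cb by blast
qed

text \<open>The two entries come from one pair of numbers by a rotation up to scaling with
  coefficients \<open>c0\<close> and \<open>c1\<close>, so their sum of squares is easy to bound.
  The last hypothesis says that the third line, on the opposite side, has the foot of the vertex in
  its shadow.\<close>

lemma right_angle_opposite: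
  fixes y :: real
  assumes "m > 0" "m^2 = c0^2 + c1^2" "k \<ge> 0" "m^2 * k^2 = m^2 - 1"
    "s0 * sinh a = c1 / m" "s0 * cosh a = c0 * k" "s1 * sinh b = c0 / m" "s1 * cosh b = c1 * k"
    and f: "c^2 = 1 + s^2" "s > 0" "c > 0" "s * cosh y \<le> c"
  shows "(s0 * s * cosh (y + a) + c0 * c)^2 + (s1 * s * cosh (y - b) + c1 * c)^2 \<le> 1 + 2 * c^2 * (2 * (c0^2 + c1^2) - 1)"
proof -
  let ?u = "k * (s * cosh y) + c"
  have "s0 * s * cosh (y + a) + c0 * c = (s0 * cosh a) * (s * cosh y) + (s0 * sinh a) * (s * sinh y) + c0 * c"
    by (simp add: cosh_add algebra_simps)
  also have "\<dots> = c0 * ?u + c1 * (s * sinh y / m)" unfolding assms(5,6) by (simp add: algebra_simps)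
  finally have 1: "s0 * s * cosh (y + a) + c0 * c = c0 * ?u + c1 * (s * sinh y / m)" .
  have "s1 * s * cosh (y - b) + c1 * c = (s1 * cosh b) * (s * cosh y) - (s1 * sinh b) * (s * sinh y) + c1 * c"
    by (simp add: cosh_diff algebra_simps)
  also have "\<dots> = c1 * ?u - c0 * (s * sinh y / m)" unfolding assms(7,8) by (simp add: algebra_simps)
  finally have 2: "s1 * s * cosh (y - b) + c1 * c = c1 * ?u - c0 * (s * sinh y / m)" .
  have "(c0 * ?u + c1 * (s * sinh y / m))^2 + (c1 * ?u - c0 * (s * sinh y / m))^2 = (c0^2 + c1^2) * (?u^2 + (s * sinh y / m)^2)"
    by (simp add: power2_eq_square algebra_simps add_divide_distrib)
  also have "\<dots> = m^2 * ?u^2 + (s * sinh y)^2" using assms(1) unfolding assms(2)[symmetric] by (simp add: power_divide distrib_left)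
  finally have e: "(s0 * s * cosh (y + a) + c0 * c)^2 + (s1 * s * cosh (y - b) + c1 * c)^2 = m^2 * ?u^2 + (s * sinh y)^2"
    unfolding 1 2 .
  have sc: "(s * cosh y)^2 \<le> c^2" using f by (intro power_mono) auto
  have "(s * sinh y)^2 = (s * cosh y)^2 - s^2" by (simp add: power_mult_distrib sinh_square_eq algebra_simps)
  then have 3: "(s * sinh y)^2 \<le> 1" using sc f(1) by linarith
  have "?u \<le> k * c + c" using f assms(3) by (intro add_mono mult_left_mono) auto
  moreover have "?u \<ge> 0" using f assms(3) by simp
  ultimately have "?u^2 \<le> (k * c + c)^2" by (intro power_mono)
  also have "\<dots> \<le> 2 * c^2 * (1 + k^2)" using zero_le_power2[of "k * c - c"] by (simp add: power2_eq_square algebra_simps)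
  finally have "m^2 * ?u^2 \<le> m^2 * (2 * c^2 * (1 + k^2))" by (intro mult_left_mono) auto
  also have "\<dots> = 2 * c^2 * (m^2 + m^2 * k^2)" by (simp add: algebra_simps)
  also have "\<dots> = 2 * c^2 * (2 * (c0^2 + c1^2) - 1)" 
  proof -
    have "m^2 + m^2 * k^2 = 2 * (c0^2 + c1^2) - 1" unfolding assms(4) by (simp add: assms(2))
    then show ?thesis by simp
  qed
  finally show ?thesis unfolding e using 3 by linarith
qed

context refl_prim
begin

lemma chn_strict: assumes "chn 1 \<sigma> e" "i < j" shows "ht (e i) < ht (e j)"
proof -
  have st: "ht (e (i + int n)) < ht (e (i + int (Suc n)))" for n
    using chnD(4)[OF assms(1), of "i + int n"] by (simp add: add_ac)
  have "ht (e (i + int 0)) < ht (e (i + int (nat (j - i))))"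
    by (rule lift_Suc_mono_less[of "\<lambda>n. ht (e (i + int n))", OF st]) (use assms(2) in simp)
  then show ?thesis using assms(2) by simp
qed

text \<open>By \<open>finite_hs\<close> the largest distance among the non-bubbles is attained, and
  \<open>level1\<close> applies there.\<close>

lemma not_bubble_small:
  assumes c: "chn \<epsilon> \<sigma> e" and nc: "\<not> disc_bounds" and i: "\<not> bubble e i" shows "(hs (e i))^2 \<le> 5/3"
proof (rule ccontr)
  assume n: "\<not> (hs (e i))^2 \<le> 5/3"
  let ?A = "(\<lambda>j. hs (e j)) ` {j. \<not> bubble e j}"
  have "?A \<subseteq> hs ` Wk \<sigma>" using chnD(3)[OF c] by blast
  then have f: "finite ?A" using finite_hs[OF chnD(2)[OF c]] finite_subset by blast
  have "Max ?A \<in> ?A" using i by (intro Max_in[OF f]) auto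
  then obtain j where j: "\<not> bubble e j" "Max ?A = hs (e j)" by auto
  have mx: "hs (e k) \<le> hs (e j)" if "\<not> bubble e k" for k
    unfolding j(2)[symmetric] using that by (intro Max_ge[OF f]) auto
  have "0 \<le> hs (e i)" using Wk_h(1)[OF chnD(3)[OF c]] by (rule less_imp_le)
  then have "(hs (e i))^2 \<le> (hs (e j))^2" using mx[OF i] by (intro power_mono)
  then show False using level1[OF c nc j(1) _ mx] n by simp
qed

lemma hc_small: assumes "e \<in> Wk \<sigma>" "(hs e)^2 \<le> 5/3" shows "(hc e)^2 \<le> 8/3" "hc e \<le> sqrt (8/3)" "hc e * hc e \<le> 8/3"
proof -
  show 1: "(hc e)^2 \<le> 8/3" using assms(2) by (simp add: Wk_h(3)[OF assms(1)])
  then show "hc e \<le> sqrt (8/3)" by (rule real_le_rsqrt)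
  show "hc e * hc e \<le> 8/3" using 1 by (simp add: power2_eq_square)
qed

lemma hc_small_mult:
  assumes "e \<in> Wk \<sigma>" "(hs e)^2 \<le> 5/3" "f \<in> Wk \<tau>" "(hs f)^2 \<le> 5/3" shows "hc e * hc f \<le> 8/3"
proof -
  have "hc e * hc f \<le> sqrt (8/3) * sqrt (8/3)"
    using hc_small(2)[OF assms(1,2)] hc_small(2)[OF assms(3,4)] Wk_h(2)[OF assms(3)] Wk_h(2)[OF assms(1)] by (intro mult_mono) auto
  then show ?thesis by simp
qed

lemma good_chain:
  assumes "good \<sigma>"
  obtains e where "chn 1 \<sigma> e" "\<And>T. \<exists>i. ht (e i) > T" "\<And>T. \<exists>i. ht (e i) < T"
proof -
  have \<sigma>: "\<sigma> = 1 \<or> \<sigma> = -1" using assms by (simp add: good_def)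
  obtain e :: "int \<Rightarrow> real^3" where e: "\<And>i. e i \<in> Wk \<sigma>" "\<And>i. ht (e i) < ht (e (i+1))"
    "\<And>i. 0 \<le> nv G (e i) (e (i+1)) \<and> nv G (e i) (e (i+1)) \<le> 1"
    "\<And>T. \<exists>i. ht (e i) > T" "\<And>T. \<exists>i. ht (e i) < T"
    using chain_ex[OF assms] by blast
  have "chn 1 \<sigma> e" unfolding chn_def using \<sigma> e(1,2,3) by simp
  then show thesis using that e(4,5) by blast
qed

text \<open>If \<open>\<rho>\<close> is orthogonal to a mirror, this mirror is a side and plays the role of the second chain.\<close>
lemma mirror_case:
  assumes r: "r \<in> Rp" "r = a *\<^sub>R \<rho>" shows disc_bounds
proof (rule ccontr)
  assume nc: "\<not> disc_bounds"
  have rr: "b r r < 0" using Rp_root[OF r(1)] root_neg by blast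
  have k0: "- b \<rho> \<rho> > 0" using \<rho> by simp
  let ?c = "a * sqrt (- b \<rho> \<rho>)"
  have rc: "r = ?c *\<^sub>R rh" using r(2) k0 by (simp add: rh_def)
  have rhr: "b rh r = - ?c" by (subst rc) (simp add: bf_lin rh_norm)
  have rn: "b r r = - (?c^2)" by (subst (1 2) rc) (simp add: bf_lin rh_norm power2_eq_square)
  have c0: "?c \<noteq> 0" using rr rn by (intro notI) simp
  define \<sigma> :: real where "\<sigma> = (if b rh r > 0 then 1 else -1)"
  have \<sigma>: "\<sigma> = 1 \<or> \<sigma> = -1" by (simp add: \<sigma>_def)
  have "b rh r \<noteq> 0" using c0 rhr by simp
  then have \<sigma>r: "\<sigma> * b rh r > 0" by (auto simp: \<sigma>_def not_less)
  have only: "s = r" if s: "s \<in> Rp" "s = a' *\<^sub>R \<rho>" for s a'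
  proof (rule Rp_scale[OF r(1) s(1)])
    have "a \<noteq> 0" using c0 by auto
    then show "s = (a' / a) *\<^sub>R r" using s(2) r(2) by simp
  qed
  have g: "good \<sigma>" unfolding good_def using \<sigma> \<sigma>r only by blast
  have wr: "wall r" unfolding wall_def wall_at_def
  proof (intro exI conjI ballI impI)
    show "r \<in> Rp" by (rule r(1))
    show "pp + qq \<in> V" by (rule V_I[OF _ uu_props(3)]) (simp_all add: bf_lin pq)
    show "b (pp + qq) r = 0" by (simp add: r(2) bf_lin \<rho>_pq)
    fix s assume s: "s \<in> Rp" "s \<noteq> r"
    then have "\<nexists>a. s = a *\<^sub>R \<rho>" using only by blast
    then show "b (pp + qq) s > 0" using Rp_sides[OF s(1)] by (simp add: bf_lin add_pos_pos)
  qed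
  have nr: "nv G r e = hc e" and ne: "r \<noteq> e" if e: "e \<in> Wk \<sigma>" for e
  proof -
    show ne: "r \<noteq> e" using side_not_\<rho>(1)[OF Wk_side[OF e]] r(2) by blast
    have ee: "b e e < 0" by (rule side_neg[OF Wk_side[OF e]])
    have gen: "\<bar>C * X / (\<bar>C\<bar> * S)\<bar> = \<bar>X\<bar> / S" if "C \<noteq> 0" "S > 0" for C X S :: real using that by (simp add: abs_mult)
    have "b r r * b e e = ?c^2 * (- b e e)" by (simp add: rn)
    then have sq: "sqrt (b r r * b e e) = \<bar>?c\<bar> * sqrt (- b e e)" by (simp only: real_sqrt_mult real_sqrt_abs)
    have bre: "b r e = ?c * b rh e" by (subst rc) (simp add: bf_lin)
    have s0: "sqrt (- b e e) > 0" using ee by simp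
    have "\<bar>nv G r e\<bar> = hc e" unfolding nv_def sq bre hc_def by (rule gen[OF c0 s0])
    then show "nv G r e = hc e" using wall_nv_ge[OF wr Wk_wall[OF e] ne] by simp
  qed
  obtain e where c: "chn 1 \<sigma> e" by (rule good_chain[OF g])
  note W = chnD(3)[OF c]
  obtain i where i: "\<not> bubble e i" using adjacent_bubbles[OF c] nc by blast
  obtain j where j: "nxt e i = e j" "\<not> bubble e j" using nxt_props(4)[OF c nc] by blast
  have lt: "ht (e i) < ht (e j)" and n70: "al (e i) (e j) \<le> 70" using nxt_props(2,3)[OF c nc, of i] j by auto
  have ne': "e i \<noteq> e j" using lt by auto
  have s: "(hs (e i))^2 \<le> 5/3" "(hs (e j))^2 \<le> 5/3" using not_bubble_small[OF c nc] i j by auto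
  \<comment> \<open>The mirror of \<rho> has entry \<open>hc\<close> with every side, so it is never
    orthogonal to one, and \<open>al\<close> is at most 10 since 4 * 8/3 is below 11. It serves as
    the middle link between two sides.\<close>
  have aa: "al r (e k) \<noteq> 0 \<and> al r (e k) \<le> 10" if "(hs (e k))^2 \<le> 5/3" for k
  proof -
    have "real (al r (e k)) = 4 * (hc (e k))^2" using al_wall[OF wr Wk_wall[OF W]] nr[OF W] by simp
    moreover have "(hc (e k))^2 \<le> 8/3" by (rule hc_small(1)[OF W that])
    moreover have "(hc (e k))^2 > 0" using Wk_h(2)[OF W[of k]] by simp
    ultimately show ?thesis by (auto intro!: Nat.gr0I)
  qed
  let ?v = "nv G (e i) (e j)"
  have v0: "?v \<ge> 0" by (rule wall_nv_ge[OF Wk_wall[OF W] Wk_wall[OF W] ne'])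
  have v2: "4 * ?v^2 \<le> 70" using n70 al_wall[OF Wk_wall[OF W] Wk_wall[OF W], of i j] by linarith
  have "?v \<le> 4.2" by (rule le_of_sq) (use v2 in \<open>simp_all add: power2_eq_square\<close>)
  then have cv: "hc (e i) * hc (e j) * ?v \<le> 8/3 * 4.2"
    using hc_small_mult[OF W s(1) W s(2)] v0 by (intro mult_mono) auto
  have DD: "DD (e i) r (e j) = 4 * ((hc (e i))^2 + (hc (e j))^2 + ?v^2 + 2 * (hc (e i) * hc (e j) * ?v) - 1)"
    using nr[OF W] nv_sym[of "e i" r] by (simp add: DD_def)
  have d: "DD (e i) r (e j) \<le> 180" unfolding DD using cv v2 hc_small(1)[OF W s(1)] hc_small(1)[OF W s(2)] by simp
  have a: "al (e i) r \<noteq> 0" "al r (e j) \<noteq> 0" "al (e i) r \<le> 10" "al r (e j) \<le> 10"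
    using aa[OF s(1)] aa[OF s(2)] al_sym[of "e i" r] by auto
  have "al (e i) r * al r (e j) \<le> 10 * 10" using a by (intro mult_le_mono)
  then have "real (al (e i) r * al r (e j)) \<le> real (10 * 10)" by (rule of_nat_mono)
  then have p: "real (al (e i) r * al r (e j)) \<le> 100" by simp
  have "DD (e i) r (e j) * real (al (e i) r * al r (e j)) \<le> 180 * 100" using d p by (intro mult_mono) auto
  then have "disc_bounds" using three_walls[OF prim_form Wk_wall[OF W] wr Wk_wall[OF W] ne[OF W, symmetric] ne[OF W] ne' a(1,2)] a d by simp
  then show False using nc by simp
qed

lemma opposite:
  assumes \<sigma>: "\<sigma> = 1 \<or> \<sigma> = -1" and e: "e \<in> Wk \<sigma>" and f: "f \<in> Wk (- \<sigma>)"
  shows "nv G e f = hs e * hs f * cosh (ht e - ht f) + hc e * hc f" "e \<noteq> f" "nv G e f > 0"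
proof -
  have \<sigma>': "- \<sigma> = 1 \<or> - \<sigma> = -1" using \<sigma> by auto
  have ss: "\<sigma> * - \<sigma> = - 1" using \<sigma> by auto
  show n: "nv G e f = hs e * hs f * cosh (ht e - ht f) + hc e * hc f"
    unfolding nv_formula[OF Wk_side[OF e] \<sigma> Wk_side[OF f] \<sigma>'] ss by simp
  show "e \<noteq> f" using Wk_side[OF e] Wk_side[OF f] by (auto simp: side_def)
  show "nv G e f > 0" unfolding n using Wk_h(1,2)[OF e] Wk_h(1,2)[OF f] by (simp add: add_pos_pos)
qed

lemma bracket:
  assumes c: "chn 1 \<sigma> f" and u: "\<And>T. \<exists>i. ht (f i) > T" "\<And>T. \<exists>i. ht (f i) < T"
  obtains j where "ht (f j) \<le> T" "T < ht (f (j+1))"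
proof -
  obtain i where i: "ht (f i) < T" using u(2) by blast
  obtain k where k: "ht (f k) > T" using u(1) by blast
  have "i < k"
  proof (rule ccontr)
    assume "\<not> i < k"
    then have "ht (f k) \<le> ht (f i)" using chn_strict[OF c, of k i] by (cases "k = i") auto
    then show False using i k by simp
  qed
  define n where "n = (LEAST n. ht (f (i + int n)) > T)"
  have ex: "ht (f (i + int (nat (k - i)))) > T" using k \<open>i < k\<close> by simp
  have n: "ht (f (i + int n)) > T" unfolding n_def by (rule LeastI[of "\<lambda>n. ht (f (i + int n)) > T", OF ex])
  have "n \<noteq> 0" using n i by (intro notI) simp
  then obtain m where m: "n = Suc m" by (cases n) auto
  have "\<not> ht (f (i + int m)) > T" using not_less_Least[of m "\<lambda>n. ht (f (i + int n)) > T"] m by (simp add: n_def)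
  then show thesis using that[of "i + int m"] n m by (simp add: add.assoc add.commute[of 1])
qed

text \<open>The hyperbolic cosine of \<open>hw e\<close> is \<open>hc e / hs e\<close>, so this
  expresses that the point at signed distance \<open>x\<close> from the foot lies in the shadow of
  \<open>e\<close>.\<close>

lemma close_iff: assumes "e \<in> Wk \<sigma>" shows "hs e * cosh x \<le> hc e \<longleftrightarrow> \<bar>x\<bar> \<le> hw e"
proof -
  have "hs e * cosh x \<le> hc e \<longleftrightarrow> cosh x \<le> cosh (hw e)"
    unfolding hw(2)[OF Wk_side[OF assms]] using Wk_h(1)[OF assms] by (simp add: pos_le_divide_eq mult.commute)
  also have "\<dots> \<longleftrightarrow> \<bar>x\<bar> \<le> hw e"
    using hw(3)[OF Wk_side[OF assms]] cosh_real_nonneg_le_iff[of "\<bar>x\<bar>" "hw e"] by (simp add: cosh_real_abs)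
  finally show ?thesis .
qed

text \<open>By the addition formula for cosh: for lines on the same side, an entry at most 1 means
  that the shadows touch or overlap.\<close>

lemma hw_add: assumes "e \<in> Wk \<sigma>" "f \<in> Wk \<tau>"
  shows "hs e * hs f * cosh x \<le> hc e * hc f + 1 \<longleftrightarrow> \<bar>x\<bar> \<le> hw e + hw f"
proof -
  note p = Wk_h(1)[OF assms(1)] Wk_h(1)[OF assms(2)]
  have "cosh (hw e + hw f) = (hc e * hc f + 1) / (hs e * hs f)"
    unfolding cosh_add hw(1,2)[OF Wk_side[OF assms(1)]] hw(1,2)[OF Wk_side[OF assms(2)]] by (simp add: add_divide_distrib)
  then have "hs e * hs f * cosh x \<le> hc e * hc f + 1 \<longleftrightarrow> cosh x \<le> cosh (hw e + hw f)"
    using p by (simp add: pos_le_divide_eq mult.commute)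
  also have "\<dots> \<longleftrightarrow> \<bar>x\<bar> \<le> hw e + hw f"
    using hw(3)[OF Wk_side[OF assms(1)]] hw(3)[OF Wk_side[OF assms(2)]] cosh_real_nonneg_le_iff[of "\<bar>x\<bar>" "hw e + hw f"] by (simp add: cosh_real_abs)
  finally show ?thesis .
qed

lemma neighbours_close:
  assumes c: "chn 1 \<sigma> f" shows "ht (f (j+1)) - ht (f j) \<le> hw (f j) + hw (f (j+1))"
proof -
  note D = chnD[OF c]
  have "nv G (f j) (f (j+1)) = hs (f j) * hs (f (j+1)) * cosh (ht (f j) - ht (f (j+1))) - hc (f j) * hc (f (j+1))"
    using nv_formula[OF Wk_side[OF D(3)] D(2) Wk_side[OF D(3)] D(2), of j "j+1"] D(2) by auto
  then have "hs (f j) * hs (f (j+1)) * cosh (ht (f j) - ht (f (j+1))) \<le> hc (f j) * hc (f (j+1)) + 1"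
    using D(5)[of j] by linarith
  then show ?thesis unfolding hw_add[OF D(3) D(3)] by linarith
qed

text \<open>Shadows of neighbours touch or overlap, so the chain covers the geodesic.
  \<open>f k\<close> is a neighbour of \<open>f j\<close> with \<open>T\<close> between the two
  feet, a substitute for \<open>f j\<close> if that is a bubble.\<close>

lemma cover:
  assumes c: "chn 1 \<sigma> f" and u: "\<And>T. \<exists>i. ht (f i) > T" "\<And>T. \<exists>i. ht (f i) < T" and nc: "\<not> disc_bounds"
  obtains j k where "\<bar>T - ht (f j)\<bar> \<le> hw (f j)" "\<bar>T - ht (f k)\<bar> \<le> \<bar>ht (f j) - ht (f k)\<bar>"
    "bubble f j \<Longrightarrow> nv G (f j) (f k) = 0 \<and> \<not> bubble f k"
proof -
  obtain j where j: "ht (f j) \<le> T" "T < ht (f (j+1))" using bracket[OF c u] by blast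
  have h: "ht (f (j+1)) - ht (f j) \<le> hw (f j) + hw (f (j+1))" by (rule neighbours_close[OF c])
  have nb: "\<not> (bubble f j \<and> bubble f (j+1))" using adjacent_bubbles[OF c] nc by blast
  show thesis
  proof (cases "T - ht (f j) \<le> hw (f j)")
    case True
    show ?thesis by (rule that[of j "j+1"]) (use True j nb in \<open>auto simp: bubble_def\<close>)
  next
    case False
    show ?thesis
      by (rule that[of "j+1" j]) (use False h j nb nv_sym[of "f (j+1)" "f j"] in \<open>auto simp: bubble_def\<close>)
  qed
qed

text \<open>Two neighbours of one chain and a wall of the other chain lying opposite to them satisfy
  \<open>three_walls\<close>. The opposite wall is orthogonal to neither, so it can be the middle
  link if the neighbours are orthogonal.\<close>

lemma all_small:
  assumes c: "chn 1 \<sigma> e" "chn 1 (- \<sigma>) f" and u: "\<And>T. \<exists>i. ht (f i) > T" "\<And>T. \<exists>i. ht (f i) < T" and nc: "\<not> disc_bounds"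
    and s: "\<And>i. (hs (e i))^2 \<le> 5/3" "\<And>i. (hs (f i))^2 \<le> 5/3"
  shows False
proof -
  note D = chnD[OF c(1)] and We = chnD(3)[OF c(1)] and Wf = chnD(3)[OF c(2)]
  note op = opposite[OF D(2) We Wf]
  let ?v = "nv G (e 0) (e 1)"
  have lt: "ht (e 0) < ht (e 1)" using D(4)[of 0] by simp
  have ne: "e 0 \<noteq> e 1" using lt by auto
  have v: "0 \<le> ?v" "?v \<le> 1" using wall_nv_ge[OF Wk_wall[OF We] Wk_wall[OF We] ne] D(5)[of 0] by auto
  have n: "real (al (e 0) (e 1)) = 4 * ?v^2" by (rule al_wall[OF Wk_wall[OF We] Wk_wall[OF We]])
  have v2: "?v^2 \<le> 1" using v by (simp add: power_le_one_iff)
  have n4: "al (e 0) (e 1) \<le> 4" using n v2 by linarith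
  have pos: "al (e i) (f j) \<noteq> 0" for i j
  proof
    assume "al (e i) (f j) = 0"
    then show False using al_wall[OF Wk_wall[OF We] Wk_wall[OF Wf], of i j] op(3)[of i j] by simp
  qed
  show False
  proof (cases "al (e 0) (e 1) = 0")
    case False
    \<comment> \<open>A point in the shadows of both \<open>e 0\<close> and
      \<open>e 1\<close>.\<close>
    let ?T = "min (ht (e 1)) (ht (e 0) + hw (e 0))"
    obtain j k where j: "\<bar>?T - ht (f j)\<bar> \<le> hw (f j)" using cover[OF c(2) u nc] by metis
    have w: "hw (e 0) > 0" "hw (e 1) > 0" using hw(3)[OF Wk_side[OF We]] by auto
    have cl: "ht (e 1) - ht (e 0) \<le> hw (e 0) + hw (e 1)" using neighbours_close[OF c(1), of 0] by simp
    have "\<bar>ht (e 0) - ht (f j)\<bar> \<le> hw (e 0) + hw (f j)" "\<bar>ht (e 1) - ht (f j)\<bar> \<le> hw (e 1) + hw (f j)"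
      using j w lt cl by (auto simp: min_def split: if_splits)
    \<comment> \<open>Overlapping shadows on opposite sides give an entry at most 2
      \<open>hc\<close> \<open>hc\<close> + 1, and 2 * 8/3 + 1 is 19/3.\<close>
    then have h: "nv G (e i) (f j) \<le> 19/3" if "i = 0 \<or> i = 1" for i
      using that hw_add[OF We Wf, of i j "ht (e i) - ht (f j)"] op(1)[of i j] hc_small_mult[OF We s(1) Wf s(2), of i j] by auto
    let ?V = "nv G (e 0) (f j)" and ?W = "nv G (e 1) (f j)"
    have V: "0 < ?V" "?V \<le> 19/3" "0 < ?W" "?W \<le> 19/3" using h op(3) by auto
    have V2: "?V^2 \<le> (19/3)^2" "?W^2 \<le> (19/3)^2" using V by (auto intro!: power_mono)
    have vVW: "?v * ?V * ?W \<le> 1 * (19/3) * (19/3)" using v V by (intro mult_mono) auto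
    have DD: "DD (e 1) (e 0) (f j) = 4 * (?v^2 + ?V^2 + ?W^2 + 2 * (?v * ?V * ?W) - 1)"
      by (simp add: DD_def nv_sym[of "e 1" "e 0"])
    have d: "DD (e 1) (e 0) (f j) \<le> 650" unfolding DD using v2 V2 vVW by (simp add: power2_eq_square)
    have "real (al (e 0) (f j)) \<le> 4 * (19/3)^2" using V2 al_wall[OF Wk_wall[OF We] Wk_wall[OF Wf]] by simp
    then have a: "al (e 0) (f j) \<le> 161" by (simp add: power2_eq_square)
    have "al (e 1) (e 0) * al (e 0) (f j) \<le> 4 * 161" using n4 a al_sym[of "e 1" "e 0"] by (intro mult_le_mono) auto
    then have "real (al (e 1) (e 0) * al (e 0) (f j)) \<le> real (4 * 161)" by (rule of_nat_mono)
    then have p: "real (al (e 1) (e 0) * al (e 0) (f j)) \<le> 644" by simp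
    have "DD (e 1) (e 0) (f j) * real (al (e 1) (e 0) * al (e 0) (f j)) \<le> 650 * 644" using d p by (intro mult_mono) auto
    then have "disc_bounds"
      using three_walls[OF prim_form Wk_wall[OF We] Wk_wall[OF We] Wk_wall[OF Wf] ne[symmetric] op(2)[of 0 j] op(2)[of 1 j] _ pos[of 0 j]] False al_sym[of "e 1" "e 0"] n4 a d
      by simp
    then show False using nc by simp
  next
    case True
    then have v0: "?v = 0" using n by simp
    note h0 = Wk_h(1,2,3)[OF We[of 0]] and h1 = Wk_h(1,2,3)[OF We[of 1]]
    have "?v = hs (e 0) * hs (e 1) * cosh (ht (e 0) - ht (e 1)) - hc (e 0) * hc (e 1)"
      using nv_formula[OF Wk_side[OF We] D(2) Wk_side[OF We] D(2), of 0 1] D(2) by auto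
    moreover have "cosh (ht (e 0) - ht (e 1)) = cosh (ht (e 1) - ht (e 0))" by (metis cosh_minus minus_diff_eq)
    ultimately have orth: "hs (e 0) * hs (e 1) * cosh (ht (e 1) - ht (e 0)) = hc (e 0) * hc (e 1)" using v0 by simp
    have lt': "ht (e 1) - ht (e 0) \<ge> 0" using lt by simp
    obtain x y m k where xy: "ht (e 1) - ht (e 0) = x + y" and
      mk: "m > 0" "m^2 = (hc (e 0))^2 + (hc (e 1))^2" "k \<ge> 0" "m^2 * k^2 = m^2 - 1"
      "hs (e 0) * sinh x = hc (e 1) / m" "hs (e 0) * cosh x = hc (e 0) * k" "hs (e 1) * sinh y = hc (e 0) / m" "hs (e 1) * cosh y = hc (e 1) * k"
      by (rule right_angle_split[OF h0(3) h1(3) h0(1) h1(1) h0(2) h1(2) orth lt'])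
    \<comment> \<open>A wall of the opposite chain whose shadow contains the foot of the vertex of
      \<open>e 0\<close> and \<open>e 1\<close>.\<close>
    obtain j k' where j: "\<bar>ht (e 0) + x - ht (f j)\<bar> \<le> hw (f j)" using cover[OF c(2) u nc] by metis
    note hf = Wk_h(1,2,3)[OF Wf[of j]]
    let ?y = "ht (f j) - (ht (e 0) + x)"
    have cy: "hs (f j) * cosh ?y \<le> hc (f j)" unfolding close_iff[OF Wf] using j by linarith
    let ?V = "nv G (e 0) (f j)" and ?W = "nv G (e 1) (f j)"
    have cs: "cosh (ht (e 0) - ht (f j)) = cosh (?y + x)" "cosh (ht (e 1) - ht (f j)) = cosh (?y - y)"
    proof -
      have "?y + x = - (ht (e 0) - ht (f j))" "?y - y = - (ht (e 1) - ht (f j))" using xy by simp_all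
      then show "cosh (ht (e 0) - ht (f j)) = cosh (?y + x)" "cosh (ht (e 1) - ht (f j)) = cosh (?y - y)" by (metis cosh_minus)+
    qed
    have c01: "2 * ((hc (e 0))^2 + (hc (e 1))^2) - 1 \<ge> 0" by (simp add: h0(3) h1(3))
    have "?V^2 + ?W^2 \<le> 1 + 2 * (hc (f j))^2 * (2 * ((hc (e 0))^2 + (hc (e 1))^2) - 1)"
      unfolding op(1) cs by (rule right_angle_opposite[OF mk hf(3,1,2) cy])
    also have "\<dots> \<le> 1 + 2 * (8/3) * (2 * (8/3 + 8/3) - 1)"
      using hc_small(1)[OF We s(1), of 0] hc_small(1)[OF We s(1), of 1] hc_small(1)[OF Wf s(2), of j] c01
      by (intro add_mono mult_mono diff_mono) auto
    finally have VW: "?V^2 + ?W^2 \<le> 527/10" by simp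
    let ?a = "al (e 0) (f j)" and ?b = "al (e 1) (f j)"
    have ab: "real ?a = 4 * ?V^2" "real ?b = 4 * ?W^2" using al_wall[OF Wk_wall[OF We] Wk_wall[OF Wf]] by auto
    have sum: "real ?a + real ?b \<le> 211" using ab VW by simp
    have prod: "4 * (real ?a * real ?b) \<le> 211^2"
    proof -
      have "4 * (real ?a * real ?b) \<le> (real ?a + real ?b)^2" using zero_le_power2[of "real ?a - real ?b"] by (simp add: power2_eq_square algebra_simps)
      also have "\<dots> \<le> 211^2" using sum by (intro power_mono) auto
      finally show ?thesis .
    qed
    have DD: "DD (e 0) (f j) (e 1) = real ?a + real ?b - 4"
      unfolding ab by (simp add: DD_def v0 nv_sym[of "f j" "e 1"])
    have d: "DD (e 0) (f j) (e 1) \<le> 207" unfolding DD using sum by simp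
    have p: "real (?a * ?b) \<le> 11131" using prod by simp
    have "DD (e 0) (f j) (e 1) * real (?a * ?b) \<le> 207 * 11131" using d p by (intro mult_mono) auto
    then have "DD (e 0) (f j) (e 1) * real (?a * ?b) \<le> 2834349" by simp
    moreover have "?a \<le> 4561" "?b \<le> 4561" using sum by linarith+
    moreover have "al (f j) (e 1) = ?b" by (rule al_sym)
    ultimately have "disc_bounds"
      using three_walls[OF prim_form Wk_wall[OF We] Wk_wall[OF Wf] Wk_wall[OF We] op(2)[of 0 j] op(2)[of 1 j, symmetric] ne pos[of 0 j]] pos[of 1 j] d by simp
    then show False using nc by simp
  qed
qed

text \<open>The farthest side \<open>e i\<close> is a bubble, so its neighbours are near. They and
  \<open>e i\<close> are completed by a wall of the opposite chain to the four walls of the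
  criterion.\<close>

lemma max_big:
  assumes c: "chn 1 \<sigma> e" "chn 1 (- \<sigma>) f" and u: "\<And>T. \<exists>i. ht (f i) > T" "\<And>T. \<exists>i. ht (f i) < T" and nc: "\<not> disc_bounds"
    and mx: "\<And>j. hs (f j) \<le> hs (e i)" and big: "\<not> (hs (e i))^2 \<le> 5/3"
  shows False
proof -
  note D = chnD[OF c(1)] and We = chnD(3)[OF c(1)] and Wf = chnD(3)[OF c(2)]
  note op = opposite[OF D(2) We Wf]
  have b: "bubble e i" using not_bubble_small[OF c(1) nc] big by blast
  have "\<not> bubble e (i+1)" "\<not> bubble e (i-1)" using adjacent_bubbles[OF c(1), of i] adjacent_bubbles[OF c(1), of "i-1"] b nc by auto
  then have s: "(hs (e (i-1)))^2 \<le> 5/3" "(hs (e (i+1)))^2 \<le> 5/3" using not_bubble_small[OF c(1) nc] by auto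
  have z: "nv G (e (i-1)) (e i) = 0" "nv G (e i) (e (i+1)) = 0" and n70: "al (e (i-1)) (e (i+1)) \<le> 70" using b by (simp_all add: bubble_def)
  let ?v = "nv G (e (i-1)) (e (i+1))" and ?s = "hs (e i)" and ?c = "hc (e i)" and ?n = "al (e (i-1)) (e (i+1))"
  note ang = mid_right_angles[OF D(2,1) We We We D(6) D(4) z]
  have v: "?v > 1" by (rule ang(1))
  have "?s^2 * (?v - 1) \<le> 2 * (sqrt (8/3))^2" by (rule ang(2)) (rule hc_small(2)[OF We s(1)] hc_small(2)[OF We s(2)])+
  then have sv: "?s^2 * (?v - 1) \<le> 16/3" by simp
  have n: "real ?n = 4 * ?v^2" by (rule al_wall[OF Wk_wall[OF We] Wk_wall[OF We]])
  have "?v^2 > 1^2" using v by (intro power_strict_mono) auto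
  then have n5: "5 \<le> ?n" using n by simp
  note h = Wk_h(1,2,3)[OF We[of i]]
  obtain j k where jk: "\<bar>ht (e i) - ht (f j)\<bar> \<le> hw (f j)" "\<bar>ht (e i) - ht (f k)\<bar> \<le> \<bar>ht (f j) - ht (f k)\<bar>"
    "bubble f j \<Longrightarrow> nv G (f j) (f k) = 0 \<and> \<not> bubble f k" using cover[OF c(2) u nc, of "ht (e i)"] by metis
  note hj = Wk_h(1,2,3)[OF Wf[of j]] and hk = Wk_h(1,2,3)[OF Wf[of k]]
  have cov: "hs (f j) * cosh (ht (e i) - ht (f j)) \<le> hc (f j)" unfolding close_iff[OF Wf] by (rule jk(1))
  have Vj: "(nv G (e i) (f j))^2 \<le> (hc (f j))^2 * (4 * ?s^2 + 2)"
  proof -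
    have "?s * (hs (f j) * cosh (ht (e i) - ht (f j))) \<le> ?s * hc (f j)" using cov h by (intro mult_left_mono) auto
    then have "nv G (e i) (f j) \<le> hc (f j) * (?s + ?c)" unfolding op(1) by (simp add: algebra_simps)
    then have "(nv G (e i) (f j))^2 \<le> (hc (f j) * (?s + ?c))^2" using op(3) by (intro power_mono) (auto intro: less_imp_le)
    also have "\<dots> = (hc (f j))^2 * (?s + ?c)^2" by (rule power_mult_distrib)
    also have "\<dots> \<le> (hc (f j))^2 * (4 * ?s^2 + 2)"
    proof (rule mult_left_mono)
      have "(?s + ?c)^2 \<le> 2 * ?s^2 + 2 * ?c^2" using zero_le_power2[of "?s - ?c"] by (simp add: power2_eq_square algebra_simps)
      then show "(?s + ?c)^2 \<le> 4 * ?s^2 + 2" by (simp add: h(3))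
    qed simp
    finally show ?thesis .
  qed
  have fin: disc_bounds if B: "?n \<le> 29 \<Longrightarrow> real (al (e i) (f l)) \<le> 16 * (4 * ?s^2 + 2)"
      "?n \<ge> 30 \<Longrightarrow> real (al (e i) (f l)) \<le> 4 * (1 + ?s^2) * (4 * ?s^2 + 2)" for l
  proof -
    have v0: "?v \<ge> 0" using v by simp
    note num = bubble_cover_numeric[OF n v0 n5 n70 sv B]
    have o: "ht (e (i-1)) < ht (e i)" "ht (e i) < ht (e (i+1))" using D(6,4)[of i] by simp_all
    then have ne: "e i \<noteq> e (i-1)" "e i \<noteq> e (i+1)" "e (i-1) \<noteq> e (i+1)" by auto
    have z': "nv G (e i) (e (i-1)) = 0" using z(1) nv_sym by metis
    have nz: "nv G (e i) (f l) \<noteq> 0" using op(3)[of i l] by simp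
    have "?n \<le> 100" using n70 by simp
    then show disc_bounds
      using four_walls[OF prim_form Wk_wall[OF We] Wk_wall[OF We] Wk_wall[OF We] Wk_wall[OF Wf] ne op(2) z' z(2) nz _ num(1)] num(2) by blast
  qed
  have aj: "real (al (e i) (f l)) = 4 * (nv G (e i) (f l))^2" for l by (rule al_wall[OF Wk_wall[OF We] Wk_wall[OF Wf]])
  show False
  proof (cases "?n \<le> 29 \<and> (hc (f j))^2 > 4")
    case False
    have q: "0 \<le> 4 * ?s^2 + 2" by simp
    have "real (al (e i) (f j)) \<le> 16 * (4 * ?s^2 + 2)" if "?n \<le> 29"
    proof -
      have "(hc (f j))^2 * (4 * ?s^2 + 2) \<le> 4 * (4 * ?s^2 + 2)" using False that by (intro mult_right_mono[OF _ q]) simp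
      then show ?thesis unfolding aj using Vj by linarith
    qed
    moreover have "real (al (e i) (f j)) \<le> 4 * (1 + ?s^2) * (4 * ?s^2 + 2)" if "?n \<ge> 30"
    proof -
      have "(hs (f j))^2 \<le> ?s^2" using mx hj by (intro power_mono) auto
      then have "(hc (f j))^2 * (4 * ?s^2 + 2) \<le> (1 + ?s^2) * (4 * ?s^2 + 2)" by (intro mult_right_mono[OF _ q]) (simp add: hj(3))
      then show ?thesis unfolding aj using Vj by linarith
    qed
    ultimately show False using fin nc by blast
  next
    case True
    \<comment> \<open>The wall opposite the foot of \<open>e i\<close> is itself far, hence a
      bubble. Its neighbour \<open>f k\<close> is near and orthogonal to it, and the foot of
      \<open>e i\<close> is no farther from that of \<open>f k\<close> than the foot of
      \<open>f j\<close> is; so \<open>f k\<close> is the fourth wall.\<close>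
    have sj: "(hs (f j))^2 > 3" using True by (simp add: hj(3))
    then have bj: "bubble f j" using not_bubble_small[OF c(2) nc, of j] by fastforce
    then have o: "nv G (f j) (f k) = 0" and sk: "(hs (f k))^2 \<le> 5/3" using jk(3) not_bubble_small[OF c(2) nc, of k] by auto
    have "nv G (f j) (f k) = hs (f j) * hs (f k) * cosh (ht (f j) - ht (f k)) - hc (f j) * hc (f k)"
      using nv_formula[OF Wk_side[OF Wf] chnD(2)[OF c(2)] Wk_side[OF Wf] chnD(2)[OF c(2)], of j k] D(2) by auto
    then have o': "hs (f j) * (hs (f k) * cosh (ht (f j) - ht (f k))) = hc (f j) * hc (f k)" using o by simp
    have ck: "(hc (f k))^2 \<le> 8/3" by (rule hc_small(1)[OF Wf sk])
    define q where "q = hc (f j) / hs (f j)"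
    have q2: "q^2 \<le> 4/3"
    proof -
      have "q^2 = (1 + (hs (f j))^2) / (hs (f j))^2" by (simp add: q_def power_divide hj(3))
      also have "\<dots> \<le> 4/3" using sj by (simp add: divide_le_eq)
      finally show ?thesis .
    qed
    have ok: "hs (f k) * cosh (ht (f j) - ht (f k)) = q * hc (f k)" using o' hj by (simp add: q_def field_simps)
    have "cosh (ht (e i) - ht (f k)) \<le> cosh (ht (f j) - ht (f k))"
      using jk(2) cosh_real_nonneg_le_iff[of "\<bar>ht (e i) - ht (f k)\<bar>" "\<bar>ht (f j) - ht (f k)\<bar>"] by (simp add: cosh_real_abs)
    then have "?s * (hs (f k) * cosh (ht (e i) - ht (f k))) \<le> ?s * (hs (f k) * cosh (ht (f j) - ht (f k)))"
      using h hk by (intro mult_left_mono) auto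
    then have "nv G (e i) (f k) \<le> hc (f k) * (?c + ?s * q)" unfolding op(1) ok by (simp add: algebra_simps)
    then have "(nv G (e i) (f k))^2 \<le> (hc (f k) * (?c + ?s * q))^2" using op(3) by (intro power_mono) (auto intro: less_imp_le)
    also have "\<dots> = (hc (f k))^2 * (?c + ?s * q)^2" by (rule power_mult_distrib)
    also have "\<dots> \<le> 8/3 * (2 + 14/3 * ?s^2)"
    proof (rule mult_mono[OF ck])
      have "(?c + ?s * q)^2 \<le> 2 * ?c^2 + 2 * (?s^2 * q^2)" using zero_le_power2[of "?c - ?s * q"] by (simp add: power2_eq_square algebra_simps)
      moreover have "?s^2 * q^2 \<le> ?s^2 * (4/3)" using q2 by (intro mult_left_mono) auto
      ultimately show "(?c + ?s * q)^2 \<le> 2 + 14/3 * ?s^2" using h(3) by linarith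
    qed auto
    finally have Vk: "(nv G (e i) (f k))^2 \<le> 8/3 * (2 + 14/3 * ?s^2)" .
    have "real (al (e i) (f k)) \<le> 16 * (4 * ?s^2 + 2)" 
    proof -
      have "9 * (nv G (e i) (f k))^2 \<le> 48 + 112 * ?s^2" using Vk by (simp add: algebra_simps)
      then have "4 * (nv G (e i) (f k))^2 \<le> 32 + 64 * ?s^2" using zero_le_power2[of ?s] by linarith
      also have "\<dots> = 16 * (4 * ?s^2 + 2)" by simp
      finally show ?thesis unfolding aj .
    qed
    then show False using fin[of k] True nc by simp
  qed
qed

text \<open>With the mirror of \<rho> excluded, both sides carry a chain. \<open>max_big\<close>,
  with the roles exchanged if the farthest side lies in the second chain, bounds all distances, and
  \<open>all_small\<close> concludes.\<close>

theorem disc_bounds_hold: disc_bounds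
proof (rule ccontr)
  assume nc: "\<not> disc_bounds"
  have "\<not> (\<exists>r\<in>Rp. \<exists>a. r = a *\<^sub>R \<rho>)" using mirror_case nc by blast
  then have g: "good 1" "good (- 1)" by (auto simp: good_def)
  obtain e where e: "chn 1 1 e" "\<And>T. \<exists>i. ht (e i) > T" "\<And>T. \<exists>i. ht (e i) < T" by (rule good_chain[OF g(1)]) blast
  obtain f where f: "chn 1 (- 1) f" "\<And>T. \<exists>i. ht (f i) > T" "\<And>T. \<exists>i. ht (f i) < T" by (rule good_chain[OF g(2)]) blast
  have e': "chn 1 (- (- 1)) e" using e(1) by simp
  let ?A = "range (\<lambda>i. hs (e i)) \<union> range (\<lambda>i. hs (f i))"
  have "?A \<subseteq> hs ` Wk 1 \<union> hs ` Wk (-1)" using chnD(3)[OF e(1)] chnD(3)[OF f(1)] by blast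
  then have fin: "finite ?A" using finite_hs finite_subset by (metis finite_UnI)
  have mx: "hs (e i) \<le> Max ?A" "hs (f i) \<le> Max ?A" for i by (auto intro!: Max_ge[OF fin])
  have "Max ?A \<in> ?A" by (intro Max_in[OF fin]) auto
  then consider (e) i where "Max ?A = hs (e i)" | (f) i where "Max ?A = hs (f i)" by auto
  then have M: "(Max ?A)^2 \<le> 5/3"
  proof cases
    case e': (e i)
    then show ?thesis using max_big[OF e(1) f nc, of i] mx by auto
  next
    case f': (f i)
    then show ?thesis using max_big[OF f(1) e' e(2,3) nc, of i] mx by auto
  qed
  have "(hs (e i))^2 \<le> 5/3" "(hs (f i))^2 \<le> 5/3" for i
    using M power_mono[OF mx(1)[of i], of 2] power_mono[OF mx(2)[of i], of 2] Wk_h(1)[OF chnD(3)[OF e(1)], of i] Wk_h(1)[OF chnD(3)[OF f(1)], of i]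
    by linarith+
  then show False using all_small[OF e(1) f nc] by blast
qed

end

section \<open>The theorem\<close>

lemma finite_index_trivial: assumes "finite (A_M G V M)" shows "finite_index_subgroup {id} (A_M G V M)"
proof -
  have "id \<in> A_M G V M" by (auto simp: A_M_def O_plus_def linear_id)
  then show ?thesis using assms by (simp add: finite_index_subgroup_def)
qed

theorem theorem8p5p10p1:
  fixes G :: "int^3^3"
  assumes "hyperbolic_lattice G" and "primitive_form G" and "reflective_hyperbolic_type G"
  shows "disc_exponent G \<le> 8 * 16144800^2 \<and> odd_rad (disc_exponent G) \<le> 2834349
         \<and> max_prime_div (disc_exponent G) \<le> 4561"
proof -
  obtain V M where VM: "is_Vplus G V" "is_fund_polygon G V M"
    and fixed_ex: "\<exists>\<rho>\<in>lat. \<rho> \<noteq> 0 \<and> bf G \<rho> \<rho> < 0 \<and> fixed_by_finite_index G V M \<rho>"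
    and fixed_neg: "\<forall>x\<in>lat. x \<noteq> 0 \<and> fixed_by_finite_index G V M x \<longrightarrow> bf G x x < 0"
    using assms(3) unfolding reflective_hyperbolic_type_def by blast
  obtain x0 where polygon: "x0 \<in> V - mirrors G" "M = closure (connected_component_set (V - mirrors G) x0) \<inter> V"
    using VM(2) unfolding is_fund_polygon_def by blast
  interpret chamber G V x0 by unfold_locales (use assms(1) VM(1) polygon(1) in auto)
  have M: "M = Ch" unfolding polygon(2) by (rule polygon_eq)
  obtain \<rho> H where \<rho>: "\<rho> \<in> lat" "bf G \<rho> \<rho> < 0"
    and H: "finite_index_subgroup H (A_M G V Ch)" "\<And>h. h \<in> H \<Longrightarrow> h \<rho> = \<rho>"
    using fixed_ex unfolding M fixed_by_finite_index_def by blast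
  have inf: "infinite (A_M G V Ch)"
  proof
    assume "finite (A_M G V Ch)"
    then have t: "finite_index_subgroup {id} (A_M G V Ch)" by (rule finite_index_trivial)
    \<comment> \<open>The trivial group would have finite index, and it fixes every vector, also one
      of positive square.\<close>
    obtain x where x: "x \<in> lat" "b x x > 0" using pos_lat by blast
    have "fixed_by_finite_index G V M x" unfolding fixed_by_finite_index_def M using t by auto
    moreover have "x \<noteq> 0" using x by (auto simp: bf_def)
    ultimately show False using fixed_neg x by fastforce
  qed
  interpret refl_prim G V x0 \<rho> H by unfold_locales (use assms(2) \<rho> H inf in auto)
  show ?thesis using disc_bounds_hold unfolding disc_bounds_def .
qed

end
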